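(* Let $\mathcal R$ be the hyperfinite II$_1$ factor and let $\mathcal U$ be a countably incomplete ultrafilter. If $M$ is a separable II$_1$ factor with $M\equiv_4\mathcal R$, then $M$ satisfies the conclusion of Popa's Factorial Commutant Embedding Problem: there is an embedding $i:M\hookrightarrow\mathcal R^{\mathcal U}$ such that the relative commutant $i(M)'\cap\mathcal R^{\mathcal U}$ is a factor.
   Context: Tracial von Neumann algebras are viewed as metric structures (continuous logic) in the usual language of tracial von Neumann algebras: variables range over operator-norm balls, the metric comes from $\|\cdot\|_2$, atomic formulas are real and imaginary parts of traces of $*$-polynomials (and distances $\|p-q\|_2$), connectives are continuous functions $f:\mathbb R^n\to\mathbb R$, and quantifiers are $\sup$ and $\inf$ over balls. $\varphi^M$ denotes the value of a formula in $M$. Ultrapowers are tracial ultrapowers; embeddings are unital trace-preserving $*$-homomorphisms. Separable means separable for the metric $\|\cdot\|_2$. Quantifier depth is defined inductively: atomic formulas have depth $\le 0$; if $\varphi=f(\varphi_1,\dots,\varphi_n)$ with $f$ continuous then $\operatorname{depth}(\varphi)\le\max_i\operatorname{depth}(\varphi_i)$; if $\varphi=\sup_{\vec x}\psi$ or $\varphi=\inf_{\vec x}\psi$ ($\vec x$ a finite tuple of variables) then $\operatorname{depth}(\varphi)\le\operatorname{depth}(\psi)+1$. For structures $M,N$, write $M\equiv_k N$ if $\sigma^M=\sigma^N$ for every sentence $\sigma$ with $\operatorname{depth}(\sigma)\le k$. *)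

theory Defs
  imports "HOL-Analysis.Analysis" "HOL-Algebra.Module"
begin

section \<open>Complex Hilbert spaces and their bounded operators\<close>

text \<open>The complex inner product is antilinear in the first argument. The norm and the metric are
  those of the underlying real inner product space.\<close>

class chilbert_space = real_inner + complete_space +
  fixes scaleC :: "complex \<Rightarrow> 'a \<Rightarrow> 'a"
    and cinner :: "'a \<Rightarrow> 'a \<Rightarrow> complex"
  assumes scaleC_add_right: "scaleC c (x + y) = scaleC c x + scaleC c y"
    and scaleC_add_left: "scaleC (c + d) x = scaleC c x + scaleC d x"
    and scaleC_scaleC: "scaleC c (scaleC d x) = scaleC (c * d) x"
    and scaleC_of_real: "scaleC (complex_of_real r) x = scaleR r x"
    and cinner_commute: "cinner x y = cnj (cinner y x)"
    and cinner_add_left: "cinner (x + y) z = cinner x z + cinner y z"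
    and cinner_scaleC_left: "cinner (scaleC c x) y = cnj c * cinner x y"
    and Re_cinner: "Re (cinner x y) = inner x y"

text \<open>The elements of \<open>'h \<Rightarrow>\<^sub>L 'h\<close> are only real-linear, so $B(H)$ consists of the complex-linear ones.\<close>

definition bounded_operators :: "('h::chilbert_space \<Rightarrow>\<^sub>L 'h) set" where
  "bounded_operators = {T. \<forall>c x. blinfun_apply T (scaleC c x) = scaleC c (blinfun_apply T x)}"

definition op_scaleC :: "complex \<Rightarrow> ('h::chilbert_space \<Rightarrow>\<^sub>L 'h) \<Rightarrow> ('h \<Rightarrow>\<^sub>L 'h)" where
  "op_scaleC c T = Blinfun (\<lambda>x. scaleC c (blinfun_apply T x))"

definition op_adjoint :: "('h::chilbert_space \<Rightarrow>\<^sub>L 'h) \<Rightarrow> ('h \<Rightarrow>\<^sub>L 'h)" where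
  "op_adjoint T = (THE S. \<forall>x y. cinner (blinfun_apply S x) y = cinner x (blinfun_apply T y))"

definition self_adjoint :: "('h::chilbert_space \<Rightarrow>\<^sub>L 'h) \<Rightarrow> bool" where
  "self_adjoint T \<longleftrightarrow> op_adjoint T = T"

definition op_le :: "('h::chilbert_space \<Rightarrow>\<^sub>L 'h) \<Rightarrow> ('h \<Rightarrow>\<^sub>L 'h) \<Rightarrow> bool" where
  "op_le S T \<longleftrightarrow> (\<forall>x. Re (cinner x (blinfun_apply S x)) \<le> Re (cinner x (blinfun_apply T x)))"


section \<open>Tracial von Neumann algebras\<close>

definition unital_star_subalgebra :: "('h::chilbert_space \<Rightarrow>\<^sub>L 'h) set \<Rightarrow> bool" where
  "unital_star_subalgebra A \<longleftrightarrow>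
     A \<subseteq> bounded_operators \<and> id_blinfun \<in> A \<and>
     (\<forall>S\<in>A. \<forall>T\<in>A. S + T \<in> A \<and> S o\<^sub>L T \<in> A) \<and>
     (\<forall>c. \<forall>T\<in>A. op_scaleC c T \<in> A) \<and>
     (\<forall>T\<in>A. op_adjoint T \<in> A)"

definition von_neumann_algebra :: "('h::chilbert_space \<Rightarrow>\<^sub>L 'h) set \<Rightarrow> bool" where
  "von_neumann_algebra A \<longleftrightarrow>
     unital_star_subalgebra A \<and> closedin strong_operator_topology A"

definition tracial_state ::
  "('h::chilbert_space \<Rightarrow>\<^sub>L 'h) set \<Rightarrow> (('h \<Rightarrow>\<^sub>L 'h) \<Rightarrow> complex) \<Rightarrow> bool" where
  "tracial_state A \<tau> \<longleftrightarrow>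
     (\<forall>S\<in>A. \<forall>T\<in>A. \<tau> (S + T) = \<tau> S + \<tau> T) \<and>
     (\<forall>c. \<forall>T\<in>A. \<tau> (op_scaleC c T) = c * \<tau> T) \<and>
     \<tau> id_blinfun = 1 \<and>
     (\<forall>T\<in>A. \<tau> (op_adjoint T o\<^sub>L T) \<in> \<real>\<^sub>\<ge>\<^sub>0) \<and>
     (\<forall>S\<in>A. \<forall>T\<in>A. \<tau> (S o\<^sub>L T) = \<tau> (T o\<^sub>L S))"

definition faithful_state ::
  "('h::chilbert_space \<Rightarrow>\<^sub>L 'h) set \<Rightarrow> (('h \<Rightarrow>\<^sub>L 'h) \<Rightarrow> complex) \<Rightarrow> bool" where
  "faithful_state A \<tau> \<longleftrightarrow> (\<forall>T\<in>A. \<tau> (op_adjoint T o\<^sub>L T) = 0 \<longrightarrow> T = 0)"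

text \<open>Normality: suprema of upward directed families of self-adjoint elements are preserved.\<close>

definition normal_state ::
  "('h::chilbert_space \<Rightarrow>\<^sub>L 'h) set \<Rightarrow> (('h \<Rightarrow>\<^sub>L 'h) \<Rightarrow> complex) \<Rightarrow> bool" where
  "normal_state A \<tau> \<longleftrightarrow>
     (\<forall>D T. D \<subseteq> {S \<in> A. self_adjoint S} \<and> D \<noteq> {} \<and>
        (\<forall>S1\<in>D. \<forall>S2\<in>D. \<exists>S3\<in>D. op_le S1 S3 \<and> op_le S2 S3) \<and>
        T \<in> A \<and> self_adjoint T \<and> (\<forall>S\<in>D. op_le S T) \<and>
        (\<forall>T'\<in>A. self_adjoint T' \<and> (\<forall>S\<in>D. op_le S T') \<longrightarrow> op_le T T')
      \<longrightarrow> Re (\<tau> T) = (SUP S\<in>D. Re (\<tau> S)))"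

definition tracial_von_neumann_algebra ::
  "('h::chilbert_space \<Rightarrow>\<^sub>L 'h) set \<Rightarrow> (('h \<Rightarrow>\<^sub>L 'h) \<Rightarrow> complex) \<Rightarrow> bool" where
  "tracial_von_neumann_algebra A \<tau> \<longleftrightarrow>
     von_neumann_algebra A \<and> tracial_state A \<tau> \<and> faithful_state A \<tau> \<and> normal_state A \<tau>"


section \<open>Tracial algebras as abstract structures\<close>

text \<open>The data of a tracial von Neumann algebra that the language of tracial von Neumann algebras
  sees. It is independent of a Hilbert space, and so also available for ultrapowers.\<close>

record 'a tracial_algebra = "(complex, 'a) module" +
  star :: "'a \<Rightarrow> 'a"
  tr :: "'a \<Rightarrow> complex"
  opnorm :: "'a \<Rightarrow> real"

definition structure_of ::
  "('h::chilbert_space \<Rightarrow>\<^sub>L 'h) set \<Rightarrow> (('h \<Rightarrow>\<^sub>L 'h) \<Rightarrow> complex) \<Rightarrow> ('h \<Rightarrow>\<^sub>L 'h) tracial_algebra" where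
  "structure_of A \<tau> =
     \<lparr>carrier = A, mult = (o\<^sub>L), one = id_blinfun, zero = 0, add = (+), smult = op_scaleC,
      star = op_adjoint, tr = \<tau>, opnorm = norm\<rparr>"

definition norm2 :: "'a tracial_algebra \<Rightarrow> 'a \<Rightarrow> real" where
  "norm2 N x = sqrt (Re (tr N (star N x \<otimes>\<^bsub>N\<^esub> x)))"

definition separable2 :: "'a tracial_algebra \<Rightarrow> bool" where
  "separable2 N \<longleftrightarrow>
     (\<exists>D. countable D \<and> D \<subseteq> carrier N \<and>
          (\<forall>x\<in>carrier N. \<forall>e>0. \<exists>d\<in>D. norm2 N (x \<ominus>\<^bsub>N\<^esub> d) < e))"

definition center :: "'a tracial_algebra \<Rightarrow> 'a set" where
  "center N = {z \<in> carrier N. \<forall>x\<in>carrier N. z \<otimes>\<^bsub>N\<^esub> x = x \<otimes>\<^bsub>N\<^esub> z}"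

definition is_factor :: "'a tracial_algebra \<Rightarrow> bool" where
  "is_factor N \<longleftrightarrow> center N = range (\<lambda>c. c \<odot>\<^bsub>N\<^esub> \<one>\<^bsub>N\<^esub>)"

definition embedding :: "'a tracial_algebra \<Rightarrow> 'b tracial_algebra \<Rightarrow> ('a \<Rightarrow> 'b) \<Rightarrow> bool" where
  "embedding M N f \<longleftrightarrow>
     f \<in> ring_hom M N \<and>
     (\<forall>c. \<forall>x\<in>carrier M. f (c \<odot>\<^bsub>M\<^esub> x) = c \<odot>\<^bsub>N\<^esub> f x) \<and>
     (\<forall>x\<in>carrier M. f (star M x) = star N (f x)) \<and>
     (\<forall>x\<in>carrier M. tr N (f x) = tr M x)"

definition relative_commutant :: "'a set \<Rightarrow> 'a tracial_algebra \<Rightarrow> 'a tracial_algebra" where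
  "relative_commutant B N =
     N\<lparr>carrier := {x \<in> carrier N. \<forall>b\<in>B. x \<otimes>\<^bsub>N\<^esub> b = b \<otimes>\<^bsub>N\<^esub> x}\<rparr>"


section \<open>II$_1$ factors\<close>

text \<open>\<^const>\<open>span\<close> is the real span; real and complex finite-dimensionality coincide.\<close>

definition finite_dimensional :: "('h::chilbert_space \<Rightarrow>\<^sub>L 'h) set \<Rightarrow> bool" where
  "finite_dimensional A \<longleftrightarrow> (\<exists>B. finite B \<and> A \<subseteq> span B)"

text \<open>The trace of a II$_1$ factor is unique, so it is carried along as part of the data.\<close>

definition II1_factor ::
  "('h::chilbert_space \<Rightarrow>\<^sub>L 'h) set \<Rightarrow> (('h \<Rightarrow>\<^sub>L 'h) \<Rightarrow> complex) \<Rightarrow> bool" where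
  "II1_factor A \<tau> \<longleftrightarrow>
     tracial_von_neumann_algebra A \<tau> \<and> is_factor (structure_of A \<tau>) \<and> \<not> finite_dimensional A"

text \<open>By the Murray--von Neumann theorem the following determines the algebra up to
  trace-preserving isomorphism.\<close>

definition hyperfinite_II1_factor ::
  "('h::chilbert_space \<Rightarrow>\<^sub>L 'h) set \<Rightarrow> (('h \<Rightarrow>\<^sub>L 'h) \<Rightarrow> complex) \<Rightarrow> bool" where
  "hyperfinite_II1_factor A \<tau> \<longleftrightarrow>
     II1_factor A \<tau> \<and>
     (\<exists>F :: nat \<Rightarrow> ('h \<Rightarrow>\<^sub>L 'h) set.
        incseq F \<and>
        (\<forall>n. unital_star_subalgebra (F n) \<and> finite_dimensional (F n)) \<and>
        strong_operator_topology closure_of (\<Union>n. F n) = A)"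


section \<open>Tracial ultrapowers\<close>

definition ultrafilter :: "'i filter \<Rightarrow> bool" where
  "ultrafilter \<U> \<longleftrightarrow>
     \<U> \<noteq> bot \<and> (\<forall>P. eventually P \<U> \<or> eventually (\<lambda>i. \<not> P i) \<U>)"

definition countably_incomplete :: "'i filter \<Rightarrow> bool" where
  "countably_incomplete \<U> \<longleftrightarrow>
     (\<exists>P :: nat \<Rightarrow> 'i \<Rightarrow> bool.
        (\<forall>n. eventually (P n) \<U>) \<and> \<not> eventually (\<lambda>i. \<forall>n. P n i) \<U>)"

definition bounded_families :: "'a tracial_algebra \<Rightarrow> ('i \<Rightarrow> 'a) set" where
  "bounded_families N = {x. range x \<subseteq> carrier N \<and> bdd_above (range (\<lambda>i. opnorm N (x i)))}"

definition ultra_rel :: "'i filter \<Rightarrow> 'a tracial_algebra \<Rightarrow> (('i \<Rightarrow> 'a) \<times> ('i \<Rightarrow> 'a)) set" where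
  "ultra_rel \<U> N =
     {(x, y). x \<in> bounded_families N \<and> y \<in> bounded_families N \<and>
              ((\<lambda>i. norm2 N (x i \<ominus>\<^bsub>N\<^esub> y i)) \<longlongrightarrow> 0) \<U>}"

text \<open>The quotient of the bounded families by the ideal of families that are null in the 2-norm
  along \<open>\<U>\<close>, with its quotient norm. The trace of the class of $x$ is $\lim_{\mathcal U} \tau(x_i)$.\<close>

definition ultrapower :: "'i filter \<Rightarrow> 'a tracial_algebra \<Rightarrow> ('i \<Rightarrow> 'a) set tracial_algebra" where
  "ultrapower \<U> N =
     \<lparr>carrier = bounded_families N // ultra_rel \<U> N,
      mult = (\<lambda>X Y. \<Union>x\<in>X. \<Union>y\<in>Y. ultra_rel \<U> N `` {\<lambda>i. x i \<otimes>\<^bsub>N\<^esub> y i}),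
      one = ultra_rel \<U> N `` {\<lambda>i. \<one>\<^bsub>N\<^esub>},
      zero = ultra_rel \<U> N `` {\<lambda>i. \<zero>\<^bsub>N\<^esub>},
      add = (\<lambda>X Y. \<Union>x\<in>X. \<Union>y\<in>Y. ultra_rel \<U> N `` {\<lambda>i. x i \<oplus>\<^bsub>N\<^esub> y i}),
      smult = (\<lambda>c X. \<Union>x\<in>X. ultra_rel \<U> N `` {\<lambda>i. c \<odot>\<^bsub>N\<^esub> x i}),
      star = (\<lambda>X. \<Union>x\<in>X. ultra_rel \<U> N `` {\<lambda>i. star N (x i)}),
      tr = (\<lambda>X. THE t. \<forall>x\<in>X. ((\<lambda>i. tr N (x i)) \<longlongrightarrow> t) \<U>),
      opnorm = (\<lambda>X. INF x\<in>X. SUP i. opnorm N (x i))\<rparr>"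


section \<open>Continuous logic for tracial von Neumann algebras\<close>

text \<open>A variable \<open>(j, r)\<close> has index \<open>j\<close> and ranges over the operator norm ball of radius \<open>r\<close>.\<close>

type_synonym var = "nat \<times> nat"

datatype star_poly =
    Var var
  | Const complex
  | Plus star_poly star_poly
  | Times star_poly star_poly
  | Star star_poly

text \<open>In \<open>Conn f \<phi>s\<close> the connective \<open>f\<close> is a function on $\mathbb R^n$, with \<open>n = length \<phi>s\<close>, where
  $\mathbb R^n$ is realised as the extensional functions on \<open>{..<n}\<close>. In \<open>QSup xs \<psi>\<close> and
  \<open>QInf xs \<psi>\<close> the quantifier binds the whole tuple \<open>xs\<close>.\<close>

datatype formula =
    ReTr star_poly
  | ImTr star_poly
  | Dist star_poly star_poly
  | Conn "(nat \<Rightarrow> real) \<Rightarrow> real" "formula list"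
  | QSup "var list" formula
  | QInf "var list" formula

fun well_formed :: "formula \<Rightarrow> bool" where
  "well_formed (ReTr p) = True"
| "well_formed (ImTr p) = True"
| "well_formed (Dist p q) = True"
| "well_formed (Conn f \<phi>s) \<longleftrightarrow>
     continuous_map (powertop_real {..<length \<phi>s}) euclideanreal f \<and>
     (\<forall>\<phi>\<in>set \<phi>s. well_formed \<phi>)"
| "well_formed (QSup xs \<psi>) = well_formed \<psi>"
| "well_formed (QInf xs \<psi>) = well_formed \<psi>"

fun depth :: "formula \<Rightarrow> nat" where
  "depth (ReTr p) = 0"
| "depth (ImTr p) = 0"
| "depth (Dist p q) = 0"
| "depth (Conn f \<phi>s) = Max (insert 0 (set (map depth \<phi>s)))"
| "depth (QSup xs \<psi>) = depth \<psi> + 1"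
| "depth (QInf xs \<psi>) = depth \<psi> + 1"

fun poly_vars :: "star_poly \<Rightarrow> var set" where
  "poly_vars (Var v) = {v}"
| "poly_vars (Const c) = {}"
| "poly_vars (Plus p q) = poly_vars p \<union> poly_vars q"
| "poly_vars (Times p q) = poly_vars p \<union> poly_vars q"
| "poly_vars (Star p) = poly_vars p"

fun free_vars :: "formula \<Rightarrow> var set" where
  "free_vars (ReTr p) = poly_vars p"
| "free_vars (ImTr p) = poly_vars p"
| "free_vars (Dist p q) = poly_vars p \<union> poly_vars q"
| "free_vars (Conn f \<phi>s) = (\<Union>\<phi>\<in>set \<phi>s. free_vars \<phi>)"
| "free_vars (QSup xs \<psi>) = free_vars \<psi> - set xs"
| "free_vars (QInf xs \<psi>) = free_vars \<psi> - set xs"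

definition sentence :: "formula \<Rightarrow> bool" where
  "sentence \<sigma> \<longleftrightarrow> well_formed \<sigma> \<and> free_vars \<sigma> = {}"

fun poly_value :: "'a tracial_algebra \<Rightarrow> (var \<Rightarrow> 'a) \<Rightarrow> star_poly \<Rightarrow> 'a" where
  "poly_value N v (Var x) = v x"
| "poly_value N v (Const c) = c \<odot>\<^bsub>N\<^esub> \<one>\<^bsub>N\<^esub>"
| "poly_value N v (Plus p q) = poly_value N v p \<oplus>\<^bsub>N\<^esub> poly_value N v q"
| "poly_value N v (Times p q) = poly_value N v p \<otimes>\<^bsub>N\<^esub> poly_value N v q"
| "poly_value N v (Star p) = star N (poly_value N v p)"

definition norm_ball :: "'a tracial_algebra \<Rightarrow> real \<Rightarrow> 'a set" where
  "norm_ball N r = {x \<in> carrier N. opnorm N x \<le> r}"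

definition reassignments :: "'a tracial_algebra \<Rightarrow> var list \<Rightarrow> (var \<Rightarrow> 'a) \<Rightarrow> (var \<Rightarrow> 'a) set" where
  "reassignments N xs v =
     {w. (\<forall>x\<in>set xs. w x \<in> norm_ball N (real (snd x))) \<and> (\<forall>x. x \<notin> set xs \<longrightarrow> w x = v x)}"

fun formula_value :: "'a tracial_algebra \<Rightarrow> (var \<Rightarrow> 'a) \<Rightarrow> formula \<Rightarrow> real" where
  "formula_value N v (ReTr p) = Re (tr N (poly_value N v p))"
| "formula_value N v (ImTr p) = Im (tr N (poly_value N v p))"
| "formula_value N v (Dist p q) = norm2 N (poly_value N v p \<ominus>\<^bsub>N\<^esub> poly_value N v q)"
| "formula_value N v (Conn f \<phi>s) =
     f (\<lambda>i\<in>{..<length \<phi>s}. map (\<lambda>\<phi>. formula_value N v \<phi>) \<phi>s ! i)"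
| "formula_value N v (QSup xs \<psi>) = (SUP w\<in>reassignments N xs v. formula_value N w \<psi>)"
| "formula_value N v (QInf xs \<psi>) = (INF w\<in>reassignments N xs v. formula_value N w \<psi>)"

text \<open>The value of a sentence does not depend on the assignment of the variables; zero lies in
  every ball.\<close>

definition sentence_value :: "'a tracial_algebra \<Rightarrow> formula \<Rightarrow> real" where
  "sentence_value N \<sigma> = formula_value N (\<lambda>_. \<zero>\<^bsub>N\<^esub>) \<sigma>"

definition equiv_depth :: "nat \<Rightarrow> 'a tracial_algebra \<Rightarrow> 'b tracial_algebra \<Rightarrow> bool" where
  "equiv_depth k M N \<longleftrightarrow>
     (\<forall>\<sigma>. sentence \<sigma> \<and> depth \<sigma> \<le> k \<longrightarrow> sentence_value M \<sigma> = sentence_value N \<sigma>)"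

end

theory Submission
  imports Defs
begin

text \<open>The hyperfinite factor has spectral gap uniformly over finite subsets: for finite \<open>X\<close> and
  \<open>e > 0\<close> there are contractions \<open>y\<^sub>0, y\<^sub>1, y\<^sub>2, y\<^sub>3\<close> such that every contraction \<open>a\<close> admits
  a contraction \<open>b\<close> commuting with \<open>X\<close> up to \<open>e\<close> for which the squared 2-norm distance of \<open>a\<close> from
  the scalars is at most $800(\|[b,a]\|_2 + \sum_j \|[y_j,a]\|_2) + e$. Indeed \<open>X\<close> lies almost in a copy
  of a matrix algebra. There \<open>y\<^sub>0, y\<^sub>1\<close> are the clock and shift matrices, \<open>y\<^sub>2\<close> is diagonal and
  \<open>y\<^sub>3\<close> is the Fourier matrix; the last two act on the joint eigenspaces of \<open>Ad y\<^sub>0\<close> and \<open>Ad y\<^sub>1\<close> as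
  a shear and a rotation of the lattice, which makes the four unitaries a quantum expander with a
  constant independent of the size. So \<open>a\<close> is close to the commutant of the matrix algebra, and
  \<open>b\<close> is found in that commutant by averaging. Sentences \<open>sup inf sup inf\<close> of depth four express the
  property, hence it passes to \<open>M\<close>.

  By sentences of depth three, finitely many values in \<open>M\<close> of formulas of depth two are approximated
  in \<open>R\<close>. Along a countably incomplete ultrafilter the approximations give the embedding of \<open>M\<close>; they
  also carry over the \<open>y\<^sub>j\<close> chosen in \<open>M\<close> together with their \<open>sup inf\<close> formulas. A central element
  of the relative commutant commutes with the \<open>y\<^sub>j\<close> and with the elements \<open>b\<close> given by these formulas,
  since those lie in the relative commutant; hence it is scalar.\<close>

section \<open>Complex Hilbert spaces and adjoints\<close>

text \<open>Depth four allows just the quantifiers \<open>sup X inf y sup a inf b\<close>, and a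
  formula has finitely many variables and a fixed connective. So the number of \<open>y\<close>s and
  the factor 800 must not grow with the matrix algebra that approximates \<open>X\<close>.
  Generators such as clock and shift alone do not suffice: their gap shrinks like the inverse of the
  size. On the other hand the hyperfinite factor has nontrivial central sequences, so no
  \<open>y\<close> chosen before \<open>a\<close> can control all of \<open>a\<close>; the
  quantifier over \<open>b\<close>, which comes after \<open>a\<close>, tests the part of
  \<open>a\<close> in the commutant of the matrices. The distance from the scalars enters as the
  variance \<open>tau (a* a) - |tau a|^2\<close>, which needs no quantifier over the scalar.

  Hyperfiniteness is given by strong closure in an arbitrary representation, whereas formulas see
  the 2-norm. The bridge is that in a factor the 2-norm is dominated by finitely many vectors, and
  this rests on comparison of projections. The operator theory avoids the spectral theorem: square
  roots and inverses are fixed points of contractions, polar parts are limits of a Newton iteration,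
  and maximality arguments are greedy sequences measured by the trace.\<close>

lemma cinner_eq_inner:
 fixes x y :: "'h::chilbert_space"
 shows "cinner x y = complex_of_real (inner x y) + \<i> * complex_of_real (inner x (scaleC (- \<i>) y))"
proof -
 have r: "cinner x (scaleC c y) = c * cinner x y" for c
  by (metis cinner_commute cinner_scaleC_left complex_cnj_cnj complex_cnj_mult)
 have "inner x (scaleC (- \<i>) y) = Im (cinner x y)" by (simp add: Re_cinner [symmetric] r)
 then show ?thesis by (simp add: complex_eq_iff Re_cinner [symmetric])
qed

lemma cinner_scaleC_right:
 fixes x y :: "'h::chilbert_space"
 shows "cinner x (scaleC c y) = c * cinner x y"
 by (metis cinner_commute cinner_scaleC_left complex_cnj_cnj complex_cnj_mult)

lemma cinner_add_right:
 fixes x y :: "'h::chilbert_space"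
 shows "cinner x (y + z) = cinner x y + cinner x z" by (metis cinner_add_left cinner_commute complex_cnj_add)

lemma cinner_ext:
 fixes x y :: "'h::chilbert_space"
 assumes "\<And>z. cinner x z = cinner y z"
 shows "x = y"
proof -
 have "inner (x - y) (x - y) = 0" by (simp only: inner_diff_left) (simp add: Re_cinner [symmetric] assms)
 then show ?thesis by simp
qed

lemma cinner_self: "cinner x x = complex_of_real ((norm (x::'h::chilbert_space))\<^sup>2)"
proof -
 have "Im (cinner x x) = 0" using arg_cong [where f = Im, OF cinner_commute [of x x]] by simp
 then show ?thesis by (simp add: complex_eq_iff Re_cinner power2_norm_eq_inner)
qed

text \<open>The representing vector minimises the quadratic functional
  \<open>J y = (norm y)^2 - 2 * f y\<close>. The parallelogram identity makes minimising sequences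
  Cauchy, and the vanishing first variation at the minimum is the claim.\<close>

lemma riesz_representation:
 fixes f :: "'h::{real_inner,complete_space} => real"
 assumes f: "bounded_linear f"
 shows "\<exists>z. \<forall>y. f y = inner z y"
proof -
 interpret bounded_linear f by (fact f)
 obtain B where B: "\<And>x. norm (f x) \<le> norm x * B" using bounded by blast
 define J where "J y = (norm y)\<^sup>2 - 2 * f y" for y
 have bdd: "- (B\<^sup>2) \<le> J y" for y
 proof -
  have "0 \<le> (norm y - B)\<^sup>2" by simp
  moreover have "f y \<le> norm y * B" using B[of y] by simp
  ultimately show ?thesis unfolding J_def power2_diff by linarith
 qed
 define m where "m = (INF y. J y)"
 have mle: "m \<le> J y" for y
  unfolding m_def by (rule cINF_lower) (use bdd in \<open>auto intro!: bdd_belowI\<close>)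
 have "\<exists>y. J y < m + inverse (real (Suc n))" for n
 proof (rule ccontr)
  assume "\<not> ?thesis"
  then have "m + inverse (real (Suc n)) \<le> (INF y. J y)" by (intro cINF_greatest) (auto simp: not_less)
  then show False by (simp add: m_def del: of_nat_Suc)
 qed
 then obtain y where y: "\<And>n. J (y n) < m + inverse (real (Suc n))" by metis
 have par: "(norm (a - b))\<^sup>2 = 2 * J a + 2 * J b - 4 * J ((1/2) *\<^sub>R (a + b))" for a b
  unfolding J_def by (simp add: power2_norm_eq_inner scaleR add inner_diff_left inner_diff_right
   inner_add_left inner_add_right inner_commute algebra_simps)
 have close: "(norm (y n - y k))\<^sup>2 \<le> 2 * inverse (real (Suc n)) + 2 * inverse (real (Suc k))" for n k
  using par[of "y n" "y k"] mle[of "(1/2) *\<^sub>R (y n + y k)"] y[of n] y[of k] by linarith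
 have "Cauchy y"
 proof (rule metric_CauchyI)
  fix e :: real assume e: "e > 0"
  obtain N where N: "inverse (real (Suc N)) < e\<^sup>2 / 4"
   using reals_Archimedean[of "e\<^sup>2/4"] e by auto
  have "dist (y n) (y k) < e" if "n \<ge> N" "k \<ge> N" for n k
  proof -
   have "inverse (real (Suc n)) \<le> inverse (real (Suc N))" "inverse (real (Suc k)) \<le> inverse (real (Suc N))"
    using that by (auto simp: field_simps)
   then have "(norm (y n - y k))\<^sup>2 < e\<^sup>2" using close[of n k] N by linarith
   then show ?thesis using e by (simp add: dist_norm power2_less_imp_less)
  qed
  then show "\<exists>M. \<forall>m\<ge>M. \<forall>n\<ge>M. dist (y m) (y n) < e" by blast
 qed
 then obtain z where z: "y \<longlonglongrightarrow> z" using Cauchy_convergent convergent_def by blast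
 have "(\<lambda>n. J (y n)) \<longlonglongrightarrow> J z"
  unfolding J_def by (intro tendsto_intros z tendsto)
 moreover have "(\<lambda>n. m + inverse (real (Suc n))) \<longlonglongrightarrow> m + 0"
  by (intro tendsto_intros LIMSEQ_inverse_real_of_nat)
 ultimately have Jz: "J z \<le> m"
  using y by (intro LIMSEQ_le[of "\<lambda>n. J (y n)" _ "\<lambda>n. m + inverse (real (Suc n))"]) (auto intro: less_imp_le)
 have "f w = inner z w" for w
 proof (rule ccontr)
  assume ne: "f w \<noteq> inner z w"
  define d where "d = f w - inner z w"
  define c where "c = inner w w"
  have c: "0 \<le> c" by (simp add: c_def)
  have J: "J (z + t *\<^sub>R w) = J z + t\<^sup>2 * c - 2 * t * d" for t
   unfolding J_def d_def c_def power2_norm_eq_inner by (simp add: scaleR add inner_add_left inner_add_right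
    inner_commute algebra_simps power2_eq_square)
  \<comment> \<open>A step in direction \<open>w\<close> that lowers \<open>J\<close> whenever
    \<open>d\<close> is nonzero; the added 1 covers the case \<open>w = 0\<close>.\<close>
  define t where "t = d / (1 + c)"
  have "t\<^sup>2 * c - 2 * t * d \<ge> 0" using J[of t] mle[of "z + t *\<^sub>R w"] Jz by linarith
  moreover have "t\<^sup>2 * c - 2 * t * d = (d\<^sup>2 / (1+c)) * (c / (1 + c) - 2)"
   using c by (simp add: t_def divide_simps power2_eq_square) (simp add: algebra_simps)
  moreover have "c / (1 + c) < 2" using c by (simp add: field_simps)
  moreover have "d\<^sup>2 / (1+c) > 0" using ne c by (simp add: d_def)
  ultimately show False by (smt (verit) mult_pos_neg)
 qed
 then show ?thesis by blast
qed

section \<open>The algebra of bounded operators\<close>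

lemma scaleC_zero_right [simp]: "scaleC c (0::'h::chilbert_space) = 0"
 using scaleC_add_right[of c 0 0] by simp

lemma scaleC_minus_right: "scaleC c (- x) = - scaleC c (x::'h::chilbert_space)"
 using scaleC_add_right[of c x "-x"] by (simp add: eq_neg_iff_add_eq_0 add.commute)

lemma scaleC_diff_right: "scaleC c (x - y) = scaleC c x - scaleC c (y::'h::chilbert_space)"
 using scaleC_add_right[of c x "-y"] by (simp add: scaleC_minus_right)

lemma scaleC_scaleR: "scaleC c (scaleR r x) = scaleR r (scaleC c (x::'h::chilbert_space))"
 by (simp add: scaleC_of_real [symmetric] scaleC_scaleC mult.commute)

lemma norm_scaleC: "norm (scaleC c x) = cmod c * norm (x::'h::chilbert_space)"
proof -
 have "complex_of_real ((norm (scaleC c x))\<^sup>2) = (c * cnj c) * cinner x x"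
  by (simp only: cinner_self [symmetric] cinner_scaleC_left cinner_scaleC_right mult_ac)
 also have "\<dots> = complex_of_real ((cmod c * norm x)\<^sup>2)"
  by (simp only: cinner_self complex_norm_square [symmetric] of_real_mult [symmetric] power_mult_distrib)
 finally have "complex_of_real ((norm (scaleC c x))\<^sup>2) = complex_of_real ((cmod c * norm x)\<^sup>2)" .
 then show ?thesis by (simp only: of_real_eq_iff) (rule power2_eq_imp_eq, simp_all)
qed

text \<open>A type of its own makes the complex-linear operators an instance of the algebra classes,
  so that ring identities can be simplified; \<open>blin\<close> carries the results back to sets of
  operators.\<close>

typedef (overloaded) 'h bop = "bounded_operators :: ('h::chilbert_space \<Rightarrow>\<^sub>L 'h) set"
 morphisms blin Bop
proof
 show "(0::'h \<Rightarrow>\<^sub>L 'h) \<in> bounded_operators" by (simp add: bounded_operators_def)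
qed

setup_lifting type_definition_bop

lemma bounded_linear_scaleC: "bounded_linear (scaleC c :: 'h::chilbert_space => 'h)"
 by (rule bounded_linear_intro[where K = "cmod c"])
   (simp_all add: scaleC_add_right scaleC_scaleR norm_scaleC)

lemma op_scaleC_apply: "blinfun_apply (op_scaleC c T) x = scaleC c (blinfun_apply T x)"
 unfolding op_scaleC_def by (subst bounded_linear_Blinfun_apply)
   (auto intro: bounded_linear_compose[OF bounded_linear_scaleC blinfun.bounded_linear_right])

instantiation bop :: (chilbert_space) real_normed_algebra
begin
lift_definition zero_bop :: "'a bop" is 0 by (simp add: bounded_operators_def)
lift_definition plus_bop :: "'a bop => 'a bop => 'a bop" is "(+)"
 by (simp add: bounded_operators_def blinfun.add_left scaleC_add_right)
lift_definition minus_bop :: "'a bop => 'a bop => 'a bop" is "(-)"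
 by (simp add: bounded_operators_def blinfun.diff_left scaleC_diff_right)
lift_definition uminus_bop :: "'a bop => 'a bop" is "uminus"
 by (simp add: bounded_operators_def blinfun.minus_left scaleC_minus_right)
lift_definition scaleR_bop :: "real => 'a bop => 'a bop" is "scaleR"
 by (simp add: bounded_operators_def blinfun.scaleR_left scaleC_scaleR)
lift_definition times_bop :: "'a bop => 'a bop => 'a bop" is "(o\<^sub>L)"
 by (simp add: bounded_operators_def)
lift_definition norm_bop :: "'a bop => real" is norm .
definition dist_bop :: "'a bop => 'a bop => real" where "dist_bop a b = norm (a - b)"
definition sgn_bop :: "'a bop => 'a bop" where "sgn_bop x = scaleR (inverse (norm x)) x"
definition uniformity_bop :: "('a bop \<times> 'a bop) filter" where
 "uniformity_bop = (INF e\<in>{0<..}. principal {(x, y). dist x y < e})"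
definition open_bop :: "'a bop set => bool" where
 "open_bop U = (\<forall>x\<in>U. eventually (\<lambda>(x', y). x' = x --> y \<in> U) uniformity)"
instance
proof
 fix a b c :: "'a bop" and r s :: real
 show "dist a b = norm (a - b)" by (rule dist_bop_def)
 show "sgn a = inverse (norm a) *\<^sub>R a" by (rule sgn_bop_def)
 show "uniformity = (INF e\<in>{0<..}. principal {(x, y). dist (x::'a bop) y < e})"
  by (rule uniformity_bop_def)
 show "open U = (\<forall>x\<in>U. \<forall>\<^sub>F (x', y) in uniformity. x' = x --> y \<in> U)" for U :: "'a bop set"
  by (rule open_bop_def)
 show "a + b + c = a + (b + c)" "a + b = b + a" "0 + a = a" "- a + a = 0" "a - b = a + - b"
  by (transfer, simp)+
 show "r *\<^sub>R (a + b) = r *\<^sub>R a + r *\<^sub>R b" "(r + s) *\<^sub>R a = r *\<^sub>R a + s *\<^sub>R a"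
  "r *\<^sub>R s *\<^sub>R a = (r * s) *\<^sub>R a" "1 *\<^sub>R a = a"
  by (transfer, simp add: scaleR_add_right scaleR_add_left)+
 show "a * b * c = a * (b * c)" "(a + b) * c = a * c + b * c" "a * (b + c) = a * b + a * c"
  "r *\<^sub>R a * b = r *\<^sub>R (a * b)" "a * r *\<^sub>R b = r *\<^sub>R (a * b)"
  by (transfer, auto intro!: blinfun_eqI simp: blinfun.bilinear_simps)+
 show "norm a = 0 \<longleftrightarrow> a = 0" by transfer simp
 show "norm (a + b) \<le> norm a + norm b" by transfer (rule norm_triangle_ineq)
 show "norm (r *\<^sub>R a) = \<bar>r\<bar> * norm a" by transfer simp
 show "norm (a * b) \<le> norm a * norm b" by transfer (rule norm_blinfun_compose)
qed
end

text \<open>Only a monoid: the Hilbert space may be zero, in which case \<open>1 = 0\<close>.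
  Accordingly the norm of 1 is bounded by 1 and not computed.\<close>

instantiation bop :: (chilbert_space) monoid_mult
begin
lift_definition one_bop :: "'a bop" is id_blinfun by (simp add: bounded_operators_def)
instance by standard (transfer, auto intro!: blinfun_eqI)+
end

lift_definition ap :: "'h::chilbert_space bop => 'h => 'h" is blinfun_apply .
lift_definition csc :: "complex => 'h::chilbert_space bop => 'h bop" is op_scaleC
 by (simp add: bounded_operators_def op_scaleC_apply scaleC_scaleC mult.commute)

lemma bop_eqI: "(\<And>x. ap S x = ap T x) ==> S = T" by transfer (rule blinfun_eqI)

lemma ap_simps [simp]:
 "ap (S + T) x = ap S x + ap T x" "ap (S - T) x = ap S x - ap T x" "ap (- S) x = - ap S x"
 "ap (r *\<^sub>R S) x = r *\<^sub>R ap S x" "ap (S * T) x = ap S (ap T x)" "ap 0 x = 0" "ap 1 x = x"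
 "ap (csc c S) x = scaleC c (ap S x)" by (transfer, simp add: blinfun.bilinear_simps op_scaleC_apply)+

lemma ap_linear:
 "ap T (x + y) = ap T x + ap T y" "ap T (x - y) = ap T x - ap T y" "ap T (- x) = - ap T x"
 "ap T (r *\<^sub>R x) = r *\<^sub>R ap T x" "ap T 0 = 0" "ap T (scaleC c x) = scaleC c (ap T x)"
 by (transfer, simp add: blinfun.bilinear_simps bounded_operators_def)+

lemma norm_ap: "norm (ap T x) \<le> norm T * norm x" by transfer (rule norm_blinfun)

lemma norm_bop_le: "0 \<le> b ==> (\<And>x. norm (ap T x) \<le> b * norm x) ==> norm T \<le> b"
 by transfer (rule norm_blinfun_bound)

lemma bounded_linear_ap: "bounded_linear (\<lambda>T. ap T x)"
 by (rule bounded_linear_intro[where K = "norm x"]) (simp_all add: norm_ap)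

lemma bounded_linear_ap_right: "bounded_linear (ap T)"
 by (rule bounded_linear_intro[where K = "norm T"]) (simp_all add: ap_linear, metis norm_ap mult.commute)

lemma bop_of_linear:
 fixes f :: "'h::chilbert_space => 'h"
 assumes "\<And>x y. f (x + y) = f x + f y" "\<And>c x. f (scaleC c x) = scaleC c (f x)"
  and "\<And>x. norm (f x) \<le> norm x * K"
 shows "\<exists>T. \<forall>x. ap T x = f x"
proof -
 have bl: "bounded_linear f" using assms(1,3) assms(2)[of "complex_of_real _"]
  by (intro bounded_linear_intro[where K = K]) (auto simp: scaleC_of_real)
 have "Blinfun f \<in> bounded_operators"
  by (simp add: bounded_operators_def bounded_linear_Blinfun_apply[OF bl] assms(2))
 then have "ap (Bop (Blinfun f)) x = f x" for x
  by (simp add: ap.rep_eq Bop_inverse bounded_linear_Blinfun_apply[OF bl])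
 then show ?thesis by blast
qed

instance bop :: (chilbert_space) banach
proof
 fix X :: "nat => 'a bop" assume X: "Cauchy X"
 have "\<exists>l. (\<lambda>n. ap (X n) x) \<longlonglongrightarrow> l" for x
  using bounded_linear.Cauchy[OF bounded_linear_ap X, of x] Cauchy_convergent convergent_def by blast
 then obtain f where f: "\<And>x. (\<lambda>n. ap (X n) x) \<longlonglongrightarrow> f x" by metis
 obtain K where K: "\<And>n. norm (X n) \<le> K" using Cauchy_Bseq[OF X] by (auto simp: Bseq_def)
 have "\<exists>T. \<forall>x. ap T x = f x"
 proof (rule bop_of_linear[where K = K])
  fix x y c
  show "f (x + y) = f x + f y" by (rule LIMSEQ_unique[OF f]) (simp only: ap_linear, intro tendsto_intros f)
  show "f (scaleC c x) = scaleC c (f x)"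
   by (rule LIMSEQ_unique[OF f]) (simp only: ap_linear, intro bounded_linear.tendsto[OF bounded_linear_scaleC] f)
  show "norm (f x) \<le> norm x * K"
  proof (rule LIMSEQ_le_const2[OF tendsto_norm[OF f]], intro exI allI impI)
   fix n show "norm (ap (X n) x) \<le> norm x * K"
    using norm_ap[of "X n" x] K[of n] by (smt (verit) mult.commute mult_left_mono norm_ge_zero)
  qed
 qed
 then obtain T where T: "\<And>x. ap T x = f x" by blast
 have "X \<longlonglongrightarrow> T"
 proof (rule metric_LIMSEQ_I)
  fix e :: real assume e: "e > 0"
  obtain N where N: "\<And>m n. m \<ge> N ==> n \<ge> N ==> norm (X m - X n) < e / 2"
   using CauchyD[OF X, of "e/2"] e by auto
  have "norm (X n - T) \<le> e / 2" if n: "n \<ge> N" for n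
  proof (rule norm_bop_le)
   fix x
   have "(\<lambda>m. norm (ap (X n) x - ap (X m) x)) \<longlonglongrightarrow> norm (ap (X n) x - f x)"
    by (intro tendsto_intros f)
   moreover have "\<exists>N. \<forall>m\<ge>N. norm (ap (X n) x - ap (X m) x) \<le> e / 2 * norm x"
   proof (intro exI allI impI)
    fix m assume "m \<ge> N"
    then show "norm (ap (X n) x - ap (X m) x) \<le> e / 2 * norm x"
     using norm_ap[of "X n - X m" x] N[OF n, of m] by (smt (verit) ap_simps(2) mult_right_mono norm_ge_zero)
   qed
   ultimately show "norm (ap (X n - T) x) \<le> e / 2 * norm x"
    using LIMSEQ_le_const2 by (simp only: T ap_simps)
  qed (use e in simp)
  then show "\<exists>no. \<forall>n\<ge>no. dist (X n) T < e"
   using e by (intro exI[of _ N]) (force simp: dist_norm)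
 qed
 then show "convergent X" by (auto simp: convergent_def)
qed

text \<open>Riesz is applied to the real inner product; since the complex one is determined by it
  through \<open>cinner_eq_inner\<close>, the real adjoint is also the complex adjoint, and its
  linearity follows by uniqueness.\<close>

lemma ex_adjoint:
 fixes T :: "'h::chilbert_space bop"
 shows "\<exists>S. \<forall>x y. cinner (ap S x) y = cinner x (ap T y)"
proof -
 have "\<exists>z. \<forall>y. inner x (ap T y) = inner z y" for x
  by (intro riesz_representation bounded_linear_compose[OF bounded_linear_inner_right bounded_linear_ap_right])
 then obtain f where f: "\<And>x y. inner x (ap T y) = inner (f x) y" by metis
 have cf: "cinner (f x) y = cinner x (ap T y)" for x y by (simp add: cinner_eq_inner f [symmetric] ap_linear)
 have "\<exists>S. \<forall>x. ap S x = f x"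
 proof (rule bop_of_linear[where K = "norm T"])
  fix x y c
  show "f (x + y) = f x + f y" by (rule cinner_ext) (simp add: cf cinner_add_left)
  show "f (scaleC c x) = scaleC c (f x)" by (rule cinner_ext) (simp add: cf cinner_scaleC_left)
  have "norm (f x) * norm (f x) \<le> norm x * norm T * norm (f x)"
  proof -
   have "norm (f x) * norm (f x) = inner x (ap T (f x))" by (simp add: f norm_eq_sqrt_inner)
   also have "\<dots> \<le> norm x * norm (ap T (f x))" by (rule norm_cauchy_schwarz)
   also have "\<dots> \<le> norm x * (norm T * norm (f x))" by (intro mult_left_mono norm_ap) simp
   finally show ?thesis by (simp add: mult_ac)
  qed
  then show "norm (f x) \<le> norm x * norm T"
   by (cases "norm (f x) = 0") (simp_all add: mult_le_cancel_right)
 qed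
 then show ?thesis using cf by metis
qed

definition adj :: "'h::chilbert_space bop => 'h bop" where
 "adj T = (SOME S. \<forall>x y. cinner (ap S x) y = cinner x (ap T y))"

lemma cinner_adj: "cinner (ap (adj T) x) y = cinner x (ap T y)"
 unfolding adj_def using someI_ex[OF ex_adjoint[of T]] by blast

lemma cinner_adj_right: "cinner x (ap (adj T) y) = cinner (ap T x) y" by (metis cinner_adj cinner_commute)

lemma adj_unique: "(\<And>x y. cinner (ap S x) y = cinner x (ap T y)) ==> S = adj T"
 by (rule bop_eqI, rule cinner_ext) (simp add: cinner_adj)

lemma adj_adj [simp]: "adj (adj T) = T" by (rule adj_unique [symmetric]) (simp add: cinner_adj_right)
lemma adj_add [simp]: "adj (S + T) = adj S + adj T"
 by (rule adj_unique [symmetric]) (simp add: cinner_adj cinner_add_left cinner_add_right)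
lemma adj_mult [simp]: "adj (S * T) = adj T * adj S" by (rule adj_unique [symmetric]) (simp add: cinner_adj)
lemma adj_csc [simp]: "adj (csc c T) = csc (cnj c) (adj T)"
 by (rule adj_unique [symmetric]) (simp add: cinner_adj cinner_scaleC_left cinner_scaleC_right)
lemma adj_one [simp]: "adj 1 = 1" by (rule adj_unique [symmetric]) simp

lemma csc_of_real: "csc (complex_of_real r) T = r *\<^sub>R T" by (rule bop_eqI) (simp add: scaleC_of_real)
lemma csc_add_right: "csc c (S + T) = csc c S + csc c T" by (rule bop_eqI) (simp add: scaleC_add_right)
lemma csc_add_left: "csc (c + d) T = csc c T + csc d T" by (rule bop_eqI) (simp add: scaleC_add_left)
lemma csc_csc [simp]: "csc c (csc d T) = csc (c * d) T" by (rule bop_eqI) (simp add: scaleC_scaleC)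
lemma csc_mult_left [simp]: "csc c S * T = csc c (S * T)" by (rule bop_eqI) simp
lemma csc_mult_right [simp]: "S * csc c T = csc c (S * T)" by (rule bop_eqI) (simp add: ap_linear)
lemma csc_one [simp]: "csc 1 T = T" using csc_of_real[of 1 T] by simp
lemma csc_zero [simp]: "csc 0 T = 0" "csc c 0 = 0" using csc_of_real[of 0 T] by (auto intro: bop_eqI)
lemma csc_minus: "csc (- c) T = - csc c T" "csc c (- T) = - csc c T"
 using csc_add_left[of c "-c" T] csc_add_right[of c T "-T"] by (simp_all add: eq_neg_iff_add_eq_0 add.commute)
lemma csc_diff_right: "csc c (S - T) = csc c S - csc c T"
 using csc_add_right[of c S "-T"] by (simp add: csc_minus)
lemma csc_diff_left: "csc (c - d) T = csc c T - csc d T"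
 using csc_add_left[of c "-d" T] by (simp add: csc_minus)
lemma csc_sum: "csc c (sum f I) = (\<Sum>i\<in>I. csc c (f i))"
 by (induction I rule: infinite_finite_induct) (simp_all add: csc_add_right)

lemma adj_scaleR [simp]: "adj (r *\<^sub>R T) = r *\<^sub>R adj T" by (simp add: csc_of_real [symmetric])
lemma adj_zero [simp]: "adj 0 = 0" using adj_scaleR[of 0 0] by simp
lemma adj_minus [simp]: "adj (- T) = - adj T" using adj_scaleR[of "-1" T] by simp
lemma adj_diff [simp]: "adj (S - T) = adj S - adj T" using adj_add[of S "-T"] by simp
lemma adj_sum: "adj (sum f I) = (\<Sum>i\<in>I. adj (f i))"
 by (induction I rule: infinite_finite_induct) simp_all
lemma adj_eq_iff [simp]: "adj S = adj T \<longleftrightarrow> S = T" by (metis adj_adj)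

lemma inner_adj: "inner (ap (adj T) x) y = inner x (ap T y)" by (simp add: Re_cinner [symmetric] cinner_adj)

lemma norm_ap_square: "(norm (ap T x))\<^sup>2 = inner x (ap (adj T * T) x)"
 by (metis ap_simps(5) inner_adj inner_commute power2_norm_eq_inner)

lemma norm_adj_le: "norm (adj T) \<le> norm T"
proof (rule norm_bop_le)
 fix x
 have "(norm (ap (adj T) x))\<^sup>2 = inner x (ap T (ap (adj T) x))"
  by (simp add: power2_norm_eq_inner inner_adj)
 also have "\<dots> \<le> norm x * (norm T * norm (ap (adj T) x))"
  by (rule order_trans[OF norm_cauchy_schwarz]) (intro mult_left_mono norm_ap norm_ge_zero)
 finally show "norm (ap (adj T) x) \<le> norm T * norm x"
  by (cases "norm (ap (adj T) x) = 0") (simp_all add: power2_eq_square mult_ac)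
qed simp

lemma norm_adj [simp]: "norm (adj T) = norm T" by (metis adj_adj norm_adj_le order_antisym)

lemma norm_csc [simp]: "norm (csc c T) = cmod c * norm T"
proof (rule order_antisym)
 show le: "norm (csc c T) \<le> cmod c * norm T" for c and T :: "'a bop" by (rule norm_bop_le)
   (auto simp: norm_scaleC mult.assoc intro!: mult_left_mono norm_ap)
 show "cmod c * norm T \<le> norm (csc c T)"
 proof (cases "c = 0")
  case False
  have "norm T \<le> cmod (inverse c) * norm (csc c T)" using le[of "inverse c" "csc c T"] False by simp
  then show ?thesis using False by (simp add: norm_inverse norm_divide field_simps)
 qed simp
qed

lemma norm_one_le: "norm (1 :: 'h::chilbert_space bop) \<le> 1" by (rule norm_bop_le) simp_all

lemma bounded_linear_adj: "bounded_linear adj" by (rule bounded_linear_intro[where K = 1]) simp_all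

lemma op_adjoint_blin: "op_adjoint (blin T) = blin (adj T)" unfolding op_adjoint_def
proof (rule the_equality)
 show "\<forall>x y. cinner (blin (adj T) x) y = cinner x (blin T y)"
  using cinner_adj[of T] by (simp add: ap.rep_eq)
 fix S assume "\<forall>x y. cinner (blinfun_apply S x) y = cinner x (blin T y)"
 then show "S = blin (adj T)" by (intro blinfun_eqI cinner_ext) (metis ap.rep_eq cinner_adj)
qed

section \<open>Positive operators\<close>

text \<open>\<open>inner\<close> is the real part of the complex inner product, so nonnegativity
  alone does not force self-adjointness: multiplication by the imaginary unit gives 0
  throughout.\<close>

definition pos :: "'h::chilbert_space bop => bool" where
 "pos T \<longleftrightarrow> adj T = T \<and> (\<forall>x. 0 \<le> inner x (ap T x))"

lemma posI: "adj T = T ==> (\<And>x. 0 \<le> inner x (ap T x)) ==> pos T" by (simp add: pos_def)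
lemma pos_adj: "pos T ==> adj T = T" by (simp add: pos_def)
lemma pos_inner: "pos T ==> 0 \<le> inner x (ap T x)" by (simp add: pos_def)
lemma pos_diff_inner: "pos (T - S) ==> inner x (ap S x) \<le> inner x (ap T x)"
 using pos_inner[of "T - S" x] by (simp add: inner_diff_right)
lemma pos_zero [simp]: "pos 0" by (simp add: pos_def)
lemma pos_one [simp]: "pos 1" by (simp add: pos_def)
lemma pos_add: "pos S ==> pos T ==> pos (S + T)" by (simp add: pos_def inner_add_right)
lemma pos_scaleR: "0 \<le> r ==> pos T ==> pos (r *\<^sub>R T)" by (simp add: pos_def)
lemma pos_sum: "(\<And>i. i \<in> I ==> pos (f i)) ==> pos (sum f I)"
 by (induction I rule: infinite_finite_induct) (simp_all add: pos_add)
lemma pos_trans: "pos (S - T) ==> pos (T - U) ==> pos (S - U)" using pos_add[of "S - T" "T - U"] by simp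

lemma pos_conj: "pos P ==> pos (adj T * P * T)"
 by (simp add: pos_def mult.assoc) (metis inner_adj inner_commute)

lemma pos_adj_mult: "pos (adj T * T)" using pos_conj[of 1 T] by simp

lemma pos_sq: "adj T = T ==> pos (T * T)" using pos_adj_mult[of T] by simp

lemma discriminant_nonpos:
 fixes a b c :: real
 assumes q: "\<And>t. 0 \<le> a + 2 * t * b + t\<^sup>2 * c" and a: "0 \<le> a" "0 \<le> c"
 shows "b\<^sup>2 \<le> a * c"
proof (cases "c = 0")
 case True
 have "b = 0"
 proof (rule ccontr)
  assume "b \<noteq> 0"
  then show False using q[of "- (a + 1) / (2 * b)"] True by (simp add: field_simps)
 qed
 then show "b\<^sup>2 \<le> a * c" using a by simp
next
 case False
 then have "a + 2 * (- b / c) * b + (- b / c)\<^sup>2 * c = (a * c - b\<^sup>2) / c"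
  by (simp add: field_simps power2_eq_square)
 then show "b\<^sup>2 \<le> a * c" using q[of "- b / c"] a False by (simp add: zero_le_divide_iff)
qed

lemma pos_cauchy_schwarz:
 assumes "pos T"
 shows "(inner x (ap T y))\<^sup>2 \<le> inner x (ap T x) * inner y (ap T y)"
proof (rule discriminant_nonpos)
 have sym: "inner y (ap T x) = inner x (ap T y)" by (metis assms inner_adj inner_commute pos_adj)
 show "0 \<le> inner x (ap T x) + 2 * t * inner x (ap T y) + t\<^sup>2 * inner y (ap T y)" for t
  using pos_inner[OF assms, of "x + t *\<^sub>R y"] sym
  by (simp add: ap_linear inner_add_left inner_add_right power2_eq_square algebra_simps)
qed (simp_all add: assms pos_inner)

text \<open>Cauchy--Schwarz for the form of \<open>T\<close> at the pair \<open>ap T x\<close>,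
  \<open>x\<close>, followed by division by \<open>(norm (ap T x))^2\<close>. It is the vector form
  of \<open>T * T <= c * T\<close>, and turns convergence of quadratic forms into strong
  convergence.\<close>

lemma pos_norm_ap:
 assumes "pos T" "\<And>y. inner y (ap T y) \<le> c * (norm y)\<^sup>2"
 shows "(norm (ap T x))\<^sup>2 \<le> c * inner x (ap T x)"
proof -
 define n where "n = (norm (ap T x))\<^sup>2"
 have "n\<^sup>2 \<le> inner (ap T x) (ap T (ap T x)) * inner x (ap T x)"
  using pos_cauchy_schwarz[OF assms(1), of "ap T x" x] by (simp add: n_def power2_norm_eq_inner)
 also have "\<dots> \<le> (c * n) * inner x (ap T x)"
  unfolding n_def by (intro mult_right_mono assms(2) pos_inner assms(1))
 finally have "n * n \<le> n * (c * inner x (ap T x))" by (simp add: power2_eq_square mult_ac)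
 moreover have "0 \<le> c * inner x (ap T x)"
 proof (cases "x = 0")
  case False
  have "0 \<le> c * (norm x)\<^sup>2" using assms(2)[of x] pos_inner[OF assms(1), of x] by linarith
  then have "0 \<le> c" using False by (simp add: zero_le_mult_iff)
  then show ?thesis by (simp add: pos_inner assms(1))
 qed simp
 ultimately have "n \<le> c * inner x (ap T x)"
  by (metis mult_le_cancel_left_pos zero_le_power2 n_def order_le_less)
 then show ?thesis by (simp add: n_def)
qed

lemma pos_norm_le:
 assumes "pos T" "pos (c *\<^sub>R 1 - T)" "0 \<le> c"
 shows "norm T \<le> c"
proof (rule norm_bop_le)
 fix x
 have b: "inner y (ap T y) \<le> c * (norm y)\<^sup>2" for y
  using pos_inner[OF assms(2), of y] by (simp add: inner_diff_right power2_norm_eq_inner)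
 have "(norm (ap T x))\<^sup>2 \<le> c * (c * (norm x)\<^sup>2)"
  using pos_norm_ap[OF assms(1) b, of x] b[of x] assms(3) mult_left_mono order_trans by blast
 then show "norm (ap T x) \<le> c * norm x"
  using assms(3) by - (rule power2_le_imp_le, simp_all add: power_mult_distrib power2_eq_square[of c] mult.assoc)
qed (rule assms(3))

lemma pos_norm_diff:
 assumes "adj T = T" "norm T \<le> c"
 shows "pos (c *\<^sub>R 1 - T)"
proof (rule posI)
 fix x
 have "inner x (ap T x) \<le> norm x * norm (ap T x)" by (rule norm_cauchy_schwarz)
 also have "\<dots> \<le> norm x * (c * norm x)"
 proof -
  have "norm (ap T x) \<le> c * norm x" by (rule order_trans[OF norm_ap]) (simp add: assms(2) mult_right_mono)
  then show ?thesis by (simp add: mult_left_mono)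
 qed
 finally show "0 \<le> inner x (ap (c *\<^sub>R 1 - T) x)"
  by (simp add: inner_diff_right power2_norm_eq_inner[symmetric] power2_eq_square mult_ac)
qed (simp add: assms)

lemma pos_norm_sq_diff: "norm T \<le> c ==> pos (c\<^sup>2 *\<^sub>R 1 - adj T * T)"
proof (rule posI)
 assume c: "norm T \<le> c"
 fix x
 have "norm (ap T x) \<le> c * norm x" using norm_ap[of T x] c by (meson mult_right_mono norm_ge_zero order_trans)
 then have "(norm (ap T x))\<^sup>2 \<le> (c * norm x)\<^sup>2" by (intro power_mono) simp_all
 then show "0 \<le> inner x (ap (c\<^sup>2 *\<^sub>R 1 - adj T * T) x)"
  using norm_ap_square[of T x] by (simp add: inner_diff_right power_mult_distrib power2_norm_eq_inner)
qed simp

lemma norm_le_of_sq: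
 assumes "pos (1 - adj T * T)" shows "norm T \<le> 1"
proof (rule norm_bop_le)
 fix x
 have "(norm (ap T x))\<^sup>2 \<le> (norm x)\<^sup>2" using pos_inner[OF assms, of x] norm_ap_square[of T x]
  by (simp add: inner_diff_right power2_norm_eq_inner)
 then show "norm (ap T x) \<le> 1 * norm x" by simp
qed simp

lemma pos_limit:
 assumes "\<And>n. pos (X n)" "\<And>x. (\<lambda>n. ap (X n) x) \<longlonglongrightarrow> ap T x"
 shows "pos T"
proof (rule posI)
 have "ap (adj T) x = ap T x" for x
 proof (rule cinner_ext)
  fix y
  have "inner (ap (adj T) x) z = inner (ap T x) z" for z
  proof (rule LIMSEQ_unique)
   show "(\<lambda>n. inner (ap (X n) x) z) \<longlonglongrightarrow> inner (ap T x) z"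
    by (intro tendsto_intros assms)
   have "(\<lambda>n. inner x (ap (X n) z)) \<longlonglongrightarrow> inner x (ap T z)"
    by (intro tendsto_intros assms)
   then show "(\<lambda>n. inner (ap (X n) x) z) \<longlonglongrightarrow> inner (ap (adj T) x) z"
    by (simp add: inner_adj) (simp add: inner_adj [symmetric] pos_adj[OF assms(1)])
  qed
  then show "cinner (ap (adj T) x) y = cinner (ap T x) y" by (simp add: cinner_eq_inner)
 qed
 then show "adj T = T" by (rule bop_eqI)
 fix x
 have "(\<lambda>n. inner x (ap (X n) x)) \<longlonglongrightarrow> inner x (ap T x)"
  by (intro tendsto_intros assms)
 then show "0 \<le> inner x (ap T x)" by (rule LIMSEQ_le_const) (simp add: pos_inner assms(1))
qed

lemma sot_limit_exists:
 fixes X :: "nat => 'h::chilbert_space bop"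
 assumes "\<And>n. norm (X n) \<le> K" "\<And>x. Cauchy (\<lambda>n. ap (X n) x)"
 shows "\<exists>T. norm T \<le> K \<and> (\<forall>x. (\<lambda>n. ap (X n) x) \<longlonglongrightarrow> ap T x)"
proof -
 have "\<exists>l. (\<lambda>n. ap (X n) x) \<longlonglongrightarrow> l" for x
  using assms(2) Cauchy_convergent convergent_def by blast
 then obtain f where f: "\<And>x. (\<lambda>n. ap (X n) x) \<longlonglongrightarrow> f x" by metis
 have bd: "norm (f x) \<le> norm x * K" for x
 proof (rule LIMSEQ_le_const2[OF tendsto_norm[OF f]], intro exI allI impI)
  fix n show "norm (ap (X n) x) \<le> norm x * K"
   using norm_ap[of "X n" x] assms(1)[of n] by (smt (verit) mult.commute mult_left_mono norm_ge_zero)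
 qed
 have "\<exists>T. \<forall>x. ap T x = f x"
 proof (rule bop_of_linear[where K = K])
  fix x y c
  show "f (x + y) = f x + f y" by (rule LIMSEQ_unique[OF f]) (simp only: ap_linear, intro tendsto_intros f)
  show "f (scaleC c x) = scaleC c (f x)"
   by (rule LIMSEQ_unique[OF f]) (simp only: ap_linear, intro bounded_linear.tendsto[OF bounded_linear_scaleC] f)
 qed (rule bd)
 then obtain T where T: "\<And>x. ap T x = f x" by blast
 moreover have "norm T \<le> K"
  by (rule norm_bop_le) (use bd assms(1)[of 0] norm_ge_zero[of "X 0"] in \<open>auto simp: T mult.commute simp del: norm_ge_zero\<close>)
 ultimately show ?thesis using f by auto
qed

text \<open>The numbers \<open>inner x (ap (X n) x)\<close> increase and are bounded, hence Cauchy;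
  \<open>pos_norm_ap\<close> for the positive differences bounds the squared distances of the
  vectors \<open>ap (X n) x\<close> by the differences of these numbers.\<close>

lemma monotone_limit:
 assumes inc: "\<And>n. pos (X (Suc n) - X n)" and p: "\<And>n. pos (X n)" and bd: "\<And>n. pos (c *\<^sub>R 1 - X n)"
 shows "\<exists>T. (\<forall>x. (\<lambda>n. ap (X n) x) \<longlonglongrightarrow> ap T x) \<and> pos T \<and> pos (c *\<^sub>R 1 - T) \<and> (\<forall>n. pos (T - X n))"
proof -
 have mono: "pos (X m - X n)" if "n \<le> m" for n m
  using that by (induction rule: dec_induct) (auto intro: pos_trans inc)
 have c: "inner y (ap (X m - X n) y) \<le> \<bar>c\<bar> * (norm y)\<^sup>2" for m n y
  using pos_inner[OF bd[of m], of y] pos_inner[OF p[of n], of y]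
  by (simp add: inner_diff_right power2_norm_eq_inner) (smt (verit) inner_ge_zero mult_right_mono)
 have nb: "norm (X n) \<le> \<bar>c\<bar>" for n
 proof (rule pos_norm_le[OF p])
  show "pos (\<bar>c\<bar> *\<^sub>R 1 - X n)"
   using pos_add[OF bd[of n] pos_scaleR[OF _ pos_one, of "\<bar>c\<bar> - c"]] by (simp add: algebra_simps)
 qed simp
 have "Cauchy (\<lambda>n. ap (X n) x)" for x
 proof -
  define u where "u n = inner x (ap (X n) x)" for n
  have "incseq u" unfolding u_def by (rule incseq_SucI) (rule pos_diff_inner[OF inc])
  moreover have "u n \<le> c * (norm x)\<^sup>2" for n
   unfolding u_def using pos_inner[OF bd[of n], of x] by (simp add: inner_diff_right power2_norm_eq_inner)
  ultimately have "convergent u" using incseq_convergent convergent_def by metis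
  then have cu: "Cauchy u" by (rule convergent_Cauchy)
  have key: "(norm (ap (X m) x - ap (X n) x))\<^sup>2 \<le> \<bar>c\<bar> * \<bar>u m - u n\<bar>" for m n
  proof -
   have *: "(norm (ap (X m) x - ap (X n) x))\<^sup>2 \<le> \<bar>c\<bar> * (u m - u n)" if "n \<le> m" for m n
    using pos_norm_ap[OF mono[OF that] c, of x] by (simp add: u_def inner_diff_right)
   show ?thesis
   proof (cases "n \<le> m")
    case True then show ?thesis using *[OF True] by (smt (verit) abs_ge_self mult_left_mono abs_ge_zero)
   next
    case False then show ?thesis using *[of m n]
     by (smt (verit, best) abs_ge_self abs_ge_zero mult_left_mono nle_le norm_minus_commute)
   qed
  qed
  show ?thesis
  proof (rule metric_CauchyI)
   fix e :: real assume e: "e > 0"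
   obtain M where M: "\<And>m n. m \<ge> M ==> n \<ge> M ==> \<bar>u m - u n\<bar> < e\<^sup>2 / (\<bar>c\<bar> + 1)"
    using CauchyD[OF cu, of "e\<^sup>2 / (\<bar>c\<bar> + 1)"] e by auto
   have "dist (ap (X m) x) (ap (X n) x) < e" if "m \<ge> M" "n \<ge> M" for m n
   proof -
    have "\<bar>c\<bar> * \<bar>u m - u n\<bar> \<le> \<bar>c\<bar> * (e\<^sup>2 / (\<bar>c\<bar> + 1))"
     using M[OF that] by (intro mult_left_mono) auto
    also have "\<dots> < e\<^sup>2" using e by (simp add: field_simps)
    finally have "(norm (ap (X m) x - ap (X n) x))\<^sup>2 < e\<^sup>2" using key[of m n] by linarith
    then show ?thesis using e by (simp add: dist_norm power2_less_imp_less)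
   qed
   then show "\<exists>M. \<forall>m\<ge>M. \<forall>n\<ge>M. dist (ap (X m) x) (ap (X n) x) < e" by blast
  qed
 qed
 then obtain T where T: "\<And>x. (\<lambda>n. ap (X n) x) \<longlonglongrightarrow> ap T x"
  using sot_limit_exists[of X "\<bar>c\<bar>", OF nb] by blast
 have "pos T" by (rule pos_limit[OF p T])
 moreover have "pos (c *\<^sub>R 1 - T)" by (rule pos_limit[OF bd]) (auto intro!: tendsto_intros T)
 moreover have "pos (T - X n)" for n
 proof (rule pos_limit[where X = "\<lambda>m. X (m + n) - X n"])
  show "(\<lambda>m. ap (X (m + n) - X n) x) \<longlonglongrightarrow> ap (T - X n) x" for x
   using LIMSEQ_ignore_initial_segment[OF T[of x], of n] by (auto intro!: tendsto_intros)
 qed (rule mono, simp)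
 ultimately show ?thesis using T by blast
qed

section \<open>Norm closed star-algebras\<close>

locale star_alg =
 fixes A :: "'h::chilbert_space bop set"
 assumes one_in [simp]: "1 \<in> A"
  and add_in [simp]: "x \<in> A ==> y \<in> A ==> x + y \<in> A"
  and mult_in [simp]: "x \<in> A ==> y \<in> A ==> x * y \<in> A"
  and csc_in [simp]: "x \<in> A ==> csc c x \<in> A"
  and adj_in [simp]: "x \<in> A ==> adj x \<in> A"
begin

lemma scaleR_in [simp]: "x \<in> A ==> r *\<^sub>R x \<in> A" by (metis csc_in csc_of_real)
lemma zero_in [simp]: "0 \<in> A" using scaleR_in[OF one_in, of 0] by simp
lemma minus_in [simp]: "x \<in> A ==> - x \<in> A" using scaleR_in[of x "-1"] by simp
lemma diff_in [simp]: "x \<in> A ==> y \<in> A ==> x - y \<in> A" using add_in[of x "-y"] by simp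
lemma sum_in [simp]: "(\<And>i. i \<in> I ==> f i \<in> A) ==> sum f I \<in> A"
 by (induction I rule: infinite_finite_induct) simp_all

end

locale cstar_alg = star_alg +
 assumes norm_closed: "closed A"
begin

lemma closed_subset_complete: "closed K ==> K \<subseteq> A ==> complete (K :: 'a bop set)"
 by (simp add: complete_eq_closed)

text \<open>If \<open>c = (T + c * c) / 2\<close> then \<open>(1 - c) * (1 - c) = 1 - T\<close>. On
  elements of norm at most \<open>norm T < 1\<close> the right side is a contraction. The complete
  set \<open>K\<close> on which Banach's theorem is applied already contains self-adjointness,
  membership in the algebra and the commutation with everything commuting with
  \<open>T\<close>.\<close>

lemma sqrt_one_minus:
 assumes T: "T \<in> A" "adj T = T" "norm T < 1"
 shows "\<exists>S\<in>A. adj S = S \<and> S * S = 1 - T \<and> (\<forall>X. X * T = T * X --> X * S = S * X)"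
proof -
 define r where "r = norm T"
 define K where "K = {c \<in> A. adj c = c \<and> norm c \<le> r \<and> (\<forall>X. X * T = T * X --> X * c = c * X)}"
 define g where "g c = (1/2) *\<^sub>R (T + c * c)" for c
 have r: "0 \<le> r" "r < 1" using T by (auto simp: r_def)
 have "closed K"
 proof -
  have "K = A \<inter> {c. adj c = c} \<inter> {c. norm c \<le> r} \<inter> (\<Inter>X\<in>{X. X * T = T * X}. {c. X * c = c * X})"
   by (auto simp: K_def)
  moreover have "closed {c :: 'a bop. adj c = c}"
   by (intro closed_Collect_eq linear_continuous_on[OF bounded_linear_adj] continuous_on_id)
  moreover have "closed {c :: 'a bop. norm c \<le> r}"
   by (intro closed_Collect_le continuous_on_norm_id continuous_on_const)
  moreover have "closed {c :: 'a bop. X * c = c * X}" for X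
   by (intro closed_Collect_eq continuous_on_mult continuous_on_id continuous_on_const)
  ultimately show ?thesis using norm_closed by (simp add: closed_Int closed_INT)
 qed
 then have cK: "complete K" by (simp add: complete_eq_closed)
 have KT: "T \<in> K" using T by (auto simp: K_def r_def)
 have gK: "g ` K \<subseteq> K"
 proof safe
  fix c assume c: "c \<in> K"
  have "norm c \<le> r" using c unfolding K_def by blast
  then have "norm (T + c * c) \<le> r + r * r"
   using r(1) by (intro order_trans[OF norm_triangle_ineq] add_mono)
    (simp_all add: r_def order_trans[OF norm_mult_ineq mult_mono])
  also have "\<dots> \<le> 2 * r" using r by (simp add: mult_left_le_one_le)
  finally have "norm (g c) \<le> r" by (simp add: g_def)
  moreover have "X * g c = g c * X" if "X * T = T * X" for X
  proof -
   have "X * c = c * X" using c that unfolding K_def by blast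
   then have "X * (c * c) = (c * c) * X" by (metis mult.assoc)
   then show ?thesis by (simp add: g_def algebra_simps that)
  qed
  moreover have "c \<in> A" "adj c = c" using c unfolding K_def by blast+
  then have "g c \<in> A" "adj (g c) = g c" using T unfolding g_def by simp_all
  ultimately show "g c \<in> K" unfolding K_def by blast
 qed
 have lip: "dist (g x) (g y) \<le> r * dist x y" if "x \<in> K" "y \<in> K" for x y
 proof -
  have e: "g x - g y = (1/2) *\<^sub>R (x * (x - y) + (x - y) * y)" by (simp add: g_def algebra_simps)
  have "norm x \<le> r" "norm y \<le> r" using that unfolding K_def by blast+
  then have "norm (x * (x - y) + (x - y) * y) \<le> r * norm (x - y) + norm (x - y) * r"
   using r(1) by (intro order_trans[OF norm_triangle_ineq add_mono] order_trans[OF norm_mult_ineq mult_mono])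
    simp_all
  then show ?thesis by (simp add: dist_norm e mult.commute)
 qed
 have "\<exists>!c\<in>K. g c = c" using Banach_fix[OF cK _ r gK] lip KT by blast
 then obtain c where c: "c \<in> K" "g c = c" by blast
 have "2 *\<^sub>R c = T + c * c" using arg_cong[OF c(2), of "\<lambda>x. 2 *\<^sub>R x"] by (simp add: g_def)
 then have "(1 - c) * (1 - c) = 1 - T" by (simp add: algebra_simps scaleR_2)
 moreover have "X * (1 - c) = (1 - c) * X" if "X * T = T * X" for X
 proof -
  have "X * c = c * X" using c(1) that unfolding K_def by blast
  then show ?thesis by (simp add: left_diff_distrib right_diff_distrib)
 qed
 moreover have "c \<in> A" "adj c = c" using c(1) unfolding K_def by blast+
 then have "1 - c \<in> A" "adj (1 - c) = 1 - c" by simp_all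
 ultimately show ?thesis by blast
qed

text \<open>The shift by \<open>e\<close> keeps the rescaled element \<open>T\<close> strictly below
  norm 1, as the fixed point construction requires. The uses let \<open>e\<close> tend to 0.\<close>

lemma sqrt_pos:
 assumes P: "P \<in> A" "pos P" and e: "e > 0"
 shows "\<exists>S\<in>A. adj S = S \<and> S * S = P + e *\<^sub>R 1 \<and> (\<forall>X. X * P = P * X --> X * S = S * X)"
proof -
 define N where "N = norm P + e"
 define T where "T = 1 - (1/N) *\<^sub>R (P + e *\<^sub>R 1)"
 have N: "N > 0" "e \<le> N" using e by (auto simp: N_def intro: add_nonneg_pos)
 have "norm T \<le> 1 - e / N"
 proof (rule pos_norm_le)
  have "T = (1/N) *\<^sub>R (norm P *\<^sub>R 1 - P)"
  proof -
   have "(1/N) *\<^sub>R (N *\<^sub>R 1 :: 'a bop) = 1" using N by simp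
   then have "T = (1/N) *\<^sub>R (N *\<^sub>R 1 - (P + e *\<^sub>R 1))" by (simp only: T_def scaleR_diff_right)
   then show ?thesis by (simp add: N_def scaleR_add_left)
  qed
  then show "pos T" using N P by (auto intro!: pos_scaleR pos_norm_diff pos_adj)
  have "(1 - e / N) *\<^sub>R 1 - T = (1/N) *\<^sub>R P" by (simp add: T_def algebra_simps)
  then show "pos ((1 - e / N) *\<^sub>R 1 - T)" using N P by (auto intro!: pos_scaleR)
 qed (use N in simp)
 then have "norm T < 1" using N e by (smt (verit) divide_pos_pos)
 moreover have "T \<in> A" "adj T = T" using P by (auto simp: T_def pos_adj)
 ultimately obtain S where S: "S \<in> A" "adj S = S" "S * S = 1 - T" "\<And>X. X * T = T * X ==> X * S = S * X"
  using sqrt_one_minus by blast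
 let ?S = "sqrt N *\<^sub>R S"
 have "?S * ?S = P + e *\<^sub>R 1" using N by (simp add: S(3)) (simp add: T_def)
 moreover have "X * ?S = ?S * X" if "X * P = P * X" for X
 proof -
  have "X * T = T * X" using that by (simp add: T_def algebra_simps)
  then have "X * S = S * X" by (rule S(4))
  then show ?thesis by simp
 qed
 moreover have "?S \<in> A" "adj ?S = ?S" using S(1,2) by simp_all
 ultimately show ?thesis by blast
qed

text \<open>Neumann series as a fixed point: with \<open>N = norm P + 1\<close> the element
  \<open>T = 1 - (1 + P) / N\<close> has norm at most \<open>1 - 1 / N\<close>, and the fixed point
  of \<open>c = 1 / N + T * c\<close> inverts \<open>1 + P\<close>.\<close>

lemma inverse_one_plus:
 assumes P: "P \<in> A" "pos P"
 shows "\<exists>X\<in>A. adj X = X \<and> X * (1 + P) = 1 \<and> (1 + P) * X = 1"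
proof -
 define N where "N = norm P + 1"
 define T where "T = 1 - (1/N) *\<^sub>R (1 + P)"
 have N: "N \<ge> 1" by (simp add: N_def)
 have r: "norm T \<le> 1 - 1 / N"
 proof (rule pos_norm_le)
  have "T = (1/N) *\<^sub>R (norm P *\<^sub>R 1 - P)"
  proof -
   have "(1/N) *\<^sub>R (N *\<^sub>R 1 :: 'a bop) = 1" using N by simp
   then have "T = (1/N) *\<^sub>R (N *\<^sub>R 1 - (1 + P))" by (simp only: T_def scaleR_diff_right)
   then show ?thesis by (simp add: N_def scaleR_add_left)
  qed
  then show "pos T" using N P by (auto intro!: pos_scaleR pos_norm_diff pos_adj)
  have "(1 - 1 / N) *\<^sub>R 1 - T = (1/N) *\<^sub>R P" by (simp add: T_def algebra_simps)
  then show "pos ((1 - 1 / N) *\<^sub>R 1 - T)" using N P by (auto intro!: pos_scaleR)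
 qed (use N in simp)
 define K where "K = {c \<in> A. adj c = c \<and> c * P = P * c}"
 define g where "g c = (1/N) *\<^sub>R 1 + T * c" for c
 have "closed K"
 proof -
  have "K = A \<inter> {c. adj c = c} \<inter> {c. c * P = P * c}" by (auto simp: K_def)
  moreover have "closed {c :: 'a bop. adj c = c}"
   by (intro closed_Collect_eq linear_continuous_on[OF bounded_linear_adj] continuous_on_id)
  moreover have "closed {c :: 'a bop. c * P = P * c}"
   by (intro closed_Collect_eq continuous_on_mult continuous_on_id continuous_on_const)
  ultimately show ?thesis using norm_closed by (simp only: closed_Int)
 qed
 then have cK: "complete K" by (simp add: complete_eq_closed)
 have KT: "0 \<in> K" by (auto simp: K_def)
 have gK: "g ` K \<subseteq> K"
 proof safe
  fix c assume c: "c \<in> K"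
  have c': "c \<in> A" "adj c = c" "c * P = P * c" using c unfolding K_def by blast+
  have cT: "c * T = T * c" "T * P = P * T" using c'(3) by (simp_all add: T_def algebra_simps)
  have "T * c * P = P * (T * c)" by (metis c'(3) cT(2) mult.assoc)
  moreover have "adj T = T" "T \<in> A" using P by (simp_all add: T_def pos_adj)
  ultimately have "adj (g c) = g c" "g c * P = P * g c" "g c \<in> A"
   using c' cT by (simp_all add: g_def distrib_left distrib_right)
  then show "g c \<in> K" unfolding K_def by blast
 qed
 have lip: "dist (g x) (g y) \<le> (1 - 1/N) * dist x y" for x y
 proof -
  have "g x - g y = T * (x - y)" by (simp add: g_def algebra_simps)
  then show ?thesis unfolding dist_norm by (metis norm_mult_ineq order_trans mult_right_mono norm_ge_zero r)
 qed
 have "\<exists>!c\<in>K. g c = c"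
  by (rule Banach_fix[OF cK _ _ _ gK, where c = "1 - 1 / N"]) (use lip KT N in auto)
 then obtain c where c: "c \<in> K" "g c = c" by blast
 have "N *\<^sub>R c = N *\<^sub>R g c" by (simp add: c)
 then have "(1 + P) * c = 1" using N by (simp add: g_def T_def algebra_simps)
 moreover have c': "c \<in> A" "adj c = c" "c * P = P * c" using c(1) unfolding K_def by blast+
 have "c * (1 + P) = (1 + P) * c" using c'(3) by (simp add: algebra_simps)
 ultimately show ?thesis using c' by metis
qed

end

interpretation UN: cstar_alg UNIV by standard auto

text \<open>The square root \<open>S\<close> of \<open>P + e\<close> commutes with \<open>Q\<close>,
  so \<open>(P + e) * Q = S * Q * S\<close> is positive; then \<open>e\<close> tends to 0.\<close>

lemma pos_commuting_mult:
 assumes "pos P" "pos Q" and c: "P * Q = Q * P"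
 shows "pos (P * Q)"
proof (rule posI)
 show "adj (P * Q) = P * Q" using assms by (simp add: pos_adj)
 fix x
 have "- e * inner x (ap Q x) \<le> inner x (ap (P * Q) x)" if e: "e > 0" for e
 proof -
  obtain S where S: "adj S = S" "S * S = P + e *\<^sub>R 1" "\<And>X. X * P = P * X ==> X * S = S * X"
   using UN.sqrt_pos[OF UNIV_I assms(1) e] by blast
  have "(P + e *\<^sub>R 1) * Q = adj S * Q * S" using S(1,2) S(3)[of Q] c by (metis mult.assoc)
  then have "pos ((P + e *\<^sub>R 1) * Q)" using pos_conj[OF assms(2)] by metis
  from pos_inner[OF this, of x] show ?thesis by (simp add: inner_add_right distrib_right)
 qed
 then have ev: "\<forall>\<^sub>F e in at_right 0. - e * inner x (ap Q x) \<le> inner x (ap (P * Q) x)"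
  by (simp add: eventually_at_filter)
 have lim: "((\<lambda>e. - e * inner x (ap Q x)) \<longlongrightarrow> - 0 * inner x (ap Q x)) (at_right 0)"
  by (intro tendsto_intros)
 show "0 \<le> inner x (ap (P * Q) x)" using tendsto_upperbound[OF lim ev] by simp
qed

text \<open>For \<open>c = 1 - (1 + P)\<^sup>-\<^sup>1\<close> the number \<open>\<langle>h, c h\<rangle>\<close> is the minimum over \<open>g\<close> of
 \<open>\<parallel>h - g\<parallel>\<^sup>2 + \<langle>g, P g\<rangle>\<close>; this makes the monotonicity in \<open>P\<close> evident.\<close>

lemma (in cstar_alg) truncation:
 assumes P: "P \<in> A" "pos P"
 shows "\<exists>C\<in>A. pos C \<and> pos (1 - C) \<and> (\<forall>h g. inner h (ap C h) \<le> (norm (h - g))\<^sup>2 + inner g (ap P g)) \<and>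
   (\<forall>h. \<exists>g. inner h (ap C h) = (norm (h - g))\<^sup>2 + inner g (ap P g))"
proof -
 obtain X where X: "X \<in> A" "adj X = X" "X * (1 + P) = 1" "(1 + P) * X = 1"
  using inverse_one_plus[OF P] by blast
 define C where "C = 1 - X"
 have h: "h = ap X h + ap P (ap X h)" for h
  using arg_cong[OF X(4), of "\<lambda>T. ap T h"] by (simp add: distrib_right)
 have sym: "inner u (ap P v) = inner (ap P u) v" for u v by (metis P(2) inner_adj pos_adj)
 \<comment> \<open>Completing the square: the minimiser is \<open>ap X h\<close>, and the right side
   says by how much another \<open>g\<close> exceeds the minimum.\<close>
 have id: "(norm (h - g))\<^sup>2 + inner g (ap P g) - inner h (ap C h) =
   (norm (ap X h - g))\<^sup>2 + inner (ap X h - g) (ap P (ap X h - g))" for h g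
 proof -
  define y where "y = ap X h"
  have h': "h = y + ap P y" using h y_def by blast
  have "ap C h = h - y" by (simp add: C_def y_def)
  then have C: "ap C h = ap P y" using h' by (metis add_diff_cancel_left')
  define p where "p = ap P y"
  define q where "q = ap P g"
  have yq: "inner y q = inner g p" unfolding p_def q_def by (metis sym inner_commute)
  have "(norm (y + p - g))\<^sup>2 + inner g q - inner (y + p) p = (norm (y - g))\<^sup>2 + inner (y - g) (p - q)"
   by (simp add: power2_norm_eq_inner inner_add_left inner_add_right inner_diff_left inner_diff_right
     yq inner_commute[of p y] inner_commute[of p g] inner_commute[of g y])
  then show ?thesis unfolding C y_def[symmetric] p_def q_def by (simp only: h' [symmetric] ap_linear)
 qed
 have pP: "0 \<le> inner u (ap P u)" for u using P by (simp add: pos_inner)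
 have 1: "inner h (ap C h) \<le> (norm (h - g))\<^sup>2 + inner g (ap P g)" for h g
  using id[of h g] pP[of "ap X h - g"] zero_le_power2[of "norm (ap X h - g)"] by linarith
 have 2: "inner h (ap C h) = (norm (h - ap X h))\<^sup>2 + inner (ap X h) (ap P (ap X h))" for h
  using id[of h "ap X h"] by (simp add: ap_linear)
 have "pos C" by (rule posI) (use X 2 pP in \<open>simp_all add: C_def\<close>)
 moreover have "pos (1 - C)"
  by (rule posI) (use X 1[of _ 0] in \<open>simp_all add: C_def inner_diff_right ap_linear power2_norm_eq_inner\<close>)
 moreover have "C \<in> A" using X by (simp add: C_def)
 ultimately show ?thesis using 1 2 by blast
qed

section \<open>Tracial von Neumann algebras and the 2-norm\<close>

text \<open>The operator-algebraic hypotheses on the type \<open>bop\<close>. Strong closedness and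
  normality are stated for sequences, the form in which all limits below are taken.\<close>

locale vna = star_alg A for A :: "'h::chilbert_space bop set" +
 fixes tau :: "'h bop => complex"
 assumes sot_closed: "(\<And>n. X n \<in> A) ==> (\<And>x. (\<lambda>n. ap (X n) x) \<longlonglongrightarrow> ap T x) ==> T \<in> A"
  and tau_add: "x \<in> A ==> y \<in> A ==> tau (x + y) = tau x + tau y"
  and tau_csc: "x \<in> A ==> tau (csc c x) = c * tau x"
  and tau_one: "tau 1 = 1"
  and tau_pos: "x \<in> A ==> tau (adj x * x) \<in> \<real>\<^sub>\<ge>\<^sub>0"
  and tau_comm: "x \<in> A ==> y \<in> A ==> tau (x * y) = tau (y * x)"
  and tau_faithful: "x \<in> A ==> tau (adj x * x) = 0 ==> x = 0"
  and tau_normal: "(\<And>n. X n \<in> A) ==> (\<And>n. pos (X n)) ==> (\<And>n. pos (X (Suc n) - X n)) ==> T \<in> A ==>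
    (\<And>x. (\<lambda>n. ap (X n) x) \<longlonglongrightarrow> ap T x) ==> (\<lambda>n. Re (tau (X n))) \<longlonglongrightarrow> Re (tau T)"
begin

sublocale cstar_alg A
proof
 show "closed A" unfolding closed_sequential_limits
 proof (intro allI impI, elim conjE)
  fix X T assume X: "\<forall>n. X n \<in> A" "X \<longlonglongrightarrow> T"
  show "T \<in> A" by (rule sot_closed[of X]) (use X bounded_linear.tendsto[OF bounded_linear_ap] in auto)
 qed
qed

lemma tau_scaleR: "x \<in> A ==> tau (r *\<^sub>R x) = of_real r * tau x"
 by (simp add: csc_of_real [symmetric] tau_csc)
lemma tau_zero [simp]: "tau 0 = 0" using tau_scaleR[of 0 0] by simp
lemma tau_minus: "x \<in> A ==> tau (- x) = - tau x" using tau_scaleR[of x "-1"] by simp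
lemma tau_diff: "x \<in> A ==> y \<in> A ==> tau (x - y) = tau x - tau y"
 using tau_add[of x "-y"] by (simp add: tau_minus)
lemma tau_sum: "(\<And>i. i \<in> I ==> f i \<in> A) ==> tau (sum f I) = (\<Sum>i\<in>I. tau (f i))"
 by (induction I rule: infinite_finite_induct) (simp_all add: tau_add)
lemmas tau_simps = tau_add tau_diff tau_minus tau_scaleR tau_csc

lemma tau_real: "x \<in> A ==> Im (tau (adj x * x)) = 0"
 using tau_pos[of x] by (auto simp: complex_nonneg_Reals_iff)
lemma tau_nonneg: "x \<in> A ==> 0 \<le> Re (tau (adj x * x))"
 using tau_pos[of x] by (auto simp: complex_nonneg_Reals_iff)

lemma tau_adj: assumes x: "x \<in> A" shows "tau (adj x) = cnj (tau x)"
proof -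
 have "Im (tau (adj (x + 1) * (x + 1))) = 0" using x by (intro tau_real) simp
 then have 1: "Im (tau (adj x)) = - Im (tau x)"
  using x tau_real[OF x] by (simp add: distrib_left distrib_right tau_simps tau_one)
 have "Im (tau (adj (x + csc \<i> 1) * (x + csc \<i> 1))) = 0" using x by (intro tau_real) simp
 then have 2: "Re (tau (adj x)) = Re (tau x)"
  using x tau_real[OF x] by (simp add: distrib_left distrib_right tau_simps tau_one)
 show ?thesis using 1 2 by (simp add: complex_eq_iff)
qed

definition n2 :: "'h bop => real" where "n2 x = sqrt (Re (tau (adj x * x)))"

lemma n2_sq: "x \<in> A ==> (n2 x)\<^sup>2 = Re (tau (adj x * x))" by (simp add: n2_def tau_nonneg)
lemma tau_adj_self: "x \<in> A ==> tau (adj x * x) = complex_of_real ((n2 x)\<^sup>2)"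
 by (simp add: complex_eq_iff n2_sq tau_real)
lemma n2_nonneg [simp]: "x \<in> A ==> 0 \<le> n2 x" by (simp add: n2_def tau_nonneg)
lemma n2_zero [simp]: "n2 0 = 0" by (simp add: n2_def)
lemma n2_eq_0: "x \<in> A ==> n2 x = 0 \<longleftrightarrow> x = 0"
 using tau_faithful[of x] by (auto simp: tau_adj_self)
lemma n2_one: "n2 1 = 1" by (simp add: n2_def tau_one)

lemma n2_sum_sq:
 assumes "x \<in> A" "y \<in> A"
 shows "(n2 (x + y))\<^sup>2 = (n2 x)\<^sup>2 + 2 * Re (tau (adj x * y)) + (n2 y)\<^sup>2"
proof -
 have "tau (adj y * x) = cnj (tau (adj x * y))" using assms by (simp flip: tau_adj)
 then show ?thesis using assms by (simp add: n2_sq distrib_left distrib_right tau_simps)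
qed

lemma n2_csc: "x \<in> A ==> n2 (csc c x) = cmod c * n2 x"
proof -
 assume x: "x \<in> A"
 have "tau (adj (csc c x) * csc c x) = (c * cnj c) * tau (adj x * x)"
  using x by (simp add: tau_csc mult.assoc mult.left_commute)
 also have "\<dots> = complex_of_real ((cmod c * n2 x)\<^sup>2)"
  using x by (simp only: tau_adj_self complex_norm_square [symmetric] of_real_mult [symmetric] power_mult_distrib)
 finally have "Re (tau (adj (csc c x) * csc c x)) = (cmod c * n2 x)\<^sup>2" by (simp only: Re_complex_of_real)
 then show ?thesis unfolding n2_def[of "csc c x"] using x by (simp only:) simp
qed

lemma n2_scaleR: "x \<in> A ==> n2 (r *\<^sub>R x) = \<bar>r\<bar> * n2 x"
 by (simp add: csc_of_real [symmetric] n2_csc)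
lemma n2_minus: "x \<in> A ==> n2 (- x) = n2 x" using n2_scaleR[of x "-1"] by simp
lemma n2_diff_commute: "x \<in> A ==> y \<in> A ==> n2 (x - y) = n2 (y - x)"
 using n2_minus[of "x - y"] by simp
lemma n2_adj: "x \<in> A ==> n2 (adj x) = n2 x" by (simp add: n2_def tau_comm)

lemma Re_tau_cs:
 assumes "x \<in> A" "y \<in> A"
 shows "\<bar>Re (tau (adj x * y))\<bar> \<le> n2 x * n2 y"
proof -
 have "(Re (tau (adj x * y)))\<^sup>2 \<le> (n2 x)\<^sup>2 * (n2 y)\<^sup>2"
 proof (rule discriminant_nonpos)
  fix t
  have "0 \<le> (n2 (x + t *\<^sub>R y))\<^sup>2" by simp
  then show "0 \<le> (n2 x)\<^sup>2 + 2 * t * Re (tau (adj x * y)) + t\<^sup>2 * (n2 y)\<^sup>2"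
   using assms by (simp add: n2_sum_sq n2_scaleR power_mult_distrib tau_simps)
 qed simp_all
 then show ?thesis using assms
  by (metis abs_le_square_iff abs_of_nonneg mult_nonneg_nonneg n2_nonneg power_mult_distrib)
qed

lemma tau_cs:
 assumes "x \<in> A" "y \<in> A"
 shows "cmod (tau (adj x * y)) \<le> n2 x * n2 y"
proof -
 define t where "t = tau (adj x * y)"
 show ?thesis
 proof (cases "t = 0")
  case False
  define u where "u = cnj t / cmod t"
  have u: "cmod u = 1" using False by (simp add: u_def norm_divide)
  have "u * t = cmod t"
   using False by (simp add: u_def complex_norm_square [symmetric] mult.commute[of "cnj t"] power2_eq_square)
  then have "cmod t = Re (tau (adj x * csc u y))" using assms by (simp add: tau_simps t_def)
  also have "\<dots> \<le> n2 x * n2 (csc u y)"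
   using Re_tau_cs[OF assms(1) csc_in[OF assms(2)], of u] by linarith
  finally show ?thesis using assms u by (simp add: n2_csc t_def)
 qed (use assms in \<open>simp add: t_def\<close>)
qed

lemma tau_le_n2: "x \<in> A ==> cmod (tau x) \<le> n2 x" using tau_cs[of 1 x] by (simp add: n2_one)

lemma n2_triangle: assumes "x \<in> A" "y \<in> A" shows "n2 (x + y) \<le> n2 x + n2 y"
proof -
 have "(n2 (x + y))\<^sup>2 \<le> (n2 x + n2 y)\<^sup>2"
  using Re_tau_cs[OF assms] assms by (simp add: n2_sum_sq power2_sum)
 then show ?thesis by (rule power2_le_imp_le) (simp add: assms)
qed

lemma n2_triangle_diff: "x \<in> A ==> y \<in> A ==> n2 (x - y) \<le> n2 x + n2 y"
 using n2_triangle[of x "-y"] by (simp add: n2_minus)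
lemma n2_dist_triangle: "x \<in> A ==> y \<in> A ==> z \<in> A ==> n2 (x - z) \<le> n2 (x - y) + n2 (y - z)"
 using n2_triangle[of "x - y" "y - z"] by simp
lemma n2_abs_diff: "x \<in> A ==> y \<in> A ==> \<bar>n2 x - n2 y\<bar> \<le> n2 (x - y)"
 using n2_triangle[of "x - y" y] n2_triangle[of "y - x" x] n2_diff_commute[of x y] by simp
lemma n2_sum_le: "finite I ==> (\<And>i. i \<in> I ==> f i \<in> A) ==> n2 (sum f I) \<le> (\<Sum>i\<in>I. n2 (f i))"
proof (induction I rule: finite_induct)
 case (insert i I)
 then have "n2 (f i + sum f I) \<le> n2 (f i) + n2 (sum f I)" by (intro n2_triangle) auto
 then show ?case using insert by (simp add: order_trans)
qed simp

lemma n2_parallelogram: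
 "x \<in> A ==> y \<in> A ==> (n2 (x + y))\<^sup>2 + (n2 (x - y))\<^sup>2 = 2 * (n2 x)\<^sup>2 + 2 * (n2 y)\<^sup>2"
 using n2_sum_sq[of x y] n2_sum_sq[of x "-y"] by (simp add: n2_minus tau_simps)

lemma pos_tau:
 assumes "x \<in> A" "pos x" shows "0 \<le> Re (tau x)"
proof (rule field_le_epsilon)
 fix e :: real assume e: "0 < e"
 obtain S where S: "S \<in> A" "adj S = S" "S * S = x + e *\<^sub>R 1" using sqrt_pos[OF assms e] by blast
 then show "0 \<le> Re (tau x) + e" using tau_nonneg[of S] assms by (simp add: tau_simps tau_one)
qed

lemma pos_tau_mono: "x \<in> A ==> y \<in> A ==> pos (y - x) ==> Re (tau x) \<le> Re (tau y)"
 using pos_tau[of "y - x"] by (simp add: tau_simps)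

text \<open>Since \<open>x * x <= norm x * x\<close>, the trace of \<open>x\<close> controls the
  squared 2-norm, and faithfulness applies.\<close>

lemma pos_tau_zero:
 assumes "x \<in> A" "pos x" "Re (tau x) \<le> 0" shows "x = 0"
proof -
 have "pos (x * (norm x *\<^sub>R 1 - x))"
  by (rule pos_commuting_mult) (use assms in \<open>simp_all add: pos_norm_diff pos_adj algebra_simps\<close>)
 then have "Re (tau (x * x)) \<le> norm x * Re (tau x)"
  using pos_tau_mono[of "x * x" "norm x *\<^sub>R x"] assms by (simp add: algebra_simps tau_simps)
 also have "\<dots> \<le> 0" using assms(3) by (simp add: mult_nonneg_nonpos)
 finally have "(n2 x)\<^sup>2 \<le> 0" using assms by (simp add: n2_sq pos_adj)
 then show ?thesis using assms by (simp add: n2_eq_0)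
qed

lemma n2_mult_left:
 assumes "x \<in> A" "y \<in> A" shows "n2 (x * y) \<le> norm x * n2 y"
proof -
 have "pos (adj y * ((norm x)\<^sup>2 *\<^sub>R 1 - adj x * x) * y)"
  by (intro pos_conj pos_norm_sq_diff order_refl)
 then have "Re (tau (adj y * (adj x * x) * y)) \<le> (norm x)\<^sup>2 * Re (tau (adj y * y))"
  using pos_tau_mono[of "adj y * (adj x * x) * y" "(norm x)\<^sup>2 *\<^sub>R (adj y * y)"] assms
  by (simp add: algebra_simps tau_simps)
 then have "(n2 (x * y))\<^sup>2 \<le> (norm x * n2 y)\<^sup>2"
  using assms by (simp add: n2_sq power_mult_distrib mult.assoc)
 then show ?thesis by (rule power2_le_imp_le) (simp add: assms)
qed

lemma n2_mult_right:
 assumes "x \<in> A" "y \<in> A" shows "n2 (x * y) \<le> n2 x * norm y"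
 using n2_mult_left[of "adj y" "adj x"] assms n2_adj[of "x * y"] n2_adj[of x] by (simp add: mult.commute)

lemma n2_le_norm: "x \<in> A ==> n2 x \<le> norm x" using n2_mult_left[of x 1] by (simp add: n2_one)

lemma n2_mult_diff:
 assumes "x \<in> A" "y \<in> A" "x' \<in> A" "y' \<in> A"
 shows "n2 (x * y - x' * y') \<le> norm x * n2 (y - y') + n2 (x - x') * norm y'"
proof -
 have "x * y - x' * y' = x * (y - y') + (x - x') * y'" by (simp add: algebra_simps)
 then show ?thesis using n2_triangle[of "x * (y - y')" "(x - x') * y'"] n2_mult_left[of x "y - y'"]
   n2_mult_right[of "x - x'" y'] assms by fastforce
qed

lemma n2_commutator_diff:
 assumes "x \<in> A" "y \<in> A" "x' \<in> A"
 shows "n2 (x' * y - y * x') \<le> n2 (x * y - y * x) + 2 * (n2 (x - x') * norm y)"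
proof -
 have e: "x' * y - y * x' = (x * y - y * x) - ((x - x') * y - y * (x - x'))" by (simp add: algebra_simps)
 have "n2 (x' * y - y * x') \<le> n2 (x * y - y * x) + n2 ((x - x') * y - y * (x - x'))"
  unfolding e using assms by (intro n2_triangle_diff) simp_all
 moreover have "n2 ((x - x') * y - y * (x - x')) \<le> n2 ((x - x') * y) + n2 (y * (x - x'))"
  using assms by (intro n2_triangle_diff) simp_all
 moreover have "n2 ((x - x') * y) \<le> n2 (x - x') * norm y" using assms by (intro n2_mult_right) simp_all
 moreover have "n2 (y * (x - x')) \<le> norm y * n2 (x - x')" using assms by (intro n2_mult_left) simp_all
 ultimately show ?thesis by (simp add: mult.commute)
qed

section \<open>Balls are complete for the 2-norm\<close>

text \<open>The limit has to be an operator on the given Hilbert space, whose vectors need have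
  nothing to do with the trace. The weighted sums \<open>P n m\<close> dominate
  \<open>X m - X n\<close> on every vector and have small trace, but no common norm bound. Their
  truncations \<open>C n m\<close> are bounded by 1 and increase in \<open>m\<close> to a strong
  limit \<open>E n\<close>. Normality keeps the trace of \<open>E n\<close> small, faithfulness
  drives \<open>E n\<close> to 0, and \<open>E n\<close> still dominates the squared differences, so
  \<open>X\<close> converges strongly.\<close>

lemma n2_complete_fast:
 assumes X: "\<And>n. X n \<in> A" "\<And>n. norm (X n) \<le> c" and d: "\<And>n. n2 (X (Suc n) - X n) \<le> (1/4)^n"
 shows "\<exists>T\<in>A. norm T \<le> c \<and> (\<lambda>n. n2 (X n - T)) \<longlonglongrightarrow> 0 \<and> (\<forall>h. (\<lambda>n. ap (X n) h) \<longlonglongrightarrow> ap T h)"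
proof -
 have c0: "0 \<le> c" using X(2)[of 0] norm_ge_zero[of "X 0"] by linarith
 define D where "D k = X (Suc k) - X k" for k
 have DA [simp]: "D k \<in> A" for k using X by (simp add: D_def)
 \<comment> \<open>The squares have trace at most \<open>(1/16)^k\<close>, so the weights
   \<open>2^(k+1)\<close> are affordable; they absorb the factor 2 that
   \<open>(a + b)^2 <= 2 * a^2 + 2 * b^2\<close> costs at each step of \<open>dom\<close>.\<close>
 define P where "P n m = (\<Sum>k=n..<m. 2^(Suc k) *\<^sub>R (adj (D k) * D k))" for n m
 have PA [simp]: "P n m \<in> A" for n m by (simp add: P_def)
 have Ppos: "pos (P n m)" for n m unfolding P_def by (intro pos_sum pos_scaleR pos_adj_mult) simp
 have Pup: "pos (P n (Suc m) - P n m)" for n m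
  by (cases "n \<le> m") (auto simp: P_def intro!: pos_scaleR pos_adj_mult)
 have Pdown: "pos (P n m - P (Suc n) m)" for n m
  by (cases "n < m") (auto simp: P_def sum.atLeast_Suc_lessThan intro!: pos_scaleR pos_adj_mult)
 have Ptau: "Re (tau (P n m)) \<le> 4 * (1/8)^n" for n m
 proof (cases "n \<le> m")
  case True
  have *: "Re (tau (P n m)) = (\<Sum>k=n..<m. 2^(Suc k) * (n2 (D k))\<^sup>2)"
   by (simp add: P_def tau_sum tau_scaleR n2_sq)
  have "Re (tau (P n m)) \<le> (\<Sum>k=n..<m. 2^(Suc k) * ((1/4)^k)\<^sup>2)"
   unfolding * by (intro sum_mono mult_left_mono power_mono) (use d in \<open>simp_all add: D_def[symmetric]\<close>)
  \<comment> \<open>The subtracted term makes the induction close: it pays for the next summand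
    \<open>2 * (1/8)^m\<close>.\<close>
  also have "\<dots> \<le> 4 * (1/8)^n - 3 * (1/8)^m" using True
  proof (induction rule: dec_induct)
   case (step m)
   have "2 ^ Suc m * ((1/4) ^ m)\<^sup>2 = 2 * (1/8 :: real)^m"
    by (simp add: power_divide power_mult_distrib [symmetric] power_mult [symmetric] power2_eq_square field_simps)
   moreover have "(\<Sum>k=n..<Suc m. 2^(Suc k) * ((1/4)^k)\<^sup>2) = (\<Sum>k=n..<m. 2^(Suc k) * ((1/4)^k)\<^sup>2) + 2 ^ Suc m * ((1/4 :: real) ^ m)\<^sup>2"
    using step.hyps by (intro sum.atLeastLessThan_Suc) simp
   moreover have "0 \<le> (1/8 :: real)^m" by simp
   moreover have "(1/8 :: real)^Suc m = (1/8)^m / 8" by simp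
   ultimately show ?case using step.IH by linarith
  qed simp
  finally show ?thesis by (smt (verit) zero_le_power divide_nonneg_nonneg)
 qed (simp add: P_def)
 have dom: "2^n * (norm (ap (X m - X n) h))\<^sup>2 \<le> inner h (ap (P n m) h)" if "n \<le> m" for n m h
  using that
 proof (induction n rule: inc_induct)
  case base
  then show ?case by (simp add: P_def)
 next
  case (step n)
  have e: "inner h (ap (P n m) h) = 2^(Suc n) * (norm (ap (D n) h))\<^sup>2 + inner h (ap (P (Suc n) m) h)"
   using step.hyps norm_ap_square[of "D n" h] by (simp add: P_def sum.atLeast_Suc_lessThan inner_add_right)
  have "ap (X m - X n) h = ap (D n) h + ap (X m - X (Suc n)) h" by (simp add: D_def)
  then have "norm (ap (X m - X n) h) \<le> norm (ap (D n) h) + norm (ap (X m - X (Suc n)) h)"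
   by (metis norm_triangle_ineq)
  then have "(norm (ap (X m - X n) h))\<^sup>2 \<le> (norm (ap (D n) h) + norm (ap (X m - X (Suc n)) h))\<^sup>2"
   by (intro power_mono) simp_all
  also have "\<dots> \<le> 2 * (norm (ap (D n) h))\<^sup>2 + 2 * (norm (ap (X m - X (Suc n)) h))\<^sup>2"
   using zero_le_power2[of "norm (ap (D n) h) - norm (ap (X m - X (Suc n)) h)"]
   unfolding power2_sum power2_diff by linarith
  finally have "2^n * (norm (ap (X m - X n) h))\<^sup>2 \<le> 2^n * (2 * (norm (ap (D n) h))\<^sup>2 + 2 * (norm (ap (X m - X (Suc n)) h))\<^sup>2)"
   by (intro mult_left_mono) simp_all
  then show ?case unfolding e using step.IH by (simp only: power_Suc distrib_left mult_ac)
 qed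
 have "\<forall>n m. \<exists>C\<in>A. pos C \<and> pos (1 - C) \<and> (\<forall>h g. inner h (ap C h) \<le> (norm (h - g))\<^sup>2 + inner g (ap (P n m) g)) \<and>
   (\<forall>h. \<exists>g. inner h (ap C h) = (norm (h - g))\<^sup>2 + inner g (ap (P n m) g))"
  using truncation[OF PA Ppos] by blast
 then obtain C where C: "\<And>n m. C n m \<in> A" "\<And>n m. pos (C n m)" "\<And>n m. pos (1 - C n m)"
  and Cle: "\<And>n m h g. inner h (ap (C n m) h) \<le> (norm (h - g))\<^sup>2 + inner g (ap (P n m) g)"
  and Ceq: "\<And>n m h. \<exists>g. inner h (ap (C n m) h) = (norm (h - g))\<^sup>2 + inner g (ap (P n m) g)"
  by metis
 have Cmono: "pos (C n' m' - C n m)" if p: "pos (P n' m' - P n m)" for n m n' m'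
 proof (rule posI)
  fix h
  obtain g where g: "inner h (ap (C n' m') h) = (norm (h - g))\<^sup>2 + inner g (ap (P n' m') g)"
   using Ceq by blast
  show "0 \<le> inner h (ap (C n' m' - C n m) h)"
   using g Cle[of h n m g] pos_diff_inner[OF p, of g] by (simp add: inner_diff_right)
 qed (simp add: C pos_adj)
 have "\<exists>E. (\<forall>x. (\<lambda>m. ap (C n m) x) \<longlonglongrightarrow> ap E x) \<and> pos E \<and> pos (1 *\<^sub>R 1 - E) \<and> (\<forall>m. pos (E - C n m))" for n
  by (rule monotone_limit) (simp_all add: C Cmono Pup)
 then obtain E where E: "\<And>n x. (\<lambda>m. ap (C n m) x) \<longlonglongrightarrow> ap (E n) x" "\<And>n. pos (E n)"
   "\<And>n. pos (1 *\<^sub>R 1 - E n)" "\<And>n m. pos (E n - C n m)" by metis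
 have EA [simp]: "E n \<in> A" for n by (rule sot_closed[of "C n"]) (use C E in auto)
 have Etau: "Re (tau (E n)) \<le> 4 * (1/8)^n" for n
 proof (rule LIMSEQ_le_const2)
  show "(\<lambda>m. Re (tau (C n m))) \<longlonglongrightarrow> Re (tau (E n))"
   by (rule tau_normal) (simp_all add: C E Cmono Pup)
  have "pos (P n m - C n m)" for m
  proof (rule posI)
   show "0 \<le> inner h (ap (P n m - C n m) h)" for h using Cle[of h n m h] by (simp add: inner_diff_right)
  qed (simp add: C Ppos pos_adj)
  then show "\<exists>N. \<forall>m\<ge>N. Re (tau (C n m)) \<le> 4 * (1/8)^n"
   using pos_tau_mono[OF C(1) PA] Ptau order_trans by blast
 qed
 have Edown: "pos (E n - E (Suc n))" for n by (rule pos_limit[where X = "\<lambda>m. C n m - C (Suc n) m"])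
   (simp_all add: Cmono Pdown tendsto_diff E)
 obtain G where G: "\<And>x. (\<lambda>n. ap (1 - E n) x) \<longlonglongrightarrow> ap G x" "pos (1 *\<^sub>R 1 - G)" "\<And>n. pos (G - (1 - E n))"
  using monotone_limit[of "\<lambda>n. 1 - E n" 1] E Edown by (auto simp: pos_adj)
 have GA: "G \<in> A" by (rule sot_closed[of "\<lambda>n. 1 - E n"]) (use G in auto)
 \<comment> \<open>Its trace is at most that of every \<open>E n\<close>, hence 0. So the forms of
   the decreasing sequence \<open>E n\<close> tend to 0 on every vector.\<close>
 have "1 - G = 0"
 proof (rule pos_tau_zero)
  show "Re (tau (1 - G)) \<le> 0"
  proof (rule LIMSEQ_le_const)
   show "(\<lambda>n. 4 * (1/8::real)^n) \<longlonglongrightarrow> 0"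
    by (intro tendsto_mult_right_zero LIMSEQ_power_zero) simp
   have "Re (tau (1 - G)) \<le> 4 * (1/8)^n" for n
    using pos_tau_mono[of "1 - G" "E n"] G(3)[of n] GA Etau[of n] by (simp add: algebra_simps)
   then show "\<exists>N. \<forall>n\<ge>N. Re (tau (1 - G)) \<le> 4 * (1/8)^n" by blast
  qed
 qed (use G GA in simp_all)
 then have G1: "G = 1" by simp
 have Elim: "(\<lambda>n. inner h (ap (E n) h)) \<longlonglongrightarrow> 0" for h
 proof -
  have "(\<lambda>n. inner h (h - ap (1 - E n) h)) \<longlonglongrightarrow> inner h (h - ap G h)"
   by (intro tendsto_intros G)
  then show ?thesis by (simp add: G1)
 qed
 \<comment> \<open>The Cauchy--Schwarz constant in
   \<open>(2 * c * a + b)^2 <= K * (a^2 + b^2)\<close>, where \<open>a\<close> and \<open>b\<close>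
   come from splitting \<open>h\<close> at the minimiser \<open>g\<close> of the truncation: the
   norm bound \<open>2 * c\<close> is used on \<open>h - g\<close> and the dominance
   \<open>dom\<close> on \<open>g\<close>.\<close>
 define K where "K = (2 * c)\<^sup>2 + 1"
 have K: "K > 0" by (simp add: K_def add_nonneg_pos)
 have key: "(norm (ap (X m - X n) h))\<^sup>2 \<le> K * inner h (ap (E n) h)" if nm: "n \<le> m" for n m h
 proof -
  obtain g where g: "inner h (ap (C n m) h) = (norm (h - g))\<^sup>2 + inner g (ap (P n m) g)"
   using Ceq by blast
  define a where "a = norm (h - g)"
  define b where "b = norm (ap (X m - X n) g)"
  have "norm (X m - X n) \<le> 2 * c"
   using norm_triangle_ineq4[of "X m" "X n"] X(2)[of m] X(2)[of n] by linarith
  then have "norm (ap (X m - X n) (h - g)) \<le> 2 * c * a"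
   unfolding a_def by (meson norm_ap mult_right_mono norm_ge_zero order_trans)
  moreover have "norm (ap (X m - X n) h) \<le> norm (ap (X m - X n) (h - g)) + b"
   unfolding b_def using norm_triangle_ineq[of "ap (X m - X n) (h - g)" "ap (X m - X n) g"]
   by (simp flip: ap_linear(1) del: ap_simps)
  ultimately have "(norm (ap (X m - X n) h))\<^sup>2 \<le> (2 * c * a + b)\<^sup>2"
   by (intro power_mono) simp_all
  also have "\<dots> \<le> K * (a\<^sup>2 + b\<^sup>2)"
   using zero_le_power2[of "2 * c * b - a"] by (simp add: K_def power2_eq_square algebra_simps)
  also have "\<dots> \<le> K * (a\<^sup>2 + inner g (ap (P n m) g))"
  proof -
   have "b\<^sup>2 \<le> 2^n * b\<^sup>2" by (simp add: mult_le_cancel_right1)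
   then show ?thesis using dom[OF nm, of g] K by (simp add: b_def)
  qed
  also have "\<dots> = K * inner h (ap (C n m) h)" by (simp add: g a_def)
  also have "\<dots> \<le> K * inner h (ap (E n) h)" using pos_diff_inner[OF E(4)] K by simp
  finally show ?thesis .
 qed
 have "Cauchy (\<lambda>n. ap (X n) h)" for h
 proof (rule metric_CauchyI)
  fix e :: real assume e: "e > 0"
  have "\<forall>\<^sub>F n in sequentially. inner h (ap (E n) h) < (e/2)\<^sup>2 / K"
   using order_tendstoD(2)[OF Elim[of h], of "(e/2)\<^sup>2 / K"] e K by simp
  then obtain N where "inner h (ap (E N) h) < (e/2)\<^sup>2 / K" by (auto simp: eventually_sequentially)
  then have N: "K * inner h (ap (E N) h) < (e/2)\<^sup>2" using K by (simp add: field_simps)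
  have "dist (ap (X m) h) (ap (X N) h) < e / 2" if "m \<ge> N" for m
  proof -
   have "(norm (ap (X m) h - ap (X N) h))\<^sup>2 < (e/2)\<^sup>2" using key[OF that, of h] N by simp
   then show ?thesis unfolding dist_norm by (rule power2_less_imp_less) (use e in simp)
  qed
  then show "\<exists>M. \<forall>m\<ge>M. \<forall>n\<ge>M. dist (ap (X m) h) (ap (X n) h) < e"
   by (intro exI[of _ N]) (metis dist_triangle_half_l)
 qed
 then obtain T where T: "norm T \<le> c" "\<And>x. (\<lambda>n. ap (X n) x) \<longlonglongrightarrow> ap T x"
  using sot_limit_exists[of X c, OF X(2)] by blast
 have TA: "T \<in> A" by (rule sot_closed[of X]) (use X T in auto)
 have fin: "(n2 (X n - T))\<^sup>2 \<le> K * (4 * (1/8)^n)" for n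
 proof -
  have "pos (K *\<^sub>R E n - adj (X n - T) * (X n - T))"
  proof (rule posI)
   fix h
   have "(norm (ap (T - X n) h))\<^sup>2 \<le> K * inner h (ap (E n) h)"
   proof (rule LIMSEQ_le_const2)
    show "(\<lambda>m. (norm (ap (X m - X n) h))\<^sup>2) \<longlonglongrightarrow> (norm (ap (T - X n) h))\<^sup>2"
     by (simp, intro tendsto_intros T)
    show "\<exists>N. \<forall>m\<ge>N. (norm (ap (X m - X n) h))\<^sup>2 \<le> K * inner h (ap (E n) h)" using key by blast
   qed
   moreover have "norm (ap (T - X n) h) = norm (ap (X n - T) h)" by (simp add: norm_minus_commute)
   ultimately show "0 \<le> inner h (ap (K *\<^sub>R E n - adj (X n - T) * (X n - T)) h)"
    using norm_ap_square[of "X n - T" h] by (simp only: ap_simps(2,4) inner_diff_right inner_scaleR_right)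
  qed (simp add: E pos_adj)
  then have "(n2 (X n - T))\<^sup>2 \<le> K * Re (tau (E n))"
   using pos_tau_mono[of "adj (X n - T) * (X n - T)" "K *\<^sub>R E n"] X TA by (simp add: n2_sq tau_scaleR)
  then show ?thesis using Etau[of n] K by (meson mult_left_mono order_trans less_imp_le)
 qed
 have "(\<lambda>n. (n2 (X n - T))\<^sup>2) \<longlonglongrightarrow> 0"
 proof (rule tendsto_sandwich[OF _ _ tendsto_const])
  show "(\<lambda>n. K * (4 * (1/8)^n)) \<longlonglongrightarrow> 0"
   by (intro tendsto_mult_right_zero LIMSEQ_power_zero) simp
 qed (use fin in auto)
 then have "(\<lambda>n. sqrt ((n2 (X n - T))\<^sup>2)) \<longlonglongrightarrow> sqrt 0" by (rule tendsto_real_sqrt)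
 then have "(\<lambda>n. n2 (X n - T)) \<longlonglongrightarrow> 0" using X TA by simp
 then show ?thesis using TA T by blast
qed

section \<open>Cauchy sequences and limits in the 2-norm under an operator norm bound\<close>

definition n2_Cauchy :: "(nat => 'h bop) => bool" where
 "n2_Cauchy X \<longleftrightarrow> (\<forall>e>0. \<exists>M. \<forall>m\<ge>M. \<forall>n\<ge>M. n2 (X m - X n) < e)"

theorem n2_complete:
 assumes X: "\<And>n. X n \<in> A" "\<And>n. norm (X n) \<le> c" and C: "n2_Cauchy X"
 shows "\<exists>T\<in>A. norm T \<le> c \<and> (\<lambda>n. n2 (X n - T)) \<longlonglongrightarrow> 0"
proof -
 have "\<exists>M. \<forall>m\<ge>M. \<forall>n\<ge>M. n2 (X m - X n) < (1/4)^k" for k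
  using C by (simp add: n2_Cauchy_def)
 then obtain M where M: "\<And>k m n. m \<ge> M k ==> n \<ge> M k ==> n2 (X m - X n) < (1/4)^k" by metis
 define r where "r k = Max (M ` {..k})" for k
 have r: "M j \<le> r k" if "j \<le> k" for j k using that by (simp add: r_def)
 have "\<exists>T\<in>A. norm T \<le> c \<and> (\<lambda>n. n2 ((X \<circ> r) n - T)) \<longlonglongrightarrow> 0 \<and> (\<forall>h. (\<lambda>n. ap ((X \<circ> r) n) h) \<longlonglongrightarrow> ap T h)"
 proof (rule n2_complete_fast)
  fix n
  show "n2 ((X \<circ> r) (Suc n) - (X \<circ> r) n) \<le> (1/4)^n"
   using M[of n "r (Suc n)" "r n"] r[of n n] r[of n "Suc n"] by simp
 qed (use X in auto)
 then obtain T where T: "T \<in> A" "norm T \<le> c" "(\<lambda>n. n2 (X (r n) - T)) \<longlonglongrightarrow> 0" by auto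
 have "(\<lambda>n. n2 (X n - T)) \<longlonglongrightarrow> 0"
 proof (rule metric_LIMSEQ_I)
  fix e :: real assume e: "e > 0"
  obtain k0 where k0: "\<And>n. n \<ge> k0 ==> n2 (X (r n) - T) < e / 2"
   using metric_LIMSEQ_D[OF T(3), of "e/2"] e T X by auto
  obtain k1 where k1: "(1/4)^k1 < e / 2" using real_arch_pow_inv[of "e/2" "1/4"] e by auto
  define k where "k = max k0 k1"
  have "n2 (X n - T) < e" if n: "n \<ge> r k" for n
  proof -
   have "n2 (X n - X (r k)) < (1/4)^k1" using n r[of k1 k] by (intro M) (auto simp: k_def)
   then show ?thesis using n2_dist_triangle[of "X n" "X (r k)" T] X T k0[of k] k1 by (simp add: k_def)
  qed
  then show "\<exists>no. \<forall>n\<ge>no. dist (n2 (X n - T)) 0 < e" using X T by (auto simp: dist_norm)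
 qed
 then show ?thesis using T by blast
qed

lemma n2_limit_unique:
 assumes "\<And>n. X n \<in> A" "S \<in> A" "T \<in> A" "(\<lambda>n. n2 (X n - S)) \<longlonglongrightarrow> 0" "(\<lambda>n. n2 (X n - T)) \<longlonglongrightarrow> 0"
 shows "S = T"
proof -
 have "n2 (S - T) \<le> 0"
 proof (rule LIMSEQ_le_const)
  show "(\<lambda>n. n2 (X n - S) + n2 (X n - T)) \<longlonglongrightarrow> 0" using tendsto_add[OF assms(4,5)] by simp
  show "\<exists>N. \<forall>n\<ge>N. n2 (S - T) \<le> n2 (X n - S) + n2 (X n - T)"
   using n2_dist_triangle[of S "X _" T] n2_diff_commute[of S "X _"] assms(1-3) by auto
 qed
 then have "n2 (S - T) = 0" using n2_nonneg[of "S - T"] assms by (intro order_antisym) simp_all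
 then show ?thesis using n2_eq_0[of "S - T"] assms by simp
qed

text \<open>Positivity is a condition on vectors and not visible in the 2-norm; but a fast
  subsequence converges strongly to the same limit, and strong limits preserve positivity.\<close>

lemma pos_n2_limit:
 assumes X: "\<And>n. X n \<in> A" "\<And>n. norm (X n) \<le> c" "\<And>n. pos (X n)" and T: "T \<in> A" "(\<lambda>n. n2 (X n - T)) \<longlonglongrightarrow> 0"
 shows "pos T"
proof -
 have "\<exists>m. n2 (X m - T) < (1/4)^Suc n" for n
  using order_tendstoD(2)[OF T(2), of "(1/4)^Suc n"] by (auto simp: eventually_sequentially)
 then obtain r where r: "\<And>n. n2 (X (r n) - T) < (1/4)^Suc n" by metis
 have lim: "(\<lambda>n. n2 (X (r n) - T)) \<longlonglongrightarrow> 0"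
 proof (rule tendsto_sandwich[OF _ _ tendsto_const])
  show "(\<lambda>n. (1/4::real)^Suc n) \<longlonglongrightarrow> 0" by (intro LIMSEQ_Suc LIMSEQ_power_zero) simp
  show "\<forall>\<^sub>F n in sequentially. n2 (X (r n) - T) \<le> (1/4)^Suc n" using r by (simp add: less_imp_le)
 qed (simp add: X(1) T(1))
 have "n2 (X (r (Suc n)) - X (r n)) \<le> (1/4)^n" for n
 proof -
  have "n2 (X (r (Suc n)) - X (r n)) \<le> n2 (X (r (Suc n)) - T) + n2 (T - X (r n))"
   by (intro n2_dist_triangle X(1) T(1))
  moreover have "n2 (T - X (r n)) = n2 (X (r n) - T)" by (intro n2_diff_commute X(1) T(1))
  moreover have "(0::real) \<le> (1/4)^n" by simp
  moreover have "n2 (X (r n) - T) * 4 < (1/4)^n" "n2 (X (r (Suc n)) - T) * 16 < (1/4)^n"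
   using r[of n] r[of "Suc n"] by simp_all
  ultimately show ?thesis by linarith
 qed
 then obtain S where S: "S \<in> A" "(\<lambda>n. n2 (X (r n) - S)) \<longlonglongrightarrow> 0" "\<And>h. (\<lambda>n. ap (X (r n)) h) \<longlonglongrightarrow> ap S h"
  using n2_complete_fast[of "\<lambda>n. X (r n)" c] X(1,2) by blast
 have "S = T" by (rule n2_limit_unique[of "\<lambda>n. X (r n)"]) (simp_all add: X(1) S(1,2) T(1) lim)
 then show ?thesis using pos_limit[of "\<lambda>n. X (r n)" T] X(3) S(3) by blast
qed

text \<open>The operator norm bound is part of the notion because multiplication is jointly
  continuous for the 2-norm only on bounded sets.\<close>

definition n2_lim :: "(nat => 'h bop) => 'h bop => bool" where
 "n2_lim X T \<longleftrightarrow> (\<forall>n. X n \<in> A) \<and> T \<in> A \<and> (\<exists>c. \<forall>n. norm (X n) \<le> c) \<and> (\<lambda>n. n2 (X n - T)) \<longlonglongrightarrow> 0"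

lemma n2_limD:
 assumes "n2_lim X T"
 shows "X n \<in> A" "T \<in> A" "\<exists>c. \<forall>n. norm (X n) \<le> c" "(\<lambda>n. n2 (X n - T)) \<longlonglongrightarrow> 0"
 using assms by (simp_all add: n2_lim_def)

lemma n2_lim_unique: "n2_lim X S ==> n2_lim X T ==> S = T"
 using n2_limit_unique[of X S T] by (simp add: n2_lim_def)

lemma n2_lim_pos: "n2_lim X T ==> (\<And>n. pos (X n)) ==> pos T"
 unfolding n2_lim_def using pos_n2_limit by blast

lemma n2_lim_const: "T \<in> A ==> n2_lim (\<lambda>n. T) T" by (auto simp: n2_lim_def)

lemma n2_lim_bound:
 assumes "\<And>n. X n \<in> A" "T \<in> A" "\<And>n. norm (X n) \<le> c" "\<And>n. n2 (X n - T) \<le> f n" "f \<longlonglongrightarrow> 0"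
 shows "n2_lim X T" unfolding n2_lim_def
proof (intro conjI)
 show "(\<lambda>n. n2 (X n - T)) \<longlonglongrightarrow> 0"
  by (rule tendsto_sandwich[OF _ _ tendsto_const assms(5)]) (simp_all add: assms(1,2,4))
qed (use assms(1-3) in blast)+

lemma n2_lim_add:
 assumes "n2_lim X S" "n2_lim Y T" shows "n2_lim (\<lambda>n. X n + Y n) (S + T)"
proof -
 note X = n2_limD[OF assms(1)] and Y = n2_limD[OF assms(2)]
 obtain c d where c: "\<And>n. norm (X n) \<le> c" and d: "\<And>n. norm (Y n) \<le> d" using X(3) Y(3) by blast
 show ?thesis
 proof (rule n2_lim_bound)
  show "norm (X n + Y n) \<le> c + d" for n
   using norm_triangle_ineq[of "X n" "Y n"] c[of n] d[of n] by linarith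
  show "n2 (X n + Y n - (S + T)) \<le> n2 (X n - S) + n2 (Y n - T)" for n
   using n2_triangle[of "X n - S" "Y n - T"] X(1,2) Y(1,2) by (simp add: add_diff_add)
  show "(\<lambda>n. n2 (X n - S) + n2 (Y n - T)) \<longlonglongrightarrow> 0" using tendsto_add[OF X(4) Y(4)] by simp
 qed (simp_all add: X(1,2) Y(1,2))
qed

lemma n2_lim_mult:
 assumes "n2_lim X S" "n2_lim Y T" shows "n2_lim (\<lambda>n. X n * Y n) (S * T)"
proof -
 note X = n2_limD[OF assms(1)] and Y = n2_limD[OF assms(2)]
 obtain c d where c: "\<And>n. norm (X n) \<le> c" and d: "\<And>n. norm (Y n) \<le> d" using X(3) Y(3) by blast
 have c0: "0 \<le> c" using c[of 0] norm_ge_zero[of "X 0"] by linarith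
 show ?thesis
 proof (rule n2_lim_bound)
  show "norm (X n * Y n) \<le> c * d" for n
   by (rule order_trans[OF norm_mult_ineq mult_mono]) (simp_all add: c d c0)
  show "n2 (X n * Y n - S * T) \<le> c * n2 (Y n - T) + n2 (X n - S) * norm T" for n
  proof -
   have "norm (X n) * n2 (Y n - T) \<le> c * n2 (Y n - T)" by (intro mult_right_mono c) (simp add: Y(1,2))
   then show ?thesis using n2_mult_diff[OF X(1)[of n] Y(1)[of n] X(2) Y(2)] by linarith
  qed
  show "(\<lambda>n. c * n2 (Y n - T) + n2 (X n - S) * norm T) \<longlonglongrightarrow> 0"
   using tendsto_add[OF tendsto_mult[OF tendsto_const Y(4), of c] tendsto_mult[OF X(4) tendsto_const, of "norm T"]] by simp
 qed (simp_all add: X(1,2) Y(1,2))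
qed

lemma n2_lim_adj: "n2_lim X T ==> n2_lim (\<lambda>n. adj (X n)) (adj T)"
 unfolding n2_lim_def using n2_adj[of "X _ - T"] by simp

lemma n2_lim_scaleR: "n2_lim X T ==> n2_lim (\<lambda>n. r *\<^sub>R X n) (r *\<^sub>R T)"
 using n2_lim_mult[OF n2_lim_const[of "r *\<^sub>R 1"], of X T] by simp

lemma n2_lim_diff: "n2_lim X S ==> n2_lim Y T ==> n2_lim (\<lambda>n. X n - Y n) (S - T)"
 using n2_lim_add[of X S "\<lambda>n. (-1) *\<^sub>R Y n" "(-1) *\<^sub>R T"] n2_lim_scaleR[of Y T "-1"] by simp

lemma n2_lim_Suc: "n2_lim X T ==> n2_lim (\<lambda>n. X (Suc n)) T"
 unfolding n2_lim_def using LIMSEQ_Suc[of "\<lambda>n. n2 (X n - T)" 0] by blast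

lemma n2_Cauchy_lim:
 "(\<And>n. X n \<in> A) ==> (\<And>n. norm (X n) \<le> c) ==> n2_Cauchy X ==> \<exists>T. n2_lim X T \<and> norm T \<le> c"
 using n2_complete[of X c] unfolding n2_lim_def by blast

end

section \<open>Averaging over unitary groups\<close>

text \<open>The convex hull of the conjugations, kept as a set of maps rather than of elements: the
  same average can then be applied to several elements, and averages can be composed.\<close>

inductive_set averages :: "'h::chilbert_space bop set => ('h bop => 'h bop) set" for G where
 averages_Ad: "u \<in> G ==> (\<lambda>x. u * x * adj u) \<in> averages G"
| averages_convex: "f \<in> averages G ==> g \<in> averages G ==> 0 \<le> t ==> t \<le> 1 ==>
  (\<lambda>x. t *\<^sub>R f x + (1 - t) *\<^sub>R g x) \<in> averages G"

lemma averages_Ad_comp: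
 assumes G: "\<And>u v. u \<in> G ==> v \<in> G ==> u * v \<in> G" and u: "u \<in> G"
 shows "g \<in> averages G ==> (\<lambda>x. u * g x * adj u) \<in> averages G"
proof (induction rule: averages.induct)
 case (averages_Ad v)
 then show ?case using averages.averages_Ad[of "u * v" G] G u by (simp add: mult.assoc)
next
 case (averages_convex f g t)
 then show ?case using averages.averages_convex[of "\<lambda>x. u * f x * adj u" G "\<lambda>x. u * g x * adj u" t]
  by (simp add: distrib_left distrib_right)
qed

lemma averages_comp:
 assumes G: "\<And>u v. u \<in> G ==> v \<in> G ==> u * v \<in> G"
 shows "f \<in> averages G ==> g \<in> averages G ==> (\<lambda>x. f (g x)) \<in> averages G"
proof (induction rule: averages.induct)
 case (averages_Ad u)
 then show ?case using averages_Ad_comp[OF G] by blast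
next
 case (averages_convex f f' t)
 then show ?case using averages.averages_convex[of "\<lambda>x. f (g x)" G "\<lambda>x. f' (g x)" t] by simp
qed

lemma averages_diff: "f \<in> averages G ==> f (x - y) = f x - f y"
proof (induction rule: averages.induct)
 case (averages_convex f g t)
 then show ?case by (simp only: scaleR_diff_right) (simp add: algebra_simps)
qed (simp add: algebra_simps)

lemma averages_norm:
 assumes "\<And>u. u \<in> G ==> norm u \<le> 1" shows "f \<in> averages G ==> norm (f x) \<le> norm x"
proof (induction rule: averages.induct)
 case (averages_Ad u)
 have "norm (u * x * adj u) \<le> norm u * norm x * norm u"
  using norm_mult_ineq[of "u * x" "adj u"] mult_right_mono[OF norm_mult_ineq[of u x], of "norm u"] by simp
 also have "\<dots> \<le> 1 * norm x * 1" using assms[OF averages_Ad] by (intro mult_mono) simp_all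
 finally show ?case by simp
next
 case (averages_convex f g t)
 have "norm (t *\<^sub>R f x + (1 - t) *\<^sub>R g x) \<le> t * norm (f x) + (1 - t) * norm (g x)"
  using norm_triangle_ineq[of "t *\<^sub>R f x" "(1 - t) *\<^sub>R g x"] averages_convex.hyps by simp
 also have "\<dots> \<le> t * norm x + (1 - t) * norm x"
  using averages_convex by (intro add_mono mult_left_mono) simp_all
 finally show ?case by (simp add: algebra_simps)
qed

context vna
begin

lemma averages_in: "G \<subseteq> A ==> f \<in> averages G ==> x \<in> A ==> f x \<in> A"
 by (rotate_tac 1, induction rule: averages.induct) auto

lemma averages_n2:
 assumes G: "G \<subseteq> A" "\<And>u. u \<in> G ==> norm u \<le> 1" and x: "x \<in> A"
 shows "f \<in> averages G ==> n2 (f x) \<le> n2 x"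
proof (induction rule: averages.induct)
 case (averages_Ad u)
 have u: "u \<in> A" "norm u \<le> 1" using averages_Ad G by auto
 have "n2 (u * x * adj u) \<le> n2 (u * x) * norm u" using n2_mult_right[of "u * x" "adj u"] u x by simp
 also have "\<dots> \<le> (norm u * n2 x) * norm u" using u x by (intro mult_right_mono n2_mult_left) simp_all
 also have "\<dots> \<le> (1 * n2 x) * 1" using u x by (intro mult_mono) simp_all
 finally show ?case by simp
next
 case (averages_convex f g t)
 have fg: "f x \<in> A" "g x \<in> A" using averages_in[OF G(1)] averages_convex.hyps x by auto
 have "n2 (t *\<^sub>R f x + (1 - t) *\<^sub>R g x) \<le> n2 (t *\<^sub>R f x) + n2 ((1 - t) *\<^sub>R g x)"
  using fg by (intro n2_triangle) simp_all
 also have "\<dots> \<le> t * n2 x + (1 - t) * n2 x"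
  using averages_convex fg by (simp add: n2_scaleR add_mono mult_left_mono)
 finally show ?case by (simp add: algebra_simps)
qed

text \<open>The element of minimal 2-norm in the closed convex hull of the orbit of \<open>x\<close> is fixed by the group.\<close>

lemma minimal_average:
 assumes G: "G \<subseteq> A" "\<And>u. u \<in> G ==> norm u \<le> 1" "\<And>u v. u \<in> G ==> v \<in> G ==> u * v \<in> G" "w \<in> G"
  and x: "x \<in> A"
 shows "\<exists>f z. (\<forall>n. f n \<in> averages G) \<and> z \<in> A \<and> (\<lambda>n. n2 (f n x - z)) \<longlonglongrightarrow> 0 \<and> (\<forall>u\<in>G. u * z * adj u = z)"
proof -
 define S where "S = (\<lambda>f. n2 (f x)) ` averages G"
 define m where "m = Inf S"
 have fA [simp]: "f x \<in> A" if "f \<in> averages G" for f using averages_in[OF G(1) that x] .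
 have ne: "averages G \<noteq> {}" using averages_Ad[OF G(4)] by blast
 have mle: "m \<le> n2 (f x)" if "f \<in> averages G" for f
  unfolding m_def S_def using that by (intro cINF_lower bdd_belowI[of _ 0]) auto
 have m0: "0 \<le> m" unfolding m_def S_def using ne by (intro cINF_greatest) auto
 have "\<exists>f\<in>averages G. n2 (f x) < m + inverse (real (Suc n))" for n
 proof -
  have "Inf S < m + inverse (real (Suc n))" unfolding m_def [symmetric] by (simp del: of_nat_Suc)
  then obtain s where "s \<in> S" "s < m + inverse (real (Suc n))"
   using cInf_lessD[of S] ne unfolding S_def by blast
  then show ?thesis by (auto simp: S_def)
 qed
 then obtain f where f: "\<And>n. f n \<in> averages G" "\<And>n. n2 (f n x) < m + inverse (real (Suc n))" by metis
 define d where "d n = inverse (real (Suc n))" for n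
 have d: "0 < d n" "d n \<le> 1" for n by (simp_all add: d_def inverse_le_1_iff)
 define K where "K = 2 * (2 * m + 1)"
 have K: "K > 0" using m0 by (simp add: K_def)
 \<comment> \<open>Parallelogram law: two elements within \<open>s\<close> and \<open>t\<close> of
   the minimal norm are close if their midpoint is not below the minimum. \<open>K\<close> is twice
   the factor in \<open>(m + s)^2 <= m^2 + (2 * m + 1) * s\<close>.\<close>
 have half: "(n2 (a - b))\<^sup>2 \<le> K * (s + t)"
  if "a \<in> A" "b \<in> A" "m \<le> n2 ((1/2) *\<^sub>R a + (1 - 1/2) *\<^sub>R b)" "n2 a \<le> m + s" "n2 b \<le> m + t" "0 \<le> s" "s \<le> 1" "0 \<le> t" "t \<le> 1" for a b s t
 proof -
  have "(1/2) *\<^sub>R a + (1 - 1/2) *\<^sub>R b = (1/2) *\<^sub>R (a + b)" by (simp add: scaleR_add_right)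
  then have "2 * m \<le> n2 (a + b)" using that by (simp add: n2_scaleR)
  then have "(2 * m)\<^sup>2 \<le> (n2 (a + b))\<^sup>2" using m0 by (intro power_mono) simp_all
  moreover have "(n2 a)\<^sup>2 \<le> (m + s)\<^sup>2" "(n2 b)\<^sup>2 \<le> (m + t)\<^sup>2"
   using that by (intro power_mono; simp)+
  moreover have "(m + s)\<^sup>2 \<le> m\<^sup>2 + (2 * m + 1) * s" "(m + t)\<^sup>2 \<le> m\<^sup>2 + (2 * m + 1) * t"
   using that mult_left_le[of s s] mult_left_le[of t t] by (simp_all add: power2_eq_square algebra_simps)
  ultimately show ?thesis
   using n2_parallelogram[OF that(1,2)] by (simp add: K_def power2_eq_square algebra_simps)
 qed
 have close: "(n2 (f n x - f k x))\<^sup>2 \<le> K * (d n + d k)" for n k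
 proof (rule half)
  show "m \<le> n2 ((1/2) *\<^sub>R f n x + (1 - 1/2) *\<^sub>R f k x)"
   using mle[OF averages_convex[OF f(1)[of n] f(1)[of k], of "1/2"]] by simp
  show "n2 (f n x) \<le> m + d n" "n2 (f k x) \<le> m + d k" using f(2)[of n] f(2)[of k] by (simp_all add: d_def)
 qed (simp_all add: f d less_imp_le)
 have dl: "d \<longlonglongrightarrow> 0" unfolding d_def by (rule LIMSEQ_inverse_real_of_nat)
 have "n2_Cauchy (\<lambda>n. f n x)" unfolding n2_Cauchy_def
 proof (intro allI impI)
  fix e :: real assume e: "e > 0"
  have "\<forall>\<^sub>F n in sequentially. d n < e\<^sup>2 / (2 * K)"
   using order_tendstoD(2)[OF dl, of "e\<^sup>2 / (2 * K)"] e K by simp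
  then obtain N where N: "\<And>n. n \<ge> N ==> d n < e\<^sup>2 / (2 * K)" by (auto simp: eventually_sequentially)
  have "n2 (f n x - f k x) < e" if "n \<ge> N" "k \<ge> N" for n k
  proof -
   have "K * (d n + d k) < K * (e\<^sup>2 / (2 * K) + e\<^sup>2 / (2 * K))"
    using N that K by (intro mult_strict_left_mono add_strict_mono) auto
   also have "\<dots> = e\<^sup>2" using K by (simp add: field_simps)
   finally have "(n2 (f n x - f k x))\<^sup>2 < e\<^sup>2" using close[of n k] by linarith
   then show ?thesis by (rule power2_less_imp_less) (use e in simp)
  qed
  then show "\<exists>M. \<forall>m\<ge>M. \<forall>n\<ge>M. n2 (f m x - f n x) < e" by blast
 qed
 then have "\<exists>T\<in>A. norm T \<le> norm x \<and> (\<lambda>n. n2 (f n x - T)) \<longlonglongrightarrow> 0"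
  by (rule n2_complete[rotated 2]) (simp_all add: averages_norm[OF G(2) f(1)] f(1))
 then obtain z where z: "z \<in> A" "(\<lambda>n. n2 (f n x - z)) \<longlonglongrightarrow> 0" by blast
 have "u * z * adj u = z" if u: "u \<in> G" for u
 proof (rule n2_limit_unique[of "\<lambda>n. u * f n x * adj u"])
  have uA: "u \<in> A" "norm u \<le> 1" using u G(1,2) by blast+
  show "\<And>n. u * f n x * adj u \<in> A" "u * z * adj u \<in> A" "z \<in> A" by (simp_all add: uA z(1) f(1))
  show "(\<lambda>n. n2 (u * f n x * adj u - u * z * adj u)) \<longlonglongrightarrow> 0"
  proof (rule tendsto_sandwich[OF _ _ tendsto_const z(2)])
   have "n2 (u * f n x * adj u - u * z * adj u) \<le> n2 (f n x - z)" for n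
    using averages_n2[OF G(1,2) _ averages_Ad[OF u], of "f n x - z"] by (simp add: f(1) z(1) right_diff_distrib left_diff_distrib)
   then show "\<forall>\<^sub>F n in sequentially. n2 (u * f n x * adj u - u * z * adj u) \<le> n2 (f n x - z)" by simp
  qed (simp add: uA z(1) f(1))
  have uf: "(\<lambda>x. u * f n x * adj u) \<in> averages G" for n
   using averages_Ad_comp[OF G(3) u f(1)] by blast
  \<comment> \<open>The conjugate is again an average and not longer than \<open>f n x\<close>, so
    it is as close to the minimum; by \<open>half\<close> the two are close, and the limit
    \<open>z\<close> is invariant.\<close>
  have "(n2 (u * f n x * adj u - f n x))\<^sup>2 \<le> K * (d n + d n)" for n
  proof (rule half)
   show "m \<le> n2 ((1/2) *\<^sub>R (u * f n x * adj u) + (1 - 1/2) *\<^sub>R f n x)"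
    using mle[OF averages_convex[OF uf[of n] f(1)[of n], of "1/2"]] by simp
   have "n2 (u * f n x * adj u) \<le> n2 (f n x)"
    using averages_n2[OF G(1,2) _ averages_Ad[OF u], of "f n x"] by (simp add: f(1))
   then show "n2 (u * f n x * adj u) \<le> m + d n" using f(2)[of n] by (simp add: d_def)
   show "n2 (f n x) \<le> m + d n" using f(2)[of n] by (simp add: d_def)
  qed (simp_all add: f d uA less_imp_le)
  moreover have "(\<lambda>n. K * (d n + d n)) \<longlonglongrightarrow> K * (0 + 0)" by (intro tendsto_intros dl)
  ultimately have "(\<lambda>n. (n2 (u * f n x * adj u - f n x))\<^sup>2) \<longlonglongrightarrow> 0"
   by - (rule tendsto_sandwich[OF _ _ tendsto_const, of _ _ _ "\<lambda>n. K * (d n + d n)"], simp_all)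
  then have "(\<lambda>n. sqrt ((n2 (u * f n x * adj u - f n x))\<^sup>2)) \<longlonglongrightarrow> sqrt 0" by (rule tendsto_real_sqrt)
  then have "(\<lambda>n. n2 (u * f n x * adj u - f n x)) \<longlonglongrightarrow> 0" by (simp add: uA f(1))
  from tendsto_add[OF this z(2)] have lim: "(\<lambda>n. n2 (u * f n x * adj u - f n x) + n2 (f n x - z)) \<longlonglongrightarrow> 0" by simp
  show "(\<lambda>n. n2 (u * f n x * adj u - z)) \<longlonglongrightarrow> 0"
  proof (rule tendsto_sandwich[OF _ _ tendsto_const lim])
   show "\<forall>\<^sub>F n in sequentially. n2 (u * f n x * adj u - z) \<le> n2 (u * f n x * adj u - f n x) + n2 (f n x - z)"
    by (intro always_eventually allI n2_dist_triangle) (simp_all add: uA z(1) f(1))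
  qed (simp add: uA z(1) f(1))
 qed
 then show ?thesis using f z by blast
qed

section \<open>Corners\<close>

definition proj :: "'h bop => bool" where
 "proj p \<longleftrightarrow> p \<in> A \<and> adj p = p \<and> p * p = p"

lemma projD: "proj p ==> p \<in> A" "proj p ==> adj p = p" "proj p ==> p * p = p" by (simp_all add: proj_def)
lemma proj_one [simp]: "proj 1" by (simp add: proj_def)
lemma proj_pos: "proj p ==> pos p" using pos_sq[of p] by (simp add: proj_def)
lemma proj_compl: "proj p ==> proj (1 - p)" by (simp add: proj_def algebra_simps)
lemma proj_norm: "proj p ==> norm p \<le> 1"
 using proj_pos[OF proj_compl, of p] by (intro norm_le_of_sq) (simp add: proj_def)
lemma proj_tau: "proj p ==> tau p = complex_of_real ((n2 p)\<^sup>2)"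
 using tau_adj_self[of p] by (simp add: proj_def)
lemma proj_tau_nonneg: "proj p ==> 0 \<le> Re (tau p)" by (simp add: proj_tau)
lemma proj_tau_pos: "proj p ==> p \<noteq> 0 ==> 0 < Re (tau p)"
 using n2_eq_0[of p] by (simp add: proj_tau projD)

definition corner_unitaries :: "'h bop => 'h bop set" where
 "corner_unitaries r = {u \<in> A. adj u * u = r \<and> u * adj u = r \<and> r * u = u \<and> u * r = u}"

lemma corner_unitariesD:
 assumes "u \<in> corner_unitaries r"
 shows "u \<in> A" "adj u * u = r" "u * adj u = r" "r * u = u" "u * r = u"
 using assms by (auto simp: corner_unitaries_def)

lemma corner_unitaries_mult:
 assumes "u \<in> corner_unitaries r" "v \<in> corner_unitaries r" shows "u * v \<in> corner_unitaries r"
proof -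
 note u = corner_unitariesD[OF assms(1)] and v = corner_unitariesD[OF assms(2)]
 have "adj (u * v) * (u * v) = adj v * (adj u * u) * v" by (simp add: mult.assoc)
 also have "\<dots> = r" by (simp add: u v mult.assoc)
 finally have 1: "adj (u * v) * (u * v) = r" .
 have "(u * v) * adj (u * v) = u * (v * adj v) * adj u" by (simp add: mult.assoc)
 also have "\<dots> = r" by (simp add: u v)
 finally have 2: "(u * v) * adj (u * v) = r" .
 have "r * (u * v) = u * v" by (simp add: u flip: mult.assoc)
 moreover have "(u * v) * r = u * v" by (simp add: v mult.assoc)
 ultimately show ?thesis using u v 1 2 by (simp add: corner_unitaries_def)
qed

lemma corner_unitaries_norm:
 assumes "proj r" "u \<in> corner_unitaries r" shows "norm u \<le> 1"
 using proj_pos[OF proj_compl[OF assms(1)]] by (intro norm_le_of_sq) (simp add: corner_unitariesD[OF assms(2)])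

lemma corner_unit: "proj r ==> r \<in> corner_unitaries r" by (simp add: corner_unitaries_def proj_def)

text \<open>A self-adjoint \<open>y\<close> in the corner with \<open>\<parallel>y\<parallel> < 1\<close> is the real part of the unitary
 \<open>y + i (1 - y\<^sup>2)\<^sup>1\<^sup>/\<^sup>2 r\<close>.\<close>

lemma corner_commute:
 assumes r: "proj r" and z: "\<And>u. u \<in> corner_unitaries r ==> z * u = u * z"
  and y: "y \<in> A" "r * y = y" "y * r = y"
 shows "z * y = y * z"
proof -
 have sa1: "z * y = y * z" if y: "y \<in> A" "r * y = y" "y * r = y" "adj y = y" "norm y < 1" for y
 proof -
  have "norm (y * y) < 1"
   using norm_mult_ineq[of y y] that(5) abs_square_less_1[of "norm y"] by (simp add: power2_eq_square)
  then obtain S where S: "S \<in> A" "adj S = S" "S * S = 1 - y * y"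
    "\<And>X. X * (y * y) = (y * y) * X ==> X * S = S * X"
  proof -
   have "y * y \<in> A" "adj (y * y) = y * y" using y by simp_all
   then show ?thesis using sqrt_one_minus[of "y * y"] \<open>norm (y * y) < 1\<close> that by blast
  qed
  have rS: "r * S = S * r" using S(4)[of r] y by (metis mult.assoc)
  have yS: "y * S = S * y" using S(4)[of y] by (simp add: mult.assoc)
  define u where "u = y + csc \<i> (S * r)"
  have adju: "adj u = y - csc \<i> (S * r)" using y S(2) rS projD(2)[OF r] by (simp add: u_def csc_minus)
  have Sr: "S * r * (S * r) = r - y * y"
  proof -
   have "S * r * (S * r) = S * S * r" using rS r by (metis mult.assoc projD(3))
   then show ?thesis by (simp add: S(3) left_diff_distrib mult.assoc y)
  qed
  have ySr: "y * (S * r) = S * r * y" by (metis mult.assoc y(2,3) yS rS)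
  have 1: "adj u * u = r"
   unfolding adju by (simp add: u_def left_diff_distrib distrib_left right_diff_distrib csc_diff_right csc_add_right ySr Sr csc_minus)
  have 2: "u * adj u = r"
   unfolding adju by (simp add: u_def distrib_right distrib_left right_diff_distrib csc_diff_right csc_add_right ySr Sr csc_minus)
  have 3: "r * u = u" "u * r = u"
  proof -
   have "r * (S * r) = S * r" "S * r * r = S * r" using rS projD(3)[OF r] by (metis mult.assoc)+
   then show "r * u = u" "u * r = u" using y by (simp_all add: u_def distrib_left distrib_right)
  qed
  have uU: "u \<in> corner_unitaries r" using 1 2 3 y(1) S(1) projD(1)[OF r] by (simp add: corner_unitaries_def u_def)
  have uU': "adj u \<in> corner_unitaries r"
  proof -
   have "r * adj u = adj (u * r)" "adj u * r = adj (r * u)" using projD(2)[OF r] by simp_all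
   then show ?thesis using uU by (simp only: 3) (simp add: corner_unitaries_def)
  qed
  have "z * (u + adj u) = (u + adj u) * z" using z[OF uU] z[OF uU'] by (simp add: distrib_left distrib_right)
  moreover have "u + adj u = 2 *\<^sub>R y" unfolding adju by (simp add: u_def scaleR_2)
  ultimately show ?thesis by simp
 qed
 have sa: "z * y = y * z" if y: "y \<in> A" "r * y = y" "y * r = y" "adj y = y" for y
 proof -
  define s where "s = inverse (norm y + 1)"
  have s: "s > 0" by (simp add: s_def add_nonneg_pos)
  have "norm (s *\<^sub>R y) < 1" by (simp add: s_def field_simps divide_less_eq_1 add_nonneg_pos add_pos_nonneg)
  then have "z * (s *\<^sub>R y) = (s *\<^sub>R y) * z" using y by (intro sa1) simp_all
  then show ?thesis using s by simp
 qed
 have ry: "r * adj y = adj y" "adj y * r = adj y" using y r by (metis adj_mult projD(2))+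
 have a: "z * (y + adj y) = (y + adj y) * z"
  using y ry by (intro sa) (simp_all add: distrib_left distrib_right add.commute)
 have "z * csc \<i> (y - adj y) = csc \<i> (y - adj y) * z"
  using y ry by (intro sa) (simp_all add: left_diff_distrib right_diff_distrib csc_diff_right csc_minus)
 then have "csc (-\<i>) (z * csc \<i> (y - adj y)) = csc (-\<i>) (csc \<i> (y - adj y) * z)" by simp
 then have b: "z * (y - adj y) = (y - adj y) * z" by simp
 have "z * ((y + adj y) + (y - adj y)) = ((y + adj y) + (y - adj y)) * z"
  by (simp only: distrib_left[of z "y + adj y"] distrib_right[of "y + adj y"] a b)
 moreover have "(y + adj y) + (y - adj y) = 2 *\<^sub>R y" by (simp add: scaleR_2)
 ultimately show ?thesis by simp
qed

lemma minimal_average_corner: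
 assumes r: "proj r" and x: "x \<in> A" "r * x = x" "x * r = x"
 shows "\<exists>f z. (\<forall>n. f n \<in> averages (corner_unitaries r)) \<and> z \<in> A \<and> (\<lambda>n. n2 (f n x - z)) \<longlonglongrightarrow> 0 \<and>
  r * z = z \<and> z * r = z \<and> (\<forall>y\<in>A. r * y = y --> y * r = y --> z * y = y * z)"
proof -
 have "corner_unitaries r \<subseteq> A" by (auto simp: corner_unitaries_def)
 then obtain f z where f: "\<And>n. f n \<in> averages (corner_unitaries r)" "z \<in> A" "(\<lambda>n. n2 (f n x - z)) \<longlonglongrightarrow> 0"
   and z: "\<And>u. u \<in> corner_unitaries r ==> u * z * adj u = z"
  using minimal_average[of "corner_unitaries r" r x] corner_unitaries_norm[OF r] corner_unitaries_mult
   corner_unit[OF r] x by blast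
 have "r * z * r = z" using z[OF corner_unit[OF r]] r by (simp add: projD)
 then have rz: "r * z = z" "z * r = z" using projD(3)[OF r] by (metis mult.assoc)+
 have zu: "z * u = u * z" if "u \<in> corner_unitaries r" for u
 proof -
  have "z * u = u * z * (adj u * u)" using z[OF that] by (metis mult.assoc)
  also have "\<dots> = u * z" by (simp add: corner_unitariesD[OF that] mult.assoc rz)
  finally show ?thesis .
 qed
 have "\<forall>y\<in>A. r * y = y --> y * r = y --> z * y = y * z" using corner_commute[OF r zu] by blast
 then show ?thesis using f rz by blast
qed

end

section \<open>Factors\<close>

locale vn_factor = vna +
 assumes center_trivial: "z \<in> A ==> (\<And>x. x \<in> A ==> z * x = x * z) ==> \<exists>c. z = csc c 1"
begin

abbreviation "av \<equiv> averages (corner_unitaries 1)"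

lemma av_comp: "f \<in> av ==> g \<in> av ==> (\<lambda>x. f (g x)) \<in> av"
 using averages_comp[of "corner_unitaries 1"] corner_unitaries_mult by blast

lemma av_in: "f \<in> av ==> x \<in> A ==> f x \<in> A"
 by (rule averages_in) (auto simp: corner_unitaries_def)

lemma av_n2: "f \<in> av ==> x \<in> A ==> n2 (f x) \<le> n2 x"
 using corner_unitaries_norm[OF proj_one] by (intro averages_n2[of "corner_unitaries 1"]) (auto simp: corner_unitaries_def)

lemma av_scalar: "f \<in> av ==> f (csc c 1) = csc c 1"
proof (induction rule: averages.induct)
 case (averages_Ad u)
 then show ?case by (simp add: corner_unitaries_def)
next
 case (averages_convex f g t)
 then show ?case by (simp flip: scaleR_add_left)
qed

lemma av_tau: "f \<in> av ==> x \<in> A ==> tau (f x) = tau x"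
proof (induction rule: averages.induct)
 case (averages_Ad u)
 have "tau (u * x * adj u) = tau (adj u * (u * x))"
  using averages_Ad by (intro tau_comm) (simp_all add: corner_unitaries_def)
 then show ?case using averages_Ad by (simp add: corner_unitaries_def flip: mult.assoc)
next
 case (averages_convex f g t)
 then show ?case by (simp add: av_in tau_simps algebra_simps)
qed

text \<open>The minimal average of \<open>x\<close> commutes with the whole algebra, so it is scalar
  in a factor; averages preserve the trace, which identifies the scalar.\<close>

lemma dixmier:
 assumes x: "x \<in> A" and e: "e > 0"
 shows "\<exists>f\<in>av. n2 (f x - csc (tau x) 1) < e"
proof -
 obtain f z where f: "\<And>n. f n \<in> av" "z \<in> A" "(\<lambda>n. n2 (f n x - z)) \<longlonglongrightarrow> 0"
   and z: "\<And>y. y \<in> A ==> z * y = y * z" using minimal_average_corner[of 1 x] x by auto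
 obtain c where c: "z = csc c 1" using center_trivial[OF f(2)] z by blast
 have "cmod (tau x - c) \<le> 0"
 proof (rule LIMSEQ_le_const[OF f(3)], intro exI allI impI)
  fix n
  have "tau (f n x - z) = tau x - c" using f x by (simp add: tau_simps av_tau av_in c tau_one)
  then show "cmod (tau x - c) \<le> n2 (f n x - z)" using tau_le_n2[of "f n x - z"] f x by (simp add: av_in)
 qed
 then have "c = tau x" by simp
 moreover obtain n where "n2 (f n x - z) < e"
  using order_tendstoD(2)[OF f(3) e] by (auto simp: eventually_sequentially)
 ultimately show ?thesis using f(1) c by blast
qed

text \<open>The average that flattens \<open>f y\<close> is applied after the one that flattens
  \<open>x\<close>. It does not spoil the first approximation, being 2-norm contractive and fixing
  scalars.\<close>

lemma dixmier2:
 assumes x: "x \<in> A" "y \<in> A" and e: "e > 0"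
 shows "\<exists>f\<in>av. n2 (f x - csc (tau x) 1) < e \<and> n2 (f y - csc (tau y) 1) < e"
proof -
 obtain f where f: "f \<in> av" "n2 (f x - csc (tau x) 1) < e" using dixmier[OF x(1) e] by blast
 obtain g where g: "g \<in> av" "n2 (g (f y) - csc (tau (f y)) 1) < e" using dixmier[OF av_in[OF f(1) x(2)] e] by blast
 have "g (f x) - csc (tau x) 1 = g (f x - csc (tau x) 1)"
  by (simp add: averages_diff[OF g(1)] av_scalar[OF g(1)])
 then have "n2 (g (f x) - csc (tau x) 1) < e"
  using av_n2[OF g(1), of "f x - csc (tau x) 1"] f x by (simp add: av_in)
 moreover have "n2 (g (f y) - csc (tau y) 1) < e" using g(2) av_tau[OF f(1) x(2)] by simp
 ultimately show ?thesis using av_comp[OF g(1) f(1)] by (intro bexI[of _ "\<lambda>x. g (f x)"] conjI)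
qed

text \<open>The hypothesis gives \<open>a * f (b * adj b) = 0\<close> for every average
  \<open>f\<close>, while averages of \<open>b * adj b\<close> come close to the scalar
  \<open>tau (b * adj b)\<close>. Hence that scalar or \<open>a\<close> vanishes.\<close>

lemma factor_prime:
 assumes ab: "a \<in> A" "b \<in> A" "\<And>x. x \<in> A ==> a * x * b = 0"
 shows "a = 0 \<or> b = 0"
proof -
 define t where "t = tau (b * adj b)"
 have af: "a * f (b * adj b) = 0" if "f \<in> av" for f using that
 proof (induction rule: averages.induct)
  case (averages_Ad u)
  then have "a * u * b = 0" using ab(3)[of u] by (simp add: corner_unitaries_def)
  then show ?case by (metis mult.assoc mult_zero_left)
 next
  case (averages_convex f g t)
  then show ?case by (simp add: distrib_left)
 qed
 have "cmod t * n2 a \<le> 0"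
 proof (rule field_le_epsilon)
  fix e :: real assume e: "e > 0"
  obtain f where f: "f \<in> av" "n2 (f (b * adj b) - csc t 1) < e / (norm a + 1)"
  proof -
   have "b * adj b \<in> A" "e / (norm a + 1) > 0" using ab(2) e by (simp_all add: add_nonneg_pos)
   then show ?thesis using dixmier that unfolding t_def by blast
  qed
  have "a * (f (b * adj b) - csc t 1) = - csc t a" by (simp add: right_diff_distrib af[OF f(1)])
  then have "cmod t * n2 a = n2 (a * (f (b * adj b) - csc t 1))" using ab(1) by (simp add: n2_minus n2_csc)
  also have "\<dots> \<le> norm a * n2 (f (b * adj b) - csc t 1)"
   using ab(1,2) f(1) by (intro n2_mult_left) (simp_all add: av_in)
  also have "\<dots> \<le> norm a * (e / (norm a + 1))" using f by (intro mult_left_mono) simp_all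
  also have "\<dots> = e * (norm a / (norm a + 1))" by simp
  also have "\<dots> \<le> e * 1" using e by (intro mult_left_mono) (simp_all add: divide_le_eq_1 add_nonneg_pos)
  finally show "cmod t * n2 a \<le> 0 + e" by simp
 qed
 then have "cmod t * n2 a = 0" using ab(1) by (intro order_antisym) simp_all
 then have "t = 0 \<or> n2 a = 0" by simp
 then show ?thesis
 proof
  assume "t = 0"
  then have "adj b = 0" using tau_faithful[of "adj b"] ab(2) by (simp add: t_def)
  then show ?thesis using adj_eq_iff[of b 0] by simp
 qed (use ab(1) n2_eq_0[of a] in simp)
qed

text \<open>An average that takes both \<open>r\<close> and \<open>z\<close> close to their traces
  turns the identity \<open>key\<close> into \<open>tau r * z = tau z * r\<close>. So a corner of a
  factor is a factor.\<close>

lemma corner_center: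
 assumes r: "proj r" "r \<noteq> 0" and z: "z \<in> A" "r * z = z" "z * r = z"
  and zc: "\<And>y. y \<in> A ==> r * y = y ==> y * r = y ==> z * y = y * z"
 shows "z = csc (tau z / tau r) r"
proof -
 have rA: "r \<in> A" "adj r = r" "r * r = r" using r by (simp_all add: projD)
 \<comment> \<open>For a single conjugation by \<open>u\<close> this says that \<open>z\<close>
   commutes with the corner element \<open>r * u * r\<close>; convex combinations preserve
   it.\<close>
 have key: "z * f r * r = r * f z * r" if "f \<in> av" for f using that
 proof (induction rule: averages.induct)
  case (averages_Ad u)
  then have u: "u \<in> A" by (simp add: corner_unitaries_def)
  have "r * (r * u * r) = r * u * r" "r * u * r * r = r * u * r" using rA(3) by (metis mult.assoc)+
  then have "z * (r * u * r) = (r * u * r) * z" using u rA(1) by (intro zc) simp_all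
  then have "(z * (r * u * r)) * adj u * r = (r * u * r) * z * adj u * r" by simp
  moreover have "(z * (r * u * r)) * adj u * r = z * u * r * adj u * r" by (metis mult.assoc z(3))
  moreover have "(r * u * r) * z * adj u * r = r * (u * z * adj u) * r" by (metis mult.assoc z(2))
  ultimately show ?case by (simp add: mult.assoc)
 next
  case (averages_convex f g t)
  then show ?case by (simp add: distrib_left distrib_right)
 qed
 have tr: "tau r \<noteq> 0" using proj_tau_pos[OF r] by auto
 have "n2 (csc (tau r) z - csc (tau z) r) \<le> 0"
 proof (rule field_le_epsilon)
  fix e :: real assume e: "e > 0"
  define d where "d = e / (norm z + 2)"
  have d: "d > 0" using e by (simp add: d_def add_nonneg_pos)
  obtain f where f: "f \<in> av" "n2 (f r - csc (tau r) 1) < d" "n2 (f z - csc (tau z) 1) < d"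
   using dixmier2[OF rA(1) z(1) d] by blast
  have fA: "f r \<in> A" "f z \<in> A" using f rA z by (simp_all add: av_in)
  have nr: "norm r \<le> 1" by (rule proj_norm[OF r(1)])
  define a where "a = f r - csc (tau r) 1"
  define b where "b = f z - csc (tau z) 1"
  have ab: "a \<in> A" "b \<in> A" "n2 a \<le> d" "n2 b \<le> d" using f fA by (auto simp: a_def b_def)
  have "csc (tau r) z - csc (tau z) r = r * b * r - z * a * r"
   using key[OF f(1)] by (simp add: a_def b_def left_diff_distrib right_diff_distrib z rA)
  then have "n2 (csc (tau r) z - csc (tau z) r) \<le> n2 (r * b * r) + n2 (z * a * r)"
   using ab rA z by (simp add: n2_triangle_diff)
  also have "n2 (r * b * r) \<le> d"
  proof -
   have "n2 (r * b * r) \<le> n2 (r * b) * norm r" using ab rA by (intro n2_mult_right) simp_all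
   also have "\<dots> \<le> n2 (r * b)" using nr ab rA by (intro mult_left_le) simp_all
   also have "\<dots> \<le> norm r * n2 b" using ab rA by (intro n2_mult_left) simp_all
   also have "\<dots> \<le> 1 * n2 b" using nr ab by (intro mult_right_mono) simp_all
   finally show ?thesis using ab by simp
  qed
  also have "n2 (z * a * r) \<le> norm z * d"
  proof -
   have "n2 (z * a * r) \<le> n2 (z * a) * norm r" using ab rA z by (intro n2_mult_right) simp_all
   also have "\<dots> \<le> n2 (z * a)" using nr ab z by (intro mult_left_le) simp_all
   also have "\<dots> \<le> norm z * n2 a" using ab z by (intro n2_mult_left) simp_all
   finally show ?thesis using ab by (meson mult_left_mono norm_ge_zero order_trans)
  qed
  also have "d + norm z * d \<le> d * (norm z + 2)" using d by (simp add: algebra_simps)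
  also have "\<dots> = e"
  proof -
   have "norm z + 2 \<noteq> 0" by (smt (verit) norm_ge_zero)
   then show ?thesis by (simp add: d_def)
  qed
  finally show "n2 (csc (tau r) z - csc (tau z) r) \<le> 0 + e" by simp
 qed
 then have "n2 (csc (tau r) z - csc (tau z) r) = 0" using rA(1) z(1) by (intro order_antisym) simp_all
 then have "csc (tau r) z = csc (tau z) r"
  using n2_eq_0[of "csc (tau r) z - csc (tau z) r"] rA(1) z(1) by simp
 then have "csc (inverse (tau r)) (csc (tau r) z) = csc (inverse (tau r)) (csc (tau z) r)" by simp
 then show ?thesis using tr by (simp add: field_simps)
qed

text \<open>Averaging over the corner unitaries moves \<open>c\<close> by at most \<open>d\<close>,
  and the minimal average is central in the corner, hence the scalar given by the trace. So almost
  commuting with all unitaries means being close to the scalars.\<close>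

lemma corner_dist_scalars:
 assumes r: "proj r" "r \<noteq> 0" and c: "c \<in> A" "r * c = c" "c * r = c"
  and d: "\<And>u. u \<in> corner_unitaries r ==> n2 (u * c - c * u) \<le> d"
 shows "n2 (c - csc (tau c / tau r) r) \<le> d"
proof -
 obtain f z where f: "\<And>n. f n \<in> averages (corner_unitaries r)" "z \<in> A" "(\<lambda>n. n2 (f n c - z)) \<longlonglongrightarrow> 0"
   and z: "r * z = z" "z * r = z" "\<And>y. y \<in> A ==> r * y = y ==> y * r = y ==> z * y = y * z"
  using minimal_average_corner[OF r(1) c] by blast
 have sub: "corner_unitaries r \<subseteq> A" by (auto simp: corner_unitaries_def)
 have fA: "f n c \<in> A" for n using averages_in[OF sub f(1) c(1)] .
 have "n2 (g c - c) \<le> d \<and> tau (g c) = tau c" if "g \<in> averages (corner_unitaries r)" for g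
  using that
 proof (induction rule: averages.induct)
  case (averages_Ad u)
  note u = corner_unitariesD[OF averages_Ad]
  have "u * c * adj u - c = (u * c - c * u) * adj u" by (simp add: left_diff_distrib mult.assoc u c)
  then have "n2 (u * c * adj u - c) \<le> n2 (u * c - c * u) * norm u"
   using n2_mult_right[of "u * c - c * u" "adj u"] u c by simp
  also have "\<dots> \<le> n2 (u * c - c * u) * 1"
   using corner_unitaries_norm[OF r(1) averages_Ad] u(1) c(1) by (intro mult_left_mono) simp_all
  also have "\<dots> \<le> d" using d[OF averages_Ad] by simp
  finally have "n2 (u * c * adj u - c) \<le> d" .
  moreover have "tau (u * c * adj u) = tau (adj u * (u * c))" using u c by (intro tau_comm) simp_all
  ultimately show ?case using u c by (simp flip: mult.assoc)
 next
  case (averages_convex f g t)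
  have fg: "f c \<in> A" "g c \<in> A" using averages_in[OF sub _ c(1)] averages_convex.hyps by auto
  have e: "t *\<^sub>R f c + (1 - t) *\<^sub>R g c - c = t *\<^sub>R (f c - c) + (1 - t) *\<^sub>R (g c - c)"
   by (simp add: algebra_simps)
  have "n2 (t *\<^sub>R f c + (1 - t) *\<^sub>R g c - c) \<le> t * n2 (f c - c) + (1 - t) * n2 (g c - c)"
   unfolding e using n2_triangle[of "t *\<^sub>R (f c - c)" "(1 - t) *\<^sub>R (g c - c)"] fg c averages_convex.hyps
   by (simp add: n2_scaleR)
  also have "\<dots> \<le> t * d + (1 - t) * d"
   using averages_convex by (intro add_mono mult_left_mono) simp_all
  finally show ?case using averages_convex.IH fg by (simp add: tau_simps algebra_simps)
 qed
 then have fd: "n2 (f n c - c) \<le> d" "tau (f n c) = tau c" for n using f(1) by blast+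
 have tz: "tau z = tau c"
 proof -
  have "cmod (tau c - tau z) \<le> 0"
  proof (rule LIMSEQ_le_const[OF f(3)], intro exI allI impI)
   fix n show "cmod (tau c - tau z) \<le> n2 (f n c - z)"
    using tau_le_n2[of "f n c - z"] fA f fd by (simp add: tau_simps)
  qed
  then show ?thesis by simp
 qed
 have "n2 (c - z) \<le> d"
 proof (rule LIMSEQ_le_const)
  show "(\<lambda>n. d + n2 (f n c - z)) \<longlonglongrightarrow> d" using tendsto_add[OF tendsto_const f(3), of d] by simp
  show "\<exists>N. \<forall>n\<ge>N. n2 (c - z) \<le> d + n2 (f n c - z)"
  proof (intro exI allI impI)
   fix n
   show "n2 (c - z) \<le> d + n2 (f n c - z)"
    using n2_dist_triangle[OF c(1) fA[of n] f(2)] n2_diff_commute[OF c(1) fA[of n]] fd(1)[of n] by simp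
  qed
 qed
 moreover have "csc (tau c / tau r) r = z" using corner_center[OF r f(2) z] unfolding tz by (rule sym)
 ultimately show ?thesis by (simp only:)
qed

end

section \<open>Polar decomposition\<close>

text \<open>Newton's iteration for the inverse square root of \<open>a\<close>, that is
  \<open>g (n+1) = g n * (3 - g n * a * g n) / 2\<close> from \<open>g 0 = 1\<close>. Where
  \<open>a\<close> is not invertible the \<open>g n\<close> diverge, but for
  \<open>a = adj y * y\<close> the products \<open>y * g n\<close> converge to the polar part of
  \<open>y\<close>.\<close>

fun polar_factor :: "'h::chilbert_space bop => nat => 'h bop" where
 "polar_factor a 0 = 1"
| "polar_factor a (Suc n) = (1/2) *\<^sub>R (polar_factor a n * (1 + 1 + 1 - polar_factor a n * a * polar_factor a n))"

lemma polar_factor_commute: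
 assumes "X * a = a * X"
 shows "X * polar_factor a n = polar_factor a n * X"
proof (induction n)
 case (Suc n)
 define g where "g = polar_factor a n"
 define t where "t = 1 + 1 + 1 - g * a * g"
 have gX: "X * g = g * X" using Suc by (simp add: g_def)
 have "X * (g * a * g) = (g * a * g) * X" by (metis gX assms mult.assoc)
 then have tX: "X * t = t * X"
  by (simp add: t_def left_diff_distrib right_diff_distrib distrib_left distrib_right)
 have "X * (g * t) = (g * t) * X" by (metis gX tX mult.assoc)
 then show ?case by (simp add: g_def t_def)
qed simp

lemma polar_factor_self: "a * polar_factor a n = polar_factor a n * a" by (rule polar_factor_commute) simp

lemma polar_factor_adj:
 assumes "adj a = a" shows "adj (polar_factor a n) = polar_factor a n"
proof (induction n)
 case (Suc n)
 define g where "g = polar_factor a n"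
 have ga: "a * g = g * a" unfolding g_def by (rule polar_factor_self)
 have "g * (g * a * g) = (g * a * g) * g" by (metis mult.assoc ga)
 moreover have "adj g = g" using Suc by (simp add: g_def)
 ultimately show ?case unfolding polar_factor.simps g_def[symmetric]
  by (simp add: left_diff_distrib right_diff_distrib distrib_left distrib_right mult.assoc assms)
qed simp

lemma (in star_alg) polar_factor_in: "a \<in> A ==> polar_factor a n \<in> A" by (induction n) simp_all

text \<open>With \<open>s = g * a * g\<close> one step gives \<open>s' = s * (3 - s)^2 / 4\<close>,
  and the claims are the factorisations \<open>4 * (s' - s) = s * (1 - s) * (5 - s)\<close> and
  \<open>4 * (1 - s') = (1 - s)^2 * (4 - s)\<close> into commuting positive factors.\<close>

lemma newton_pos:
 assumes s: "pos s" "pos (1 - s)"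
 defines "s' \<equiv> (1/4) *\<^sub>R (s * ((1 + 1 + 1 - s) * (1 + 1 + 1 - s)))"
 shows "pos (s' - s)" "pos (1 - s')" "pos s'"
proof -
 have p: "pos (s * (1 - s))" by (rule pos_commuting_mult) (simp_all add: s right_diff_distrib left_diff_distrib)
 have "pos (1 + 1 + 1 + 1 + (1 - s))" by (intro pos_add s(2) pos_one)
 then have "pos (s * (1 - s) * (1 + 1 + 1 + 1 + (1 - s)))"
  by (rule pos_commuting_mult[OF p]) (simp add: algebra_simps)
 moreover have "s * (1 - s) * (1 + 1 + 1 + 1 + (1 - s)) = s * ((1 + 1 + 1 - s) * (1 + 1 + 1 - s)) - (s + s + s + s)"
  by (simp add: algebra_simps)
 ultimately have "pos ((1/4) *\<^sub>R (s * ((1 + 1 + 1 - s) * (1 + 1 + 1 - s)) - (s + s + s + s)))"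
  by (intro pos_scaleR) simp_all
 moreover have four: "(1/4) *\<^sub>R (x + x + x + x) = x" for x :: "'a bop"
 proof -
  have "x + x + x + x = 4 *\<^sub>R x"
   using scaleR_add_left[of 1 1 x] scaleR_add_left[of 2 1 x] scaleR_add_left[of 3 1 x] by simp
  then show ?thesis by simp
 qed
 ultimately show 1: "pos (s' - s)" by (simp only: s'_def scaleR_diff_right four)
 have "pos (1 + 1 + 1 + (1 - s))" by (intro pos_add s(2) pos_one)
 then have "pos (adj (1 - s) * (1 + 1 + 1 + (1 - s)) * (1 - s))" by (rule pos_conj)
 moreover have "adj (1 - s) * (1 + 1 + 1 + (1 - s)) * (1 - s) = (1 + 1 + 1 + 1) - s * ((1 + 1 + 1 - s) * (1 + 1 + 1 - s))"
  by (simp add: pos_adj[OF s(1)]) (simp add: algebra_simps)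
 ultimately have "pos ((1/4) *\<^sub>R ((1 + 1 + 1 + 1) - s * ((1 + 1 + 1 - s) * (1 + 1 + 1 - s))))"
  by (intro pos_scaleR) simp_all
 then show "pos (1 - s')" by (simp only: s'_def scaleR_diff_right four)
 show "pos s'" using pos_add[OF 1 s(1)] by simp
qed

lemma polar_step:
 "polar_factor a (Suc n) * a * polar_factor a (Suc n) =
  (1/4) *\<^sub>R ((polar_factor a n * a * polar_factor a n) * ((1 + 1 + 1 - polar_factor a n * a * polar_factor a n) *
   (1 + 1 + 1 - polar_factor a n * a * polar_factor a n)))"
proof -
 define g where "g = polar_factor a n"
 define t where "t = 1 + 1 + 1 - g * a * g"
 have ga: "a * g = g * a" unfolding g_def by (rule polar_factor_self)
 have "(g * a * g) * a = a * (g * a * g)" "(g * a * g) * g = g * (g * a * g)" by (metis ga mult.assoc)+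
 then have ta: "t * a = a * t" "t * g = g * t"
  by (simp_all add: t_def left_diff_distrib right_diff_distrib distrib_left distrib_right)
 have "(g * t) * a * (g * t) = (g * a * g) * (t * t)" by (metis mult.assoc ta)
 then show ?thesis unfolding polar_factor.simps g_def[symmetric] t_def[symmetric] by simp
qed

lemma polar_contraction:
 assumes a: "pos a" "pos (1 - a)"
 shows "pos (polar_factor a n * a * polar_factor a n) \<and> pos (1 - polar_factor a n * a * polar_factor a n)"
proof (induction n)
 case (Suc n)
 then show ?case using newton_pos[of "polar_factor a n * a * polar_factor a n"] by (simp only: polar_step)
qed (use a in simp)

lemma polar_increasing:
 assumes a: "pos a" "pos (1 - a)"
 shows "pos (polar_factor a (Suc n) * a * polar_factor a (Suc n) - polar_factor a n * a * polar_factor a n)"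
 unfolding polar_step using newton_pos(1) polar_contraction[OF a] by blast

lemma polar_increasing_le:
 assumes a: "pos a" "pos (1 - a)" and "m \<le> n"
 shows "pos (polar_factor a n * a * polar_factor a n - polar_factor a m * a * polar_factor a m)"
 using assms(3) by (induction rule: dec_induct) (auto intro: pos_trans polar_increasing[OF a] simp del: polar_factor.simps)

text \<open>The cross terms in the 2-norm of \<open>y * g n - y * g m\<close>. A step from
  \<open>n\<close> to \<open>n + 1\<close> adds half of \<open>g m * a * g n * (1 - s)\<close>, a
  product of commuting positive elements.\<close>

lemma polar_mixed:
 assumes a: "pos a" "pos (1 - a)" and "m \<le> n"
 shows "pos (polar_factor a m * a * polar_factor a n) \<and>
  pos (polar_factor a m * a * polar_factor a n - polar_factor a m * a * polar_factor a m)" using assms(3)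
proof (induction rule: dec_induct)
 case base
 then show ?case using polar_contraction[OF a] by simp
next
 case (step n)
 define g where "g = polar_factor a n"
 define h where "h = polar_factor a m"
 define s where "s = g * a * g"
 have ga: "a * g = g * a" "a * h = h * a" "h * g = g * h"
  unfolding g_def h_def by (rule polar_factor_self, rule polar_factor_self, rule polar_factor_commute, rule polar_factor_self[symmetric])
 have s1: "pos (1 - s)" using polar_contraction[OF a] by (simp add: s_def g_def)
 have c: "pos (h * a * g)" using step.IH by (simp add: g_def h_def)
 have comm: "X * s = s * X" if "X * a = a * X" "X * g = g * X" for X
  unfolding s_def by (metis that mult.assoc)
 have "h * s = s * h" "a * s = s * a" "g * s = s * g" by (intro comm; simp add: ga)+
 then have "(h * a * g) * s = s * (h * a * g)" by (metis mult.assoc)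
 then have "pos ((h * a * g) * (1 - s))"
  by (intro pos_commuting_mult c s1) (simp add: left_diff_distrib right_diff_distrib)
 then have p: "pos ((1/2) *\<^sub>R ((h * a * g) * (1 - s)))" by (intro pos_scaleR) simp_all
 have "h * a * polar_factor a (Suc n) = (1/2) *\<^sub>R (h * a * g * (1 + 1 + (1 - s)))"
  by (simp add: g_def s_def mult.assoc add_diff_eq)
 also have "\<dots> = h * a * g + (1/2) *\<^sub>R ((h * a * g) * (1 - s))"
  by (simp add: distrib_left scaleR_add_right flip: scaleR_add_left)
 finally have e: "h * a * polar_factor a (Suc n) = h * a * g + (1/2) *\<^sub>R ((h * a * g) * (1 - s))" .
 have "pos (h * a * g - h * a * h)" using step.IH by (simp add: g_def h_def)
 then show ?case using pos_add[OF c p] pos_add[OF _ p, of "h * a * g - h * a * h"] e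
  by (simp only: h_def[symmetric]) (simp add: algebra_simps)
qed

context vna
begin

text \<open>The squared 2-norm distance of \<open>Y n\<close> and \<open>Y m\<close> is at most the
  increase of the bounded increasing numbers \<open>u n\<close>, so \<open>Y\<close> has a limit
  \<open>v\<close>. Passing to the limit in
  \<open>2 * Y (n+1) = 3 * Y n - Y n * adj (Y n) * Y n\<close> shows that \<open>v\<close> is a
  partial isometry.\<close>

theorem polar_decomposition:
 assumes y: "y \<in> A" "norm y \<le> 1"
 shows "\<exists>v. n2_lim (\<lambda>n. y * polar_factor (adj y * y) n) v \<and> v * adj v * v = v \<and> y * (adj v * v) = y \<and>
  pos (adj v * y)"
proof -
 define a where "a = adj y * y"
 define g where "g = polar_factor a"
 define Y where "Y n = y * g n" for n
 have aA: "a \<in> A" "adj a = a" "pos a" using y by (simp_all add: a_def pos_adj_mult)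
 have a1: "pos (1 - a)" using pos_norm_sq_diff[OF y(2)] by (simp add: a_def)
 have gA: "g n \<in> A" "adj (g n) = g n" "a * g n = g n * a" for n
  by (simp_all add: g_def polar_factor_in aA polar_factor_adj polar_factor_self)
 have YA: "Y n \<in> A" for n using y gA by (simp add: Y_def)
 have YY: "adj (Y m) * Y n = g m * a * g n" for m n by (simp add: Y_def gA a_def mult.assoc)
 have Yn: "norm (Y n) \<le> 1" for n
  by (rule norm_le_of_sq) (simp add: YY, simp add: g_def polar_contraction aA a1)
 define u where "u n = Re (tau (g n * a * g n))" for n
 have "incseq u" unfolding u_def incseq_def using polar_increasing_le[OF aA(3) a1] gA aA
  by (auto simp: g_def polar_factor_in intro!: pos_tau_mono)
 moreover have "u n \<le> 1" for n
  using pos_tau_mono[of "g n * a * g n" 1] polar_contraction[OF aA(3) a1, of n] gA aA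
  by (simp add: u_def g_def polar_factor_in tau_one)
 ultimately obtain l where "u \<longlonglongrightarrow> l" using incseq_convergent[of u 1] by metis
 then have cu: "Cauchy u" by (rule LIMSEQ_imp_Cauchy)
 have d1: "(n2 (Y n - Y m))\<^sup>2 \<le> u n - u m" if "m \<le> n" for m n
 proof -
  have mix: "Re (tau (g m * a * g m)) \<le> Re (tau (g m * a * g n))"
   using polar_mixed[OF aA(3) a1 that] gA aA by (intro pos_tau_mono) (simp_all add: g_def polar_factor_in)
  have "tau (g n * a * g m) = cnj (tau (g m * a * g n))"
   using tau_adj[of "g m * a * g n"] gA aA by (simp add: mult.assoc)
  then have s: "Re (tau (g n * a * g m)) = Re (tau (g m * a * g n))" by simp
  have "(n2 (Y n - Y m))\<^sup>2 = Re (tau (g n * a * g n - g n * a * g m - (g m * a * g n - g m * a * g m)))"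
   using YA by (simp add: n2_sq right_diff_distrib left_diff_distrib YY)
    (simp add: tau_simps gA aA)
  also have "\<dots> = u n - 2 * Re (tau (g m * a * g n)) + u m" using s by (simp add: u_def tau_simps gA aA)
  also have "\<dots> \<le> u n - u m" using mix by (simp add: u_def)
  finally show ?thesis .
 qed
 have "n2_Cauchy Y" unfolding n2_Cauchy_def
 proof (intro allI impI)
  fix e :: real assume e: "e > 0"
  then have "e\<^sup>2 > 0" by simp
  then obtain M where M: "\<And>m n. m \<ge> M ==> n \<ge> M ==> norm (u m - u n) < e\<^sup>2"
   using CauchyD[OF cu, of "e\<^sup>2"] by blast
  have *: "n2 (Y m - Y n) < e" if "M \<le> n" "n \<le> m" for m n
  proof (rule power2_less_imp_less)
   show "(n2 (Y m - Y n))\<^sup>2 < e\<^sup>2" using d1[OF that(2)] M[of m n] that by simp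
  qed (use e in simp)
  have "n2 (Y m - Y n) < e" if "M \<le> n" "M \<le> m" for m n
  proof (cases "n \<le> m")
   case False
   then show ?thesis using *[of m n] that n2_diff_commute[OF YA YA, of m n] by simp
  qed (use * that in simp)
  then show "\<exists>M. \<forall>m\<ge>M. \<forall>n\<ge>M. n2 (Y m - Y n) < e" by blast
 qed
 then obtain v where v: "n2_lim Y v" using n2_Cauchy_lim[of Y 1] YA Yn by blast
 have v1: "v * adj v * v = v"
 proof -
  have l1: "n2_lim (\<lambda>n. (1 + 1) *\<^sub>R Y (Suc n)) ((1 + 1) *\<^sub>R v)"
   by (rule n2_lim_scaleR[OF n2_lim_Suc[OF v]])
  have l2: "(\<lambda>n. (1 + 1) *\<^sub>R Y (Suc n)) = (\<lambda>n. Y n + Y n + Y n - Y n * adj (Y n) * Y n)"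
  proof
   fix n
   have "Y n * adj (Y n) * Y n = Y n * (g n * a * g n)" by (simp only: mult.assoc YY)
   then show "(1 + 1) *\<^sub>R Y (Suc n) = Y n + Y n + Y n - Y n * adj (Y n) * Y n"
    by (simp add: Y_def g_def distrib_left right_diff_distrib mult.assoc)
  qed
  have l3: "n2_lim (\<lambda>n. Y n + Y n + Y n - Y n * adj (Y n) * Y n) (v + v + v - v * adj v * v)"
   by (rule n2_lim_diff[OF n2_lim_add[OF n2_lim_add[OF v v] v] n2_lim_mult[OF n2_lim_mult[OF v n2_lim_adj[OF v]] v]])
  have "(1 + 1) *\<^sub>R v = v + v + v - v * adj v * v" using n2_lim_unique[OF l1[unfolded l2] l3] .
  then have "v + v = v + v + v - v * adj v * v" by (simp only: scaleR_add_left scaleR_one)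
  then have "v * adj v * v + (v + v) = v + (v + v)" by (metis add.assoc add.commute diff_add_cancel)
  then show ?thesis by (rule add_right_imp_eq)
 qed
 define e where "e = adj v * v"
 have vA: "v \<in> A" using v by (rule n2_limD)
 have ee: "e * e = e" "adj e = e" "e \<in> A" using v1 vA by (simp_all add: e_def mult.assoc)
 have "n2 (y * (1 - e)) = 0"
 proof -
  have "n2_lim (\<lambda>n. Y n * (1 - e)) (v * (1 - e))"
   by (rule n2_lim_mult[OF v n2_lim_const]) (simp add: ee)
  moreover have "v * (1 - e) = 0" using v1 by (simp add: e_def right_diff_distrib mult.assoc)
  ultimately have "n2_lim (\<lambda>n. Y n * (1 - e)) 0" by (simp only:)
  then have lim: "(\<lambda>n. n2 (Y n * (1 - e))) \<longlonglongrightarrow> 0" using n2_limD(4)[of "\<lambda>n. Y n * (1 - e)" 0] by (simp only: diff_zero)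
  \<comment> \<open>The squares \<open>adj (Y n) * Y n\<close> increase from
    \<open>adj y * y\<close>, so \<open>y * (1 - e)\<close> is at most as long as
    \<open>Y n * (1 - e)\<close>, which tends to \<open>v * (1 - e) = 0\<close>.\<close>
  have le: "n2 (y * (1 - e)) \<le> n2 (Y n * (1 - e))" for n
  proof (rule power2_le_imp_le)
   define f where "f = 1 - e"
   have fA: "f \<in> A" by (simp add: f_def ee)
   have "pos (adj f * (g n * a * g n - a) * f)"
    using polar_increasing_le[OF aA(3) a1, of 0 n] by (intro pos_conj) (simp add: g_def)
   then have "pos (adj f * (g n * a * g n) * f - adj f * a * f)"
    by (simp only: right_diff_distrib left_diff_distrib)
   then have "Re (tau (adj f * a * f)) \<le> Re (tau (adj f * (g n * a * g n) * f))"
    using gA aA fA by (intro pos_tau_mono) simp_all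
   moreover have "adj (Y n * f) * (Y n * f) = adj f * (adj (Y n) * Y n) * f"
    by (simp only: adj_mult mult.assoc)
   moreover have "adj (y * f) * (y * f) = adj f * a * f" by (simp only: adj_mult mult.assoc a_def)
   ultimately have "(n2 (y * f))\<^sup>2 \<le> (n2 (Y n * f))\<^sup>2"
    using y YA fA by (simp only: n2_sq mult_in YY)
   then show "(n2 (y * (1 - e)))\<^sup>2 \<le> (n2 (Y n * (1 - e)))\<^sup>2" by (simp only: f_def)
  qed (simp add: YA ee)
  have "n2 (y * (1 - e)) \<le> 0" by (rule LIMSEQ_le_const[OF lim]) (use le in blast)
  then show ?thesis using y ee by (intro order_antisym) simp_all
 qed
 then have ye: "y * e = y" using n2_eq_0[of "y * (1 - e)"] y ee by (simp add: right_diff_distrib)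
 have "pos (adj v * y)"
 proof (rule n2_lim_pos)
  show "n2_lim (\<lambda>n. adj (Y n) * y) (adj v * y)" by (rule n2_lim_mult[OF n2_lim_adj[OF v] n2_lim_const[OF y(1)]])
  fix n
  have "adj (Y n) * y = g 0 * a * g n" using YY[of n 0] gA(3)[of n] by (simp add: Y_def g_def)
  then show "pos (adj (Y n) * y)" using polar_mixed[OF aA(3) a1, of 0 n] by (simp add: g_def)
 qed
 then show ?thesis using v v1 ye unfolding Y_def g_def a_def e_def by blast
qed

text \<open>Closure under bounded 2-norm limits is what keeps polar parts inside
  \<open>B\<close>.\<close>

definition subalg :: "'h bop set => bool" where
 "subalg B \<longleftrightarrow> star_alg B \<and> B \<subseteq> A \<and> (\<forall>X T. (\<forall>n. X n \<in> B) --> n2_lim X T --> T \<in> B)"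

lemma subalg_self: "subalg A" using star_alg_axioms by (auto simp: subalg_def n2_lim_def)

text \<open>Rescaling \<open>y\<close> into the unit ball does not change its polar part. The extra
  clauses hold for every term of the iteration and pass to the limit: they replace statements about
  supports and about functional calculus.\<close>

lemma subalg_polar:
 assumes B: "subalg B" and y: "y \<in> B"
 shows "\<exists>v\<in>B. v * adj v * v = v \<and> y * (adj v * v) = y \<and> pos (adj v * y) \<and>
  (\<forall>p\<in>A. p * y = y --> p * v = v) \<and> (\<forall>p\<in>A. y * p = y --> v * p = v) \<and> (adj y = y --> adj v = v)"
proof -
 interpret B: star_alg B using B by (simp add: subalg_def)
 define s where "s = inverse (norm y + 1)"
 have s: "s > 0" by (simp add: s_def add_nonneg_pos)
 define z where "z = s *\<^sub>R y"
 have zy: "y = (1/s) *\<^sub>R z" using s by (simp add: z_def)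
 have zB: "z \<in> B" "z \<in> A" using y B by (auto simp: z_def subalg_def)
 have "norm y * s \<le> 1" by (simp add: s_def field_simps divide_le_eq_1 add_pos_nonneg)
 then have "norm z \<le> 1" using s by (simp add: z_def mult.commute)
 then obtain v where v: "n2_lim (\<lambda>n. z * polar_factor (adj z * z) n) v" "v * adj v * v = v"
   "z * (adj v * v) = z" "pos (adj v * z)" using polar_decomposition[OF zB(2)] by blast
 define Y where "Y n = z * polar_factor (adj z * z) n" for n
 have vY: "n2_lim Y v" unfolding Y_def by (rule v(1))
 have "Y n \<in> B" for n using zB by (simp add: Y_def B.polar_factor_in)
 then have vB: "v \<in> B" using B vY by (auto simp: subalg_def)
 have 1: "p * v = v" if p: "p \<in> A" "p * y = y" for p
 proof (rule n2_lim_unique[OF _ vY])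
  have "p * z = z" by (simp add: z_def p)
  then have e: "(\<lambda>n. p * Y n) = Y" by (simp add: Y_def fun_eq_iff flip: mult.assoc)
  show "n2_lim Y (p * v)" by (rule n2_lim_mult[OF n2_lim_const[OF p(1)] vY, unfolded e])
 qed
 have 2: "v * p = v" if p: "p \<in> A" "y * p = y" for p
 proof -
  have zp: "z * p = z" by (simp add: z_def p)
  define q where "q = adj z * z"
  have "adj p * adj z = adj z" using arg_cong[OF zp, of adj] by simp
  then have 3: "adj p * q = q" by (simp add: q_def flip: mult.assoc)
  have qp: "q * p = q" by (simp add: q_def mult.assoc zp)
  have "z * polar_factor q n * p = z * polar_factor q n" for n
  proof (induction n)
   case (Suc n)
   have "z * (polar_factor q n * (polar_factor q n * q * polar_factor q n)) = z * polar_factor q n * polar_factor q n * polar_factor q n * q"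
    by (simp add: mult.assoc polar_factor_self)
   then have "z * (polar_factor q n * (polar_factor q n * q * polar_factor q n)) * p = z * (polar_factor q n * (polar_factor q n * q * polar_factor q n))"
    by (simp add: mult.assoc qp)
   then show ?case using Suc by (simp add: left_diff_distrib right_diff_distrib distrib_left distrib_right mult.assoc)
  qed (simp add: zp)
  then have e: "(\<lambda>n. Y n * p) = Y" by (simp add: Y_def q_def fun_eq_iff)
  show ?thesis by (rule n2_lim_unique[OF n2_lim_mult[OF vY n2_lim_const[OF p(1)], unfolded e] vY])
 qed
 have 3: "adj v = v" if "adj y = y"
 proof (rule n2_lim_unique[OF _ vY])
  have z: "adj z = z" by (simp add: z_def that)
  have "z * polar_factor (z * z) n = polar_factor (z * z) n * z" for n
   by (rule polar_factor_commute) (simp add: mult.assoc)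
  then have e: "(\<lambda>n. adj (Y n)) = Y" by (simp add: Y_def fun_eq_iff z polar_factor_adj)
  show "n2_lim Y (adj v)" by (rule n2_lim_adj[OF vY, unfolded e])
 qed
 have "y * (adj v * v) = y" using v(3) by (simp add: zy)
 moreover have "pos (adj v * y)" using pos_scaleR[OF _ v(4), of "1/s"] s by (simp add: zy)
 ultimately show ?thesis using vB v(2) 1 2 3 by blast
qed

end

section \<open>Minimal projections\<close>

context vna
begin

definition minproj :: "'h bop set => 'h bop => bool" where
 "minproj B q \<longleftrightarrow> proj q \<and> q \<in> B \<and> q \<noteq> 0 \<and> (\<forall>p\<in>B. proj p --> q * p = p --> p = 0 \<or> p = q)"

lemma subalgD: "subalg B ==> star_alg B" "subalg B ==> B \<subseteq> A" by (simp_all add: subalg_def)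

text \<open>Subtract the right multiple of \<open>q\<close> to get \<open>k\<close> of trace 0. With
  the sign \<open>v\<close> of \<open>k\<close> and its support \<open>e = v * v\<close>, the
  projection \<open>p = (e + v) / 2\<close> supports the positive part of \<open>k\<close>.
  Minimality leaves \<open>p = 0\<close> or \<open>p = q\<close>, so \<open>- k\<close> or
  \<open>k\<close> is positive, and trace 0 makes it vanish.\<close>

lemma minproj_selfadjoint:
 assumes B: "subalg B" and q: "minproj B q" and x: "x \<in> B" "adj x = x" "q * x = x" "x * q = x"
 shows "x = csc (tau x / tau q) q"
proof -
 interpret B: star_alg B using B by (rule subalgD)
 have BA: "b \<in> A" if "b \<in> B" for b using subalgD(2)[OF B] that by blast
 have qp: "proj q" "q \<in> B" "q \<noteq> 0" using q by (auto simp: minproj_def)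
 note qA = projD[OF qp(1)]
 define s where "s = Re (tau x) / Re (tau q)"
 have tq: "Re (tau q) > 0" "Im (tau q) = 0" using proj_tau_pos[OF qp(1,3)] proj_tau[OF qp(1)] by simp_all
 have tx: "Im (tau x) = 0" using tau_adj[OF BA[OF x(1)]] x(2) by (simp add: complex_eq_iff)
 have sc: "tau x / tau q = complex_of_real s"
  using tq tx by (simp add: s_def complex_eq_iff Re_divide Im_divide power2_eq_square)
 define k where "k = x - s *\<^sub>R q"
 have k: "k \<in> B" "adj k = k" "q * k = k" "k * q = k"
  using x qp qA by (simp_all add: k_def right_diff_distrib left_diff_distrib)
 obtain v where v: "v \<in> B" "v * adj v * v = v" "k * (adj v * v) = k" "pos (adj v * k)"
   "q * v = v" "v * q = v" "adj v = v" using subalg_polar[OF B k(1)] k qA(1) by blast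
 define e where "e = v * v"
 have vv: "v * v * v = v" using v(2,7) by simp
 have ve: "v * e = v" "e * v = v" using vv by (simp_all add: e_def mult.assoc)
 have ee: "e * e = e" "adj e = e" using ve by (simp_all add: e_def v(7) mult.assoc)
 have ke: "k * e = k" using v(3,7) by (simp add: e_def)
 have ek: "e * k = k" using arg_cong[OF ke, of adj] by (simp add: ee k)
 have qe: "q * e = e" using v(5) by (simp add: e_def flip: mult.assoc)
 define p where "p = (1/2) *\<^sub>R (e + v)"
 have pp: "proj p"
 proof -
  have "(e + v) * (e + v) = (e + v) + (e + v)" using ve ee(1) by (simp add: distrib_left distrib_right e_def[symmetric])
  then have "p * p = (1/2) *\<^sub>R ((1/2) *\<^sub>R ((e + v) + (e + v)))" by (simp add: p_def)
  also have "(1/2) *\<^sub>R ((e + v) + (e + v)) = e + v" by (simp only: scaleR_half_double)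
  finally have "p * p = p" by (simp add: p_def)
  then show ?thesis using v(1,7) BA ee(2) by (simp add: proj_def p_def e_def)
 qed
 have "p \<in> B" "q * p = p" using v qe by (simp_all add: p_def e_def distrib_left)
 then have "p = 0 \<or> p = q" using q pp by (auto simp: minproj_def)
 then have "pos k \<or> pos (- k)"
 proof
  assume "p = 0"
  then have "v = - e" by (simp add: p_def) (simp add: eq_neg_iff_add_eq_0 add.commute)
  then have "adj v * k = - k" using ek v(7) ee(2) by simp
  then show ?thesis using v(4) by simp
 next
  assume "p = q"
  then have e2: "e + v = q + q" using scaleR_half_double[of q] by (simp add: p_def) (metis scaleR_2 scaleR_half_double scaleR_cancel_left zero_neq_numeral scaleR_right_imp_eq scaleR_add_right)
  have ep: "proj e" using ee v(1) BA by (simp add: proj_def e_def)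
  have "v - q = q - e" using e2 by (simp add: algebra_simps)
  moreover have "q * e = e" by (rule qe)
  have "(q - e) * (q - e) = q - e"
  proof -
   have "e * q = e" using arg_cong[OF qe, of adj] ee qA by simp
   then show ?thesis using qe ee qA by (simp add: left_diff_distrib right_diff_distrib)
  qed
  have "v * e = (q + q - e) * e" using e2 by (metis add_diff_cancel_left')
  then have "v = e" using ve qe ee by (simp add: left_diff_distrib distrib_right)
  then have "adj v * k = k" using ek ee(2) by simp
  then show ?thesis using v(4) by simp
 qed
 moreover have "Re (tau k) = 0" using tq BA x qp by (simp add: k_def tau_simps s_def)
 ultimately have "k = 0" using pos_tau_zero[of k] pos_tau_zero[of "- k"] BA[OF k(1)] by (auto simp: tau_minus)
 then show ?thesis unfolding sc by (simp add: k_def csc_of_real)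
qed

lemma minproj_scalar:
 assumes B: "subalg B" and q: "minproj B q" and x: "x \<in> B" "q * x = x" "x * q = x"
 shows "\<exists>c. x = csc c q"
proof -
 interpret B: star_alg B using B by (rule subalgD)
 have qq: "adj q = q" using q by (simp add: minproj_def projD)
 have xs: "q * adj x = adj x" "adj x * q = adj x"
  using arg_cong[OF x(3), of adj] arg_cong[OF x(2), of adj] qq by simp_all
 obtain a where a: "x + adj x = csc a q"
  using minproj_selfadjoint[OF B q, of "x + adj x"] x xs by (simp add: distrib_left distrib_right add.commute)
 have "csc \<i> (x - adj x) = csc (tau (csc \<i> (x - adj x)) / tau q) q"
  by (rule minproj_selfadjoint[OF B q])
   (simp_all add: x xs right_diff_distrib left_diff_distrib csc_diff_right csc_minus)
 then obtain b where "csc \<i> (x - adj x) = csc b q" by blast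
 then have "csc (- \<i>) (csc \<i> (x - adj x)) = csc (- \<i>) (csc b q)" by (simp only:)
 then have b: "x - adj x = csc (- \<i> * b) q" by simp
 have "x + x = (x + adj x) + (x - adj x)" by simp
 then have "x + x = csc (a + - \<i> * b) q" unfolding a b csc_add_left .
 then have "csc (1/2) (x + x) = csc (1/2 * (a + - \<i> * b)) q" by (simp only: csc_csc)
 moreover have "csc (1/2) (x + x) = x" by (simp add: csc_add_right flip: csc_add_left)
 ultimately show ?thesis by metis
qed

text \<open>For \<open>w = p * x * q\<close> both \<open>adj w * w\<close> and
  \<open>w * adj w\<close> are scalar multiples of the minimal projections; normalising
  \<open>w\<close> by the scalar gives the partial isometry.\<close>

lemma minproj_pair:
 assumes B: "subalg B" and p: "minproj B p" and q: "minproj B q"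
  and x: "x \<in> B" "p * x * q \<noteq> 0"
 shows "\<exists>v\<in>B. adj v * v = q \<and> v * adj v = p"
proof -
 interpret B: star_alg B using B by (rule subalgD)
 have BA: "b \<in> A" if "b \<in> B" for b using subalgD(2)[OF B] that by blast
 have pp: "proj p" "p \<in> B" and qp: "proj q" "q \<in> B" "q \<noteq> 0" using p q by (auto simp: minproj_def)
 define w where "w = p * x * q"
 have wB: "w \<in> B" "w \<noteq> 0" using x pp qp by (simp_all add: w_def)
 have pw: "p * w = w" "w * q = w" using projD(3)[OF pp(1)] projD(3)[OF qp(1)]
  by (simp_all add: w_def mult.assoc) (simp add: mult.assoc[symmetric])
 have wp: "adj w * p = adj w" "q * adj w = adj w"
  using arg_cong[OF pw(1), of adj] arg_cong[OF pw(2), of adj] projD(2)[OF pp(1)] projD(2)[OF qp(1)] by simp_all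
 have qw: "q * (adj w * w) = adj w * w" "adj w * w * q = adj w * w"
  using wp(2) pw(2) by (simp_all add: mult.assoc flip: mult.assoc[of q "adj w" w])
 obtain c where c: "adj w * w = csc c q" using minproj_scalar[OF B q _ qw] wB by auto
 have n2w: "n2 w > 0" using n2_eq_0[of w] n2_nonneg[of w] wB BA by fastforce
 have tq: "Re (tau q) > 0" "Im (tau q) = 0" using proj_tau_pos[OF qp(1,3)] proj_tau[OF qp(1)] by simp_all
 have "complex_of_real ((n2 w)\<^sup>2) = c * tau q" using tau_adj_self[of w] wB BA qp c by (simp add: tau_csc)
 then have "c = complex_of_real ((n2 w)\<^sup>2) / tau q" using tq by auto
 then have cr: "c = complex_of_real ((n2 w)\<^sup>2 / Re (tau q))"
  using tq by (simp add: complex_eq_iff Re_divide Im_divide power2_eq_square)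
 define d where "d = (n2 w)\<^sup>2 / Re (tau q)"
 have d: "d > 0" using n2w tq by (simp add: d_def)
 define v where "v = (1 / sqrt d) *\<^sub>R w"
 have dq: "adj w * w = d *\<^sub>R q" by (simp only: c cr d_def csc_of_real)
 have "adj v * v = (1 / sqrt d * (1 / sqrt d)) *\<^sub>R (d *\<^sub>R q)"
  by (simp only: dq[symmetric]) (simp add: v_def)
 also have "\<dots> = q" using d by (simp add: real_sqrt_mult_self flip: real_sqrt_mult)
 finally have vv: "adj v * v = q" .
 have vB: "v \<in> B" using wB by (simp add: v_def)
 have pv: "p * (v * adj v) = v * adj v" "v * adj v * p = v * adj v"
  using pw(1) wp(1) by (simp_all add: v_def mult.assoc) (simp add: mult.assoc[symmetric])
 obtain b where b: "v * adj v = csc b p" using minproj_scalar[OF B p _ pv] vB by auto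
 have vq: "v * q = v" using pw(2) by (simp add: v_def)
 have "(v * adj v) * (v * adj v) = v * (adj v * v) * adj v" by (simp only: mult.assoc)
 also have "\<dots> = v * adj v" by (simp only: vv vq)
 finally have bb: "csc (b * b) p = csc b p" using projD(3)[OF pp(1)] by (simp add: b)
 have p0: "p \<noteq> 0" using p by (simp add: minproj_def)
 have "csc (b * b - b) p = 0" using bb by (simp add: csc_diff_left)
 then have "norm (csc (b * b - b) p) = 0" by (simp only: norm_zero)
 then have "b * b = b" using p0 by simp
 moreover have "b \<noteq> 0"
 proof
  assume "b = 0"
  then have "v * adj v = 0" using b by simp
  then have "adj v * (v * adj v) * v = 0" by simp
  then have "(adj v * v) * (adj v * v) = 0" by (simp only: mult.assoc)
  then show False using vv projD(3)[OF qp(1)] qp(3) by simp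
 qed
 ultimately have "b = 1" by simp
 then show ?thesis using vB vv b by auto
qed

definition orth_family :: "'h bop set => nat => (nat => 'h bop) => bool" where
 "orth_family B n q \<longleftrightarrow> (\<forall>i<n. proj (q i) \<and> q i \<in> B \<and> q i \<noteq> 0) \<and> (\<forall>i<n. \<forall>j<n. i \<noteq> j --> q i * q j = 0)"

lemma orth_family_sum:
 assumes "orth_family B n q"
 shows "proj (\<Sum>i<n. q i)" "\<And>j. j < n ==> (\<Sum>i<n. q i) * q j = q j" "\<And>j. j < n ==> q j * (\<Sum>i<n. q i) = q j"
proof -
 have 1: "(\<Sum>i<n. q i) * q j = q j" if "j < n" for j
 proof -
  have "(\<Sum>i<n. q i) * q j = (\<Sum>i<n. if i = j then q j else 0)"
   unfolding sum_distrib_right using assms that by (intro sum.cong) (auto simp: orth_family_def projD)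
  then show ?thesis using that by simp
 qed
 then show "\<And>j. j < n ==> (\<Sum>i<n. q i) * q j = q j" .
 have a: "adj (\<Sum>i<n. q i) = (\<Sum>i<n. q i)"
  unfolding adj_sum using assms by (intro sum.cong) (auto simp: orth_family_def projD)
 show "\<And>j. j < n ==> q j * (\<Sum>i<n. q i) = q j"
 proof -
  fix j assume j: "j < n"
  have "adj ((\<Sum>i<n. q i) * q j) = adj (q j)" using 1[OF j] by simp
  moreover have "adj (q j) = q j" using assms j by (simp add: orth_family_def projD)
  ultimately show "q j * (\<Sum>i<n. q i) = q j" by (simp only: adj_mult a)
 qed
 have "(\<Sum>i<n. q i) * (\<Sum>i<n. q i) = (\<Sum>i<n. q i)"
  unfolding sum_distrib_left by (intro sum.cong) (simp_all add: 1)
 moreover have "(\<Sum>i<n. q i) \<in> A" using assms by (intro sum_in) (simp add: orth_family_def projD)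
 ultimately show "proj (\<Sum>i<n. q i)" using a by (simp add: proj_def)
qed

text \<open>In a family of largest size nothing can be left over and nothing can be split: a nonzero
  \<open>1 - S\<close>, or a proper part \<open>p\<close> of some \<open>q i\<close> together with
  \<open>q i - p\<close>, would give a longer family.\<close>

lemma maximal_orth_family:
 assumes B: "subalg B" and bd: "\<And>n q. orth_family B n q ==> n \<le> N"
 shows "\<exists>n q. orth_family B n q \<and> (\<Sum>i<n. q i) = 1 \<and> (\<forall>i<n. minproj B (q i))"
proof -
 interpret B: star_alg B using B by (rule subalgD)
 define P where "P n \<longleftrightarrow> (\<exists>q. orth_family B n q)" for n
 have P0: "P 0" by (simp add: P_def orth_family_def)
 define n where "n = (GREATEST n. P n)"
 have "P n" unfolding n_def by (rule GreatestI_nat[of P 0 N]) (use P0 bd in \<open>auto simp: P_def\<close>)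
 then obtain q where q: "orth_family B n q" by (auto simp: P_def)
 have "\<not> P (Suc n)"
 proof
  assume "P (Suc n)"
  then have "Suc n \<le> n" unfolding n_def by (rule Greatest_le_nat[of P _ N]) (use bd in \<open>auto simp: P_def\<close>)
  then show False by simp
 qed
 then have max: "\<not> orth_family B (Suc n) q'" for q' by (auto simp: P_def)
 note s = orth_family_sum[OF q]
 have qi: "proj (q i)" "q i \<in> B" "q i \<noteq> 0" if "i < n" for i using q that by (auto simp: orth_family_def)
 have qij: "q i * q j = 0" if "i < n" "j < n" "i \<noteq> j" for i j using q that by (auto simp: orth_family_def)
 define S where "S = (\<Sum>i<n. q i)"
 have SB: "S \<in> B" unfolding S_def using qi by (intro B.sum_in) simp
 have "1 - S = 0"
 proof (rule ccontr)
  assume ne: "1 - S \<noteq> 0"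
  have "orth_family B (Suc n) (q(n := 1 - S))" unfolding orth_family_def
  proof (intro conjI allI impI)
   fix i j assume ij: "i < Suc n" "j < Suc n" "i \<noteq> j"
   have *: "(1 - S) * q j = 0" "q j * (1 - S) = 0" if "j < n" for j
    using s(2,3)[OF that] by (simp_all add: S_def left_diff_distrib right_diff_distrib)
   show "(q(n := 1 - S)) i * (q(n := 1 - S)) j = 0" using ij * qij by (auto simp: less_Suc_eq)
  next
   fix i assume "i < Suc n"
   then show "proj ((q(n := 1 - S)) i) " "(q(n := 1 - S)) i \<in> B" "(q(n := 1 - S)) i \<noteq> 0"
    using qi ne proj_compl[OF s(1)] SB by (auto simp: less_Suc_eq S_def)
  qed
  then show False using max by blast
 qed
 then have S1: "(\<Sum>i<n. q i) = 1" by (simp add: S_def)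
 have "minproj B (q i)" if i: "i < n" for i unfolding minproj_def
 proof (intro conjI ballI impI qi i)
  fix p assume p: "p \<in> B" "proj p" "q i * p = p"
  show "p = 0 \<or> p = q i"
  proof (rule ccontr)
   assume ne: "\<not> (p = 0 \<or> p = q i)"
   have pq: "p * q i = p" using arg_cong[OF p(3), of adj] p(2) qi(1)[OF i] by (simp add: projD)
   have pj: "p * q j = 0" "q j * p = 0" if "j < n" "j \<noteq> i" for j
   proof -
    have "p * q j = p * (q i * q j)" "q j * p = (q j * q i) * p" using p(3) pq by (simp_all add: mult.assoc flip: mult.assoc[of p "q i"])
    then show "p * q j = 0" "q j * p = 0" using qij[of i j] qij[of j i] i that by simp_all
   qed
   have r: "proj (q i - p)" using p pq qi[OF i] by (simp add: proj_def left_diff_distrib right_diff_distrib)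
   have "orth_family B (Suc n) (q(i := p, n := q i - p))" unfolding orth_family_def
   proof (intro conjI allI impI)
    fix a b assume ab: "a < Suc n" "b < Suc n" "a \<noteq> b"
    have e: "p * (q i - p) = 0" "(q i - p) * p = 0" using p pq by (simp_all add: right_diff_distrib left_diff_distrib projD)
    have e2: "q j * (q i - p) = 0" "(q i - p) * q j = 0" if "j < n" "j \<noteq> i" for j
     using pj[OF that] qij[of j i] qij[of i j] that i by (simp_all add: right_diff_distrib left_diff_distrib)
    show "(q(i := p, n := q i - p)) a * (q(i := p, n := q i - p)) b = 0"
     using ab i e e2 pj qij by (auto simp: less_Suc_eq)
   next
    fix a assume "a < Suc n"
    then show "proj ((q(i := p, n := q i - p)) a)" "(q(i := p, n := q i - p)) a \<in> B" "(q(i := p, n := q i - p)) a \<noteq> 0"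
     using qi p ne r i by (auto simp: less_Suc_eq)
   qed
   then show False using max by blast
  qed
 qed
 then show ?thesis using q S1 by blast
qed

text \<open>Matrix units: \<open>q\<^sub>i\<close> are minimal projections, \<open>c i\<close> is the representative of the class of \<open>q\<^sub>i\<close>
 and \<open>v\<^sub>i\<close> is a partial isometry from \<open>q\<^bsub>c i\<^esub>\<close> to \<open>q\<^sub>i\<close>.\<close>

theorem matrix_units:
 assumes B: "subalg B" and bd: "\<And>n q. orth_family B n q ==> n \<le> N"
 shows "\<exists>n q c v. orth_family B n q \<and> (\<Sum>i<n. q i) = 1 \<and>
  (\<forall>i<n. c i < n \<and> v i \<in> B \<and> adj (v i) * v i = q (c i) \<and> v i * adj (v i) = q i) \<and>
  (\<forall>x\<in>B. \<exists>l. x = (\<Sum>i<n. \<Sum>j<n. if c i = c j then csc (l i j) (v i * adj (v j)) else 0))"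
proof -
 interpret B: star_alg B using B by (rule subalgD)
 obtain n q where q: "orth_family B n q" "(\<Sum>i<n. q i) = 1" and mp: "\<And>i. i < n ==> minproj B (q i)"
 proof -
  have "\<exists>n q. orth_family B n q \<and> (\<Sum>i<n. q i) = 1 \<and> (\<forall>i<n. minproj B (q i))"
   by (rule maximal_orth_family[OF B]) (rule bd)
  then show ?thesis using that by blast
 qed
 have qi: "proj (q i)" "q i \<in> B" "q i \<noteq> 0" if "i < n" for i using q that by (auto simp: orth_family_def)
 have qq: "q i * q i = q i" "adj (q i) = q i" if "i < n" for i using projD[OF qi(1)[OF that]] by auto
 \<comment> \<open>Murray--von Neumann equivalence inside \<open>B\<close>. By
   \<open>minproj_pair\<close> a nonzero block \<open>q i * x * q j\<close> forces it, so blocks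
   between inequivalent projections vanish.\<close>
 define R where "R i j \<longleftrightarrow> (\<exists>v\<in>B. adj v * v = q j \<and> v * adj v = q i)" for i j
 have pisom: "v * q j = v" if "adj v * v = q j" "j < n" for v j
 proof -
  have "(v - v * q j) = 0"
  proof -
   have "adj (v - v * q j) * (v - v * q j) = adj v * v - adj v * v * q j - (q j * (adj v * v) - q j * (adj v * v) * q j)"
    by (simp add: left_diff_distrib right_diff_distrib mult.assoc qq[OF that(2)])
   also have "\<dots> = 0" by (simp add: that(1) qq[OF that(2)])
   finally have "adj (v - v * q j) * (v - v * q j) = 0" .
   then have "norm (ap (v - v * q j) x) = 0" for x using norm_ap_square[of "v - v * q j" x] by simp
   then show ?thesis by (intro bop_eqI) simp
  qed
  then show ?thesis by simp
 qed
 have Rsym: "R j i" if "R i j" for i j using that unfolding R_def by (metis B.adj_in adj_adj)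
 have Rtrans: "R i k" if r: "R i j" "R j k" "i < n" "j < n" "k < n" for i j k
 proof -
  obtain v w where v: "v \<in> B" "adj v * v = q j" "v * adj v = q i" and w: "w \<in> B" "adj w * w = q k" "w * adj w = q j"
   using r(1,2) by (auto simp: R_def)
  have vq: "v * q j = v" by (rule pisom[OF v(2) that(4)])
  have wk: "w * q k = w" by (rule pisom[OF w(2) that(5)])
  have qw: "q j * w = w"
  proof -
   have "q j * w = w * (adj w * w)" by (simp add: w(3)[symmetric] mult.assoc)
   then show ?thesis by (simp only: w(2) wk)
  qed
  have "adj (v * w) * (v * w) = adj w * ((adj v * v) * w)" by (simp add: mult.assoc)
  then have 1: "adj (v * w) * (v * w) = q k" by (simp only: v(2) qw w(2))
  have "(v * w) * adj (v * w) = v * (w * adj w) * adj v" by (simp add: mult.assoc)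
  then have 2: "(v * w) * adj (v * w) = q i" by (simp only: w(3) vq v(3))
  show ?thesis unfolding R_def using 1 2 v(1) w(1) B.mult_in by blast
 qed
 have Rrefl: "R i i" if "i < n" for i
  unfolding R_def using qi(2)[OF that] qq[OF that] by (intro bexI[of _ "q i"]) simp_all
 \<comment> \<open>The least index picks the same representative for the whole class, so
   \<open>c i = c j\<close> expresses equivalence.\<close>
 define c where "c i = (LEAST j. j < n \<and> R i j)" for i
 have c: "c i < n" "R i (c i)" if "i < n" for i
  using LeastI[of "\<lambda>j. j < n \<and> R i j" i] that Rrefl by (auto simp: c_def)
 have ceq: "c i = c j" if "R i j" "i < n" "j < n" for i j
 proof -
  have "(k < n \<and> R i k) = (k < n \<and> R j k)" for k
   using Rtrans[of j i k] Rtrans[of i j k] Rsym that by blast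
  then show ?thesis by (simp add: c_def)
 qed
 have "\<forall>i. \<exists>v. i < n --> v \<in> B \<and> adj v * v = q (c i) \<and> v * adj v = q i"
  using c(2) unfolding R_def by blast
 then obtain v where v: "\<And>i. i < n ==> v i \<in> B \<and> adj (v i) * v i = q (c i) \<and> v i * adj (v i) = q i"
  by metis
 have "\<exists>l. x = (\<Sum>i<n. \<Sum>j<n. if c i = c j then csc (l i j) (v i * adj (v j)) else 0)" if x: "x \<in> B" for x
 proof -
  have "\<exists>l. q i * x * q j = (if c i = c j then csc l (v i * adj (v j)) else 0)" if ij: "i < n" "j < n" for i j
  proof (cases "c i = c j")
   case False
   have "q i * x * q j = 0"
   proof (rule ccontr)
    assume "q i * x * q j \<noteq> 0"
    then have "R i j" unfolding R_def using minproj_pair[OF B mp mp x] ij by blast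
    then show False using ceq ij False by blast
   qed
   then show ?thesis using False by simp
  next
   case True
   define y where "y = adj (v i) * x * v j"
   have yB: "y \<in> B" using v ij x by (simp add: y_def)
   have vq: "v i * q (c i) = v i" "v j * q (c i) = v j"
    using pisom[of "v i" "c i"] pisom[of "v j" "c j"] v ij c True by auto
   have qv: "q (c i) * adj (v i) = adj (v i)"
    using arg_cong[OF vq(1), of adj] qq(2)[OF c(1)[OF ij(1)]] by simp
   have "y * q (c i) = y" unfolding y_def by (simp only: mult.assoc vq)
   moreover have "q (c i) * y = y" unfolding y_def by (simp only: qv flip: mult.assoc)
   ultimately obtain l where l: "y = csc l (q (c i))" using minproj_scalar[OF B mp[OF c(1)[OF ij(1)]] yB] by blast
   have "q i * x * q j = v i * adj (v i) * x * (v j * adj (v j))" using v ij by simp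
   also have "\<dots> = v i * y * adj (v j)" by (simp only: y_def mult.assoc)
   also have "\<dots> = csc l (v i * adj (v j))" by (simp add: l vq)
   finally show ?thesis using True by auto
  qed
  then have "\<exists>l. \<forall>i j. i < n --> j < n --> q i * x * q j = (if c i = c j then csc (l i j) (v i * adj (v j)) else 0)"
   by metis
  then obtain l where l: "\<And>i j. i < n ==> j < n ==> q i * x * q j = (if c i = c j then csc (l i j) (v i * adj (v j)) else 0)"
   by blast
  have "x = (\<Sum>i<n. q i) * x * (\<Sum>j<n. q j)" by (simp add: q(2))
  also have "\<dots> = (\<Sum>i<n. \<Sum>j<n. q i * x * q j)"
   by (simp only: sum_distrib_left sum_distrib_right) (rule sum.swap)
  also have "\<dots> = (\<Sum>i<n. \<Sum>j<n. if c i = c j then csc (l i j) (v i * adj (v j)) else 0)"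
   using l by (intro sum.cong) auto
  finally show ?thesis by blast
 qed
 then show ?thesis using q c v by blast
qed

section \<open>Finite dimensional subalgebras\<close>

text \<open>Induction over the spanning set. By the induction hypothesis a new vector outside the
  old span has positive 2-norm distance \<open>d\<close> from it, so its coefficients along a Cauchy
  sequence are Cauchy and converge.\<close>

lemma n2_closed_span:
 assumes "finite S" "S \<subseteq> A" "\<And>n. X n \<in> span S" "T \<in> A" "(\<lambda>n. n2 (X n - T)) \<longlonglongrightarrow> 0"
 shows "T \<in> span S" using assms
proof (induction S arbitrary: X T rule: finite_induct)
 case empty
 then have X: "X n = 0" for n by simp
 then have "n2 T = 0" using empty.prems(3,4) by (simp add: n2_minus LIMSEQ_const_iff)
 then show ?case using empty.prems n2_eq_0 by simp
next
 case (insert b S)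
 have spA: "x \<in> A" if "x \<in> span (insert b S)" for x using that insert.prems(1)
  by (induction rule: span_induct_alt) auto
 have SA: "S \<subseteq> A" "b \<in> A" using insert.prems by auto
 have sA: "x \<in> A" if "x \<in> span S" for x using spA span_mono[of S "insert b S"] that by blast
 show ?case
 proof (cases "b \<in> span S")
  case True
  then have "span (insert b S) = span S" by (rule span_redundant)
  then have "\<And>n. X n \<in> span S" using insert.prems(2) by simp
  then have "T \<in> span S" using insert.IH[of X T] SA(1) insert.prems(3,4) by blast
  then show ?thesis using \<open>span (insert b S) = span S\<close> by simp
 next
  case False
  have "\<exists>d>0. \<forall>s\<in>span S. d \<le> n2 (b - s)"
  proof (rule ccontr)
   assume "\<not> ?thesis"
   then have "\<exists>s\<in>span S. n2 (b - s) < inverse (real (Suc n))" for n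
    by (meson inverse_positive_iff_positive not_le of_nat_0_less_iff zero_less_Suc)
   then obtain s where s: "\<And>n. s n \<in> span S" "\<And>n. n2 (b - s n) < inverse (real (Suc n))" by metis
   have "(\<lambda>n. n2 (s n - b)) \<longlonglongrightarrow> 0"
   proof (rule tendsto_sandwich[OF _ _ tendsto_const LIMSEQ_inverse_real_of_nat])
    show "\<forall>\<^sub>F n in sequentially. n2 (s n - b) \<le> inverse (real (Suc n))"
     using s(2) n2_diff_commute[OF SA(2) sA[OF s(1)]] by (intro always_eventually allI) (metis less_imp_le)
   qed (simp add: sA[OF s(1)] SA)
   then have "b \<in> span S" using insert.IH[of s b] SA s(1) by blast
   then show False using False by blast
  qed
  then obtain d where d: "d > 0" "\<And>s. s \<in> span S ==> d \<le> n2 (b - s)" by blast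
  have lower: "d * \<bar>k\<bar> \<le> n2 (s + k *\<^sub>R b)" if "s \<in> span S" for s k
  proof (cases "k = 0")
   case False
   have e: "k *\<^sub>R (b - (- (1 / k)) *\<^sub>R s) = s + k *\<^sub>R b" using False by (simp add: scaleR_diff_right algebra_simps)
   have "n2 (s + k *\<^sub>R b) = \<bar>k\<bar> * n2 (b - (- (1 / k)) *\<^sub>R s)"
    unfolding e[symmetric] using SA(2) sA[OF that] by (intro n2_scaleR) simp
   moreover have "d \<le> n2 (b - (- (1 / k)) *\<^sub>R s)" by (rule d(2)[OF span_scale[OF that]])
   ultimately show ?thesis by (simp only: mult.commute[of d]) (simp add: mult_left_mono)
  qed (simp add: sA that)
  have "\<exists>k. X n - k *\<^sub>R b \<in> span S" for n using insert.prems(2)[of n] by (simp add: span_insert)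
  then obtain k where k: "\<And>n. X n - k n *\<^sub>R b \<in> span S" by metis
  have XA: "X n \<in> A" for n using spA insert.prems(2) by blast
  have kd: "d * \<bar>k m - k n\<bar> \<le> n2 (X m - X n)" for m n
  proof -
   have e: "(X m - k m *\<^sub>R b - (X n - k n *\<^sub>R b)) + (k m - k n) *\<^sub>R b = X m - X n" by (simp add: algebra_simps)
   show ?thesis using lower[OF span_diff[OF k[of m] k[of n]], of "k m - k n"] unfolding e .
  qed
  have "Cauchy k"
  proof (rule CauchyI)
   fix e :: real assume e: "e > 0"
   then have "\<forall>\<^sub>F n in sequentially. n2 (X n - T) < d * e / 2"
    using order_tendstoD(2)[OF insert.prems(4), of "d * e / 2"] d by simp
   then obtain M where M: "\<And>n. n \<ge> M ==> n2 (X n - T) < d * e / 2" by (auto simp: eventually_sequentially)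
   have "norm (k m - k n) < e" if "m \<ge> M" "n \<ge> M" for m n
   proof -
    have "n2 (X m - X n) \<le> n2 (X m - T) + n2 (T - X n)" by (intro n2_dist_triangle XA insert.prems(3))
    also have "n2 (T - X n) = n2 (X n - T)" by (intro n2_diff_commute XA insert.prems(3))
    finally have "d * \<bar>k m - k n\<bar> < d * e" using kd[of m n] M[OF that(1)] M[OF that(2)] by simp
    then show ?thesis using d by simp
   qed
   then show "\<exists>M. \<forall>m\<ge>M. \<forall>n\<ge>M. norm (k m - k n) < e" by blast
  qed
  then obtain l where l: "k \<longlonglongrightarrow> l" using Cauchy_convergent convergent_def by blast
  have "T - l *\<^sub>R b \<in> span S"
  proof (rule insert.IH[of "\<lambda>n. X n - k n *\<^sub>R b"])
   show "(\<lambda>n. n2 (X n - k n *\<^sub>R b - (T - l *\<^sub>R b))) \<longlonglongrightarrow> 0"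
   proof (rule tendsto_sandwich[OF _ _ tendsto_const])
    show "(\<lambda>n. n2 (X n - T) + \<bar>l - k n\<bar> * n2 b) \<longlonglongrightarrow> 0"
     using tendsto_add[OF insert.prems(4) tendsto_mult[OF tendsto_rabs[OF tendsto_diff[OF tendsto_const l]] tendsto_const, of l "n2 b"]]
     by simp
    have "n2 (X n - k n *\<^sub>R b - (T - l *\<^sub>R b)) \<le> n2 (X n - T) + \<bar>l - k n\<bar> * n2 b" for n
    proof -
     have e: "X n - k n *\<^sub>R b - (T - l *\<^sub>R b) = (X n - T) + (l - k n) *\<^sub>R b" by (simp add: algebra_simps)
     show ?thesis unfolding e
      using n2_triangle[of "X n - T" "(l - k n) *\<^sub>R b"] XA insert.prems(3) SA(2) by (simp add: n2_scaleR)
    qed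
    then show "\<forall>\<^sub>F n in sequentially. n2 (X n - k n *\<^sub>R b - (T - l *\<^sub>R b)) \<le> n2 (X n - T) + \<bar>l - k n\<bar> * n2 b" by simp
   qed (simp add: XA SA insert.prems(3))
  qed (simp_all add: SA k insert.prems(3))
  then show ?thesis by (auto simp: span_insert)
 qed
qed

lemma orth_family_finite_dim:
 assumes S: "finite S" "B \<subseteq> span S" and q: "orth_family B n q"
 shows "n \<le> card S"
proof -
 have q': "q i * q i = q i" "q i \<noteq> 0" "q i \<in> B" if "i < n" for i using q that by (auto simp: orth_family_def projD)
 have qij: "q i * q j = 0" if "i < n" "j < n" "i \<noteq> j" for i j using q that by (auto simp: orth_family_def)
 have inj: "inj_on q {..<n}"
 proof (rule inj_onI)
  fix i j assume "i \<in> {..<n}" "j \<in> {..<n}" "q i = q j"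
  then show "i = j" using q'(1,2)[of i] qij[of i j] by (metis lessThan_iff)
 qed
 have ind: "independent (q ` {..<n})"
 proof (rule independent_if_scalars_zero)
  fix u x assume u: "(\<Sum>v\<in>q ` {..<n}. u v *\<^sub>R v) = 0" and "x \<in> q ` {..<n}"
  then obtain i where i: "i < n" "x = q i" by auto
  have "0 = q i * (\<Sum>j<n. u (q j) *\<^sub>R q j)" using u by (simp add: sum.reindex[OF inj])
  also have "\<dots> = (\<Sum>j<n. if j = i then u (q i) *\<^sub>R q i else 0)"
   unfolding sum_distrib_left using i qij q' by (intro sum.cong) auto
  also have "\<dots> = u x *\<^sub>R q i" using i by simp
  finally show "u x = 0" using q'(2)[OF i(1)] by simp
 qed simp
 have "card (q ` {..<n}) \<le> card S" using independent_span_bound[OF S(1) ind] S(2) q'(3) by auto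
 then show ?thesis by (simp add: card_image[OF inj])
qed

lemma subalg_finite_dim:
 assumes "star_alg B" "B \<subseteq> A" "finite S" "B \<subseteq> span S"
 shows "subalg B"
proof -
 interpret B: star_alg B by fact
 have "subspace B" unfolding subspace_def by simp
 obtain S' where S': "S' \<subseteq> B" "independent S'" "B \<subseteq> span S'"
  using maximal_independent_subset[of B] by blast
 have spS: "span S' = B" using span_minimal[OF S'(1) \<open>subspace B\<close>] S'(3) by (rule subset_antisym)
 have "finite S'" using independent_span_bound[OF assms(3) S'(2)] S'(1) assms(4) by blast
 then have "T \<in> B" if "\<And>n. X n \<in> B" "n2_lim X T" for X T
 proof -
  have "S' \<subseteq> A" using S'(1) assms(2) by blast
  moreover have "X n \<in> span S'" for n using that(1) spS by simp
  ultimately have "T \<in> span S'"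
   using n2_closed_span[OF \<open>finite S'\<close>, of X T] n2_limD(2,4)[OF that(2)] by blast
  then show ?thesis using spS by simp
 qed
 then show ?thesis using assms(1,2) unfolding subalg_def by blast
qed

text \<open>If all nonzero projections had trace at least \<open>e\<close>, orthogonal families
  would have at most \<open>1 / e\<close> members, and the algebra itself would be spanned by
  finitely many matrix units.\<close>

lemma small_projection:
 assumes inf: "\<And>S. finite S ==> \<not> A \<subseteq> span S" and e: "e > 0"
 shows "\<exists>r. proj r \<and> r \<noteq> 0 \<and> Re (tau r) < e"
proof (rule ccontr)
 assume "\<not> ?thesis"
 then have big: "e \<le> Re (tau r)" if "proj r" "r \<noteq> 0" for r using that by force
 have bd: "n \<le> nat \<lceil>1 / e\<rceil>" if q: "orth_family A n q" for n q
 proof -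
  have "real n * e = (\<Sum>i<n. e)" by simp
  also have "\<dots> \<le> (\<Sum>i<n. Re (tau (q i)))"
   using q by (intro sum_mono big) (auto simp: orth_family_def)
  also have "\<dots> = Re (tau (\<Sum>i<n. q i))" using q by (subst tau_sum) (auto simp: orth_family_def)
  also have "\<dots> \<le> Re (tau 1)"
   using orth_family_sum(1)[OF q] by (intro pos_tau_mono) (simp_all add: projD proj_pos proj_compl)
  finally have "real n \<le> 1 / e" using e by (simp add: tau_one field_simps)
  then show ?thesis by linarith
 qed
 obtain n :: nat and c :: "nat => nat" and v :: "nat => 'h bop" where v: "\<And>i. i < n ==> v i \<in> A"
   and x: "\<And>x. x \<in> A ==> \<exists>l. x = (\<Sum>i<n. \<Sum>j<n. if c i = c j then csc (l i j) (v i * adj (v j)) else 0)"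
 proof -
  have "\<exists>n q c v. orth_family A n q \<and> (\<Sum>i<n. q i) = 1 \<and>
   (\<forall>i<n. c i < n \<and> v i \<in> A \<and> adj (v i) * v i = q (c i) \<and> v i * adj (v i) = q i) \<and>
   (\<forall>x\<in>A. \<exists>l. x = (\<Sum>i<n. \<Sum>j<n. if c i = c j then csc (l i j) (v i * adj (v j)) else 0))"
   by (rule matrix_units[OF subalg_self]) (rule bd)
  then obtain n :: nat and c :: "nat => nat" and v :: "nat => 'h bop" where 1: "\<forall>i<n. v i \<in> A"
   and 2: "\<forall>x\<in>A. \<exists>l. x = (\<Sum>i<n. \<Sum>j<n. if c i = c j then csc (l i j) (v i * adj (v j)) else 0)" by blast
  show ?thesis by (rule that[of n v c]) (use 1 2 in blast)+
 qed
 \<comment> \<open>\<open>span\<close> is the real span, hence the second copy with the factor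
   \<open>\<i>\<close>.\<close>
 define S where "S = (\<lambda>(i, j). v i * adj (v j)) ` ({..<n} \<times> {..<n}) \<union> (\<lambda>(i, j). csc \<i> (v i * adj (v j))) ` ({..<n} \<times> {..<n})"
 have "A \<subseteq> span S"
 proof
  fix x assume "x \<in> A"
  then obtain l where l: "x = (\<Sum>i<n. \<Sum>j<n. if c i = c j then csc (l i j) (v i * adj (v j)) else 0)" using x by blast
  have "csc z (v i * adj (v j)) \<in> span S" if "i < n" "j < n" for i j and z :: complex
  proof -
   have "v i * adj (v j) \<in> S" "csc \<i> (v i * adj (v j)) \<in> S" using that by (force simp: S_def)+
   then have "Re z *\<^sub>R (v i * adj (v j)) + Im z *\<^sub>R csc \<i> (v i * adj (v j)) \<in> span S"
    by (intro span_add span_scale span_base)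
   moreover have "Re z *\<^sub>R (v i * adj (v j)) + Im z *\<^sub>R csc \<i> (v i * adj (v j)) = csc (of_real (Re z) + of_real (Im z) * \<i>) (v i * adj (v j))"
    by (simp only: csc_of_real[symmetric] csc_add_left csc_csc)
   moreover have "of_real (Re z) + of_real (Im z) * \<i> = z" by (simp add: complex_eq_iff)
   ultimately show ?thesis by simp
  qed
  then show "x \<in> span S" unfolding l by (intro span_sum) (simp add: span_zero)
 qed
 moreover have "finite S" unfolding S_def by (intro finite_UnI finite_imageI finite_cartesian_product finite_lessThan)
 ultimately show False using inf by blast
qed

end

section \<open>Comparison of projections\<close>

text \<open>Each step realises at least half of the gain still possible. As the total gain is
  bounded, the possible gain tends to 0 along the sequence. This yields maximal objects as limits of
  sequences.\<close>

lemma greedy_sequence: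
 fixes V :: "'s => real"
 assumes s0: "s0 \<in> S" and step: "\<And>s s'. s \<in> S ==> P s s' ==> s' \<in> S \<and> V s \<le> V s'"
  and refl: "\<And>s. s \<in> S ==> P s s" and bd: "\<And>s. s \<in> S ==> V s \<le> b"
 shows "\<exists>f. f 0 = s0 \<and> (\<forall>n. f n \<in> S \<and> P (f n) (f (Suc n))) \<and>
  (\<forall>d>0. \<exists>n. \<forall>s'. P (f n) s' --> V s' - V (f n) < d)"
proof -
 have "\<exists>s'. P s s' \<and> (\<forall>t. P s t --> V t - V s \<le> 2 * (V s' - V s))" if s: "s \<in> S" for s
 proof -
  define G where "G = (\<lambda>t. V t - V s) ` {t. P s t}"
  have ne: "0 \<in> G" unfolding G_def using refl[OF s] by force
  have bG: "bdd_above G" unfolding G_def using step[OF s] bd by (intro bdd_aboveI[of _ "b - V s"]) force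
  have le: "V t - V s \<le> Sup G" if "P s t" for t using that bG by (intro cSup_upper) (auto simp: G_def)
  show ?thesis
  proof (cases "Sup G > 0")
   case True
   then have "Sup G / 2 < Sup G" by simp
   then obtain g where "g \<in> G" "Sup G / 2 < g" using less_cSupD[of G] ne by blast
   then obtain s' where "P s s'" "Sup G / 2 < V s' - V s" by (auto simp: G_def)
   then show ?thesis using le by (intro exI[of _ s'] conjI allI impI) force+
  next
   case False
   then show ?thesis using le refl[OF s] by (intro exI[of _ s] conjI allI impI) force+
  qed
 qed
 then obtain N where N: "\<And>s. s \<in> S ==> P s (N s)" "\<And>s t. s \<in> S ==> P s t ==> V t - V s \<le> 2 * (V (N s) - V s)"
  by metis
 define f where "f n = (N ^^ n) s0" for n
 have fS: "f n \<in> S" for n by (induction n) (use s0 step N(1) in \<open>auto simp: f_def\<close>)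
 have fs: "f (Suc n) = N (f n)" for n by (simp add: f_def)
 have inc: "incseq (\<lambda>n. V (f n))"
  by (rule incseq_SucI) (use step[OF fS N(1)[OF fS]] in \<open>simp add: fs\<close>)
 obtain l where l: "(\<lambda>n. V (f n)) \<longlonglongrightarrow> l"
  using incseq_convergent[OF inc, of b] bd fS by metis
 have "\<exists>n. \<forall>s'. P (f n) s' --> V s' - V (f n) < d" if d: "d > 0" for d
 proof -
  have "(\<lambda>n. V (f (Suc n)) - V (f n)) \<longlonglongrightarrow> l - l" by (intro tendsto_diff LIMSEQ_Suc[OF l] l)
  then have "\<forall>\<^sub>F n in sequentially. V (f (Suc n)) - V (f n) < d / 2"
   by (rule order_tendstoD(2)) (use d in simp)
  then obtain n where n: "V (f (Suc n)) - V (f n) < d / 2" by (auto simp: eventually_sequentially)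
  have "V s' - V (f n) < d" if "P (f n) s'" for s'
  proof -
   have "V s' - V (f n) \<le> 2 * (V (f (Suc n)) - V (f n))" using N(2)[OF fS[of n] that] by (simp only: fs)
   also have "\<dots> < 2 * (d / 2)" using n by (intro mult_strict_left_mono) simp_all
   finally show ?thesis by simp
  qed
  then show ?thesis by blast
 qed
 then show ?thesis using fS N(1)[OF fS] by (intro exI[of _ f]) (simp add: fs f_def)
qed

context vna
begin

text \<open>Partial isometries with initial projection below \<open>r\<close> and final projection
  below \<open>q\<close>, when \<open>r\<close> and \<open>q\<close> are projections.\<close>

definition pis :: "'h bop => 'h bop => 'h bop set" where
 "pis r q = {w \<in> A. w * adj w * w = w \<and> w * r = w \<and> q * w = w}"

lemma pisD:
 assumes "w \<in> pis r q" shows "w \<in> A" "w * adj w * w = w" "w * r = w" "q * w = w"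
 using assms by (auto simp: pis_def)

lemma pis_initial:
 assumes w: "w \<in> pis r q" and r: "proj r"
 shows "proj (adj w * w)" "adj w * w * r = adj w * w" "r * (adj w * w) = adj w * w" "proj (r - adj w * w)"
  "w * (adj w * w) = w"
proof -
 note w' = pisD[OF w] and r' = projD[OF r]
 show 0: "w * (adj w * w) = w" using w'(2) by (simp add: mult.assoc)
 show 1: "proj (adj w * w)" using w'(1) 0 by (simp add: proj_def mult.assoc)
 show 2: "adj w * w * r = adj w * w" by (simp add: mult.assoc w'(3))
 show 3: "r * (adj w * w) = adj w * w" using arg_cong[OF 2, of adj] r' by (simp add: mult.assoc)
 show "proj (r - adj w * w)"
  using projD[OF 1] r' 2 3 by (simp add: proj_def left_diff_distrib right_diff_distrib)
qed

lemma pis_adj: "w \<in> pis r q ==> proj r ==> proj q ==> adj w \<in> pis q r"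
proof -
 assume a: "w \<in> pis r q" "proj r" "proj q"
 note w = pisD[OF a(1)]
 show ?thesis
  using arg_cong[OF w(2), of adj] arg_cong[OF w(3), of adj] arg_cong[OF w(4), of adj] w(1) projD(2)[OF a(2)] projD(2)[OF a(3)]
  by (simp add: pis_def mult.assoc)
qed

lemma pis_final:
 assumes w: "w \<in> pis r q" and r: "proj r" "proj q"
 shows "proj (w * adj w)" "w * adj w * q = w * adj w" "q * (w * adj w) = w * adj w" "proj (q - w * adj w)"
 using pis_initial(1-4)[OF pis_adj[OF w r] r(2)] by simp_all

lemma pis_norm: assumes "w \<in> pis r q" "proj r" shows "norm w \<le> 1"
 by (rule norm_le_of_sq) (rule proj_pos[OF proj_compl[OF pis_initial(1)[OF assms]]])

lemma pis_orth:
 assumes w: "w \<in> pis r q" and r: "proj r" "proj q" and x: "x \<in> pis (r - adj w * w) (q - w * adj w)"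
 shows "x * (adj w * w) = 0" "w * adj w * x = 0" "x * adj w = 0" "adj w * x = 0" "x \<in> pis r q"
proof -
 define e where "e = adj w * w"
 define f where "f = w * adj w"
 note x' = pisD[OF x, folded e_def f_def]
 note e = pis_initial[OF w r(1), folded e_def] and f = pis_final[OF w r, folded f_def]
 have "x * e = (x * (r - e)) * e" by (simp only: x'(3))
 also have "\<dots> = 0" using e(3) projD(3)[OF e(1)] by (simp add: mult.assoc left_diff_distrib)
 finally show xe: "x * (adj w * w) = 0" by (simp add: e_def)
 have "f * x = f * ((q - f) * x)" by (simp only: x'(4))
 also have "\<dots> = 0" using f(2) projD(3)[OF f(1)] by (simp add: mult.assoc[symmetric] right_diff_distrib)
 finally show fx: "w * adj w * x = 0" by (simp add: f_def)
 have "adj w = adj (w * e)" using e(5) by simp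
 then have "adj w = e * adj w" using projD(2)[OF e(1)] by simp
 then have "x * adj w = (x * e) * adj w" by (metis mult.assoc)
 then show "x * adj w = 0" using xe by (simp add: e_def)
 have "adj w = adj w * f" using arg_cong[OF pisD(2)[OF w], of adj] by (simp add: f_def mult.assoc)
 then have "adj w * x = adj w * (f * x)" by (metis mult.assoc)
 then show "adj w * x = 0" using fx by (simp add: f_def)
 have "x * r = (x * (r - e)) * r" by (simp only: x'(3))
 also have "\<dots> = x * (r - e)" using e(2) projD(3)[OF r(1)] by (simp only: mult.assoc left_diff_distrib)
 finally have xr: "x * r = x" by (simp only: x'(3))
 have "q * x = q * ((q - f) * x)" by (simp only: x'(4))
 also have "\<dots> = (q - f) * x" using f(3) projD(3)[OF r(2)] by (simp only: mult.assoc[symmetric] right_diff_distrib)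
 finally have "q * x = x" by (simp only: x'(4))
 then show "x \<in> pis r q" using x' xr by (simp add: pis_def)
qed

lemma pis_add:
 assumes w: "w \<in> pis r q" and r: "proj r" "proj q" and x: "x \<in> pis (r - adj w * w) (q - w * adj w)"
 shows "w + x \<in> pis r q" "adj (w + x) * (w + x) = adj w * w + adj x * x" "(w + x) * adj (w + x) = w * adj w + x * adj x"
proof -
 note o = pis_orth[OF w r x]
 have o': "w * adj x = 0" "adj x * w = 0"
  using arg_cong[OF o(3), of adj] arg_cong[OF o(4), of adj] by simp_all
 show 1: "adj (w + x) * (w + x) = adj w * w + adj x * x" by (simp add: distrib_left distrib_right o o')
 show "(w + x) * adj (w + x) = w * adj w + x * adj x" by (simp add: distrib_left distrib_right o o')
 have "w * (adj x * x) = 0" using o'(1) by (simp add: mult.assoc[symmetric])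
 then have "(w + x) * (adj w * w + adj x * x) = w + x"
  using pisD(2)[OF w] pisD(2)[OF x] o(1) by (simp add: distrib_left distrib_right mult.assoc[symmetric])
 then have "(w + x) * adj (w + x) * (w + x) = w + x" by (simp only: mult.assoc 1)
 then show "w + x \<in> pis r q" using pisD[OF w] pisD[OF o(5)] by (simp add: pis_def distrib_left distrib_right)
qed

lemma proj_tau_le: "proj p ==> Re (tau p) \<le> 1"
 using pos_tau_mono[of p 1] by (simp add: projD proj_pos proj_compl tau_one)

end

context vn_factor
begin

lemma pis_exists:
 assumes "proj r" "r \<noteq> 0" "proj q" "q \<noteq> 0"
 shows "\<exists>v\<in>pis r q. v \<noteq> 0"
proof -
 note r = projD[OF assms(1)] and q = projD[OF assms(3)]
 obtain x where x: "x \<in> A" "q * x * r \<noteq> 0" using factor_prime[OF q(1) r(1)] assms by blast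
 define y where "y = q * x * r"
 have y: "y \<in> A" "q * y = y" "y * r = y" using x q r by (simp_all add: y_def mult.assoc) (simp add: mult.assoc[symmetric])
 obtain v where v: "v \<in> A" "v * adj v * v = v" "y * (adj v * v) = y" "q * v = v" "v * r = v"
  using subalg_polar[OF subalg_self y(1)] y q(1) r(1) by blast
 have "v \<noteq> 0" using v(3) x(2) by (auto simp: y_def)
 then show ?thesis using v by (auto simp: pis_def)
qed

text \<open>Partial isometries are enlarged greedily by orthogonal pieces; the squared 2-norm of a
  difference is the trace gained, so a limit \<open>w\<close> exists. If \<open>w\<close> did not
  exhaust \<open>r\<close>, the trace inequality would leave room in \<open>q\<close> as well, and a
  piece between the two remainders would contradict that the possible gain tends to 0.\<close>

theorem comparison:
 assumes r: "proj r" and q: "proj q" and le: "Re (tau r) \<le> Re (tau q)"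
 shows "\<exists>w\<in>pis r q. adj w * w = r"
proof -
 define P where "P w w' \<longleftrightarrow> (\<exists>x\<in>pis (r - adj w * w) (q - w * adj w). w' = w + x)" for w w'
 define V where "V w = Re (tau (adj w * w))" for w
 have z: "0 \<in> pis a b" for a b by (simp add: pis_def)
 have step: "w' \<in> pis r q \<and> V w \<le> V w'" if w: "w \<in> pis r q" and p: "P w w'" for w w'
 proof -
  obtain x where x: "x \<in> pis (r - adj w * w) (q - w * adj w)" "w' = w + x" using p by (auto simp: P_def)
  show ?thesis using pis_add[OF w r q x(1)] pisD(1)[OF w] pisD(1)[OF x(1)] tau_nonneg[OF pisD(1)[OF x(1)]]
   by (simp add: x(2) V_def tau_simps)
 qed
 have "\<exists>f. f 0 = 0 \<and> (\<forall>n. f n \<in> pis r q \<and> P (f n) (f (Suc n))) \<and>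
  (\<forall>d>0. \<exists>n. \<forall>s'. P (f n) s' --> V s' - V (f n) < d)"
 proof (rule greedy_sequence[where b = 1])
  show "V s \<le> 1" if "s \<in> pis r q" for s
   unfolding V_def by (rule proj_tau_le[OF pis_initial(1)[OF that r]])
  show "P s s" for s using z by (auto simp: P_def)
 qed (use step z in blast)+
 then obtain W where W: "\<And>n. W n \<in> pis r q" "\<And>n. P (W n) (W (Suc n))"
   "\<And>d. d > 0 ==> \<exists>n. \<forall>s'. P (W n) s' --> V s' - V (W n) < d" by blast
 obtain x where x: "\<And>n. x n \<in> pis (r - adj (W n) * W n) (q - W n * adj (W n))" "\<And>n. W (Suc n) = W n + x n"
  using W(2) unfolding P_def by metis
 define e where "e n = adj (W n) * W n" for n
 define f where "f n = W n * adj (W n)" for n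
 have WA: "W n \<in> A" for n using pisD(1)[OF W(1)] .
 have en: "proj (e n)" for n unfolding e_def by (rule pis_initial(1)[OF W(1) r])
 have fn: "proj (f n)" for n unfolding f_def by (rule pis_final(1)[OF W(1) r q])
 have esuc: "e (Suc n) = e n + adj (x n) * x n" "f (Suc n) = f n + x n * adj (x n)" for n
  using pis_add(2,3)[OF W(1) r q x(1), of n] by (simp_all add: e_def f_def x(2))
 have xe: "x n * e n = 0" "f n * x n = 0" for n
  using pis_orth(1,2)[OF W(1) r q x(1)] by (simp_all add: e_def f_def)
 have ee: "e m * e n = e n" "f n * f m = f n" if "n \<le> m" for n m using that
 proof (induction m rule: dec_induct)
  case base
  { case 1 show ?case by (rule projD(3)[OF en]) }
  { case 2 show ?case by (rule projD(3)[OF fn]) }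
 next
  case (step m)
  { case 1
   have "x m * e n = (x m * e m) * e n" using step.IH(1) by (simp add: mult.assoc)
   then show ?case using step.IH(1) xe(1) by (simp add: esuc distrib_right mult.assoc) }
  { case 2
   have "f n * x m = f n * (f m * x m)" using step.IH(2) by (simp add: mult.assoc[symmetric])
   then have "f n * x m = 0" using xe(2) by simp
   then show ?case using step.IH(2) by (simp add: esuc distrib_left mult.assoc[symmetric]) }
 qed
 have Wf: "f n * W n = W n" for n using pisD(2)[OF W(1)] by (simp add: f_def)
 have fW: "adj (W n) * W m = e n" if "n \<le> m" for n m using that
 proof (induction m rule: dec_induct)
  case (step m)
  have "adj (W n) * x m = adj (f n * W n) * x m" by (simp only: Wf)
  also have "\<dots> = adj (W n) * (f n * x m)" using projD(2)[OF fn] by (simp add: mult.assoc)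
  also have "f n * x m = f n * f m * x m" using ee(2)[of n m] step by simp
  also have "\<dots> = 0" using xe(2) by (simp add: mult.assoc)
  finally show ?case using step.IH by (simp add: x(2) distrib_left)
 qed (simp add: e_def)
 have VV: "V (W n) = Re (tau (e n))" for n by (simp add: V_def e_def)
 have dist: "(n2 (W m - W n))\<^sup>2 = V (W m) - V (W n)" if "n \<le> m" for m n
 proof -
  have "(n2 (W m + (- W n)))\<^sup>2 = (n2 (W m))\<^sup>2 + 2 * Re (tau (adj (W m) * (- W n))) + (n2 (- W n))\<^sup>2"
   using WA by (intro n2_sum_sq) simp_all
  moreover have "adj (W m) * W n = e n" using arg_cong[OF fW[OF that], of adj] projD(2)[OF en[of n]] by simp
  ultimately show ?thesis
   using WA en projD(1)[OF en[of n]] by (simp add: n2_minus n2_sq tau_minus VV) (simp add: e_def)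
 qed
 have inc: "incseq (\<lambda>n. V (W n))" by (rule incseq_SucI) (use step[OF W(1) W(2)] in blast)
 have Vb: "V (W n) \<le> 1" for n unfolding VV by (rule proj_tau_le[OF en])
 obtain l where l: "(\<lambda>n. V (W n)) \<longlonglongrightarrow> l"
  using incseq_convergent[OF inc, of 1] Vb by metis
 have cu: "Cauchy (\<lambda>n. V (W n))" by (rule LIMSEQ_imp_Cauchy[OF l])
 have "n2_Cauchy W" unfolding n2_Cauchy_def
 proof (intro allI impI)
  fix d :: real assume d: "d > 0"
  then have "d\<^sup>2 > 0" by simp
  then obtain M where M: "\<And>m n. m \<ge> M ==> n \<ge> M ==> norm (V (W m) - V (W n)) < d\<^sup>2"
   using CauchyD[OF cu, of "d\<^sup>2"] by blast
  have *: "n2 (W m - W n) < d" if "M \<le> n" "n \<le> m" for m n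
  proof (rule power2_less_imp_less)
   show "(n2 (W m - W n))\<^sup>2 < d\<^sup>2" using dist[OF that(2)] M[of m n] that by simp
  qed (use d in simp)
  have "n2 (W m - W n) < d" if "M \<le> n" "M \<le> m" for m n
  proof (cases "n \<le> m")
   case False
   then show ?thesis using *[of m n] that n2_diff_commute[OF WA WA, of m n] by simp
  qed (use * that in simp)
  then show "\<exists>M. \<forall>m\<ge>M. \<forall>n\<ge>M. n2 (W m - W n) < d" by blast
 qed
 then obtain w where w: "n2_lim W w" using n2_Cauchy_lim[of W 1] WA pis_norm[OF W(1) r] by blast
 have wA: "w \<in> A" by (rule n2_limD(2)[OF w])
 have l1: "n2_lim (\<lambda>n. W n * adj (W n) * W n) (w * adj w * w)"
  by (rule n2_lim_mult[OF n2_lim_mult[OF w n2_lim_adj[OF w]] w])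
 have l2: "n2_lim (\<lambda>n. W n * r) (w * r)" by (rule n2_lim_mult[OF w n2_lim_const[OF projD(1)[OF r]]])
 have l3: "n2_lim (\<lambda>n. q * W n) (q * w)" by (rule n2_lim_mult[OF n2_lim_const[OF projD(1)[OF q]] w])
 have wp: "w \<in> pis r q"
  using n2_lim_unique[OF l1[unfolded pisD(2)[OF W(1)]] w] n2_lim_unique[OF l2[unfolded pisD(3)[OF W(1)]] w]
   n2_lim_unique[OF l3[unfolded pisD(4)[OF W(1)]] w] wA by (simp add: pis_def)
 have el: "n2_lim e (adj w * w)" "n2_lim f (w * adj w)"
  unfolding e_def f_def by (rule n2_lim_mult[OF n2_lim_adj[OF w] w], rule n2_lim_mult[OF w n2_lim_adj[OF w]])
 have lim_shift: "n2_lim (\<lambda>m. X (m + n)) T" if "n2_lim X T" for X T n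
  using that unfolding n2_lim_def using LIMSEQ_ignore_initial_segment[of "\<lambda>n. n2 (X n - T)" 0 n] by blast
 have ew: "(adj w * w) * e n = e n" for n
 proof (rule n2_lim_unique)
  show "n2_lim (\<lambda>m. e (m + n) * e n) ((adj w * w) * e n)"
   by (rule n2_lim_mult[OF lim_shift[OF el(1)] n2_lim_const[OF projD(1)[OF en]]])
  show "n2_lim (\<lambda>m. e (m + n) * e n) (e n)" using ee(1)[of n] n2_lim_const[OF projD(1)[OF en[of n]]] by simp
 qed
 have fw: "f n * (w * adj w) = f n" for n
 proof (rule n2_lim_unique)
  show "n2_lim (\<lambda>m. f n * f (m + n)) (f n * (w * adj w))"
   by (rule n2_lim_mult[OF n2_lim_const[OF projD(1)[OF fn]] lim_shift[OF el(2)]])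
  show "n2_lim (\<lambda>m. f n * f (m + n)) (f n)" using ee(2)[of n] n2_lim_const[OF projD(1)[OF fn[of n]]] by simp
 qed
 have "r - adj w * w = 0"
 proof (rule ccontr)
  assume ne: "r - adj w * w \<noteq> 0"
  have pr: "proj (r - adj w * w)" "proj (q - w * adj w)" using pis_initial(4)[OF wp r] pis_final(4)[OF wp r q] .
  have "0 < Re (tau (r - adj w * w))" by (rule proj_tau_pos[OF pr(1) ne])
  also have "\<dots> \<le> Re (tau (q - w * adj w))"
   using le tau_comm[of "adj w" w] wA projD(1)[OF r] projD(1)[OF q] by (simp add: tau_simps)
  finally have "q - w * adj w \<noteq> 0" by auto
  then obtain y where y: "y \<in> pis (r - adj w * w) (q - w * adj w)" "y \<noteq> 0" using pis_exists[OF pr(1) ne pr(2)] by blast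
  note o = pis_orth[OF wp r q y(1)]
  note y' = pisD[OF o(5)]
  \<comment> \<open>The projections of \<open>w\<close> dominate those of every \<open>W n\<close>,
    so a piece orthogonal to \<open>w\<close> was available at each finite stage.\<close>
  have yn: "y \<in> pis (r - e n) (q - f n)" for n
  proof -
   have "y * (adj w * w) * e n = y * ((adj w * w) * e n)" by (rule mult.assoc)
   then have 1: "y * e n = 0" by (simp only: ew o(1) mult_zero_left)
   have "f n * y = f n * (w * adj w) * y" by (simp only: fw)
   then have 2: "f n * y = 0" using o(2) by (simp add: mult.assoc)
   show ?thesis using y' 1 2 by (simp add: pis_def left_diff_distrib right_diff_distrib)
  qed
  define d where "d = Re (tau (adj y * y))"
  have "n2 y \<noteq> 0" using n2_eq_0[OF y'(1)] y(2) by simp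
  then have d: "d > 0" unfolding d_def n2_sq[OF y'(1), symmetric] by simp
  obtain n where n: "\<And>s'. P (W n) s' ==> V s' - V (W n) < d" using W(3)[OF d] by blast
  have "P (W n) (W n + y)" using yn[of n] by (auto simp: P_def e_def f_def)
  moreover have "V (W n + y) - V (W n) = d"
   using pis_add(2)[OF W(1) r q yn[of n, unfolded e_def f_def]] WA y'(1) by (simp add: V_def d_def tau_simps)
  ultimately show False using n[of "W n + y"] by simp
 qed
 then show ?thesis using wp by (intro bexI[of _ w]) simp_all
qed

text \<open>Division of \<open>q\<close> by \<open>r\<close> with remainder:
  \<open>comparison\<close> places a further copy of \<open>r\<close> under what is left of
  \<open>q\<close> as long as its trace is at least that of \<open>r\<close>. The number
  \<open>N\<close> bounds the number of copies.\<close>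

lemma packing:
 assumes r: "proj r" "r \<noteq> 0" and q: "proj q"
 shows "\<exists>(m::nat) w. (\<forall>l<m. w l \<in> A \<and> q * w l = w l) \<and> (\<forall>l<m. \<forall>k<m. adj (w l) * w k = (if l = k then r else 0)) \<and>
  proj (q - (\<Sum>l<m. w l * adj (w l))) \<and> Re (tau (q - (\<Sum>l<m. w l * adj (w l)))) < Re (tau r)"
proof -
 have tr: "Re (tau r) > 0" by (rule proj_tau_pos[OF r])
 obtain N :: nat where "Re (tau q) / Re (tau r) < real N" using reals_Archimedean2 by blast
 then have "Re (tau q) < real N * Re (tau r)" using tr by (simp add: field_simps)
 then show ?thesis using q
 proof (induction N arbitrary: q)
  case 0
  then show ?case using proj_tau_nonneg[of q] by simp
 next
  case (Suc N)
  show ?case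
  proof (cases "Re (tau q) < Re (tau r)")
   case True
   then show ?thesis using Suc.prems(2) by (intro exI[of _ 0]) simp
  next
   case False
   then obtain u where u: "u \<in> pis r q" "adj u * u = r" using comparison[OF r(1) Suc.prems(2)] by auto
   note u' = pisD[OF u(1)] and uf = pis_final[OF u(1) r(1) Suc.prems(2)]
   define q' where "q' = q - u * adj u"
   have "Re (tau q') = Re (tau q) - Re (tau r)"
    using tau_comm[of u "adj u"] u u' projD(1)[OF Suc.prems(2)] by (simp add: q'_def tau_simps)
   then have "Re (tau q') < real N * Re (tau r)" using Suc.prems(1) by (simp add: algebra_simps)
   from Suc.IH[OF this uf(4)[folded q'_def]] obtain m :: nat and w :: "nat => 'a bop" where
    w: "\<And>l. l < m ==> w l \<in> A \<and> q' * w l = w l" "\<And>l k. l < m ==> k < m ==> adj (w l) * w k = (if l = k then r else 0)"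
     "proj (q' - (\<Sum>l<m. w l * adj (w l)))" "Re (tau (q' - (\<Sum>l<m. w l * adj (w l)))) < Re (tau r)" by blast
   define w' where "w' l = (case l of 0 => u | Suc l => w l)" for l
   have w's [simp]: "w' 0 = u" "w' (Suc l) = w l" for l by (simp_all add: w'_def)
   have uq: "adj u * q' = 0"
    using arg_cong[OF u'(4), of adj] arg_cong[OF u'(2), of adj] projD(2)[OF Suc.prems(2)]
    by (simp add: q'_def right_diff_distrib mult.assoc)
   have uw: "adj u * w k = 0" "adj (w k) * u = 0" if "k < m" for k
   proof -
    have "adj u * w k = adj u * (q' * w k)" using w(1)[OF that] by simp
    then show "adj u * w k = 0" using uq by (simp add: mult.assoc[symmetric])
    then have "adj (adj u * w k) = adj 0" by simp
    then show "adj (w k) * u = 0" by simp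
   qed
   have qq: "q * q' = q'" using uf(3) projD(3)[OF Suc.prems(2)] by (simp add: q'_def right_diff_distrib)
   have qw: "q * w k = w k" if "k < m" for k using w(1)[OF that] qq by (metis mult.assoc)
   have s: "q - (\<Sum>l<Suc m. w' l * adj (w' l)) = q' - (\<Sum>l<m. w l * adj (w l))"
    by (simp only: sum.lessThan_Suc_shift w's q'_def) simp
   show ?thesis
   proof (intro exI[of _ "Suc m"] exI[of _ w'] conjI allI impI)
    fix l assume "l < Suc m"
    then show "w' l \<in> A" "q * w' l = w' l" using w(1) qw u' by (cases l; simp)+
   next
    fix l k assume "l < Suc m" "k < Suc m"
    then show "adj (w' l) * w' k = (if l = k then r else 0)" using w(2) uw u(2) by (cases l; cases k; simp)
   qed (simp_all only: s w(3,4))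
  qed
 qed
qed

section \<open>The trace as a finite sum of vector functionals\<close>

text \<open>A Hahn decomposition for the difference of the trace and the vector functional of
  \<open>h\<close>. The element \<open>a\<close> is greedily maximal for collecting positive values
  of the difference, so beneath \<open>1 - a\<close> the difference is not positive.\<close>

lemma hahn_decomposition:
 "\<exists>a\<in>A. pos a \<and> pos (1 - a) \<and> inner h (ap a h) \<le> Re (tau a) \<and>
  (\<forall>x\<in>A. pos x --> pos (1 - a - x) --> Re (tau x) \<le> inner h (ap x h))"
proof -
 define V where "V x = Re (tau x) - inner h (ap x h)" for x
 define S where "S = {a \<in> A. pos a \<and> pos (1 - a)}"
 define P where "P a a' \<longleftrightarrow> (\<exists>x\<in>A. pos x \<and> pos (1 - a - x) \<and> 0 \<le> V x \<and> a' = a + x)" for a a'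
 have Vadd: "V (a + x) = V a + V x" if "a \<in> A" "x \<in> A" for a x
  using that by (simp add: V_def tau_add inner_add_right)
 have "\<exists>f. f 0 = 0 \<and> (\<forall>n. f n \<in> S \<and> P (f n) (f (Suc n))) \<and>
  (\<forall>d>0. \<exists>n. \<forall>s'. P (f n) s' --> V s' - V (f n) < d)"
 proof (rule greedy_sequence[where b = 1])
  show "0 \<in> S" by (simp add: S_def)
  show "P s s" if "s \<in> S" for s using that unfolding P_def S_def by (intro bexI[of _ 0]) (simp_all add: V_def)
  show "V s \<le> 1" if "s \<in> S" for s
   using that pos_tau_mono[of s 1] pos_inner[of s h] by (simp add: S_def V_def tau_one)
  show "s' \<in> S \<and> V s \<le> V s'" if "s \<in> S" "P s s'" for s s'
   using that Vadd by (auto simp: P_def S_def pos_add diff_diff_add)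
 qed
 then obtain a where a: "a 0 = 0" "\<And>n. a n \<in> S" "\<And>n. P (a n) (a (Suc n))"
   "\<And>d. d > 0 ==> \<exists>n. \<forall>s'. P (a n) s' --> V s' - V (a n) < d" by blast
 have aS: "a n \<in> A" "pos (a n)" "pos (1 - a n)" for n using a(2)[of n] by (auto simp: S_def)
 have inc: "pos (a (Suc n) - a n)" for n using a(3)[of n] by (auto simp: P_def)
 obtain T where T: "\<And>x. (\<lambda>n. ap (a n) x) \<longlonglongrightarrow> ap T x" "pos T" "pos (1 *\<^sub>R 1 - T)" "\<And>n. pos (T - a n)"
  using monotone_limit[of a 1] inc aS by auto
 have TA: "T \<in> A" by (rule sot_closed[of a]) (use aS(1) T(1) in auto)
 have "(\<lambda>n. Re (tau (a n))) \<longlonglongrightarrow> Re (tau T)" by (rule tau_normal) (use aS inc TA T(1) in auto)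
 moreover have "(\<lambda>n. inner h (ap (a n) h)) \<longlonglongrightarrow> inner h (ap T h)" by (intro tendsto_intros T)
 ultimately have Vl: "(\<lambda>n. V (a n)) \<longlonglongrightarrow> V T" unfolding V_def by (rule tendsto_diff)
 have V0: "0 \<le> V (a n)" for n
 proof (induction n)
  case (Suc n)
  obtain x where "x \<in> A" "0 \<le> V x" "a (Suc n) = a n + x" using a(3)[of n] by (auto simp: P_def)
  then show ?case using Vadd[OF aS(1)] Suc by simp
 qed (simp add: a(1) V_def)
 have "0 \<le> V T" by (rule LIMSEQ_le_const[OF Vl]) (use V0 in blast)
 moreover have "V x \<le> 0" if x: "x \<in> A" "pos x" "pos (1 - T - x)" for x
 proof (rule ccontr)
  assume n: "\<not> V x \<le> 0"
  then obtain n where n': "\<And>s'. P (a n) s' ==> V s' - V (a n) < V x" using a(4)[of "V x"] by force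
  have "pos ((1 - T - x) + (T - a n))" by (intro pos_add x T)
  then have "pos (1 - a n - x)" by (simp add: algebra_simps)
  then have "P (a n) (a n + x)" using x n by (auto simp: P_def)
  then show False using n'[of "a n + x"] Vadd[OF aS(1) x(1)] by simp
 qed
 ultimately show ?thesis using TA T(2,3) by (intro bexI[of _ T]) (simp_all add: V_def)
qed

text \<open>Below \<open>d = 1 - a\<close> from the Hahn decomposition the trace is dominated by the
  vector functional. To replace \<open>d\<close> by a projection, take the part where
  \<open>d\<close> is larger than half its norm, so that \<open>d * d >= s^2 * p\<close>.\<close>

lemma dominated_projection:
 "\<exists>p h. proj p \<and> p \<noteq> 0 \<and> (\<forall>t\<in>A. n2 (t * p) \<le> norm (ap t h))"
proof -
 have "(1 :: 'a bop) \<noteq> 0" using tau_one tau_zero by (metis zero_neq_one)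
 then obtain h0 :: 'a where h0: "h0 \<noteq> 0" using bop_eqI[of "1 :: 'a bop" 0] by auto
 \<comment> \<open>With norm 2 the vector functional takes the value 4 at 1 and exceeds the trace
   there, so \<open>a = 1\<close> is excluded.\<close>
 define h where "h = (2 / norm h0) *\<^sub>R h0"
 have hn: "norm h = 2" using h0 by (simp add: h_def)
 obtain a where a: "a \<in> A" "pos a" "pos (1 - a)" "inner h (ap a h) \<le> Re (tau a)"
   "\<And>x. x \<in> A ==> pos x ==> pos (1 - a - x) ==> Re (tau x) \<le> inner h (ap x h)"
  using hahn_decomposition by blast
 define d where "d = 1 - a"
 have d: "d \<in> A" "pos d" "pos (1 - d)" "adj d = d" using a by (simp_all add: d_def pos_adj)
 have d0: "d \<noteq> 0"
 proof
  assume "d = 0"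
  then have "a = 1" by (simp add: d_def)
  then show False using a(4) hn by (simp add: tau_one power2_norm_eq_inner[symmetric])
 qed
 have dom: "n2 (t * d) \<le> norm (ap t (ap d h))" if t: "t \<in> A" for t
 proof -
  define c where "c = (norm t)\<^sup>2 + 1"
  have c: "c > 0" by (simp add: c_def add_nonneg_pos)
  define x where "x = adj (t * d) * (t * d)"
  have xA: "x \<in> A" using t d by (simp add: x_def)
  have px: "pos x" unfolding x_def by (rule pos_adj_mult)
  have 1: "pos (adj d * ((norm t)\<^sup>2 *\<^sub>R 1 - adj t * t) * d)"
   by (intro pos_conj pos_norm_sq_diff order_refl)
  have 2: "pos (d * (1 - d))" by (rule pos_commuting_mult) (simp_all add: d left_diff_distrib right_diff_distrib)
  have 3: "pos ((norm t)\<^sup>2 *\<^sub>R (d * (1 - d)))" using 2 by (intro pos_scaleR) simp_all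
  \<comment> \<open>A sum of positive terms equal to \<open>c * d - adj (t * d) * (t * d)\<close>.
    After division by \<open>c\<close> the square lies below \<open>1 - a\<close>, where the Hahn
    decomposition applies.\<close>
  have "pos (d + (adj d * ((norm t)\<^sup>2 *\<^sub>R 1 - adj t * t) * d + (norm t)\<^sup>2 *\<^sub>R (d * (1 - d))))"
   by (intro pos_add d 1 3)
  also have "d + (adj d * ((norm t)\<^sup>2 *\<^sub>R 1 - adj t * t) * d + (norm t)\<^sup>2 *\<^sub>R (d * (1 - d))) = c *\<^sub>R d - x"
   by (simp add: x_def c_def d(4) left_diff_distrib right_diff_distrib scaleR_add_left scaleR_diff_right mult.assoc)
  finally have "pos ((1/c) *\<^sub>R (c *\<^sub>R d - x))" using c by (intro pos_scaleR) simp_all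
  then have "pos (d - (1/c) *\<^sub>R x)" using c by (simp add: scaleR_diff_right)
  then have "Re (tau ((1/c) *\<^sub>R x)) \<le> inner h (ap ((1/c) *\<^sub>R x) h)"
   using xA px c by (intro a(5) pos_scaleR) (simp_all add: d_def)
  then have "Re (tau x) \<le> inner h (ap x h)" using c xA by (simp add: tau_scaleR divide_le_cancel)
  then have "(n2 (t * d))\<^sup>2 \<le> (norm (ap (t * d) h))\<^sup>2"
   unfolding norm_ap_square x_def using t d by (simp add: n2_sq)
  then show ?thesis using power2_le_imp_le[of "n2 (t * d)" "norm (ap (t * d) h)"] by simp
 qed
 \<comment> \<open>The polar part \<open>v\<close> of \<open>k = d - s\<close> is its sign, and
   \<open>p = (v * v + v) / 2\<close> the spectral projection of \<open>d\<close> for values above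
   \<open>s\<close>. It is nonzero because \<open>d <= s\<close> would contradict the norm of
   \<open>d\<close>.\<close>
 define s where "s = norm d / 2"
 have s: "s > 0" using d0 by (simp add: s_def)
 have nle: "\<not> pos (s *\<^sub>R 1 - d)"
 proof
  assume "pos (s *\<^sub>R 1 - d)"
  then have "norm d \<le> s" using s by (intro pos_norm_le d) simp_all
  then show False using d0 by (simp add: s_def)
 qed
 define k where "k = d - s *\<^sub>R 1"
 have k: "k \<in> A" "adj k = k" using d by (simp_all add: k_def)
 obtain v where v: "v \<in> A" "v * adj v * v = v" "k * (adj v * v) = k" "pos (adj v * k)" "adj v = v"
  using subalg_polar[OF subalg_self k(1)] k by blast
 define e where "e = v * v"
 have ve: "v * e = v" "e * v = v" using v(2,5) by (simp_all add: e_def mult.assoc)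
 have ee: "e * e = e" "adj e = e" using ve by (simp_all add: e_def v(5) mult.assoc)
 have ke: "k * e = k" using v(3,5) by (simp add: e_def)
 have ek: "e * k = k" using arg_cong[OF ke, of adj] by (simp add: ee k)
 have vk: "v * k = k * v" using pos_adj[OF v(4)] by (simp add: v(5) k(2))
 define p where "p = (1/2) *\<^sub>R (e + v)"
 have pp: "p * p = p"
 proof -
  have "(e + v) * (e + v) = (e + v) + (e + v)" using ve ee(1) by (simp add: distrib_left distrib_right e_def[symmetric])
  then have "p * p = (1/2) *\<^sub>R ((1/2) *\<^sub>R ((e + v) + (e + v)))" by (simp add: p_def)
  also have "(1/2) *\<^sub>R ((e + v) + (e + v)) = e + v" by (simp only: scaleR_half_double)
  finally show ?thesis by (simp add: p_def)
 qed
 have pr: "proj p" using v(1,5) ee(2) pp by (simp add: proj_def p_def e_def)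
 note p' = projD[OF pr]
 have p0: "p \<noteq> 0"
 proof
  assume "p = 0"
  then have "v = - e" by (simp add: p_def) (simp add: eq_neg_iff_add_eq_0 add.commute)
  then have "adj v * k = - k" using ek v(5) ee(2) by simp
  then show False using v(4) nle by (simp add: k_def)
 qed
 have pv: "p * v = p" using ve by (simp add: p_def distrib_right e_def[symmetric] add.commute)
 have "e * k = k * e" using ek ke by simp
 then have pk: "p * k = k * p" using vk by (simp add: p_def distrib_left distrib_right)
 have "pos (adj p * (adj v * k) * p)" by (rule pos_conj[OF v(4)])
 also have "adj p * (adj v * k) * p = k * p"
 proof -
  have "adj p * (adj v * k) * p = (p * v) * k * p" by (simp add: p' v(5) mult.assoc)
  also have "\<dots> = k * (p * p)" by (simp only: pv pk mult.assoc)
  finally show ?thesis by (simp only: pp)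
 qed
 finally have kp: "pos (k * p)" .
 have dk: "d = k + s *\<^sub>R 1" by (simp add: k_def)
 have "pos ((k * p) * (k + (2 * s) *\<^sub>R 1) + 0)"
 proof -
  have "pos (d + s *\<^sub>R 1)" using s by (intro pos_add d pos_scaleR) simp_all
  moreover have "d + s *\<^sub>R 1 = k + (2 * s) *\<^sub>R 1" by (simp add: dk scaleR_2 flip: scaleR_scaleR)
  ultimately have c: "pos (k + (2 * s) *\<^sub>R 1)" by simp
  have "(k * p) * k = k * (k * p)" using pk by (simp add: mult.assoc)
  then have "pos ((k * p) * (k + (2 * s) *\<^sub>R 1))"
   by (intro pos_commuting_mult[OF kp c]) (simp add: distrib_left distrib_right)
  then show ?thesis by simp
 qed
 moreover have "(k * p) * (k + (2 * s) *\<^sub>R 1) + 0 = d * d * p - s\<^sup>2 *\<^sub>R p"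
 proof -
  have "d * d * p = k * k * p + s *\<^sub>R (k * p) + (s *\<^sub>R (k * p) + s\<^sup>2 *\<^sub>R p)"
   by (simp add: dk distrib_left distrib_right power2_eq_square scaleR_add_right)
  moreover have "k * p * k = k * k * p" using pk by (simp add: mult.assoc)
  moreover have "(2 * s) *\<^sub>R (k * p) = s *\<^sub>R (k * p) + s *\<^sub>R (k * p)"
   by (simp flip: scaleR_add_left)
  ultimately show ?thesis by (simp add: distrib_left)
 qed
 ultimately have dp: "pos (d * d * p - s\<^sup>2 *\<^sub>R p)" by simp
 have pd: "p * d = d * p" using pk by (simp add: dk distrib_left distrib_right)
 have "pos (adj (d * (1 - p)) * (d * (1 - p)))" by (rule pos_adj_mult)
 also have "adj (d * (1 - p)) * (d * (1 - p)) = d * d - d * d * p"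
 proof -
  have "p * (d * d) = d * d * p" using pd by (metis mult.assoc)
  moreover have "d * d * p * p = d * d * p" by (simp only: mult.assoc pp)
  ultimately show ?thesis by (simp add: d(4) p' left_diff_distrib right_diff_distrib mult.assoc[symmetric])
 qed
 finally have "pos (d * d - d * d * p + (d * d * p - s\<^sup>2 *\<^sub>R p))" using dp by (rule pos_add)
 then have dd: "pos (d * d - s\<^sup>2 *\<^sub>R p)" by simp
 have fin: "n2 (t * p) \<le> norm (ap t ((1/s) *\<^sub>R ap d h))" if t: "t \<in> A" for t
 proof -
  have "pos (adj (adj t) * (d * d - s\<^sup>2 *\<^sub>R p) * adj t)" by (rule pos_conj[OF dd])
  then have "pos (t * (d * d) * adj t - s\<^sup>2 *\<^sub>R (t * p * adj t))" by (simp add: left_diff_distrib right_diff_distrib)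
  then have "s\<^sup>2 * Re (tau (t * p * adj t)) \<le> Re (tau (t * (d * d) * adj t))"
   using pos_tau_mono[of "s\<^sup>2 *\<^sub>R (t * p * adj t)" "t * (d * d) * adj t"] t d p' by (simp add: tau_scaleR)
  moreover have "(n2 (t * x))\<^sup>2 = Re (tau (t * (x * x) * adj t))" if "x \<in> A" "adj x = x" for x
   using tau_comm[of "adj (t * x)" "t * x"] t that by (simp add: n2_sq mult.assoc)
  ultimately have "s\<^sup>2 * (n2 (t * p))\<^sup>2 \<le> (n2 (t * d))\<^sup>2" using d p' by simp
  then have "(s * n2 (t * p))\<^sup>2 \<le> (n2 (t * d))\<^sup>2" by (simp add: power_mult_distrib)
  then have "s * n2 (t * p) \<le> n2 (t * d)" using t d by (intro power2_le_imp_le[of "s * n2 (t * p)"]) simp_all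
  then have "s * n2 (t * p) \<le> norm (ap t (ap d h))" using dom[OF t] by linarith
  then show ?thesis using s by (simp add: ap_linear field_simps)
 qed
 then show ?thesis using pr p0 by blast
qed

text \<open>Translates of \<open>p\<close> by partial isometries fill up 1 except for a remainder
  that itself embeds below \<open>p\<close>. So finitely many translates of one vector suffice in a
  factor. Strong neighbourhoods test finitely many vectors, hence they control the 2-norm.\<close>

theorem trace_dominated:
 "\<exists>(N::nat) h. \<forall>t\<in>A. n2 t \<le> (\<Sum>l<N. norm (ap t (h l)))"
proof -
 obtain p h where p: "proj p" "p \<noteq> 0" and dom: "\<And>t. t \<in> A ==> n2 (t * p) \<le> norm (ap t h)"
  using dominated_projection by blast
 obtain m :: nat and w where w: "\<And>l. l < m ==> w l \<in> A" "\<And>l. l < m ==> adj (w l) * w l = p"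
   and rest: "proj (1 - (\<Sum>l<m. w l * adj (w l)))" "Re (tau (1 - (\<Sum>l<m. w l * adj (w l)))) < Re (tau p)"
  using packing[OF p proj_one] by fastforce
 define q where "q = 1 - (\<Sum>l<m. w l * adj (w l))"
 obtain u where u: "u \<in> pis q p" "adj u * u = q" using comparison[OF rest(1) p(1)] rest(2) by (auto simp: q_def)
 note u' = pisD[OF u(1)]
 have un: "norm u \<le> 1" by (rule pis_norm[OF u(1)]) (use rest(1) in \<open>simp add: q_def\<close>)
 have wn: "norm (w l) \<le> 1" if "l < m" for l
  using proj_pos[OF proj_compl[OF p(1)]] w(2)[OF that] by (intro norm_le_of_sq) simp
 have wp: "w l * p = w l" if "l < m" for l
 proof -
  define x where "x = w l - w l * p"
  have "adj x * x = p - p * p - (p * p - p * p * p)"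
   using w(2)[OF that] projD(2)[OF p(1)] by (simp add: x_def left_diff_distrib right_diff_distrib mult.assoc) (simp add: mult.assoc[symmetric])
  then have "adj x * x = 0" using projD(3)[OF p(1)] by simp
  then have "norm (ap x z) = 0" for z using norm_ap_square[of x z] by simp
  then have "x = 0" by (intro bop_eqI) simp
  then show ?thesis by (simp add: x_def)
 qed
 define H where "H l = (if l < m then ap (w l) h else ap (adj u) h)" for l
 have "n2 t \<le> (\<Sum>l<Suc m. norm (ap t (H l)))" if t: "t \<in> A" for t
 proof -
  have e: "t = (\<Sum>l<m. t * (w l * adj (w l))) + t * q" by (simp add: q_def right_diff_distrib sum_distrib_left)
  have "n2 t \<le> n2 (\<Sum>l<m. t * (w l * adj (w l))) + n2 (t * q)"
   by (subst (1) e, rule n2_triangle) (use t w rest(1) in \<open>auto simp: q_def projD intro!: sum_in mult_in adj_in\<close>)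
  also have "n2 (\<Sum>l<m. t * (w l * adj (w l))) \<le> (\<Sum>l<m. n2 (t * (w l * adj (w l))))"
   using t w by (intro n2_sum_le) auto
  also have "\<dots> \<le> (\<Sum>l<m. norm (ap t (H l)))"
  proof (rule sum_mono)
   fix l assume "l \<in> {..<m}"
   then have l: "l < m" by simp
   have "t * (w l * adj (w l)) = (t * w l * p) * adj (w l)" using wp[OF l] by (simp add: mult.assoc)
   then have "n2 (t * (w l * adj (w l))) \<le> n2 (t * w l * p) * norm (w l)"
    using n2_mult_right[of "t * w l * p" "adj (w l)"] t w(1)[OF l] projD(1)[OF p(1)] by simp
   also have "\<dots> \<le> n2 (t * w l * p)" using wn[OF l] t w(1)[OF l] projD(1)[OF p(1)] by (intro mult_left_le) simp_all
   also have "\<dots> \<le> norm (ap (t * w l) h)" using dom[of "t * w l"] t w(1)[OF l] by simp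
   finally show "n2 (t * (w l * adj (w l))) \<le> norm (ap t (H l))" using l by (simp add: H_def)
  qed
  also have "n2 (t * q) \<le> norm (ap t (H m))"
  proof -
   have up: "adj u * p = adj u" using arg_cong[OF u'(4), of adj] projD(2)[OF p(1)] by simp
   have "t * q = (t * adj u * p) * u" using up u(2) by (simp add: mult.assoc)
   then have "n2 (t * q) \<le> n2 (t * adj u * p) * norm u"
    using n2_mult_right[of "t * adj u * p" u] t u'(1) projD(1)[OF p(1)] by simp
   also have "\<dots> \<le> n2 (t * adj u * p)" using un t u'(1) projD(1)[OF p(1)] by (intro mult_left_le) simp_all
   also have "\<dots> \<le> norm (ap (t * adj u) h)" using dom[of "t * adj u"] t u'(1) by simp
   finally show ?thesis by (simp add: H_def)
  qed
  finally show ?thesis by simp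
 qed
 then show ?thesis by blast
qed

end

section \<open>Approximation by matrix algebras\<close>

locale hyperfinite_factor = vn_factor A tau for A :: "'h::chilbert_space bop set" and tau +
 fixes F :: "nat => 'h bop set"
 assumes infinite_dim: "finite S ==> \<not> A \<subseteq> span S"
  and F_inc: "m \<le> n ==> F m \<subseteq> F n"
  and F_star: "star_alg (F n)" and F_sub: "F n \<subseteq> A"
  and F_fin: "\<exists>S. finite S \<and> F n \<subseteq> span S"
  and F_dense: "x \<in> A ==> finite H ==> e > 0 ==> \<exists>n. \<exists>y\<in>F n. \<forall>h\<in>H. norm (ap (x - y) h) < e"
begin

lemma F_n2_dense:
 assumes x: "x \<in> A" and e: "e > 0"
 shows "\<exists>n. \<exists>y\<in>F n. n2 (x - y) < e"
proof -
 obtain N :: nat and h where h: "\<And>t. t \<in> A ==> n2 t \<le> (\<Sum>l<N. norm (ap t (h l)))"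
  using trace_dominated by blast
 define d where "d = e / (real N + 1)"
 have d: "d > 0" using e by (simp add: d_def)
 have fin: "finite (h ` {..<N})" by simp
 obtain n y where y: "y \<in> F n" "\<forall>z\<in>h ` {..<N}. norm (ap (x - y) z) < d"
  using F_dense[OF x fin d] by metis
 have yA: "y \<in> A" using F_sub y(1) by blast
 have "n2 (x - y) \<le> (\<Sum>l<N. norm (ap (x - y) (h l)))" using h[of "x - y"] x yA by simp
 also have "\<dots> \<le> (\<Sum>l<N. d)" using y(2) by (intro sum_mono) (simp add: less_imp_le del: ap_simps)
 also have "\<dots> = e * (real N / (real N + 1))" by (simp add: d_def)
 also have "\<dots> < e * 1" using e by (intro mult_strict_left_mono) simp_all
 finally show ?thesis using y(1) by auto
qed

lemma F_n2_dense_finite: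
 assumes "finite X" "X \<subseteq> A" "e > 0"
 shows "\<exists>n. \<forall>x\<in>X. \<exists>y\<in>F n. n2 (x - y) < e" using assms(1,2)
proof (induction X rule: finite_induct)
 case (insert x X)
 then obtain n where n: "\<And>x. x \<in> X ==> \<exists>y\<in>F n. n2 (x - y) < e" by auto
 obtain k where k: "\<exists>y\<in>F k. n2 (x - y) < e" using F_n2_dense[of x e] insert.prems assms(3) by auto
 have "F n \<subseteq> F (max n k)" "F k \<subseteq> F (max n k)" using F_inc[of n "max n k"] F_inc[of k "max n k"] by simp_all
 then show ?case using n k by (intro exI[of _ "max n k"]) blast
qed simp

text \<open>A finite dimensional algebra close to \<open>X\<close> is a sum of matrix blocks whose
  minimal projections have unrelated traces. To fit them into one full matrix algebra, every
  representative minimal projection is cut into copies of one small projection \<open>r\<close> and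
  a remainder of trace less than that of \<open>r\<close>; the partial isometries \<open>v i\<close>
  distribute the copies over the block.\<close>

theorem matrix_approximation:
 assumes X: "finite X" "X \<subseteq> A" and e: "e > 0"
 shows "\<exists>(K::nat) g r. proj r \<and> r \<noteq> 0 \<and> (\<forall>i<K. g i \<in> A) \<and> (\<forall>i<K. \<forall>j<K. adj (g i) * g j = (if i = j then r else 0)) \<and>
  n2 (1 - (\<Sum>i<K. g i * adj (g i))) < e \<and>
  (\<forall>x\<in>X. \<exists>l. n2 (x - (\<Sum>i<K. \<Sum>j<K. csc (l i j) (g i * adj (g j)))) < e)"
proof -
 obtain N where N: "\<And>x. x \<in> X ==> \<exists>y\<in>F N. n2 (x - y) < e / 2"
  using F_n2_dense_finite[OF X, of "e/2"] e by auto
 then obtain Y where Y: "\<And>x. x \<in> X ==> Y x \<in> F N" "\<And>x. x \<in> X ==> n2 (x - Y x) < e / 2" by metis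
 obtain S where S: "finite S" "F N \<subseteq> span S" using F_fin by blast
 have sub: "subalg (F N)" by (rule subalg_finite_dim[OF F_star F_sub S])
 have "\<exists>n q c v. orth_family (F N) n q \<and> (\<Sum>i<n. q i) = 1 \<and>
  (\<forall>i<n. c i < n \<and> v i \<in> F N \<and> adj (v i) * v i = q (c i) \<and> v i * adj (v i) = q i) \<and>
  (\<forall>x\<in>F N. \<exists>l. x = (\<Sum>i<n. \<Sum>j<n. if c i = c j then csc (l i j) (v i * adj (v j)) else 0))"
  by (rule matrix_units[OF sub]) (rule orth_family_finite_dim[OF S])
 then obtain n :: nat and q :: "nat => 'h bop" and c :: "nat => nat" and v :: "nat => 'h bop" where q: "orth_family (F N) n q" "(\<Sum>i<n. q i) = 1"
  and v: "\<forall>i<n. c i < n \<and> v i \<in> F N \<and> adj (v i) * v i = q (c i) \<and> v i * adj (v i) = q i"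
  and F: "\<forall>x\<in>F N. \<exists>l. x = (\<Sum>i<n. \<Sum>j<n. if c i = c j then csc (l i j) (v i * adj (v j)) else 0)" by blast
 have qp: "proj (q i)" if "i < n" for i using q(1) that by (simp add: orth_family_def)
 have qij: "q i * q j = 0" if "i < n" "j < n" "i \<noteq> j" for i j using q(1) that by (simp add: orth_family_def)
 have c: "c i < n" if "i < n" for i using v that by blast
 have vA: "v i \<in> A" if "i < n" for i using v that F_sub by blast
 have vv: "adj (v i) * v i = q (c i)" "v i * adj (v i) = q i" if "i < n" for i using v that by blast+
 have vn: "norm (v i) \<le> 1" if "i < n" for i
  using proj_pos[OF proj_compl[OF qp[OF c[OF that]]]] vv(1)[OF that] by (intro norm_le_of_sq) simp
 have vpis: "v i \<in> pis (q (c i)) (q i)" if "i < n" for i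
 proof -
  have 1: "x * p = x" if p: "proj p" "adj x * x = p" for x p
  proof -
   have "adj (x - x * p) * (x - x * p) = p - p * p - (p * p - p * (p * p))"
    using p projD[OF p(1)] by (simp add: left_diff_distrib right_diff_distrib mult.assoc) (simp add: mult.assoc[symmetric])
   then have "adj (x - x * p) * (x - x * p) = 0" using projD(3)[OF p(1)] by simp
   then have "norm (ap (x - x * p) z) = 0" for z using norm_ap_square[of "x - x * p" z] by simp
   then have "x - x * p = 0" by (intro bop_eqI) simp
   then show ?thesis by simp
  qed
  have a: "v i * q (c i) = v i" by (rule 1[OF qp[OF c[OF that]] vv(1)[OF that]])
  have "adj (v i) * q i = adj (v i)" by (rule 1[OF qp[OF that]]) (simp add: vv(2)[OF that])
  then have "adj (adj (v i) * q i) = v i" by simp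
  then have b: "q i * v i = v i" using projD(2)[OF qp[OF that]] by simp
  show ?thesis using a b vA[OF that] vv(2)[OF that] by (simp add: pis_def)
 qed
 have "\<forall>x. \<exists>l. x \<in> X --> Y x = (\<Sum>i<n. \<Sum>j<n. if c i = c j then csc (l i j) (v i * adj (v j)) else 0)"
  using F Y(1) by blast
 from choice[OF this] obtain L where
  L: "\<And>x. x \<in> X ==> Y x = (\<Sum>i<n. \<Sum>j<n. if c i = c j then csc (L x i j) (v i * adj (v j)) else 0)"
  by blast
 \<comment> \<open>Bounds the total size of the coefficients of each \<open>Y x\<close> as well as
   the number \<open>n\<close> of minimal projections; the remainders enter the error of
   \<open>Y x\<close> and of the unit with these weights.\<close>
 define M where "M = (\<Sum>x\<in>X. \<Sum>i<n. \<Sum>j<n. cmod (L x i j)) + real n + 1"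
 have M: "(\<Sum>i<n. \<Sum>j<n. cmod (L x i j)) + real n < M" if "x \<in> X" for x
 proof -
  have "(\<Sum>i<n. \<Sum>j<n. cmod (L x i j)) \<le> (\<Sum>x\<in>X. \<Sum>i<n. \<Sum>j<n. cmod (L x i j))"
   using X(1) that by (intro member_le_sum[of x X "\<lambda>x. \<Sum>i<n. \<Sum>j<n. cmod (L x i j)"]) (auto intro!: sum_nonneg)
  then show ?thesis by (simp add: M_def)
 qed
 have M0: "real n < M" by (simp add: M_def sum_nonneg add_nonneg_pos)
 then have Mp: "M > 0" by simp
 define d where "d = e / (2 * M)"
 have d: "d > 0" using e Mp by (simp add: d_def)
 have Md: "M * d = e / 2" using Mp by (simp add: d_def)
 \<comment> \<open>The projection \<open>r\<close> is chosen after the coefficients: every remainder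
   has trace below that of \<open>r\<close>, hence 2-norm at most \<open>d\<close>.\<close>
 obtain r where r: "proj r" "r \<noteq> 0" "Re (tau r) < d\<^sup>2"
  using small_projection[OF infinite_dim, of "d\<^sup>2"] d by auto
 define Q where "Q s m w \<longleftrightarrow> (\<forall>l<m. w l \<in> A \<and> q s * w l = w l) \<and>
   (\<forall>l<m. \<forall>k<m. adj (w l) * w k = (if l = k then r else 0)) \<and>
   proj (q s - (\<Sum>l<m. w l * adj (w l))) \<and> Re (tau (q s - (\<Sum>l<m. w l * adj (w l)))) < Re (tau r)"
  for s and m :: nat and w
 have "\<exists>m w. Q s m w" if "s < n" for s unfolding Q_def by (rule packing[OF r(1,2) qp[OF that]])
 then have "\<forall>s. \<exists>m. s < n --> (\<exists>w. Q s m w)" by blast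
 from choice[OF this] obtain m where "\<forall>s. \<exists>w. s < n --> Q s (m s) w" by blast
 from choice[OF this] obtain w where Q: "\<And>s. s < n ==> Q s (m s) (w s)" by blast
 have w: "w s l \<in> A \<and> q s * w s l = w s l" if "s < n" "l < m s" for s l
  using Q[OF that(1)] that(2) by (simp add: Q_def)
 have ww: "adj (w s l) * w s k = (if l = k then r else 0)" if "s < n" "l < m s" "k < m s" for s l k
  using Q[OF that(1)] that(2,3) by (simp add: Q_def)
 have rem: "proj (q s - (\<Sum>l<m s. w s l * adj (w s l)))"
   "Re (tau (q s - (\<Sum>l<m s. w s l * adj (w s l)))) < Re (tau r)" if "s < n" for s
  using Q[OF that] by (simp_all add: Q_def)
 define R where "R s = q s - (\<Sum>l<m s. w s l * adj (w s l))" for s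
 have RA: "R s \<in> A" if "s < n" for s using projD(1)[OF rem(1)[OF that]] by (simp add: R_def)
 have Rn: "n2 (R s) \<le> d" if "s < n" for s
 proof (rule power2_le_imp_le)
  show "(n2 (R s))\<^sup>2 \<le> d\<^sup>2"
   using rem[OF that, folded R_def] r(3) n2_sq[OF RA[OF that]] projD[OF rem(1)[OF that, folded R_def]] by simp
 qed (use d in simp)
 have vRv: "n2 (v i * R (c i) * adj (v j)) \<le> d" if "i < n" "j < n" for i j
 proof -
  note A = vA[OF that(1)] vA[OF that(2)] RA[OF c[OF that(1)]]
  have "n2 (v i * R (c i) * adj (v j)) \<le> n2 (v i * R (c i)) * norm (v j)"
   using n2_mult_right[of "v i * R (c i)" "adj (v j)"] A by simp
  also have "\<dots> \<le> n2 (v i * R (c i))" using vn[OF that(2)] A by (intro mult_left_le) simp_all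
  also have "\<dots> \<le> norm (v i) * n2 (R (c i))" using A by (intro n2_mult_left) simp_all
  also have "\<dots> \<le> 1 * n2 (R (c i))" using vn[OF that(1)] A by (intro mult_right_mono) simp_all
  finally show ?thesis using Rn[OF c[OF that(1)]] by simp
 qed
 \<comment> \<open>A pair \<open>(i, l)\<close> stands for the copy number \<open>l\<close> of
   \<open>r\<close> inside \<open>q (c i)\<close>, moved below \<open>q i\<close> by
   \<open>v i\<close>.\<close>
 define I where "I = Sigma {..<n} (\<lambda>i. {..<m (c i)})"
 have finI: "finite I" by (simp add: I_def)
 define G where "G z = v (fst z) * w (c (fst z)) (snd z)" for z
 have GA: "G z \<in> A" if "z \<in> I" for z using that vA w c by (auto simp: G_def I_def)
 have GG: "adj (G y) * G z = (if y = z then r else 0)" if "y \<in> I" "z \<in> I" for y z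
 proof -
  obtain i l j k where yz: "y = (i, l)" "z = (j, k)" by (metis surj_pair)
  have il: "i < n" "l < m (c i)" "j < n" "k < m (c j)" using that by (auto simp: I_def yz)
  have e: "adj (G y) * G z = adj (w (c i) l) * (adj (v i) * v j) * w (c j) k" by (simp add: G_def yz mult.assoc)
  show ?thesis
  proof (cases "i = j")
   case True
   have "adj (G y) * G z = adj (w (c i) l) * q (c i) * w (c i) k" using e vv(1)[OF il(1)] True by simp
   then have "adj (G y) * G z = adj (w (c i) l) * (q (c i) * w (c i) k)" by (simp only: mult.assoc)
   then show ?thesis using w[OF c[OF il(1)], of k] ww[OF c[OF il(1)], of l k] il True by (simp add: yz)
  next
   case False
   have "adj (v i) * v j = adj (q i * v i) * (q j * v j)" using pisD(4)[OF vpis[OF il(1)]] pisD(4)[OF vpis[OF il(3)]] by simp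
   also have "\<dots> = adj (v i) * (q i * q j) * v j" using projD(2)[OF qp[OF il(1)]] by (simp add: mult.assoc)
   finally show ?thesis using e qij[OF il(1,3) False] False by (simp add: yz)
  qed
 qed
 have wsum: "(\<Sum>l<m (c i). v i * w (c i) l * adj (v j * w (c i) l)) = v i * (q (c i) - R (c i)) * adj (v j)" for i j
  by (simp add: R_def sum_distrib_left sum_distrib_right mult.assoc)
 have Isum: "(\<Sum>z\<in>I. f z) = (\<Sum>i<n. \<Sum>a<m (c i). f (i, a))" for f :: "nat \<times> nat => 'h bop"
  unfolding I_def using sum.Sigma[of "{..<n}" "\<lambda>i. {..<m (c i)}" "\<lambda>i a. f (i, a)"] by simp
 have unit: "n2 (1 - (\<Sum>z\<in>I. G z * adj (G z))) < e"
 proof -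
  have "(\<Sum>z\<in>I. G z * adj (G z)) = (\<Sum>i<n. \<Sum>l<m (c i). v i * w (c i) l * adj (v i * w (c i) l))"
   by (simp only: Isum G_def fst_conv snd_conv)
  also have "\<dots> = (\<Sum>i<n. q i - v i * R (c i) * adj (v i))"
   unfolding wsum using pisD(3)[OF vpis] vv(2) by (intro sum.cong) (simp_all add: left_diff_distrib right_diff_distrib)
  finally have "1 - (\<Sum>z\<in>I. G z * adj (G z)) = (\<Sum>i<n. v i * R (c i) * adj (v i))"
   by (simp add: sum_subtractf q(2))
  then have "n2 (1 - (\<Sum>z\<in>I. G z * adj (G z))) \<le> (\<Sum>i<n. n2 (v i * R (c i) * adj (v i)))"
   using n2_sum_le[of "{..<n}" "\<lambda>i. v i * R (c i) * adj (v i)"] vA RA c by simp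
  also have "\<dots> \<le> (\<Sum>i<n. d)" by (intro sum_mono) (simp add: vRv)
  also have "\<dots> \<le> M * d" using M0 d by simp
  finally show ?thesis using Md e by simp
 qed
 have appr: "\<exists>l. n2 (x - (\<Sum>y\<in>I. \<Sum>z\<in>I. csc (l y z) (G y * adj (G z)))) < e" if x: "x \<in> X" for x
 proof -
  define l where "l y z = (if snd y = snd z \<and> c (fst y) = c (fst z) then L x (fst y) (fst z) else 0)" for y z :: "nat \<times> nat"
  define T where "T = (\<Sum>y\<in>I. \<Sum>z\<in>I. csc (l y z) (G y * adj (G z)))"
  have "T = (\<Sum>i<n. \<Sum>a<m (c i). \<Sum>j<n. \<Sum>b<m (c j). csc (l (i, a) (j, b)) (G (i, a) * adj (G (j, b))))"
   unfolding T_def by (simp only: Isum)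
  also have "\<dots> = (\<Sum>i<n. \<Sum>j<n. \<Sum>a<m (c i). \<Sum>b<m (c j). csc (l (i, a) (j, b)) (G (i, a) * adj (G (j, b))))"
   by (intro sum.cong refl sum.swap)
  also have "\<dots> = (\<Sum>i<n. \<Sum>j<n. if c i = c j then csc (L x i j) (v i * (q (c i) - R (c i)) * adj (v j)) else 0)"
  proof (intro sum.cong refl)
   fix i j assume "i \<in> {..<n}" "j \<in> {..<n}"
   show "(\<Sum>a<m (c i). \<Sum>b<m (c j). csc (l (i, a) (j, b)) (G (i, a) * adj (G (j, b)))) =
     (if c i = c j then csc (L x i j) (v i * (q (c i) - R (c i)) * adj (v j)) else 0)"
   proof (cases "c i = c j")
    case True
    have "(\<Sum>a<m (c i). \<Sum>b<m (c j). csc (l (i, a) (j, b)) (G (i, a) * adj (G (j, b)))) =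
     (\<Sum>a<m (c i). \<Sum>b<m (c i). if a = b then csc (L x i j) (G (i, a) * adj (G (j, a))) else 0)"
     using True by (intro sum.cong) (auto simp: l_def)
    also have "\<dots> = (\<Sum>a<m (c i). csc (L x i j) (v i * w (c i) a * adj (v j * w (c i) a)))"
     using True by (simp add: G_def)
    also have "\<dots> = csc (L x i j) (v i * (q (c i) - R (c i)) * adj (v j))"
     by (simp only: csc_sum[symmetric] wsum)
    finally show ?thesis using True by simp
   qed (simp add: l_def)
  qed
  finally have T: "T = \<dots>" .
  have "Y x - T = (\<Sum>i<n. \<Sum>j<n. if c i = c j then csc (L x i j) (v i * R (c i) * adj (v j)) else 0)"
   unfolding T L[OF x] sum_subtractf[symmetric]
  proof (intro sum.cong refl)
   fix i j assume "i \<in> {..<n}" "j \<in> {..<n}"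
   then have vq: "v i * q (c i) = v i" using pisD(3)[OF vpis[of i]] by simp
   show "(if c i = c j then csc (L x i j) (v i * adj (v j)) else 0) -
     (if c i = c j then csc (L x i j) (v i * (q (c i) - R (c i)) * adj (v j)) else 0) =
     (if c i = c j then csc (L x i j) (v i * R (c i) * adj (v j)) else 0)"
   proof (cases "c i = c j")
    case True
    then show ?thesis using vq by (simp add: right_diff_distrib left_diff_distrib csc_diff_right)
   qed simp
  qed
  also have "n2 \<dots> \<le> (\<Sum>i<n. n2 (\<Sum>j<n. if c i = c j then csc (L x i j) (v i * R (c i) * adj (v j)) else 0))"
   using vA RA c by (intro n2_sum_le) (auto intro!: sum_in)
  also have "\<dots> \<le> (\<Sum>i<n. \<Sum>j<n. n2 (if c i = c j then csc (L x i j) (v i * R (c i) * adj (v j)) else 0))"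
   using vA RA c by (intro sum_mono n2_sum_le) auto
  also have "\<dots> \<le> (\<Sum>i<n. \<Sum>j<n. cmod (L x i j) * d)"
  proof (intro sum_mono)
   fix i j assume "i \<in> {..<n}" "j \<in> {..<n}"
   then have ij: "i < n" "j < n" by simp_all
   have "v i * R (c i) * adj (v j) \<in> A" using vA RA c ij by simp
   then have key: "n2 (csc (L x i j) (v i * R (c i) * adj (v j))) \<le> cmod (L x i j) * d"
    using vRv[OF ij] by (simp add: n2_csc mult_left_mono)
   show "n2 (if c i = c j then csc (L x i j) (v i * R (c i) * adj (v j)) else 0) \<le> cmod (L x i j) * d"
   proof (cases "c i = c j")
    case True
    then show ?thesis using key by simp
   qed (use d in simp)
  qed
  also have "\<dots> = (\<Sum>i<n. \<Sum>j<n. cmod (L x i j)) * d" by (simp add: sum_distrib_right)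
  also have "\<dots> < M * d" using M[OF x] d by simp
  finally have 1: "n2 (Y x - T) < e / 2" by (simp add: Md)
  have TA: "T \<in> A" unfolding T_def using GA by (intro sum_in csc_in mult_in adj_in)
  have "n2 (x - T) \<le> n2 (x - Y x) + n2 (Y x - T)"
   using x X Y(1)[OF x] F_sub TA by (intro n2_dist_triangle) auto
  then have "n2 (x - T) < e" using 1 Y(2)[OF x] by simp
  then show ?thesis unfolding T_def by blast
 qed
 obtain h where h: "bij_betw h {..<card I} I"
  using ex_bij_betw_nat_finite[OF finI] by (auto simp: atLeast0LessThan)
 have hI: "h i \<in> I" if "i < card I" for i using bij_betwE[OF h] that by simp
 have hinj: "h i = h j \<longleftrightarrow> i = j" if "i < card I" "j < card I" for i j
  using bij_betw_imp_inj_on[OF h] that by (auto simp: inj_on_def)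
 have hsum: "(\<Sum>z\<in>I. f z) = (\<Sum>i<card I. f (h i))" for f :: "nat \<times> nat => 'h bop"
  by (rule sum.reindex_bij_betw[OF h, symmetric])
 have 1: "\<forall>i<card I. G (h i) \<in> A" using GA hI by blast
 have 2: "\<forall>i<card I. \<forall>j<card I. adj (G (h i)) * G (h j) = (if i = j then r else 0)" using GG hI hinj by simp
 have 3: "n2 (1 - (\<Sum>i<card I. G (h i) * adj (G (h i)))) < e" using unit by (simp only: hsum)
 have 4: "\<exists>l. n2 (x - (\<Sum>i<card I. \<Sum>j<card I. csc (l i j) (G (h i) * adj (G (h j))))) < e" if x: "x \<in> X" for x
 proof -
  obtain l where "n2 (x - (\<Sum>y\<in>I. \<Sum>z\<in>I. csc (l y z) (G y * adj (G z)))) < e" using appr[OF x] by blast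
  then show ?thesis unfolding hsum by (intro exI[of _ "\<lambda>i j. l (h i) (h j)"])
 qed
 show ?thesis
  by (rule exI[of _ "card I"], rule exI[of _ "\<lambda>i. G (h i)"], rule exI[of _ r]) (use r(1,2) 1 2 3 4 in blast)
qed

end

section \<open>A quantum expander\<close>

lemma bop_eq_0I: "adj x * x = 0 ==> x = 0"
proof -
 assume "adj x * x = 0"
 then have "norm (ap x z) = 0" for z using norm_ap_square[of x z] by simp
 then show ?thesis by (intro bop_eqI) simp
qed

lemma isometry_initial:
 assumes "adj p = p" "p * p = p" "adj x * x = p" shows "x * p = x"
proof -
 have "adj (x - x * p) * (x - x * p) = (adj x * x) - (adj x * x) * p - (p * (adj x * x) - p * (adj x * x) * p)"
  using assms(1) by (simp add: left_diff_distrib right_diff_distrib mult.assoc)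
 also have "\<dots> = 0" by (simp add: assms(2,3))
 finally show ?thesis using bop_eq_0I[of "x - x * p"] by simp
qed

text \<open>The elements \<open>g i * adj (g j)\<close> are matrix units of size \<open>K\<close>
  for the corner \<open>f\<close>, with multiplicity space \<open>r\<close>. The unit
  \<open>f\<close> of the matrix algebra need not be 1.\<close>

locale matrix_system = vn_factor A tau for A :: "'h::chilbert_space bop set" and tau +
 fixes K :: nat and g :: "nat => 'h bop" and r :: "'h bop"
 assumes K: "K > 0" and r: "proj r" "r \<noteq> 0" and gA: "i < K ==> g i \<in> A"
  and gg: "i < K ==> j < K ==> adj (g i) * g j = (if i = j then r else 0)"
begin

definition Z :: "int set" where "Z = {0..<int K}"
text \<open>Columns indexed periodically by all integers, so that shifting an index needs no case
  distinction at the boundary.\<close>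

definition gm :: "int => 'h bop" where "gm a = g (nat (a mod int K))"
definition om :: "int => complex" where "om a = cis (2 * pi * of_int a / of_nat K)"
definition f :: "'h bop" where "f = (\<Sum>a\<in>Z. gm a * adj (gm a))"

lemma finZ [simp]: "finite Z" by (simp add: Z_def)
lemma modZ: "a mod int K \<in> Z" using K by (simp add: Z_def)
lemma Zmod: "a \<in> Z ==> a mod int K = a" by (simp add: Z_def)

lemma om_add: "om (a + b) = om a * om b" by (simp add: om_def cis_mult distrib_left add_divide_distrib)
lemma om_zero [simp]: "om 0 = 1" by (simp add: om_def)
lemma om_minus: "om (- a) = cnj (om a)" by (simp add: om_def cis_cnj)
lemma om_norm [simp]: "cmod (om a) = 1" by (simp add: om_def)
lemma om_cnj [simp]: "om a * cnj (om a) = 1" "cnj (om a) * om a = 1"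
 using om_add[of a "-a"] by (simp_all add: om_minus mult.commute)
lemma om_cancel [simp]: "om (- a) * om a = 1" by (simp add: om_minus)
lemma om_mult_K: "om (int K * a) = 1"
proof -
 have "2 * pi * of_int (int K * a) / of_nat K = 2 * pi * of_int a" using K by simp
 then show ?thesis unfolding om_def using cis_multiple_2pi[of "of_int a"] by simp
qed
lemma om_diff: "om (a - b) = om a * cnj (om b)" using om_add[of a "- b"] by (simp add: om_minus)
lemma om_mod: "om (a mod int K) = om a"
proof -
 have "om a = om (int K * (a div int K) + a mod int K)" by simp
 then show ?thesis by (simp only: om_add om_mult_K) simp
qed
lemma om_mult_mod: "om (a mod int K * b) = om (a * b)"
proof -
 have "om (a * b) = om (int K * (a div int K * b) + a mod int K * b)"
  by (metis mult_div_mod_eq distrib_right mult.assoc)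
 then show ?thesis by (simp only: om_add om_mult_K) simp
qed
lemma om_power: "om a ^ n = om (a * int n)" by (induction n) (simp_all add: om_add distrib_left mult.commute)

lemma om_eq_1: "om a = 1 \<longleftrightarrow> int K dvd a"
proof
 assume "om a = 1"
 then have "cos (2 * pi * of_int a / of_nat K) = 1" unfolding om_def by (metis cis.sel(1) one_complex.sel(1))
 then obtain n :: int where "2 * pi * of_int a / of_nat K = of_int n * 2 * pi" using cos_one_2pi_int by auto
 then have "real_of_int a = real_of_int n * real K" using K by (simp add: field_simps)
 then have "a = n * int K" by (metis of_int_eq_iff of_int_mult of_int_of_nat_eq)
 then show "int K dvd a" by simp
next
 assume "int K dvd a"
 then show "om a = 1" by (auto simp: dvd_def om_mult_K)
qed

lemma om_sum: "(\<Sum>i<K. om (a * int i)) = (if int K dvd a then of_nat K else 0)"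
proof (cases "int K dvd a")
 case True
 then have "om (a * int i) = 1" for i using om_eq_1[of "a * int i"] by simp
 then show ?thesis using True by simp
next
 case False
 have "(\<Sum>i<K. om (a * int i)) = (\<Sum>i<K. om a ^ i)" by (simp add: om_power)
 also have "\<dots> = (om a ^ K - 1) / (om a - 1)" using False om_eq_1[of a] by (intro geometric_sum) simp
 also have "om a ^ K = 1" using om_mult_K[of a] by (simp add: om_power mult.commute)
 finally show ?thesis using False by simp
qed

lemma sum_Z: "(\<Sum>a\<in>Z. h a) = (\<Sum>i<K. h (int i))"
proof -
 have "Z = int ` {..<K}" by (auto simp: Z_def image_iff) (metis nat_0_le of_nat_less_iff lessThan_iff)
 then show ?thesis by (simp add: sum.reindex)
qed

lemma om_sum_Z: "(\<Sum>b\<in>Z. om (a * b)) = (if int K dvd a then of_nat K else 0)"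
 using om_sum[of a] by (simp add: sum_Z)

lemma periodic_sum_shift:
 fixes h :: "int => 'b::ab_group_add"
 assumes "\<And>a. h (a + int K) = h a"
 shows "(\<Sum>a\<in>Z. h (a + 1)) = (\<Sum>a\<in>Z. h a)"
proof -
 have "(\<Sum>i<K. h (int (Suc i))) - (\<Sum>i<K. h (int i)) = h (int K) - h (int 0)"
  unfolding sum_subtractf[symmetric] by (rule sum_lessThan_telescope)
 then show ?thesis using assms[of 0] by (simp add: sum_Z add.commute)
qed

lemma gmA [simp]: "gm a \<in> A"
 using gA[of "nat (a mod int K)"] modZ[of a] by (simp add: gm_def Z_def nat_less_iff)
lemma gm_mod: "gm (a mod int K) = gm a" by (simp add: gm_def)
lemma gm_period: "gm (a + int K) = gm a" by (simp add: gm_def)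
lemma gmgm: "adj (gm a) * gm b = (if a mod int K = b mod int K then r else 0)"
proof -
 have "nat (a mod int K) < K" "nat (b mod int K) < K" using modZ[of a] modZ[of b] by (simp_all add: Z_def nat_less_iff)
 moreover have "nat (a mod int K) = nat (b mod int K) \<longleftrightarrow> a mod int K = b mod int K"
  using modZ[of a] modZ[of b] by (intro eq_nat_nat_iff) (simp_all add: Z_def)
 ultimately show ?thesis using gg by (simp add: gm_def)
qed
lemma gmr: "gm a * r = gm a" by (rule isometry_initial) (simp_all add: projD r gmgm)
lemma rgm: "r * adj (gm a) = adj (gm a)" using arg_cong[OF gmr[of a], of adj] projD(2)[OF r(1)] by simp

text \<open>The operator that sends the column \<open>gm b\<close> to \<open>h b\<close>. Unitaries
  are given by their columns, and by \<open>f_ext\<close> identities between them can be checked on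
  columns.\<close>

definition col :: "(int => 'h bop) => 'h bop" where "col h = (\<Sum>a\<in>Z. h a * adj (gm a))"

lemma col_gm:
 assumes "\<And>a. h (a mod int K) = h a" "\<And>a. h a * r = h a"
 shows "col h * gm b = h b"
proof -
 have "col h * gm b = (\<Sum>a\<in>Z. h a * (adj (gm a) * gm b))" by (simp add: col_def sum_distrib_right mult.assoc)
 also have "\<dots> = (\<Sum>a\<in>Z. if a = b mod int K then h b else 0)"
  using assms by (intro sum.cong) (auto simp: gmgm Zmod)
 finally show ?thesis using modZ[of b] by simp
qed

lemma f_col: "f = col gm" by (simp add: f_def col_def)
lemma f_gm: "f * gm b = gm b" unfolding f_col by (rule col_gm) (simp_all add: gm_mod gmr)
lemma f_adj [simp]: "adj f = f" by (simp add: f_def adj_sum)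
lemma fA [simp]: "f \<in> A" by (simp add: f_def)
lemma gm_f: "adj (gm b) * f = adj (gm b)" using arg_cong[OF f_gm[of b], of adj] by simp
lemma ff [simp]: "f * f = f"
proof -
 have "f * f = (\<Sum>a\<in>Z. (f * gm a) * adj (gm a))" by (subst (2) f_def) (simp add: sum_distrib_left mult.assoc)
 then show ?thesis by (simp only: f_gm f_def[symmetric])
qed
lemma proj_f: "proj f" by (simp add: proj_def)

lemma f_ext:
 assumes "y * f = y" "z * f = z" "\<And>b. y * gm b = z * gm b"
 shows "y = z"
proof -
 have "x * f = (\<Sum>a\<in>Z. (x * gm a) * adj (gm a))" for x by (simp add: f_def sum_distrib_left mult.assoc)
 then have "y * f = z * f" using assms(3) by simp
 then show ?thesis using assms(1,2) by simp
qed

lemma corner_f_eq: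
 assumes "f * x = x" "x * f = x"
 shows "x = (\<Sum>a\<in>Z. \<Sum>b\<in>Z. gm a * (adj (gm a) * x * gm b) * adj (gm b))"
proof -
 have "x = f * x * f" using assms by simp
 also have "\<dots> = (\<Sum>b\<in>Z. \<Sum>a\<in>Z. gm a * adj (gm a) * x * (gm b * adj (gm b)))"
  by (simp add: f_def sum_distrib_left sum_distrib_right)
 also have "\<dots> = (\<Sum>a\<in>Z. \<Sum>b\<in>Z. gm a * (adj (gm a) * x * gm b) * adj (gm b))"
  by (subst sum.swap) (simp add: mult.assoc)
 finally show ?thesis .
qed

abbreviation "UF \<equiv> corner_unitaries f"

text \<open>The relations of the columns give \<open>adj y * y = f\<close>. The projection
  \<open>y * adj y\<close> lies below \<open>f\<close> and has the same trace, so it is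
  \<open>f\<close> as well.\<close>

lemma col_unitary:
 assumes h: "\<And>a. h a \<in> A" "\<And>a. h a * r = h a" "\<And>a. f * h a = h a"
  and hh: "\<And>a b. a \<in> Z ==> b \<in> Z ==> adj (h a) * h b = (if a = b then r else 0)"
 shows "col h \<in> UF"
proof -
 define y where "y = col h"
 have yA: "y \<in> A" using h by (simp add: y_def col_def)
 have fy: "f * y = y" using h(3) by (simp add: y_def col_def sum_distrib_left mult.assoc[symmetric])
 have yf: "y * f = y" by (simp add: y_def col_def sum_distrib_right mult.assoc gm_f)
 have "adj y * y = (\<Sum>b\<in>Z. \<Sum>a\<in>Z. gm a * (adj (h a) * h b) * adj (gm b))"
  by (simp add: y_def col_def adj_sum sum_distrib_left sum_distrib_right mult.assoc)
 also have "\<dots> = (\<Sum>b\<in>Z. \<Sum>a\<in>Z. if a = b then gm b * adj (gm b) else 0)"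
  using hh by (intro sum.cong) (auto simp: gmr)
 also have "\<dots> = f" by (simp add: f_def)
 finally have 1: "adj y * y = f" .
 define p where "p = y * adj y"
 have "p * p = y * (adj y * y) * adj y" by (simp add: p_def mult.assoc)
 then have pp: "proj p" using yA yf by (simp add: proj_def p_def 1)
 have fp: "f * p = p" using fy by (simp add: p_def mult.assoc[symmetric])
 have pf: "p * f = p" using arg_cong[OF fp, of adj] projD(2)[OF pp] by simp
 have "proj (f - p)" using pp fp pf by (simp add: proj_def left_diff_distrib right_diff_distrib)
 moreover have "Re (tau (f - p)) \<le> 0"
  using tau_comm[of y "adj y"] yA 1 projD(1)[OF pp] by (simp add: p_def tau_simps)
 ultimately have "f - p = 0" using pos_tau_zero[of "f - p"] proj_pos[of "f - p"] projD(1) by blast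
 then have "y * adj y = f" by (simp add: p_def)
 then show ?thesis using 1 yA fy yf by (simp add: corner_unitaries_def y_def)
qed

section \<open>Clock, shift, quadratic phase and Fourier unitaries\<close>

definition u where "u = col (\<lambda>a. csc (om a) (gm a))"
definition v where "v = col (\<lambda>a. gm (a + 1))"
text \<open>A quadratic phase. The exponent \<open>a * (a + K)\<close> in place of the square of
  \<open>a\<close> makes it periodic modulo \<open>K\<close> for even and for odd
  \<open>K\<close>.\<close>

definition ze :: "int => complex" where "ze a = cis (pi * of_int (a * (a + int K)) / of_nat K)"
definition w where "w = col (\<lambda>a. csc (ze a) (gm a))"
definition rK :: complex where "rK = complex_of_real (1 / sqrt (real K))"
definition S where "S = col (\<lambda>a. \<Sum>c\<in>Z. csc (rK * om (c * a)) (gm c))"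

lemma ze_norm: "ze a * cnj (ze a) = 1" "cnj (ze a) * ze a = 1" by (simp_all add: ze_def cis_cnj cis_mult)

lemma ze_period: "ze (a + int K) = ze a"
proof -
 have "pi * of_int ((a + int K) * (a + int K + int K)) / of_nat K =
   pi * of_int (a * (a + int K)) / of_nat K + 2 * pi * of_int (a + int K)" using K by (simp add: field_simps)
 then have "ze (a + int K) = ze a * cis (2 * pi * of_int (a + int K))" by (simp only: ze_def cis_mult)
 then show ?thesis using cis_multiple_2pi[of "of_int (a + int K)"] by simp
qed

lemma ze_mod: "ze (a mod int K) = ze a"
proof -
 have n: "ze (b + int K * int n) = ze b" for b n
 proof (induction n)
  case (Suc n)
  then show ?case using ze_period[of "b + int K * int n"] by (simp add: algebra_simps)
 qed simp
 show ?thesis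
 proof (cases "a div int K \<ge> 0")
  case True
  then have "a = a mod int K + int K * int (nat (a div int K))" by simp
  then show ?thesis using n[of "a mod int K" "nat (a div int K)"] by metis
 next
  case False
  then have "a mod int K = a + int K * int (nat (- (a div int K)))" by (simp add: minus_mult_div_eq_mod[symmetric])
  then show ?thesis using n[of a "nat (- (a div int K))"] by metis
 qed
qed

lemma ze_step: "ze (a + 1) = cis (pi * of_int (1 + int K) / of_nat K) * om a * ze a"
proof -
 have "pi * of_int ((a + 1) * (a + 1 + int K)) / of_nat K =
   pi * of_int (1 + int K) / of_nat K + 2 * pi * of_int a / of_nat K + pi * of_int (a * (a + int K)) / of_nat K"
  using K by (simp add: field_simps)
 then show ?thesis by (simp only: ze_def om_def cis_mult)
qed

lemma u_gm: "u * gm b = csc (om b) (gm b)" unfolding u_def by (rule col_gm) (simp_all add: om_mod gm_mod gmr)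
lemma v_gm: "v * gm b = gm (b + 1)"
 unfolding v_def by (rule col_gm) (simp_all add: gmr, metis gm_mod mod_add_left_eq)
lemma w_gm: "w * gm b = csc (ze b) (gm b)" unfolding w_def by (rule col_gm) (simp_all add: ze_mod gm_mod gmr)
lemma om_mult_mod': "om (a * (b mod int K)) = om (a * b)"
 using om_mult_mod[of b a] by (simp add: mult.commute)
lemma S_gm: "S * gm b = (\<Sum>c\<in>Z. csc (rK * om (c * b)) (gm c))"
 unfolding S_def by (rule col_gm) (simp_all add: om_mult_mod' sum_distrib_right gmr)

lemma u_unitary: "u \<in> UF" unfolding u_def by (rule col_unitary) (auto simp: gmr f_gm gmgm Zmod)
lemma w_unitary: "w \<in> UF" unfolding w_def by (rule col_unitary) (auto simp: gmr f_gm gmgm Zmod ze_norm)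
lemma v_unitary: "v \<in> UF" unfolding v_def
proof (rule col_unitary)
 fix a b assume ab: "a \<in> Z" "b \<in> Z"
 have "(a + 1) mod int K = (b + 1) mod int K \<longleftrightarrow> a mod int K = b mod int K"
  by (metis add_diff_cancel_right' mod_add_left_eq mod_diff_left_eq)
 then show "adj (gm (a + 1)) * gm (b + 1) = (if a = b then r else 0)" using ab by (simp add: gmgm Zmod)
qed (simp_all add: gmr f_gm)
lemma rK_cnj: "cnj rK = rK" by (simp add: rK_def)
lemma rK_sq: "rK * rK * of_nat K = 1"
proof -
 have "complex_of_real (1 / sqrt (real K) * (1 / sqrt (real K)) * real K) = 1" using K by simp
 then show ?thesis unfolding rK_def by (simp only: of_real_mult of_real_of_nat_eq)
qed
lemma S_unitary: "S \<in> UF" unfolding S_def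
proof (rule col_unitary)
 fix a b assume ab: "a \<in> Z" "b \<in> Z"
 have "adj (\<Sum>c\<in>Z. csc (rK * om (c * a)) (gm c)) * (\<Sum>c\<in>Z. csc (rK * om (c * b)) (gm c)) =
   (\<Sum>d\<in>Z. \<Sum>c\<in>Z. csc (rK * cnj (om (c * a)) * (rK * om (d * b))) (adj (gm c) * gm d))"
  by (simp add: adj_sum sum_distrib_left sum_distrib_right rK_cnj csc_sum mult.commute mult.left_commute)
 also have "\<dots> = (\<Sum>d\<in>Z. \<Sum>c\<in>Z. if c = d then csc (rK * rK * om (d * (b - a))) r else 0)"
 proof (intro sum.cong refl)
  fix c d assume "c \<in> Z" "d \<in> Z"
  then show "csc (rK * cnj (om (c * a)) * (rK * om (d * b))) (adj (gm c) * gm d) =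
    (if c = d then csc (rK * rK * om (d * (b - a))) r else 0)"
   by (auto simp: gmgm Zmod right_diff_distrib om_diff mult_ac)
 qed
 also have "\<dots> = csc (rK * rK * (\<Sum>d\<in>Z. om ((b - a) * d))) r"
 proof -
  have csc_sum_left: "(\<Sum>d\<in>D. csc (q d) r) = csc (\<Sum>d\<in>D. q d) r" for q and D :: "int set"
   by (induction D rule: infinite_finite_induct) (simp_all add: csc_add_left)
  show ?thesis by (simp add: csc_sum_left sum_distrib_left mult.commute[of "b - a"])
 qed
 also have "\<dots> = (if a = b then r else 0)"
 proof (cases "a = b")
  case False
  then have "\<not> int K dvd b - a" using ab by (metis Zmod mod_eq_dvd_iff)
  then show ?thesis using False by (simp add: om_sum_Z)
 qed (simp add: om_sum_Z[of 0, simplified] rK_sq)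
 finally show "adj (\<Sum>c\<in>Z. csc (rK * om (c * a)) (gm c)) * (\<Sum>c\<in>Z. csc (rK * om (c * b)) (gm c)) = (if a = b then r else 0)" .
qed (simp_all add: sum_distrib_right sum_distrib_left gmr f_gm)

lemma UF_D:
 assumes "y \<in> UF"
 shows "y \<in> A" "adj y * y = f" "y * adj y = f" "f * y = y" "y * f = y" "adj y * f = adj y" "f * adj y = adj y" "norm y \<le> 1"
proof -
 note D = corner_unitariesD[OF assms]
 show "y \<in> A" "adj y * y = f" "y * adj y = f" "f * y = y" "y * f = y" by (rule D)+
 show "adj y * f = adj y" "f * adj y = adj y" using arg_cong[OF D(4), of adj] arg_cong[OF D(5), of adj] by simp_all
 show "norm y \<le> 1" by (rule corner_unitaries_norm[OF proj_f assms])
qed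

lemma uv: "u * v = csc (om 1) (v * u)"
proof (rule f_ext)
 show "u * v * f = u * v" "csc (om 1) (v * u) * f = csc (om 1) (v * u)"
  using UF_D(5)[OF u_unitary] UF_D(5)[OF v_unitary] by (simp_all add: mult.assoc)
 show "u * v * gm b = csc (om 1) (v * u) * gm b" for b by (simp add: mult.assoc u_gm v_gm om_add mult.commute)
qed

lemma wu: "w * u = u * w"
proof (rule f_ext)
 show "w * u * f = w * u" "u * w * f = u * w"
  using UF_D(5)[OF u_unitary] UF_D(5)[OF w_unitary] by (simp_all add: mult.assoc)
 show "w * u * gm b = u * w * gm b" for b by (simp add: mult.assoc u_gm w_gm mult.commute)
qed

definition ka :: complex where "ka = cis (pi * of_int (1 + int K) / of_nat K)"

lemma wv: "w * v = csc ka (v * u * w)"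
proof (rule f_ext)
 show "w * v * f = w * v" "csc ka (v * u * w) * f = csc ka (v * u * w)"
  using UF_D(5)[OF v_unitary] UF_D(5)[OF w_unitary] by (simp_all add: mult.assoc)
 show "w * v * gm b = csc ka (v * u * w) * gm b" for b
  by (simp add: mult.assoc u_gm w_gm v_gm ze_step ka_def mult_ac)
qed

lemma uS: "u * S = S * v"
proof (rule f_ext)
 show "u * S * f = u * S" "S * v * f = S * v"
  using UF_D(5)[OF v_unitary] UF_D(5)[OF S_unitary] by (simp_all add: mult.assoc)
 show "u * S * gm b = S * v * gm b" for b
  by (simp add: mult.assoc S_gm v_gm sum_distrib_left u_gm distrib_left om_add mult_ac)
qed

lemma vSu: "v * S * u = S"
proof (rule f_ext)
 show "v * S * u * f = v * S * u" "S * f = S"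
  using UF_D(5)[OF u_unitary] UF_D(5)[OF S_unitary] by (simp_all add: mult.assoc)
 fix b
 have "v * S * u * gm b = (\<Sum>c\<in>Z. csc (om b * (rK * om (c * b))) (gm (c + 1)))"
  by (simp add: mult.assoc S_gm u_gm sum_distrib_left v_gm csc_sum)
 also have "\<dots> = (\<Sum>c\<in>Z. csc (rK * om ((c + 1) * b)) (gm (c + 1)))"
 proof -
  have "om b * (rK * om (c * b)) = rK * om ((c + 1) * b)" for c by (simp add: distrib_right om_add)
  note e = this
  show ?thesis by (simp only: e)
 qed
 also have "\<dots> = (\<Sum>c\<in>Z. csc (rK * om (c * b)) (gm c))"
  by (rule periodic_sum_shift[of "\<lambda>c. csc (rK * om (c * b)) (gm c)"])
   (simp add: gm_period distrib_right om_add om_mult_K)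
 finally show "v * S * u * gm b = S * gm b" by (simp add: S_gm)
qed

lemma u_power: "u ^ K * f = f"
proof (rule f_ext)
 have "u ^ n * gm b = csc (om (b * int n)) (gm b)" for n b
  by (induction n) (simp_all add: mult.assoc u_gm power_Suc2 om_add distrib_left mult_ac del: power_Suc)
 then show "u ^ K * f * gm b = f * gm b" for b using om_mult_K[of b] by (simp add: mult.assoc f_gm mult.commute)
qed (simp_all add: mult.assoc)

lemma v_power: "v ^ K * f = f"
proof (rule f_ext)
 have "v ^ n * gm b = gm (b + int n)" for n b
  by (induction n arbitrary: b) (simp_all add: mult.assoc v_gm power_Suc2 add_ac del: power_Suc)
 then show "v ^ K * f * gm b = f * gm b" for b by (simp add: mult.assoc f_gm gm_period)
qed (simp_all add: mult.assoc)

end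

section \<open>Masses on the integer lattice under a shear and a rotation\<close>

lemma sum_Un_le:
 fixes m :: "'a => real"
 assumes "finite X" "finite Y" "\<And>p. m p \<ge> 0"
 shows "sum m (X \<union> Y) \<le> sum m X + sum m Y"
 using sum.union_inter[OF assms(1,2), of m] sum_nonneg[of "X \<inter> Y" m] assms(3) by simp

text \<open>The shear and its inverse push the quadrants into their halves, and the rotation exchanges the
 quadrants; so an almost invariant mass concentrates at the origin.\<close>

lemma sector_bound:
 fixes m :: "int \<times> int => real" and J :: "int set" and L :: int
 defines "sh \<equiv> \<lambda>p. (fst p, snd p - fst p)" and "ro \<equiv> \<lambda>p. (snd p, - fst p)"
 assumes finJ: "finite J" and nn: "\<And>p. m p \<ge> 0" and J: "{-2*L..2*L} \<subseteq> J" "L \<ge> 0"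
  and far: "sum m {p \<in> J \<times> J. \<bar>fst p\<bar> > L \<or> \<bar>snd p\<bar> > L} \<le> \<phi>"
  and sh: "\<And>X. X \<subseteq> J \<times> J ==> sh ` X \<subseteq> J \<times> J ==> \<bar>sum m (sh ` X) - sum m X\<bar> \<le> \<kappa>"
  and ro: "\<And>X. X \<subseteq> J \<times> J ==> ro ` X \<subseteq> J \<times> J ==> \<bar>sum m (ro ` X) - sum m X\<bar> \<le> \<kappa>"
 shows "sum m (J \<times> J - {(0,0)}) \<le> 7 * \<phi> + 11 * \<kappa>"
proof -
 \<comment> \<open>Shearing the box \<open>N\<close> of radius \<open>L\<close> in either direction
   at most doubles a coordinate, so the image stays in \<open>B\<close> and hence in
   \<open>J\<close>, without wraparound.\<close>
 define B where "B = {-2*L..2*L} \<times> {-2*L..2*L}"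
 have BJ: "B \<subseteq> J \<times> J" using J by (auto simp: B_def)
 have finB: "finite B" by (simp add: B_def)
 define N where "N = {-L..L} \<times> {-L..L}"
 have NB: "N \<subseteq> B" using J(2) by (auto simp: N_def B_def)
 define F where "F = {p \<in> J \<times> J. \<bar>fst p\<bar> > L \<or> \<bar>snd p\<bar> > L}"
 define Q1 where "Q1 = {p \<in> N. fst p > 0 \<and> snd p > 0 \<or> fst p < 0 \<and> snd p < 0}"
 define Q2 where "Q2 = {p \<in> N. fst p > 0 \<and> snd p < 0 \<or> fst p < 0 \<and> snd p > 0}"
 define E1 where "E1 = {p \<in> Q1. \<bar>snd p\<bar> \<le> \<bar>fst p\<bar>}"
 define D1 where "D1 = {p \<in> Q1. \<bar>snd p\<bar> > \<bar>fst p\<bar>}"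
 define E2 where "E2 = {p \<in> Q2. \<bar>snd p\<bar> \<le> \<bar>fst p\<bar>}"
 define D2 where "D2 = {p \<in> Q2. \<bar>snd p\<bar> > \<bar>fst p\<bar>}"
 define H where "H = {p \<in> N. snd p = 0 \<and> fst p \<noteq> 0}"
 define V where "V = {p \<in> N. fst p = 0 \<and> snd p \<noteq> 0}"
 note defs = Q1_def Q2_def E1_def D1_def E2_def D2_def H_def V_def
 have sub: "Q1 \<subseteq> B" "Q2 \<subseteq> B" "E1 \<subseteq> B" "D1 \<subseteq> B" "E2 \<subseteq> B" "D2 \<subseteq> B" "H \<subseteq> B" "V \<subseteq> B"
  using NB by (auto simp: defs)
 have fin: "finite Q1" "finite Q2" "finite E1" "finite D1" "finite E2" "finite D2" "finite H" "finite V"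
  using sub[THEN finite_subset] finB by blast+
 have finF: "finite F" using finJ by (simp add: F_def)
 have F: "sum m F \<le> \<phi>" using far by (simp add: F_def)
 have mono: "sum m X \<le> sum m Y" if "X \<subseteq> Y" "finite Y" for X Y
  using that nn by (intro sum_mono2) auto
 have split: "sum m Q1 = sum m E1 + sum m D1" "sum m Q2 = sum m E2 + sum m D2"
  using fin by (subst sum.union_disjoint[symmetric]; auto simp: E1_def D1_def E2_def D2_def intro!: sum.cong)+
 \<comment> \<open>On coordinates of equal sign the inverse shear makes the second coordinate
   strictly dominant, so the preimage of \<open>Q1 = E1 + D1\<close> lies in \<open>D1\<close> or
   far out. Almost invariance then leaves little mass for \<open>E1\<close>. In \<open>e2\<close>
   the shear does the same for opposite signs.\<close>
 have e1: "sum m E1 \<le> \<phi> + \<kappa>"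
 proof -
  define X where "X = (\<lambda>p. (fst p, snd p + fst p)) ` Q1"
  have X: "sh ` X = Q1" by (simp add: X_def sh_def image_comp)
  have XB: "X \<subseteq> B" by (auto simp: X_def Q1_def N_def B_def)
  have "X \<subseteq> D1 \<union> F" using XB BJ by (auto simp: X_def Q1_def D1_def F_def N_def)
  then have "sum m X \<le> sum m (D1 \<union> F)" using fin finF by (intro mono) auto
  also have "\<dots> \<le> sum m D1 + sum m F" using fin finF nn by (intro sum_Un_le) auto
  finally have "sum m X \<le> sum m D1 + sum m F" .
  moreover have "\<bar>sum m (sh ` X) - sum m X\<bar> \<le> \<kappa>" by (rule sh) (use X XB BJ sub in auto)
  ultimately show ?thesis using F split(1) unfolding X by linarith
 qed
 have e2: "sum m E2 \<le> \<phi> + \<kappa>"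
 proof -
  have XB: "sh ` Q2 \<subseteq> B" by (auto simp: sh_def Q2_def N_def B_def)
  have "sh ` Q2 \<subseteq> D2 \<union> F" using XB BJ by (auto simp: sh_def Q2_def D2_def F_def N_def)
  then have "sum m (sh ` Q2) \<le> sum m (D2 \<union> F)" using fin finF by (intro mono) auto
  also have "\<dots> \<le> sum m D2 + sum m F" using fin finF nn by (intro sum_Un_le) auto
  finally have "sum m (sh ` Q2) \<le> sum m D2 + sum m F" .
  moreover have "\<bar>sum m (sh ` Q2) - sum m Q2\<bar> \<le> \<kappa>" by (rule sh) (use XB BJ sub in auto)
  ultimately show ?thesis using F split(2) by linarith
 qed
 have move: "sum m X \<le> sum m Y + \<kappa>" if "X \<subseteq> B" "h ` X \<subseteq> Y" "Y \<subseteq> B" "h = sh \<or> h = ro" for X Y h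
 proof -
  have "sum m (h ` X) \<le> sum m Y" using that finB by (intro mono) (auto intro: finite_subset)
  moreover have "X \<subseteq> J \<times> J" "h ` X \<subseteq> J \<times> J" using that BJ by auto
  ultimately show ?thesis using sh[of X] ro[of X] that(4) by auto
 qed
 have im: "ro ` D1 \<subseteq> E2" "ro ` D2 \<subseteq> E1" "ro ` V \<subseteq> H" "sh ` H \<subseteq> E2"
  by (auto simp: ro_def sh_def defs N_def)
 \<comment> \<open>The remaining pieces are moved into \<open>E1\<close> or \<open>E2\<close>. The
   far part has mass at most \<phi>, the two \<open>E\<close> parts \<phi> + \<kappa>, the two
   \<open>D\<close> parts and \<open>H\<close> \<phi> + 2 \<kappa>, and \<open>V\<close> \<phi> + 3
   \<kappa>, which add up to 7 \<phi> + 11 \<kappa>.\<close>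
 have "sum m D1 \<le> sum m E2 + \<kappa>" "sum m D2 \<le> sum m E1 + \<kappa>" "sum m V \<le> sum m H + \<kappa>" "sum m H \<le> sum m E2 + \<kappa>"
  using move[OF _ im(1)] move[OF _ im(2)] move[OF _ im(3)] move[OF _ im(4)] sub by auto
 moreover have "sum m (J \<times> J - {(0,0)}) \<le> sum m F + (sum m E1 + (sum m D1 + (sum m E2 + (sum m D2 + (sum m H + sum m V)))))"
 proof -
  have "J \<times> J - {(0,0)} \<subseteq> F \<union> (E1 \<union> (D1 \<union> (E2 \<union> (D2 \<union> (H \<union> V)))))"
  proof (rule subsetI)
   fix p assume p: "p \<in> J \<times> J - {(0,0)}"
   show "p \<in> F \<union> (E1 \<union> (D1 \<union> (E2 \<union> (D2 \<union> (H \<union> V)))))"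
   proof (cases "p \<in> F")
    case False
    then have N: "p \<in> N" using p by (cases p) (auto simp: F_def N_def)
    have "(fst p \<noteq> 0 \<or> snd p \<noteq> 0)" using p by (cases p) auto
    then consider "snd p = 0" "fst p \<noteq> 0" | "fst p = 0" "snd p \<noteq> 0" | "fst p > 0 \<and> snd p > 0 \<or> fst p < 0 \<and> snd p < 0"
     | "fst p > 0 \<and> snd p < 0 \<or> fst p < 0 \<and> snd p > 0" by linarith
    then show ?thesis using N by cases (simp_all add: defs, auto)
   qed simp
  qed
  then have "sum m (J \<times> J - {(0,0)}) \<le> sum m (F \<union> (E1 \<union> (D1 \<union> (E2 \<union> (D2 \<union> (H \<union> V))))))"
   using fin finF by (intro mono) auto
  also have "\<dots> \<le> sum m F + (sum m E1 + (sum m D1 + (sum m E2 + (sum m D2 + (sum m H + sum m V)))))"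
  proof -
   have *: "sum m (X \<union> Y) \<le> sum m X + b" if "finite X" "finite Y" "sum m Y \<le> b" for X Y b
    using sum_Un_le[of X Y m] nn that by fastforce
   show ?thesis by (intro * fin finF finite_UnI order_refl)
  qed
  finally show ?thesis .
 qed
 ultimately show ?thesis using e1 e2 F by linarith
qed

section \<open>Joint eigenspaces of the conjugations by clock and shift\<close>

definition linop :: "('h::chilbert_space bop => 'h bop) => bool" where
 "linop T \<longleftrightarrow> (\<forall>x y. T (x + y) = T x + T y) \<and> (\<forall>c x. T (csc c x) = csc c (T x))"

lemma linopD: "linop T ==> T (x + y) = T x + T y" "linop T ==> T (csc c x) = csc c (T x)"
 by (simp_all add: linop_def)
lemma linop_zero: "linop T ==> T 0 = 0" using linopD(2)[of T 0 0] by simp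
lemma linop_sum: "linop T ==> T (sum h I) = (\<Sum>i\<in>I. T (h i))"
 by (induction I rule: infinite_finite_induct) (simp_all add: linop_zero linopD)
lemma linop_diff: "linop T ==> T (x - y) = T x - T y" using linopD(1)[of T "x - y" y] by simp
lemma linop_power: "linop T ==> linop (T ^^ n)" by (induction n) (simp_all add: linop_def)

definition Ad :: "'h::chilbert_space bop => 'h bop => 'h bop" where "Ad y x = y * x * adj y"

lemma linop_Ad [simp]: "linop (Ad y)" by (simp add: linop_def Ad_def distrib_left distrib_right)

lemma Ad_power: "(Ad y ^^ n) x = y ^ n * x * adj (y ^ n)" by (induction n) (simp_all add: Ad_def mult.assoc)

lemma csc_sum_left: "(\<Sum>i\<in>I. csc (q i) z) = csc (\<Sum>i\<in>I. q i) z"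
 by (induction I rule: infinite_finite_induct) (simp_all add: csc_add_left)

context matrix_system begin

text \<open>\<open>J\<close> is the system of residues modulo \<open>K\<close> centred at 0, so that
  the absolute value of a residue measures how far its root of unity is from 1.\<close>

definition m0 :: int where "m0 = - int (K div 2)"
definition J :: "int set" where "J = {m0..<m0 + int K}"
definition Co where "Co = {x \<in> A. f * x = x \<and> x * f = x}"
text \<open>The discrete Fourier average of the powers of \<open>T\<close>: on elements fixed by the
  \<open>K\<close>-th power of \<open>T\<close> it projects onto the eigenspace for
  \<open>om s\<close>.\<close>

definition pr :: "('h bop => 'h bop) => int => 'h bop => 'h bop" where
 "pr T s x = csc (1 / of_nat K) (\<Sum>i<K. csc (om (- s * int i)) ((T ^^ i) x))"

lemma finJ [simp]: "finite J" by (simp add: J_def)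

lemma J_inj: "s \<in> J ==> t \<in> J ==> int K dvd s - t \<longleftrightarrow> s = t"
proof
 assume "s \<in> J" "t \<in> J" "int K dvd s - t"
 moreover from this have "\<bar>s - t\<bar> < int K" by (auto simp: J_def)
 ultimately show "s = t" using zdvd_imp_le[of "int K" "\<bar>s - t\<bar>"] by (cases "s = t") auto
qed simp

lemma om_sum_J: "(\<Sum>s\<in>J. om (a * s)) = (if int K dvd a then of_nat K else 0)"
proof -
 have "J = (\<lambda>b. m0 + b) ` Z" unfolding J_def Z_def image_add_atLeastLessThan by (simp add: add.commute)
 then have "(\<Sum>s\<in>J. om (a * s)) = om (a * m0) * (\<Sum>b\<in>Z. om (a * b))"
  by (simp add: sum.reindex distrib_left om_add sum_distrib_left)
 moreover have "int K dvd a ==> om (a * m0) = 1" using om_eq_1[of "a * m0"] by simp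
 ultimately show ?thesis by (simp add: om_sum_Z)
qed

lemma pr_linop: assumes T: "linop T" shows "linop (pr T s)"
proof -
 note P = linopD[OF linop_power[OF T]]
 have "pr T s (x + y) = pr T s x + pr T s y" for x y by (simp add: pr_def P csc_add_right sum.distrib)
 moreover have "pr T s (csc c x) = csc c (pr T s x)" for c x by (simp add: pr_def P csc_sum mult_ac)
 ultimately show ?thesis by (simp add: linop_def)
qed

lemma pr_eigen:
 assumes T: "linop T" and x: "(T ^^ K) x = x"
 shows "T (pr T s x) = csc (om s) (pr T s x)"
proof -
 define h where "h i = csc (om (- s * int i)) ((T ^^ i) x)" for i
 have "(\<Sum>i<K. h (Suc i)) - (\<Sum>i<K. h i) = h K - h 0"
  unfolding sum_subtractf[symmetric] by (rule sum_lessThan_telescope)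
 moreover have "h K = h 0" using x om_mult_K[of "- s"] by (simp add: h_def mult.commute)
 ultimately have e: "(\<Sum>i<K. h (Suc i)) = (\<Sum>i<K. h i)" by simp
 have "T (h i) = csc (om s) (h (Suc i))" for i
 proof -
  have "- s * int i = s + - s * int (Suc i)" by (simp add: algebra_simps)
  then have "om (- s * int i) = om s * om (- s * int (Suc i))" by (metis om_add)
  then show ?thesis by (simp add: h_def linopD[OF T])
 qed
 then have "T (\<Sum>i<K. h i) = csc (om s) (\<Sum>i<K. h (Suc i))" by (simp add: linop_sum[OF T] csc_sum)
 then have "T (\<Sum>i<K. h i) = csc (om s) (\<Sum>i<K. h i)" by (simp only: e)
 then show ?thesis unfolding pr_def h_def[symmetric] by (simp add: linopD[OF T] mult.commute)
qed

lemma pr_total: "(\<Sum>s\<in>J. pr T s x) = x"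
proof -
 have "(\<Sum>s\<in>J. pr T s x) = csc (1 / of_nat K) (\<Sum>i<K. \<Sum>s\<in>J. csc (om (- s * int i)) ((T ^^ i) x))"
  unfolding pr_def by (subst sum.swap) (simp add: csc_sum)
 also have "\<dots> = csc (1 / of_nat K) (\<Sum>i<K. csc (\<Sum>s\<in>J. om (- int i * s)) ((T ^^ i) x))"
  by (simp add: csc_sum_left mult.commute)
 also have "\<dots> = csc (1 / of_nat K) (\<Sum>i<K. if i = 0 then csc (of_nat K) x else 0)"
 proof -
  have d: "int K dvd - int i \<longleftrightarrow> i = 0" if "i < K" for i using that by (auto dest: dvd_imp_le)
  have "(\<Sum>i<K. csc (\<Sum>s\<in>J. om (- int i * s)) ((T ^^ i) x)) = (\<Sum>i<K. if i = 0 then csc (of_nat K) x else 0)"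
   by (rule sum.cong) (use d in \<open>auto simp: om_sum_J simp del: mult_minus_left\<close>)
  then show ?thesis by simp
 qed
 also have "\<dots> = x" using K by simp
 finally show ?thesis .
qed

lemma pr_on_eigen:
 assumes T: "linop T" "T x = csc (om t) x"
 shows "pr T s x = (if int K dvd t - s then x else 0)"
proof -
 have "(T ^^ n) x = csc (om (t * int n)) x" for n
  by (induction n) (simp_all add: linopD[OF T(1)] T(2) om_add distrib_left mult.commute)
 then have "pr T s x = csc (1 / of_nat K) (\<Sum>i<K. csc (om ((t - s) * int i)) x)"
  unfolding pr_def by (simp add: om_add[symmetric] left_diff_distrib)
 also have "\<dots> = csc (1 / of_nat K * (\<Sum>i<K. om ((t - s) * int i))) x" by (simp add: csc_sum_left)
 finally show ?thesis using K by (simp add: om_sum)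
qed

lemma pr_commute:
 assumes "linop T'" "\<And>y. y \<in> Co ==> T y \<in> Co" "\<And>y. y \<in> Co ==> T' (T y) = T (T' y)" "x \<in> Co"
 shows "T' (pr T s x) = pr T s (T' x)"
proof -
 have "T' ((T ^^ n) x) = (T ^^ n) (T' x) \<and> (T ^^ n) x \<in> Co" for n
  by (induction n) (simp_all add: assms)
 then show ?thesis by (simp add: pr_def linopD[OF assms(1)] linop_sum[OF assms(1)])
qed

lemma CoD: "x \<in> Co ==> x \<in> A" "x \<in> Co ==> f * x = x" "x \<in> Co ==> x * f = x"
 by (simp_all add: Co_def)
lemma Co_csc: "x \<in> Co ==> csc c x \<in> Co" by (simp add: Co_def)
lemma Co_sum: "(\<And>i. i \<in> I ==> h i \<in> Co) ==> sum h I \<in> Co"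
 by (simp add: Co_def sum_distrib_left sum_distrib_right)
lemma Co_diff: "x \<in> Co ==> y \<in> Co ==> x - y \<in> Co"
 by (simp add: Co_def left_diff_distrib right_diff_distrib)
lemma Co_Ad: "y \<in> UF ==> x \<in> Co ==> Ad y x \<in> Co"
proof -
 assume y: "y \<in> UF" and x: "x \<in> Co"
 have "f * (y * x * adj y) = (f * y) * x * adj y" "y * x * adj y * f = y * x * (adj y * f)" by (simp_all only: mult.assoc)
 then show ?thesis using UF_D[OF y] CoD[OF x] by (simp add: Co_def Ad_def)
qed
lemma Co_pr: "x \<in> Co ==> (\<And>y. y \<in> Co ==> T y \<in> Co) ==> pr T s x \<in> Co"
proof -
 assume T: "x \<in> Co" "\<And>y. y \<in> Co ==> T y \<in> Co"
 have "(T ^^ n) x \<in> Co" for n by (induction n) (simp_all add: T)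
 then show ?thesis unfolding pr_def by (intro Co_csc Co_sum)
qed

lemma Ad_n2: "y \<in> UF ==> x \<in> Co ==> n2 (Ad y x) = n2 x"
proof -
 assume y: "y \<in> UF" and x: "x \<in> Co"
 note Y = UF_D[OF y] and X = CoD[OF x]
 have "tau (adj (Ad y x) * Ad y x) = tau (y * (adj x * ((adj y * y) * x) * adj y))"
  by (simp add: Ad_def mult.assoc)
 also have "\<dots> = tau (adj x * ((adj y * y) * x) * adj y * y)" using X Y by (intro tau_comm) auto
 also have "\<dots> = tau (adj x * x)" using X Y by (simp add: mult.assoc)
 finally show ?thesis by (simp add: n2_def)
qed

lemma Ad_Ad: "Ad y (Ad z x) = Ad (y * z) x" by (simp add: Ad_def mult.assoc)
lemma Ad_csc: "c * cnj c = 1 ==> Ad (csc c y) x = Ad y x" by (simp add: Ad_def mult.commute)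

lemma Ad_uv: "Ad u (Ad v x) = Ad v (Ad u x)" unfolding Ad_Ad uv by (rule Ad_csc) simp

lemma Ad_K: "x \<in> Co ==> (Ad u ^^ K) x = x" "x \<in> Co ==> (Ad v ^^ K) x = x"
proof -
 assume x: "x \<in> Co"
 have *: "y ^ K * x * adj (y ^ K) = x" if "y ^ K * f = f" for y
 proof -
  have "y ^ K * x = x" using that CoD(2)[OF x] by (metis mult.assoc)
  moreover have "f * adj (y ^ K) = f" using arg_cong[OF that, of adj] by simp
  then have "x * adj (y ^ K) = x" using CoD(3)[OF x] by (metis mult.assoc)
  ultimately show ?thesis by simp
 qed
 show "(Ad u ^^ K) x = x" "(Ad v ^^ K) x = x" unfolding Ad_power using * u_power v_power by blast+
qed

definition EV where "EV p = {x \<in> Co. Ad u x = csc (om (fst p)) x \<and> Ad v x = csc (om (snd p)) x}"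
definition P where "P p x = pr (Ad u) (fst p) (pr (Ad v) (snd p) x)"

lemma P_linop [simp]: "linop (P p)"
 using linopD[OF pr_linop[OF linop_Ad[of u]]] linopD[OF pr_linop[OF linop_Ad[of v]]] by (simp add: linop_def P_def)

lemma P_Co: "x \<in> Co ==> P p x \<in> Co" unfolding P_def by (intro Co_pr Co_Ad u_unitary v_unitary)

lemma P_EV: "x \<in> Co ==> P p x \<in> EV p"
proof -
 assume x: "x \<in> Co"
 define y where "y = pr (Ad v) (snd p) x"
 have y: "y \<in> Co" unfolding y_def by (intro Co_pr Co_Ad v_unitary x)
 have "Ad v (P p x) = pr (Ad u) (fst p) (Ad v y)"
  unfolding P_def y_def[symmetric] by (rule pr_commute) (use y Ad_uv Co_Ad u_unitary in auto)
 also have "\<dots> = csc (om (snd p)) (P p x)"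
 proof -
  have "Ad v y = csc (om (snd p)) y" unfolding y_def by (rule pr_eigen[OF linop_Ad Ad_K(2)[OF x]])
  then show ?thesis by (simp add: P_def y_def[symmetric] linopD[OF pr_linop[OF linop_Ad]])
 qed
 finally show ?thesis using pr_eigen[OF linop_Ad Ad_K(1)[OF y], of "fst p"] P_Co[OF x]
  by (simp add: EV_def P_def y_def)
qed

lemma P_total: "(\<Sum>p\<in>J \<times> J. P p x) = x"
proof -
 have "(\<Sum>p\<in>J \<times> J. P p x) = (\<Sum>t\<in>J. \<Sum>s\<in>J. pr (Ad u) s (pr (Ad v) t x))"
  by (subst sum.swap) (simp add: sum.cartesian_product P_def split_beta)
 then show ?thesis by (simp add: pr_total)
qed

lemma P_on_EV: "x \<in> EV q ==> P p x = (if int K dvd fst q - fst p \<and> int K dvd snd q - snd p then x else 0)"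
 using pr_on_eigen[OF linop_Ad[of u]] pr_on_eigen[OF linop_Ad[of v]] linop_zero[OF pr_linop[OF linop_Ad]]
 by (simp add: EV_def P_def)

text \<open>Conjugation by \<open>u\<close> and by \<open>v\<close> preserves the trace pairing, so
  the pairing of eigenvectors for different eigenvalues is multiplied by a root of unity other than
  1.\<close>

lemma EV_orthogonal:
 assumes x: "x \<in> EV p" and y: "y \<in> EV q" and ne: "p \<noteq> q" "p \<in> J \<times> J" "q \<in> J \<times> J"
 shows "tau (adj x * y) = 0"
proof -
 have C: "x \<in> Co" "y \<in> Co" using x y by (auto simp: EV_def)
 note X = CoD[OF C(1)] and Y = CoD[OF C(2)]
 have *: "tau (adj x * y) = 0" if z: "z \<in> UF" "Ad z x = csc (om s) x" "Ad z y = csc (om t) y" and st: "\<not> int K dvd t - s" for z s t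
 proof -
  note D = UF_D[OF z(1)]
  have "tau (adj (Ad z x) * Ad z y) = tau (z * (adj x * ((adj z * z) * y) * adj z))"
   by (simp add: Ad_def mult.assoc)
  also have "\<dots> = tau (adj x * ((adj z * z) * y) * adj z * z)" using X Y D by (intro tau_comm) auto
  also have "\<dots> = tau (adj x * y)" using X Y D by (simp add: mult.assoc)
  finally have "tau (adj x * y) = om (t - s) * tau (adj x * y)" using z X Y by (simp add: om_diff tau_csc mult.commute)
  then show ?thesis using om_eq_1[of "t - s"] st by simp
 qed
 show ?thesis
 proof (cases "fst p = fst q")
  case False
  then have "\<not> int K dvd fst q - fst p" using ne J_inj[of "fst q" "fst p"] by (auto simp: mem_Times_iff)
  then show ?thesis using *[OF u_unitary, of "fst p" "fst q"] x y by (auto simp: EV_def)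
 next
  case True
  then have "\<not> int K dvd snd q - snd p" using ne J_inj[of "snd q" "snd p"] by (auto simp: mem_Times_iff prod_eq_iff)
  then show ?thesis using *[OF v_unitary, of "snd p" "snd q"] x y by (auto simp: EV_def)
 qed
qed

lemma n2_orthogonal_sum:
 assumes "\<And>p. p \<in> J \<times> J ==> h p \<in> EV p" "X \<subseteq> J \<times> J"
 shows "(n2 (\<Sum>p\<in>X. csc (c p) (h p)))\<^sup>2 = (\<Sum>p\<in>X. (cmod (c p))\<^sup>2 * (n2 (h p))\<^sup>2)"
proof -
 have fin: "finite X" using finite_subset[OF assms(2)] by simp
 have hA: "h p \<in> A" if "p \<in> X" for p using assms that CoD(1) by (auto simp: EV_def)
 have "tau (adj (\<Sum>p\<in>X. csc (c p) (h p)) * (\<Sum>p\<in>X. csc (c p) (h p))) =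
   (\<Sum>q\<in>X. \<Sum>p\<in>X. tau (csc (cnj (c p) * c q) (adj (h p) * h q)))"
  using hA by (simp add: adj_sum sum_distrib_left sum_distrib_right tau_sum csc_sum mult.commute)
 also have "\<dots> = (\<Sum>q\<in>X. \<Sum>p\<in>X. if p = q then of_real ((cmod (c q))\<^sup>2 * (n2 (h q))\<^sup>2) else 0)"
 proof (intro sum.cong refl)
  fix p q assume pq: "p \<in> X" "q \<in> X"
  show "tau (csc (cnj (c p) * c q) (adj (h p) * h q)) = (if p = q then of_real ((cmod (c q))\<^sup>2 * (n2 (h q))\<^sup>2) else 0)"
  proof (cases "p = q")
   case True
   then show ?thesis using hA pq complex_norm_square[of "c q"] by (simp add: tau_csc tau_adj_self mult.commute)
  next
   case False
   have "tau (adj (h p) * h q) = 0" by (rule EV_orthogonal[OF assms(1) assms(1)]) (use pq False assms(2) in auto)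
   then show ?thesis using hA pq False by (simp add: tau_csc)
  qed
 qed
 also have "\<dots> = of_real (\<Sum>q\<in>X. (cmod (c q))\<^sup>2 * (n2 (h q))\<^sup>2)" using fin by simp
 finally show ?thesis using hA by (simp add: n2_sq)
qed

definition mass where "mass x p = (n2 (P p x))\<^sup>2"

lemma mass_nonneg: "mass x p \<ge> 0" by (simp add: mass_def)

lemma mass_total: "x \<in> Co ==> (\<Sum>p\<in>J \<times> J. mass x p) = (n2 x)\<^sup>2"
 using n2_orthogonal_sum[of "\<lambda>p. P p x" "J \<times> J" "\<lambda>_. 1"] by (simp add: P_EV P_total mass_def)

lemma mass_near_origin: "x \<in> Co ==> (n2 (x - P (0,0) x))\<^sup>2 = (\<Sum>p\<in>J \<times> J - {(0,0)}. mass x p)"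
proof -
 assume x: "x \<in> Co"
 have "0 \<in> J" using K by (auto simp: J_def m0_def)
 then have "(\<Sum>p\<in>J \<times> J. P p x) = P (0,0) x + (\<Sum>p\<in>J \<times> J - {(0,0)}. P p x)"
  by (intro sum.remove) auto
 then have "x - P (0,0) x = (\<Sum>p\<in>J \<times> J - {(0,0)}. P p x)" by (metis P_total add_diff_cancel_left')
 then show ?thesis
  using n2_orthogonal_sum[of "\<lambda>p. P p x" "J \<times> J - {(0,0)}" "\<lambda>_. 1"] x by (simp add: P_EV mass_def)
qed

lemma mass_displacement:
 assumes x: "x \<in> Co" and y: "(y, c) \<in> {(u, fst), (v, snd)}"
 shows "(n2 (Ad y x - x))\<^sup>2 = (\<Sum>p\<in>J \<times> J. (cmod (om (c p) - 1))\<^sup>2 * mass x p)"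
proof -
 have "Ad y x - x = Ad y (\<Sum>p\<in>J \<times> J. P p x) - (\<Sum>p\<in>J \<times> J. P p x)" by (simp add: P_total)
 also have "\<dots> = (\<Sum>p\<in>J \<times> J. csc (om (c p) - 1) (P p x))"
  unfolding linop_sum[OF linop_Ad] sum_subtractf[symmetric]
  using P_EV[OF x] y by (intro sum.cong) (auto simp: EV_def csc_diff_left)
 finally show ?thesis using n2_orthogonal_sum[of "\<lambda>p. P p x" "J \<times> J" "\<lambda>p. om (c p) - 1"] x by (simp add: P_EV mass_def)
qed

text \<open>If conjugation by \<open>y\<close> permutes the joint eigenspaces through
  \<open>h\<close>, it intertwines the projections. Injectivity of \<open>h\<close> is needed modulo
  \<open>K\<close>, since the projections depend only on residues.\<close>

lemma mass_transport:
 assumes y: "y \<in> UF" and x: "x \<in> Co" and p: "p \<in> J \<times> J"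
  and EV: "\<And>q z. z \<in> EV q ==> Ad y z \<in> EV (h q)"
  and inj: "\<And>q. int K dvd fst (h q) - fst (h p) ==> int K dvd snd (h q) - snd (h p) ==>
    int K dvd fst q - fst p \<and> int K dvd snd q - snd p"
 shows "P (h p) (Ad y x) = Ad y (P p x)"
proof -
 have "P (h p) (Ad y x) = P (h p) (Ad y (\<Sum>q\<in>J \<times> J. P q x))" by (simp add: P_total)
 also have "\<dots> = (\<Sum>q\<in>J \<times> J. P (h p) (Ad y (P q x)))"
  by (simp add: linop_sum[OF linop_Ad] linop_sum[OF P_linop])
 also have "\<dots> = (\<Sum>q\<in>J \<times> J. if q = p then Ad y (P p x) else 0)"
 proof (intro sum.cong refl)
  fix q assume q: "q \<in> J \<times> J"
  have "q = p" if "int K dvd fst (h q) - fst (h p)" "int K dvd snd (h q) - snd (h p)"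
   using inj[OF that] J_inj[of "fst q" "fst p"] J_inj[of "snd q" "snd p"] p q
   by (auto simp: mem_Times_iff prod_eq_iff)
  then show "P (h p) (Ad y (P q x)) = (if q = p then Ad y (P p x) else 0)"
   using P_on_EV[OF EV[OF P_EV[OF x]], of "h p" q] by auto
 qed
 also have "\<dots> = Ad y (P p x)" using p by simp
 finally show ?thesis .
qed

text \<open>The vectors of 2-norms of components before and after the move differ in the Euclidean
  norm by at most the norm of \<open>Ad y x - x\<close>. Both have norm at most 1, so the difference
  of their squares costs a further factor 2.\<close>

lemma mass_almost_invariant:
 assumes y: "y \<in> UF" and x: "x \<in> Co" "n2 x \<le> 1" and X: "X \<subseteq> J \<times> J" "h ` X \<subseteq> J \<times> J" and h: "inj h"
  and t: "\<And>p. p \<in> J \<times> J ==> P (h p) (Ad y x) = Ad y (P p x)"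
 shows "\<bar>sum (mass x) (h ` X) - sum (mass x) X\<bar> \<le> 2 * n2 (Ad y x - x)"
proof -
 define z where "z = Ad y x - x"
 have C: "Ad y x \<in> Co" "z \<in> Co" using Co_Ad[OF y x(1)] Co_diff[OF Co_Ad[OF y x(1)] x(1)] by (simp_all add: z_def)
 have fin: "finite X" using finite_subset[OF X(1)] by simp
 define a b c where "a p = n2 (P p x)" and "b p = n2 (P (h p) x)" and "c p = n2 (P (h p) z)" for p
 have nn: "a p \<ge> 0" "b p \<ge> 0" "c p \<ge> 0" for p
  unfolding a_def b_def c_def by (intro n2_nonneg CoD(1) P_Co x(1) C(2))+
 have ab: "a p \<le> b p + c p" "b p \<le> a p + c p" if "p \<in> X" for p
 proof -
  have "P (h p) z = Ad y (P p x) - P (h p) x" using t[OF subsetD[OF X(1) that]] by (simp add: z_def linop_diff[OF P_linop])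
  moreover have "n2 (Ad y (P p x)) = a p" using Ad_n2[OF y P_Co[OF x(1)]] by (simp add: a_def)
  moreover have "Ad y (P p x) \<in> A" "P (h p) x \<in> A" by (intro CoD(1) Co_Ad[OF y] P_Co x(1))+
  ultimately show "a p \<le> b p + c p" "b p \<le> a p + c p" using n2_abs_diff[of "Ad y (P p x)" "P (h p) x"] by (auto simp: b_def c_def)
 qed
 define \<alpha> \<beta> \<gamma> where "\<alpha> = L2_set a X" and "\<beta> = L2_set b X" and "\<gamma> = L2_set c X"
 have tri: "\<alpha> \<le> \<beta> + \<gamma>" "\<beta> \<le> \<alpha> + \<gamma>"
 proof -
  have "\<alpha> \<le> L2_set (\<lambda>p. b p + c p) X" "\<beta> \<le> L2_set (\<lambda>p. a p + c p) X"
   unfolding \<alpha>_def \<beta>_def by (rule L2_set_mono; use ab nn in simp)+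
  then show "\<alpha> \<le> \<beta> + \<gamma>" "\<beta> \<le> \<alpha> + \<gamma>"
   using L2_set_triangle_ineq[of b c X] L2_set_triangle_ineq[of a c X] by (simp_all add: \<alpha>_def \<beta>_def \<gamma>_def)
 qed
 have im: "sum g (h ` X) = (\<Sum>p\<in>X. g (h p))" for g :: "int \<times> int => real"
  using h by (subst sum.reindex) (auto intro: inj_on_subset)
 have sq: "\<alpha>\<^sup>2 = sum (mass x) X" "\<beta>\<^sup>2 = sum (mass x) (h ` X)" "\<gamma>\<^sup>2 = sum (mass z) (h ` X)"
  unfolding \<alpha>_def \<beta>_def \<gamma>_def im by (simp_all add: L2_set_def sum_nonneg mass_def a_def b_def c_def)
 have le: "sum (mass q) Y \<le> (n2 q)\<^sup>2" if "q \<in> Co" "Y \<subseteq> J \<times> J" for q Y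
  unfolding mass_total[OF that(1), symmetric] using that mass_nonneg by (intro sum_mono2) auto
 have nn3: "\<alpha> \<ge> 0" "\<beta> \<ge> 0" by (simp_all add: \<alpha>_def \<beta>_def L2_set_nonneg)
 have "\<alpha>\<^sup>2 \<le> (n2 x)\<^sup>2" "\<beta>\<^sup>2 \<le> (n2 x)\<^sup>2" "\<gamma>\<^sup>2 \<le> (n2 z)\<^sup>2" unfolding sq using le x C X by auto
 then have "\<alpha> \<le> n2 x" "\<beta> \<le> n2 x" "\<gamma> \<le> n2 z"
  using power2_le_imp_le n2_nonneg CoD(1)[OF x(1)] CoD(1)[OF C(2)] by blast+
 then have l: "\<alpha> \<le> 1" "\<beta> \<le> 1" "\<gamma> \<le> n2 z" using x(2) by linarith+
 have "\<bar>\<beta>\<^sup>2 - \<alpha>\<^sup>2\<bar> = \<bar>\<beta> - \<alpha>\<bar> * (\<beta> + \<alpha>)"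
 proof -
  have "\<beta>\<^sup>2 - \<alpha>\<^sup>2 = (\<beta> - \<alpha>) * (\<beta> + \<alpha>)" by (simp add: power2_eq_square algebra_simps)
  then show ?thesis using nn3 by (simp add: abs_mult)
 qed
 also have "\<dots> \<le> n2 z * 2" using tri l nn3 by (intro mult_mono) auto
 finally show ?thesis by (simp add: sq z_def)
qed

end

section \<open>The expander inequality\<close>

context matrix_system begin

text \<open>The relation \<open>w * v = ka * v * u * w\<close> says that conjugation by
  \<open>w\<close> acts on eigenvalues as a shear; the phase \<open>ka\<close> cancels in a
  conjugation. In the same way \<open>uS\<close> and \<open>vSu\<close> make the Fourier unitary a
  rotation.\<close>

lemma w_EV: assumes z: "z \<in> EV q" shows "Ad w z \<in> EV (fst q, snd q - fst q)"
proof -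
 have C: "z \<in> Co" and e: "Ad u z = csc (om (fst q)) z" "Ad v z = csc (om (snd q)) z" using z by (auto simp: EV_def)
 note A = linopD(2)[OF linop_Ad]
 have 1: "Ad u (Ad w z) = csc (om (fst q)) (Ad w z)" using e(1) by (metis Ad_Ad A wu)
 have "v * w * u = csc (cnj ka) (w * v)"
 proof -
  have "v * w * u = v * u * w" by (simp add: wu mult.assoc)
  moreover have "cnj ka * ka = 1" by (simp add: ka_def cis_cnj cis_mult)
  ultimately show ?thesis by (simp only: wv csc_csc csc_one)
 qed
 then have "Ad v (Ad w (Ad u z)) = Ad (csc (cnj ka) (w * v)) z" by (simp only: Ad_Ad mult.assoc)
 also have "\<dots> = Ad w (Ad v z)" by (subst Ad_csc) (simp_all add: ka_def cis_cnj cis_mult Ad_Ad)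
 finally have "csc (om (fst q)) (Ad v (Ad w z)) = csc (om (snd q)) (Ad w z)" by (simp add: e A)
 then have "csc (cnj (om (fst q))) (csc (om (fst q)) (Ad v (Ad w z))) = csc (cnj (om (fst q))) (csc (om (snd q)) (Ad w z))" by simp
 then have "Ad v (Ad w z) = csc (om (snd q - fst q)) (Ad w z)" by (simp add: om_diff mult.commute)
 then show ?thesis using 1 Co_Ad[OF w_unitary C] by (simp add: EV_def)
qed

lemma S_EV: assumes z: "z \<in> EV q" shows "Ad S z \<in> EV (snd q, - fst q)"
proof -
 have C: "z \<in> Co" and e: "Ad u z = csc (om (fst q)) z" "Ad v z = csc (om (snd q)) z" using z by (auto simp: EV_def)
 note A = linopD(2)[OF linop_Ad]
 have 1: "Ad u (Ad S z) = csc (om (snd q)) (Ad S z)" using e(2) by (metis Ad_Ad A uS)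
 have "Ad v (Ad S (Ad u z)) = Ad S z" using vSu by (simp add: Ad_Ad mult.assoc)
 then have "csc (om (fst q)) (Ad v (Ad S z)) = Ad S z" by (simp add: e A)
 then have "csc (cnj (om (fst q))) (csc (om (fst q)) (Ad v (Ad S z))) = csc (cnj (om (fst q))) (Ad S z)" by simp
 then have "Ad v (Ad S z) = csc (om (- fst q)) (Ad S z)" by (simp add: om_minus)
 then show ?thesis using 1 Co_Ad[OF S_unitary C] by (simp add: EV_def)
qed

text \<open>Beyond an eighth of \<open>K\<close> the angle is at least \<open>pi / 4\<close>, so
  \<open>|om s - 1|^2 = 2 - 2 * cos \<theta>\<close> is at least \<open>2 - sqrt 2\<close>, which is
  above 1/2. An eighth is small enough for the doubled box to fit into \<open>J\<close>.\<close>

lemma om_far: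
 assumes s: "s \<in> J" and far: "\<bar>s\<bar> > int (K div 8)"
 shows "1 / 2 \<le> (cmod (om s - 1))\<^sup>2"
proof -
 define \<theta> where "\<theta> = 2 * pi * of_int \<bar>s\<bar> / of_nat K"
 have "2 * \<bar>s\<bar> \<le> int K" "8 * \<bar>s\<bar> \<ge> int K" using s far by (auto simp: J_def m0_def)
 then have r: "2 * real_of_int \<bar>s\<bar> \<le> real K" "8 * real_of_int \<bar>s\<bar> \<ge> real K" by linarith+
 have "pi / 4 \<le> \<theta>" using r(2) K by (simp add: \<theta>_def field_simps)
 moreover have "\<theta> \<le> pi" using r(1) K by (simp add: \<theta>_def field_simps)
 ultimately have "cos \<theta> \<le> cos (pi / 4)" using pi_gt_zero by (intro cos_monotone_0_pi_le) auto
 also have "\<dots> = sqrt 2 / 2" by (rule cos_45)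
 also have "\<dots> \<le> 3 / 4"
 proof -
  have "sqrt 2 \<le> 3 / 2" by (rule real_le_lsqrt) (simp_all add: power2_eq_square)
  then show ?thesis by simp
 qed
 finally have c: "cos \<theta> \<le> 3 / 4" .
 have "Re (om s) = cos \<theta>" by (cases "s \<ge> 0") (simp_all add: om_def \<theta>_def)
 moreover have "(cmod (om s - 1))\<^sup>2 = (cmod (om s))\<^sup>2 + 1 - 2 * Re (om s)"
  unfolding cmod_power2 by (simp add: power2_eq_square algebra_simps)
 ultimately show ?thesis using c by simp
qed

text \<open>Small displacement by \<open>u\<close> and \<open>v\<close> bounds the mass far from the
  origin, small displacement by \<open>w\<close> and \<open>S\<close> makes the mass almost
  invariant under shear and rotation, and \<open>sector_bound\<close> concentrates it at the origin.
  The constant is \<open>7 * 4\<close> from \<phi>, which also covers the \<open>11 * 2\<close> from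
  \<kappa>.\<close>

lemma expander:
 assumes x: "x \<in> Co" "n2 x \<le> 1"
 shows "(n2 (x - P (0,0) x))\<^sup>2 \<le> 28 * (n2 (Ad u x - x) + n2 (Ad v x - x) + n2 (Ad w x - x) + n2 (Ad S x - x))"
proof -
 define \<delta> where "\<delta> y = n2 (Ad y x - x)" for y
 have xA: "x \<in> A" by (rule CoD(1)[OF x(1)])
 have dA: "Ad y x - x \<in> A" if "y \<in> UF" for y using CoD(1)[OF Co_diff[OF Co_Ad[OF that x(1)] x(1)]] .
 have \<delta>: "0 \<le> \<delta> y" "\<delta> y \<le> 2" if "y \<in> UF" for y
  using n2_triangle_diff[of "Ad y x" x] n2_nonneg[OF dA[OF that]] Ad_n2[OF that x(1)] CoD(1)[OF Co_Ad[OF that x(1)]] xA x(2)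
  by (simp_all add: \<delta>_def)
 note U = u_unitary v_unitary w_unitary S_unitary
 define L where "L = int (K div 8)"
 define \<phi> where "\<phi> = 4 * (\<delta> u + \<delta> v)"
 define \<kappa> where "\<kappa> = 2 * (\<delta> w + \<delta> S)"
 have far: "sum (mass x) {p \<in> J \<times> J. \<bar>fst p\<bar> > L \<or> \<bar>snd p\<bar> > L} \<le> \<phi>"
 proof -
  define d where "d s = (cmod (om s - 1))\<^sup>2" for s
  have d: "d s \<ge> 0" "s \<in> J ==> \<bar>s\<bar> > L ==> 1 \<le> 2 * d s" for s using om_far[of s] by (auto simp: d_def L_def)
  have "sum (mass x) {p \<in> J \<times> J. \<bar>fst p\<bar> > L \<or> \<bar>snd p\<bar> > L} \<le>
    (\<Sum>p\<in>{p \<in> J \<times> J. \<bar>fst p\<bar> > L \<or> \<bar>snd p\<bar> > L}. 2 * d (fst p) * mass x p + 2 * d (snd p) * mass x p)"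
  proof (rule sum_mono)
   fix p assume "p \<in> {p \<in> J \<times> J. \<bar>fst p\<bar> > L \<or> \<bar>snd p\<bar> > L}"
   then have "1 \<le> 2 * d (fst p) + 2 * d (snd p)"
    using d(1)[of "fst p"] d(1)[of "snd p"] d(2)[of "fst p"] d(2)[of "snd p"] by (auto simp: mem_Times_iff)
   from mult_right_mono[OF this mass_nonneg[of x p]]
   show "mass x p \<le> 2 * d (fst p) * mass x p + 2 * d (snd p) * mass x p" by (simp add: distrib_right)
  qed
  also have "\<dots> \<le> (\<Sum>p\<in>J \<times> J. 2 * d (fst p) * mass x p + 2 * d (snd p) * mass x p)"
   using d(1) mass_nonneg by (intro sum_mono2) auto
  also have "\<dots> = 2 * (\<delta> u)\<^sup>2 + 2 * (\<delta> v)\<^sup>2"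
   using mass_displacement[OF x(1), of u fst] mass_displacement[OF x(1), of v snd]
   by (simp add: sum.distrib \<delta>_def d_def mult.assoc sum_distrib_left)
  also have "\<dots> \<le> \<phi>"
  proof -
   have "(\<delta> y)\<^sup>2 \<le> 2 * \<delta> y" if "y \<in> UF" for y
    using \<delta>[OF that] by (simp add: power2_eq_square mult_right_mono)
   then show ?thesis using U by (simp add: \<phi>_def) (smt (verit))
  qed
  finally show ?thesis .
 qed
 have sh: "\<bar>sum (mass x) ((\<lambda>p. (fst p, snd p - fst p)) ` X) - sum (mass x) X\<bar> \<le> \<kappa>"
  if X: "X \<subseteq> J \<times> J" "(\<lambda>p. (fst p, snd p - fst p)) ` X \<subseteq> J \<times> J" for X
 proof -
  have "\<bar>sum (mass x) ((\<lambda>p. (fst p, snd p - fst p)) ` X) - sum (mass x) X\<bar> \<le> 2 * n2 (Ad w x - x)"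
  proof (rule mass_almost_invariant[OF U(3) x X])
   show "inj (\<lambda>p::int \<times> int. (fst p, snd p - fst p))" by (auto simp: inj_def prod_eq_iff)
   fix p assume p: "p \<in> J \<times> J"
   show "P (fst p, snd p - fst p) (Ad w x) = Ad w (P p x)"
   proof (rule mass_transport[OF U(3) x(1) p])
    fix q :: "int \<times> int"
    assume "int K dvd fst (fst q, snd q - fst q) - fst (fst p, snd p - fst p)"
     "int K dvd snd (fst q, snd q - fst q) - snd (fst p, snd p - fst p)"
    then have d: "int K dvd fst q - fst p" "int K dvd snd q - fst q - (snd p - fst p)" by simp_all
    have "snd q - fst q - (snd p - fst p) + (fst q - fst p) = snd q - snd p" by simp
    with dvd_add[OF d(2,1)] d(1) show "int K dvd fst q - fst p \<and> int K dvd snd q - snd p" by simp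
   qed (rule w_EV)
  qed
  then show ?thesis using \<delta>(1)[OF U(4)] by (simp add: \<kappa>_def \<delta>_def)
 qed
 have ro: "\<bar>sum (mass x) ((\<lambda>p. (snd p, - fst p)) ` X) - sum (mass x) X\<bar> \<le> \<kappa>"
  if X: "X \<subseteq> J \<times> J" "(\<lambda>p. (snd p, - fst p)) ` X \<subseteq> J \<times> J" for X
 proof -
  have "\<bar>sum (mass x) ((\<lambda>p. (snd p, - fst p)) ` X) - sum (mass x) X\<bar> \<le> 2 * n2 (Ad S x - x)"
  proof (rule mass_almost_invariant[OF U(4) x X])
   show "inj (\<lambda>p::int \<times> int. (snd p, - fst p))" by (auto simp: inj_def prod_eq_iff)
   fix p assume p: "p \<in> J \<times> J"
   show "P (snd p, - fst p) (Ad S x) = Ad S (P p x)"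
   proof (rule mass_transport[OF U(4) x(1) p])
    fix q :: "int \<times> int"
    assume "int K dvd fst (snd q, - fst q) - fst (snd p, - fst p)"
     "int K dvd snd (snd q, - fst q) - snd (snd p, - fst p)"
    then have "int K dvd snd q - snd p" "int K dvd - (fst q - fst p)" by simp_all
    then show "int K dvd fst q - fst p \<and> int K dvd snd q - snd p" by (simp only: dvd_minus_iff)
   qed (rule S_EV)
  qed
  then show ?thesis using \<delta>(1)[OF U(3)] by (simp add: \<kappa>_def \<delta>_def)
 qed
 have "{-2*L..2*L} \<subseteq> J"
 proof
  fix s assume "s \<in> {-2*L..2*L}"
  then have "- 2 * int (K div 8) \<le> s" "s \<le> 2 * int (K div 8)" by (auto simp: L_def)
  moreover have "2 * (K div 8) \<le> K div 2" "2 * (K div 8) + K div 2 < K" using K by auto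
  then have "2 * int (K div 8) \<le> int (K div 2)" "2 * int (K div 8) + int (K div 2) < int K" by linarith+
  ultimately show "s \<in> J" by (auto simp: J_def m0_def)
 qed
 then have "sum (mass x) (J \<times> J - {(0,0)}) \<le> 7 * \<phi> + 11 * \<kappa>"
  using far by (intro sector_bound[of J "mass x" L, OF finJ mass_nonneg _ _ _ sh ro]) (simp_all add: L_def)
 also have "\<dots> \<le> 28 * (\<delta> u + \<delta> v + \<delta> w + \<delta> S)"
  using \<delta>(1)[OF U(3)] \<delta>(1)[OF U(4)] by (simp add: \<phi>_def \<kappa>_def)
 finally show ?thesis by (simp add: mass_near_origin[OF x(1)] \<delta>_def)
qed

lemma n2_P_le: "x \<in> Co ==> p \<in> J \<times> J ==> n2 (P p x) \<le> n2 x"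
proof -
 assume x: "x \<in> Co" and p: "p \<in> J \<times> J"
 have "mass x p \<le> (\<Sum>p\<in>J \<times> J. mass x p)" using p by (intro member_le_sum) (auto simp: mass_nonneg)
 then have "(n2 (P p x))\<^sup>2 \<le> (n2 x)\<^sup>2" by (simp add: mass_total[OF x]) (simp add: mass_def)
 then show ?thesis by (rule power2_le_imp_le) (simp add: CoD(1)[OF x])
qed

section \<open>The commutant of the matrix algebra in the corner\<close>

lemma Ad_fixed: assumes "y \<in> UF" "x \<in> Co" "Ad y x = x" shows "y * x = x * y"
proof -
 have "x * y = y * x * (adj y * y)" using assms(3) by (metis Ad_def mult.assoc)
 then show ?thesis using UF_D(2)[OF assms(1)] CoD(3)[OF assms(2)] by (simp add: mult.assoc)
qed

text \<open>The amplification of the corner of \<open>r\<close>: the same \<open>d\<close> in every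
  diagonal place of the matrix. For \<open>d\<close> in that corner it commutes with all matrix
  units.\<close>

definition am where "am d = (\<Sum>a\<in>Z. gm a * d * adj (gm a))"

lemma am_gm:
 assumes "d * r = d" shows "am d * gm b = gm b * d"
proof -
 have dr: "gm a * d * r = gm a * d" for a using assms by (simp add: mult.assoc)
 have "am d = col (\<lambda>a. gm a * d)" by (simp add: am_def col_def)
 then show ?thesis using col_gm[of "\<lambda>a. gm a * d" b] dr by (simp add: gm_mod)
qed

lemma am_mult:
 assumes "d * r = d" shows "am d * am d' = am (d * d')"
proof -
 have "am d * am d' = (\<Sum>a\<in>Z. (am d * gm a) * d' * adj (gm a))" by (subst (2) am_def) (simp add: sum_distrib_left mult.assoc)
 then show ?thesis by (simp only: am_gm[OF assms]) (simp add: am_def mult.assoc)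
qed

lemma am_adj: "adj (am d) = am (adj d)" by (simp add: am_def adj_sum mult.assoc)
lemma am_diff: "am (d - d') = am d - am d'" by (simp add: am_def left_diff_distrib right_diff_distrib sum_subtractf)
lemma am_csc: "am (csc c d) = csc c (am d)" by (simp add: am_def csc_sum)
lemma am_r: "am r = f" by (simp add: am_def f_def gmr)
lemma am_A: "d \<in> A ==> am d \<in> A" by (simp add: am_def)

lemma tau_am: assumes "d \<in> A" "d * r = d" shows "tau (am d) = of_nat K * tau d"
proof -
 have "tau (gm a * d * adj (gm a)) = tau d" for a
  using tau_comm[of "gm a" "d * adj (gm a)"] assms by (simp add: mult.assoc gmgm)
 then show ?thesis using assms by (simp add: am_def tau_sum sum_Z)
qed

lemma n2_am: assumes "d \<in> A" "r * d = d" "d * r = d" shows "n2 (am d) = sqrt (real K) * n2 d"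
proof -
 have dr: "adj d * r = adj d" using arg_cong[OF assms(2), of adj] projD(2)[OF r(1)] by simp
 have "(n2 (am d))\<^sup>2 = Re (tau (am (adj d) * am d))" using assms by (simp add: n2_sq am_A am_adj)
 also have "am (adj d) * am d = am (adj d * d)" by (rule am_mult[OF dr])
 also have "Re (tau \<dots>) = real K * (n2 d)\<^sup>2"
  using assms tau_am[of "adj d * d"] by (simp add: n2_sq mult.assoc)
 finally have "n2 (am d) = sqrt (real K * (n2 d)\<^sup>2)" using assms am_A by (metis n2_nonneg real_sqrt_unique)
 then show ?thesis using assms by (simp add: real_sqrt_mult)
qed

text \<open>Commuting with the clock kills the off-diagonal entries, as its eigenvalues are
  distinct; commuting with the shift makes all diagonal entries equal.\<close>

lemma fixed_is_amplified:
 assumes x: "x \<in> Co" and u: "Ad u x = x" and v: "Ad v x = x"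
 shows "x = am (adj (gm 0) * x * gm 0)"
proof -
 note X = CoD[OF x]
 define c where "c a b = adj (gm a) * x * gm b" for a b
 have ux: "u * x = x * u" and vx: "v * x = x * v" using Ad_fixed u v u_unitary v_unitary x by blast+
 have gu: "adj (gm a) * u = csc (om a) (adj (gm a))" for a
 proof -
  have "adj u * (u * gm a) = gm a" using UF_D(2)[OF u_unitary] by (simp add: mult.assoc[symmetric] f_gm)
  then have "csc (cnj (om a)) (csc (om a) (adj u * gm a)) = csc (cnj (om a)) (gm a)" by (simp add: u_gm)
  then have "adj u * gm a = csc (cnj (om a)) (gm a)" by simp
  from arg_cong[OF this, of adj] show ?thesis by simp
 qed
 have c0: "c a b = 0" if "a \<in> Z" "b \<in> Z" "a \<noteq> b" for a b
 proof -
  have "csc (om a) (c a b) = adj (gm a) * (u * x) * gm b" using gu[of a] by (simp add: c_def mult.assoc[symmetric])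
  also have "\<dots> = csc (om b) (c a b)" by (simp add: ux c_def mult.assoc u_gm)
  finally have "csc (cnj (om b)) (csc (om a) (c a b)) = csc (cnj (om b)) (csc (om b) (c a b))" by simp
  then have "csc (om (a - b) - 1) (c a b) = 0" by (simp add: csc_diff_left om_diff mult.commute)
  then have "csc (1 / (om (a - b) - 1)) (csc (om (a - b) - 1) (c a b)) = 0" by simp
  moreover have "om (a - b) \<noteq> 1"
  proof -
   have "a - b \<noteq> 0" "\<bar>a - b\<bar> < int K" using that by (auto simp: Z_def)
   then show ?thesis using om_eq_1[of "a - b"] zdvd_imp_le[of "int K" "\<bar>a - b\<bar>"] by auto
  qed
  ultimately show ?thesis by simp
 qed
 have cS: "c (a + 1) (a + 1) = c a a" for a
 proof -
  have "c (a + 1) (a + 1) = adj (gm a) * (adj v * (x * v)) * gm a" by (simp add: c_def v_gm[symmetric] mult.assoc)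
  also have "adj v * (x * v) = x" using UF_D(2)[OF v_unitary] X by (simp add: vx[symmetric] mult.assoc[symmetric])
  finally show ?thesis by (simp add: c_def)
 qed
 have cn: "c (int n) (int n) = c 0 0" for n
 proof (induction n)
  case (Suc n)
  then show ?case using cS[of "int n"] by (simp add: add.commute)
 qed simp
 have "x = (\<Sum>a\<in>Z. \<Sum>b\<in>Z. gm a * c a b * adj (gm b))" unfolding c_def by (rule corner_f_eq[OF X(2,3)])
 also have "\<dots> = (\<Sum>a\<in>Z. \<Sum>b\<in>Z. if a = b then gm a * c 0 0 * adj (gm a) else 0)"
 proof (intro sum.cong refl)
  fix a b assume ab: "a \<in> Z" "b \<in> Z"
  show "gm a * c a b * adj (gm b) = (if a = b then gm a * c 0 0 * adj (gm a) else 0)"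
  proof (cases "a = b")
   case True
   then show ?thesis using cn[of "nat a"] ab by (simp add: Z_def)
  qed (simp add: c0 ab)
 qed
 also have "\<dots> = am (c 0 0)" by (simp add: am_def)
 finally show ?thesis by (simp only: c_def)
qed

text \<open>An element of the commutant is the amplification of some \<open>c\<close> in the corner
  of \<open>r\<close>. That corner has a unitary whose commutator with \<open>c\<close> is almost as
  long as the distance of \<open>c\<close> from the scalars; its amplification serves as
  \<open>b\<close>. Amplification scales both 2-norms by the same factor
  \<open>sqrt K\<close>.\<close>

lemma commutant_detects_scalars:
 assumes x: "x \<in> Co" and u: "Ad u x = x" and v: "Ad v x = x" and e: "e > 0"
 shows "\<exists>b\<in>UF. (\<forall>i<K. \<forall>j<K. b * (g i * adj (g j)) = (g i * adj (g j)) * b) \<and>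
   n2 (x - csc (tau x / tau f) f) \<le> n2 (b * x - x * b) + e"
proof -
 note X = CoD[OF x]
 define c where "c = adj (gm 0) * x * gm 0"
 have xc: "x = am c" using fixed_is_amplified[OF x u v] by (simp add: c_def)
 have c: "c \<in> A" "r * c = c" "c * r = c"
  using X by (simp_all add: c_def mult.assoc gmr) (simp add: mult.assoc[symmetric] rgm)
 have rr: "r \<in> A" "r * r = r" using projD r(1) by auto
 define l where "l = tau c / tau r"
 define k where "k = sqrt (real K)"
 have k: "k > 0" using K by (simp add: k_def)
 have lx: "tau x / tau f = l" using tau_am[OF c(1,3)] tau_am[OF rr] K by (simp add: xc[symmetric] am_r l_def)
 have "\<exists>y\<in>corner_unitaries r. n2 (y * c - c * y) > n2 (c - csc l r) - e / k"
 proof (rule ccontr)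
  assume "\<not> ?thesis"
  then have "n2 (c - csc l r) \<le> n2 (c - csc l r) - e / k"
   unfolding l_def by (intro corner_dist_scalars[OF r c]) (auto simp: not_less)
  then show False using divide_pos_pos[OF e k] by simp
 qed
 then obtain y where y: "y \<in> corner_unitaries r" and ny: "n2 (y * c - c * y) > n2 (c - csc l r) - e / k" by blast
 note Y = corner_unitariesD[OF y]
 have Y': "y \<in> A" "adj y * y = r" "y * adj y = r" "r * y = y" "y * r = y" by (rule Y)+
 have ar: "adj y * r = adj y" using arg_cong[OF Y'(4), of adj] projD(2)[OF r(1)] by simp
 define b where "b = am y"
 have cr: "(y * c - c * y) * r = y * c - c * y" "r * (y * c - c * y) = y * c - c * y"
  using c Y' by (simp_all add: left_diff_distrib right_diff_distrib mult.assoc) (metis mult.assoc)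
 have bU: "b \<in> UF"
 proof -
  have "adj b * b = f" "b * adj b = f" "f * b = b" "b * f = b"
   by (simp_all add: b_def am_adj am_mult ar Y' am_r[symmetric] am_mult[OF rr(2)])
  then show ?thesis using Y' by (simp add: corner_unitaries_def b_def am_A)
 qed
 moreover have "b * (g i * adj (g j)) = (g i * adj (g j)) * b" if "i < K" "j < K" for i j
 proof -
  have gi: "g i = gm (int i)" "g j = gm (int j)" using that by (simp_all add: gm_def)
  have "am (adj y) * gm (int j) = gm (int j) * adj y" by (rule am_gm[OF ar])
  from arg_cong[OF this, of adj] have "adj (gm (int j)) * am y = y * adj (gm (int j))" by (simp add: am_adj)
  moreover have "am y * gm (int i) = gm (int i) * y" by (rule am_gm[OF Y'(5)])
  ultimately show ?thesis unfolding b_def gi by (metis mult.assoc)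
 qed
 moreover have "n2 (x - csc (tau x / tau f) f) \<le> n2 (b * x - x * b) + e"
 proof -
  have "b * x - x * b = am (y * c - c * y)" by (simp add: b_def xc am_mult c Y' am_diff)
  then have 1: "n2 (b * x - x * b) = k * n2 (y * c - c * y)" using n2_am[OF _ cr(2,1)] c Y' by (simp add: k_def)
  have "x - csc (tau x / tau f) f = am (c - csc l r)" unfolding lx by (simp add: xc[symmetric] am_diff am_csc am_r)
  then have 2: "n2 (x - csc (tau x / tau f) f) = k * n2 (c - csc l r)"
   using n2_am[of "c - csc l r"] c rr by (simp add: k_def left_diff_distrib right_diff_distrib)
  have "k * n2 (c - csc l r) \<le> k * (n2 (y * c - c * y) + e / k)" using ny k by (intro mult_left_mono) auto
  then show ?thesis using 1 2 k by (simp add: distrib_left)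
 qed
 ultimately show ?thesis by blast
qed

end

section \<open>The spectral gap of the hyperfinite factor\<close>

context hyperfinite_factor begin

text \<open>The left side is the variance, the minimum of the right side over \<open>l\<close>. It
  allows an arbitrary approximating scalar to be used although the formulas do not mention
  one.\<close>

lemma n2_scalar_distance: assumes "a \<in> A" shows "(n2 a)\<^sup>2 - (cmod (tau a))\<^sup>2 \<le> (n2 (a - csc l 1))\<^sup>2"
proof -
 have "(n2 (a + csc (- l) 1))\<^sup>2 = (n2 a)\<^sup>2 + 2 * Re (- l * cnj (tau a)) + (cmod l)\<^sup>2"
  using assms by (simp add: n2_sum_sq tau_csc tau_adj n2_csc n2_one)
 moreover have "(cmod (tau a))\<^sup>2 + 2 * Re (- l * cnj (tau a)) + (cmod l)\<^sup>2 = (cmod (tau a - l))\<^sup>2"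
  unfolding cmod_power2 by (simp add: power2_eq_square algebra_simps)
 moreover have e: "a - csc l 1 = a + csc (- l) 1" by (simp add: csc_minus)
 ultimately show ?thesis using zero_le_power2[of "cmod (tau a - l)"] unfolding e by linarith
qed

text \<open>The contraction \<open>a\<close> is cut down to \<open>x\<close> in the corner of the
  matrices, then replaced by its component \<open>x0\<close> fixed by clock and shift, which the
  expander controls; \<open>x0\<close> lies in the commutant, where a unitary \<open>b\<close> tests
  its distance from the scalars. As \<open>b\<close> commutes with the matrix units, it almost
  commutes with \<open>X\<close>.\<close>

theorem spectral_gap:
 assumes X: "finite X" "X \<subseteq> A" and e: "e > 0"
 shows "\<exists>y. (\<forall>j. y j \<in> A \<and> norm (y j) \<le> 1) \<and> (\<forall>a\<in>A. norm a \<le> 1 --> (\<exists>b\<in>A. norm b \<le> 1 \<and>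
   (\<forall>x\<in>X. n2 (b * x - x * b) \<le> e) \<and>
   (n2 a)\<^sup>2 - (cmod (tau a))\<^sup>2 \<le> 800 * (n2 (b * a - a * b) + (\<Sum>j<4::nat. n2 (y j * a - a * y j))) + e))"
proof -
 \<comment> \<open>The final estimate collects \<open>3 * (81 + 9 * 28 * 16) = 12339\<close> times
   \<eta>, so 20000 suffices. The bound 1/2 keeps \<open>f\<close> away from 0 and gives \<eta>^2 <=
   \<eta>.\<close>
 define \<eta> where "\<eta> = min (1/2) (e / 20000)"
 have \<eta>: "\<eta> > 0" "\<eta> \<le> 1/2" "20000 * \<eta> \<le> e" using e by (auto simp: \<eta>_def min_def)
 obtain K g r where r: "proj r" "r \<noteq> 0" and g: "\<And>i. i < (K::nat) ==> g i \<in> A"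
   "\<And>i j. i < K ==> j < K ==> adj (g i) * g j = (if i = j then r else 0)"
  and s: "n2 (1 - (\<Sum>i<K. g i * adj (g i))) < \<eta>"
  and lX: "\<And>x. x \<in> X ==> \<exists>l. n2 (x - (\<Sum>i<K. \<Sum>j<K. csc (l i j) (g i * adj (g j)))) < \<eta>"
  using matrix_approximation[OF X \<eta>(1)] by blast
 have K: "K > 0"
 proof (rule ccontr)
  assume "\<not> K > 0"
  then show False using s \<eta>(2) by (simp add: n2_one)
 qed
 interpret matrix_system A tau K g r by unfold_locales (use K r g in auto)
 have fg: "(\<Sum>i<K. g i * adj (g i)) = f" unfolding f_def sum_Z by (intro sum.cong) (auto simp: gm_def)
 have f1: "n2 (1 - f) < \<eta>" using s by (simp add: fg)
 have nf: "norm f \<le> 1" by (rule proj_norm[OF proj_f])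
 \<comment> \<open>Only the indices below 4 are summed; the \<open>min\<close> gives the others a
   value that is a contraction too.\<close>
 define y where "y j = [u, v, w, S] ! min j 3" for j :: nat
 have yU: "y j \<in> UF" for j
 proof -
  have "y j \<in> set [u, v, w, S]" unfolding y_def by (rule nth_mem) simp
  then show ?thesis using u_unitary v_unitary w_unitary S_unitary by auto
 qed
 note yA = UF_D(1)[OF yU] and yn = UF_D(8)[OF yU]
 have y4: "(\<Sum>j<4. h (y j)) = h u + h v + h w + h S" for h :: "'h bop => real"
  by (simp add: numeral_eq_Suc y_def)
 show ?thesis
 proof (intro exI[of _ y] conjI allI ballI impI)
  show "y j \<in> A" "norm (y j) \<le> 1" for j using yA yn by auto
  fix a assume a: "a \<in> A" "norm a \<le> 1"
  define x where "x = f * a * f"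
  have x: "x \<in> Co" using a by (simp add: Co_def x_def mult.assoc) (simp add: mult.assoc[symmetric])
  have xA: "x \<in> A" by (rule CoD(1)[OF x])
  have fa: "norm (f * a) \<le> 1" using norm_mult_ineq[of f a] nf a(2) mult_mono[of "norm f" 1 "norm a" 1] by simp
  have nx: "norm x \<le> 1" using norm_mult_ineq[of "f * a" f] nf fa mult_mono[of "norm (f * a)" 1 "norm f" 1] by (simp add: x_def)
  have nx2: "n2 x \<le> 1" using n2_le_norm[OF xA] nx by simp
  have ax: "n2 (a - x) \<le> 2 * \<eta>"
  proof -
   have "n2 ((1 - f) * a) \<le> n2 (1 - f) * norm a" using a by (intro n2_mult_right) auto
   also have "\<dots> \<le> n2 (1 - f) * 1" using a by (intro mult_left_mono) auto
   finally have 1: "n2 ((1 - f) * a) \<le> n2 (1 - f)" by simp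
   have "n2 (f * a * (1 - f)) \<le> norm (f * a) * n2 (1 - f)" using a by (intro n2_mult_left) auto
   also have "\<dots> \<le> 1 * n2 (1 - f)" using fa by (intro mult_right_mono) auto
   finally have 2: "n2 (f * a * (1 - f)) \<le> n2 (1 - f)" by simp
   have "a - x = (1 - f) * a + f * a * (1 - f)" by (simp add: x_def left_diff_distrib right_diff_distrib)
   then show ?thesis using n2_triangle[of "(1 - f) * a" "f * a * (1 - f)"] 1 2 f1 a by simp
  qed
  define D where "D = (\<Sum>j<4. n2 (y j * a - a * y j))"
  define x0 where "x0 = P (0,0) x"
  have x0: "x0 \<in> Co" "x0 \<in> EV (0,0)" using P_Co[OF x] P_EV[OF x] by (auto simp: x0_def)
  have x0A: "x0 \<in> A" by (rule CoD(1)[OF x0(1)])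
  have cy: "n2 (Ad z x - x) \<le> n2 (z * a - a * z) + 4 * \<eta>" if "z \<in> UF" for z
  proof -
   note Y = UF_D[OF that]
   have "Ad z x - x = (z * x - x * z) * adj z"
    using Y CoD[OF x] by (simp add: Ad_def left_diff_distrib mult.assoc)
   then have "n2 (Ad z x - x) \<le> n2 (z * x - x * z) * norm (adj z)" using Y xA by (simp add: n2_mult_right del: norm_adj)
   also have "\<dots> \<le> n2 (z * x - x * z) * 1" using Y xA by (intro mult_left_mono) auto
   also have "n2 (z * x - x * z) = n2 (x * z - z * x)" using Y xA by (intro n2_diff_commute) auto
   also have "\<dots> \<le> n2 (a * z - z * a) + 2 * (n2 (a - x) * norm z)" using Y xA a by (intro n2_commutator_diff)
   also have "n2 (a * z - z * a) = n2 (z * a - a * z)" using Y a by (intro n2_diff_commute) auto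
   finally have "n2 (Ad z x - x) \<le> n2 (z * a - a * z) + 2 * (n2 (a - x) * norm z)" by simp
   moreover have "n2 (a - x) * norm z \<le> n2 (a - x) * 1" using Y a xA by (intro mult_left_mono) auto
   ultimately show ?thesis using ax by simp
  qed
  have "(n2 (x - x0))\<^sup>2 \<le> 28 * (D + 16 * \<eta>)"
  proof -
   have arith: "m \<le> 28 * (d1' + d2' + d3' + d4' + 16 * \<eta>)"
    if "m \<le> 28 * (d1 + d2 + d3 + d4)" "d1 \<le> d1' + 4 * \<eta>" "d2 \<le> d2' + 4 * \<eta>" "d3 \<le> d3' + 4 * \<eta>" "d4 \<le> d4' + 4 * \<eta>"
    for m d1 d2 d3 d4 d1' d2' d3' d4' :: real using that by argo
   show ?thesis unfolding D_def y4[of "\<lambda>z. n2 (z * a - a * z)"] x0_def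
    by (rule arith[OF expander[OF x nx2] cy[OF u_unitary] cy[OF v_unitary] cy[OF w_unitary] cy[OF S_unitary]])
  qed
  define t where "t = n2 (x - x0)"
  have t: "t\<^sup>2 \<le> 28 * (D + 16 * \<eta>)" "t \<ge> 0" using \<open>(n2 (x - x0))\<^sup>2 \<le> 28 * (D + 16 * \<eta>)\<close> xA x0A by (simp_all add: t_def)
  have fixed: "Ad u x0 = x0" "Ad v x0 = x0" using x0(2) by (simp_all add: EV_def)
  obtain b where b: "b \<in> UF" "\<And>i j. i < K ==> j < K ==> b * (g i * adj (g j)) = (g i * adj (g j)) * b"
   and nb: "n2 (x0 - csc (tau x0 / tau f) f) \<le> n2 (b * x0 - x0 * b) + \<eta>"
   using commutant_detects_scalars[OF x0(1) fixed \<eta>(1)] by blast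
  note B = UF_D[OF b(1)]
  define q where "q = n2 (b * a - a * b)"
  define l where "l = tau x0 / tau f"
  have ax0: "n2 (a - x0) \<le> 2 * \<eta> + t" using n2_dist_triangle[of a x x0] a xA x0A ax by (simp add: t_def)
  \<comment> \<open>The trace of \<open>f\<close> is the square of its 2-norm, which is at least
    1/2, and \<open>tau x0\<close> is at most that 2-norm; so the quotient is at most its
    inverse.\<close>
  have l: "cmod l \<le> 2"
  proof -
   have nf2: "n2 f \<ge> 1/2" using n2_triangle[of "1 - f" f] f1 \<eta>(2) by (simp add: n2_one)
   have tf: "tau f = of_real ((n2 f)\<^sup>2)" using tau_adj_self[of f] by simp
   have "cmod (tau x0) \<le> n2 f * n2 x0" using tau_cs[of f x0] CoD(2)[OF x0(1)] x0A by simp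
   also have "\<dots> \<le> n2 f * 1"
   proof -
    have "(0, 0) \<in> J \<times> J" using K by (auto simp: J_def m0_def)
    from n2_P_le[OF x this] show ?thesis using nx2 by (intro mult_left_mono) (auto simp: x0_def)
   qed
   finally have "cmod (tau x0) \<le> n2 f" by simp
   then have "cmod l \<le> n2 f / (n2 f)\<^sup>2" unfolding l_def tf norm_divide norm_of_real abs_power2
    by (rule divide_right_mono) simp
   also have "\<dots> = 1 / n2 f" by (simp add: power2_eq_square)
   also have "\<dots> \<le> 2" using nf2 by (simp add: field_simps)
   finally show ?thesis .
  qed
  have bx0: "n2 (b * x0 - x0 * b) \<le> q + 2 * (2 * \<eta> + t)"
  proof -
   have "n2 (x0 * b - b * x0) \<le> n2 (a * b - b * a) + 2 * (n2 (a - x0) * norm b)" using B x0A a by (intro n2_commutator_diff)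
   moreover have "n2 (a - x0) * norm b \<le> n2 (a - x0) * 1" using B a x0A by (intro mult_left_mono) auto
   ultimately show ?thesis using ax0 n2_diff_commute[of "x0 * b" "b * x0"] n2_diff_commute[of "a * b" "b * a"] B x0A a by (simp add: q_def)
  qed
  \<comment> \<open>The path is \<open>a\<close>, \<open>x0\<close>, \<open>l * f\<close>,
    \<open>l\<close>, of lengths at most 2 \<eta> + t, then q + 2 (2 \<eta> + t) + \<eta>, then 2
    \<eta>.\<close>
  have main: "n2 (a - csc l 1) \<le> 9 * \<eta> + 3 * t + q"
  proof -
   have "n2 (csc l f - csc l 1) \<le> 2 * \<eta>"
   proof -
    have "n2 (csc l f - csc l 1) = cmod l * n2 (1 - f)"
     using n2_csc[of "f - 1" l] n2_diff_commute[of f 1] by (simp add: csc_diff_right)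
    also have "\<dots> \<le> 2 * \<eta>" using l f1 by (intro mult_mono) auto
    finally show ?thesis .
   qed
   moreover have "n2 (a - csc l 1) \<le> n2 (a - x0) + (n2 (x0 - csc l f) + n2 (csc l f - csc l 1))"
    using n2_dist_triangle[of a x0 "csc l 1"] n2_dist_triangle[of x0 "csc l f" "csc l 1"] a x0A by simp
   ultimately show ?thesis using ax0 bx0 nb by (simp add: l_def)
  qed
  show "\<exists>b\<in>A. norm b \<le> 1 \<and> (\<forall>x\<in>X. n2 (b * x - x * b) \<le> e) \<and>
   (n2 a)\<^sup>2 - (cmod (tau a))\<^sup>2 \<le> 800 * (n2 (b * a - a * b) + (\<Sum>j<4::nat. n2 (y j * a - a * y j))) + e"
  proof (intro bexI[of _ b] conjI ballI)
   fix x assume x: "x \<in> X"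
   then obtain L where L: "n2 (x - (\<Sum>i<K. \<Sum>j<K. csc (L i j) (g i * adj (g j)))) < \<eta>" using lX by blast
   define z where "z = (\<Sum>i<K. \<Sum>j<K. csc (L i j) (g i * adj (g j)))"
   have zA: "z \<in> A" unfolding z_def using g(1) by (intro sum_in csc_in) auto
   have xA': "x \<in> A" using x X by auto
   have "b * z = z * b" by (simp add: z_def sum_distrib_left sum_distrib_right b(2))
   then have "n2 (x * b - b * x) \<le> 0 + 2 * (n2 (z - x) * norm b)" using n2_commutator_diff[of z b x] B zA xA' by simp
   also have "\<dots> \<le> 2 * (n2 (z - x) * 1)"
    using mult_left_mono[OF B(8) n2_nonneg[of "z - x"]] zA xA' by simp
   also have "\<dots> \<le> e" using L \<eta> n2_diff_commute[OF zA xA'] by (simp add: z_def)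
   finally show "n2 (b * x - x * b) \<le> e" using n2_diff_commute[of "x * b" "b * x"] B xA' by simp
  next
   have q: "0 \<le> q" "q \<le> 2"
   proof -
    show "0 \<le> q" using B a by (simp add: q_def)
    have "norm (b * a - a * b) \<le> norm b * norm a + norm a * norm b"
     using norm_triangle_ineq4[of "b * a" "a * b"] norm_mult_ineq[of b a] norm_mult_ineq[of a b] by linarith
    also have "\<dots> \<le> 1 * 1 + 1 * 1" using B a by (intro add_mono mult_mono) auto
    finally show "q \<le> 2" using n2_le_norm[of "b * a - a * b"] B a by (simp add: q_def)
   qed
   have "(n2 a)\<^sup>2 - (cmod (tau a))\<^sup>2 \<le> (n2 (a - csc l 1))\<^sup>2" by (rule n2_scalar_distance[OF a(1)])
   also have "\<dots> \<le> (9 * \<eta> + 3 * t + q)\<^sup>2" using main a by (intro power_mono) auto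
   also have "\<dots> \<le> 3 * (81 * \<eta>\<^sup>2 + 9 * t\<^sup>2 + q\<^sup>2)"
   proof -
    have "0 \<le> (9 * \<eta> - 3 * t)\<^sup>2 + (9 * \<eta> - q)\<^sup>2 + (3 * t - q)\<^sup>2" by simp
    then show ?thesis by (simp add: power2_eq_square algebra_simps)
   qed
   \<comment> \<open>The expander bounds the square of \<open>t\<close> linearly, and
     \<open>q <= 2\<close> does so for the square of \<open>q\<close>. The factor of
     \<open>D\<close> becomes \<open>3 * 9 * 28 = 756\<close>, whence the constant 800.\<close>
   also have "\<dots> \<le> 3 * (81 * \<eta> + 9 * (28 * (D + 16 * \<eta>)) + 2 * q)"
   proof -
    have "\<eta>\<^sup>2 \<le> \<eta>" "q\<^sup>2 \<le> 2 * q" using \<eta> q by (simp_all add: power2_eq_square mult_right_mono)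
    then show ?thesis using t(1) by simp
   qed
   also have "\<dots> \<le> 800 * (q + D) + e"
   proof -
    have "D \<ge> 0" unfolding D_def using yA a by (intro sum_nonneg n2_nonneg) auto
    then show ?thesis using q(1) \<eta> by simp
   qed
   finally show "(n2 a)\<^sup>2 - (cmod (tau a))\<^sup>2 \<le> 800 * (n2 (b * a - a * b) + (\<Sum>j<4::nat. n2 (y j * a - a * y j))) + e"
    by (simp add: q_def D_def)
  qed (use B in auto)
 qed
qed

end

section \<open>Tracial von Neumann algebras as structures\<close>

definition dist2 :: "'a tracial_algebra => 'a => 'a => real" where
 "dist2 N x y = norm2 N (x \<ominus>\<^bsub>N\<^esub> y)"

text \<open>The facts about a tracial von Neumann algebra on which the evaluation of formulas and
  the ultrapower argument rest, free of the Hilbert space. The expansion of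
  \<open>dist2 N x (c \<odot> y)\<close> is the trace of the inner product structure: it computes
  distances from scalars out of traces.\<close>

locale tracial_structure =
 fixes N :: "'a tracial_algebra" (structure)
 assumes closed [simp]: "\<one> \<in> carrier N" "\<zero> \<in> carrier N"
  "x \<in> carrier N ==> y \<in> carrier N ==> x \<oplus> y \<in> carrier N"
  "x \<in> carrier N ==> y \<in> carrier N ==> x \<otimes> y \<in> carrier N"
  "x \<in> carrier N ==> c \<odot> x \<in> carrier N"
  "x \<in> carrier N ==> star N x \<in> carrier N"
 and opnorm: "x \<in> carrier N ==> 0 \<le> opnorm N x" "opnorm N \<zero> = 0" "opnorm N \<one> \<le> 1"
  "x \<in> carrier N ==> y \<in> carrier N ==> opnorm N (x \<oplus> y) \<le> opnorm N x + opnorm N y"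
  "x \<in> carrier N ==> y \<in> carrier N ==> opnorm N (x \<otimes> y) \<le> opnorm N x * opnorm N y"
  "x \<in> carrier N ==> opnorm N (c \<odot> x) = cmod c * opnorm N x"
  "x \<in> carrier N ==> opnorm N (star N x) = opnorm N x"
 and dist2_nonneg [simp]: "x \<in> carrier N ==> y \<in> carrier N ==> 0 \<le> dist2 N x y"
 and dist2_refl [simp]: "x \<in> carrier N ==> dist2 N x x = 0"
 and dist2_sym: "x \<in> carrier N ==> y \<in> carrier N ==> dist2 N x y = dist2 N y x"
 and dist2_triangle: "x \<in> carrier N ==> y \<in> carrier N ==> z \<in> carrier N ==> dist2 N x z \<le> dist2 N x y + dist2 N y z"
 and dist2_add: "x \<in> carrier N ==> y \<in> carrier N ==> x' \<in> carrier N ==> y' \<in> carrier N ==>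
   dist2 N (x \<oplus> y) (x' \<oplus> y') \<le> dist2 N x x' + dist2 N y y'"
 and dist2_mult: "x \<in> carrier N ==> y \<in> carrier N ==> x' \<in> carrier N ==> y' \<in> carrier N ==>
   dist2 N (x \<otimes> y) (x' \<otimes> y') \<le> opnorm N x * dist2 N y y' + dist2 N x x' * opnorm N y'"
 and dist2_smult: "x \<in> carrier N ==> y \<in> carrier N ==> dist2 N (c \<odot> x) (c \<odot> y) = cmod c * dist2 N x y"
 and dist2_star: "x \<in> carrier N ==> y \<in> carrier N ==> dist2 N (star N x) (star N y) = dist2 N x y"
 and tr_dist2: "x \<in> carrier N ==> y \<in> carrier N ==> cmod (tr N x - tr N y) \<le> dist2 N x y"
 and tr_le: "x \<in> carrier N ==> cmod (tr N x) \<le> opnorm N x"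
 and dist2_smult_sq: "x \<in> carrier N ==> y \<in> carrier N ==> (dist2 N x (c \<odot> y))\<^sup>2 =
   Re (tr N (star N x \<otimes> x)) - 2 * Re (c * tr N (star N x \<otimes> y)) + (cmod c)\<^sup>2 * Re (tr N (star N y \<otimes> y))"
 and scalar: "x \<in> carrier N ==> (c \<odot> \<one>) \<otimes> x = c \<odot> x" "x \<in> carrier N ==> x \<otimes> (c \<odot> \<one>) = c \<odot> x"
  "x \<in> carrier N ==> y \<in> carrier N ==> (c \<odot> x) \<otimes> y = c \<odot> (x \<otimes> y)"
  "x \<in> carrier N ==> y \<in> carrier N ==> x \<otimes> (c \<odot> y) = c \<odot> (x \<otimes> y)"
  "x \<in> carrier N ==> c \<odot> (c' \<odot> x) = (c * c') \<odot> x" "x \<in> carrier N ==> 1 \<odot> x = x"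
 and tr_scalar: "x \<in> carrier N ==> tr N (star N x \<otimes> \<one>) = cnj (tr N x)" "tr N (star N \<one> \<otimes> \<one>) = 1"

locale blin_structure = vna A tau for A :: "'h::chilbert_space bop set" and tau +
 fixes R :: "('h \<Rightarrow>\<^sub>L 'h) set" and \<tau> :: "('h \<Rightarrow>\<^sub>L 'h) => complex"
 assumes R: "R = blin ` A" and tau: "tau x = \<tau> (blin x)"
begin

abbreviation N where "N \<equiv> structure_of R \<tau>"

lemma carrier_iff: "x \<in> carrier N \<longleftrightarrow> (\<exists>x'\<in>A. x = blin x')"
 by (auto simp: structure_of_def R)

lemma structure_simps:
 "blin x \<otimes>\<^bsub>N\<^esub> blin y = blin (x * y)" "blin x \<oplus>\<^bsub>N\<^esub> blin y = blin (x + y)"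
 "c \<odot>\<^bsub>N\<^esub> blin x = blin (csc c x)" "star N (blin x) = blin (adj x)"
 "\<one>\<^bsub>N\<^esub> = blin 1" "\<zero>\<^bsub>N\<^esub> = blin 0" "opnorm N (blin x) = norm x" "tr N (blin x) = tau x"
 by (simp_all add: structure_of_def times_bop.rep_eq plus_bop.rep_eq csc.rep_eq one_bop.rep_eq
   zero_bop.rep_eq norm_bop.rep_eq op_adjoint_blin tau)

lemma dist2_blin: assumes "y \<in> A" shows "dist2 N (blin x) (blin y) = n2 (x - y)"
proof -
 have "\<ominus>\<^bsub>N\<^esub> blin y = blin (- y)" unfolding a_inv_def m_inv_def
 proof (rule the_equality)
  show "blin (- y) \<in> carrier (add_monoid N) \<and> blin y \<otimes>\<^bsub>add_monoid N\<^esub> blin (- y) = \<one>\<^bsub>add_monoid N\<^esub> \<and>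
    blin (- y) \<otimes>\<^bsub>add_monoid N\<^esub> blin y = \<one>\<^bsub>add_monoid N\<^esub>"
   using assms by (auto simp: carrier_iff structure_simps)
  fix z assume "z \<in> carrier (add_monoid N) \<and> blin y \<otimes>\<^bsub>add_monoid N\<^esub> z = \<one>\<^bsub>add_monoid N\<^esub> \<and>
    z \<otimes>\<^bsub>add_monoid N\<^esub> blin y = \<one>\<^bsub>add_monoid N\<^esub>"
  then obtain z' where z: "z = blin z'" "y + z' = 0" by (auto simp: carrier_iff structure_simps blin_inject)
  then have "z' = - y" using minus_unique[of y z'] by simp
  then show "z = blin (- y)" using z(1) by simp
 qed
 then show ?thesis by (simp add: dist2_def a_minus_def structure_simps norm2_def n2_def)
qed

lemma dist2_smult_sq_blin:
 assumes "x \<in> A" "y \<in> A"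
 shows "(n2 (x - csc c y))\<^sup>2 = Re (tau (adj x * x)) - 2 * Re (c * tau (adj x * y)) + (cmod c)\<^sup>2 * Re (tau (adj y * y))"
 using n2_sum_sq[of x "csc (- c) y"] assms by (simp add: n2_csc tau_csc power_mult_distrib flip: n2_sq) (simp add: csc_minus tau_minus)

sublocale tracial_structure N
proof unfold_locales
 note * = carrier_iff structure_simps dist2_blin
 show "\<one>\<^bsub>N\<^esub> \<in> carrier N" "\<zero>\<^bsub>N\<^esub> \<in> carrier N" by (auto simp: *)
 show "opnorm N \<zero>\<^bsub>N\<^esub> = 0" "opnorm N \<one>\<^bsub>N\<^esub> \<le> 1" by (simp_all add: structure_simps norm_one_le)
 show "tr N (star N \<one>\<^bsub>N\<^esub> \<otimes>\<^bsub>N\<^esub> \<one>\<^bsub>N\<^esub>) = 1" by (simp add: structure_simps tau_one)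
 fix c c' :: complex and x y x' y' z
 assume xC: "x \<in> carrier N"
 then obtain X where X: "X \<in> A" "x = blin X" by (auto simp: carrier_iff)
 show "c \<odot>\<^bsub>N\<^esub> x \<in> carrier N" "star N x \<in> carrier N" using X by (auto simp: *)
 show "0 \<le> opnorm N x" "opnorm N (c \<odot>\<^bsub>N\<^esub> x) = cmod c * opnorm N x" "opnorm N (star N x) = opnorm N x"
  "dist2 N x x = 0" using X by (auto simp: *)
 show "cmod (tr N x) \<le> opnorm N x" using X tau_le_n2[of X] n2_le_norm[of X] by (simp add: *)
 show "(c \<odot>\<^bsub>N\<^esub> \<one>\<^bsub>N\<^esub>) \<otimes>\<^bsub>N\<^esub> x = c \<odot>\<^bsub>N\<^esub> x" "x \<otimes>\<^bsub>N\<^esub> (c \<odot>\<^bsub>N\<^esub> \<one>\<^bsub>N\<^esub>) = c \<odot>\<^bsub>N\<^esub> x"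
  "c \<odot>\<^bsub>N\<^esub> (c' \<odot>\<^bsub>N\<^esub> x) = (c * c') \<odot>\<^bsub>N\<^esub> x" "1 \<odot>\<^bsub>N\<^esub> x = x" using X by (auto simp: *)
 show "tr N (star N x \<otimes>\<^bsub>N\<^esub> \<one>\<^bsub>N\<^esub>) = cnj (tr N x)" using X by (simp add: structure_simps tau_adj)
 assume yC: "y \<in> carrier N"
 then obtain Y where Y: "Y \<in> A" "y = blin Y" by (auto simp: carrier_iff)
 show "x \<oplus>\<^bsub>N\<^esub> y \<in> carrier N" "x \<otimes>\<^bsub>N\<^esub> y \<in> carrier N" using X Y by (auto simp: *)
 show "opnorm N (x \<oplus>\<^bsub>N\<^esub> y) \<le> opnorm N x + opnorm N y" "opnorm N (x \<otimes>\<^bsub>N\<^esub> y) \<le> opnorm N x * opnorm N y"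
  using X Y by (simp_all add: structure_simps norm_triangle_ineq norm_mult_ineq)
 show "0 \<le> dist2 N x y" "dist2 N x y = dist2 N y x" using X Y n2_diff_commute[of X Y] by (simp_all add: *)
 show "dist2 N (c \<odot>\<^bsub>N\<^esub> x) (c \<odot>\<^bsub>N\<^esub> y) = cmod c * dist2 N x y"
  using X Y n2_csc[of "X - Y" c] by (simp add: * csc_diff_right)
 show "dist2 N (star N x) (star N y) = dist2 N x y" using X Y n2_adj[of "X - Y"] by (simp add: *)
 show "cmod (tr N x - tr N y) \<le> dist2 N x y" using X Y tau_le_n2[of "X - Y"] by (simp add: * tau_diff)
 show "(dist2 N x (c \<odot>\<^bsub>N\<^esub> y))\<^sup>2 = Re (tr N (star N x \<otimes>\<^bsub>N\<^esub> x)) -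
   2 * Re (c * tr N (star N x \<otimes>\<^bsub>N\<^esub> y)) + (cmod c)\<^sup>2 * Re (tr N (star N y \<otimes>\<^bsub>N\<^esub> y))"
  using X Y dist2_smult_sq_blin[of X Y c] by (simp add: *)
 show "(c \<odot>\<^bsub>N\<^esub> x) \<otimes>\<^bsub>N\<^esub> y = c \<odot>\<^bsub>N\<^esub> (x \<otimes>\<^bsub>N\<^esub> y)" "x \<otimes>\<^bsub>N\<^esub> (c \<odot>\<^bsub>N\<^esub> y) = c \<odot>\<^bsub>N\<^esub> (x \<otimes>\<^bsub>N\<^esub> y)"
  using X Y by (simp_all add: structure_simps)
 show "dist2 N x z \<le> dist2 N x y + dist2 N y z" if "z \<in> carrier N"
  using X Y that n2_dist_triangle[of X Y] by (auto simp: *)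
 assume "x' \<in> carrier N" "y' \<in> carrier N"
 then obtain X' Y' where X': "X' \<in> A" "x' = blin X'" and Y': "Y' \<in> A" "y' = blin Y'" by (auto simp: carrier_iff)
 show "dist2 N (x \<oplus>\<^bsub>N\<^esub> y) (x' \<oplus>\<^bsub>N\<^esub> y') \<le> dist2 N x x' + dist2 N y y'"
  using X Y X' Y' n2_triangle[of "X - X'" "Y - Y'"] by (simp add: * algebra_simps)
 show "dist2 N (x \<otimes>\<^bsub>N\<^esub> y) (x' \<otimes>\<^bsub>N\<^esub> y') \<le> opnorm N x * dist2 N y y' + dist2 N x x' * opnorm N y'"
  using X Y X' Y' n2_mult_diff[of X Y X' Y'] by (simp add: *)
qed

end

text \<open>The conclusion of \<open>spectral_gap\<close> in terms that atomic formulas name: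
  distances of commutators, and the variance with real and imaginary part of the trace
  separated.\<close>

definition spectral_gap_property :: "'a tracial_algebra => bool" where
 "spectral_gap_property N \<longleftrightarrow> (\<forall>X e. finite X \<and> X \<subseteq> carrier N \<and> e > 0 -->
   (\<exists>y. (\<forall>j. y j \<in> norm_ball N 1) \<and> (\<forall>a\<in>norm_ball N 1. \<exists>b\<in>norm_ball N 1.
    (\<forall>x\<in>X. dist2 N (b \<otimes>\<^bsub>N\<^esub> x) (x \<otimes>\<^bsub>N\<^esub> b) \<le> e) \<and>
    Re (tr N (star N a \<otimes>\<^bsub>N\<^esub> a)) - (Re (tr N a))\<^sup>2 - (Im (tr N a))\<^sup>2 \<le>
     800 * (dist2 N (b \<otimes>\<^bsub>N\<^esub> a) (a \<otimes>\<^bsub>N\<^esub> b) + (\<Sum>j<4::nat. dist2 N (y j \<otimes>\<^bsub>N\<^esub> a) (a \<otimes>\<^bsub>N\<^esub> y j))) + e)))"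

lemma (in blin_structure) spectral_gap_propertyI:
 assumes "hyperfinite_factor A tau F" shows "spectral_gap_property N" unfolding spectral_gap_property_def
proof (intro allI impI, elim conjE)
 interpret hyperfinite_factor A tau F by (rule assms)
 fix X and e :: real assume X: "finite X" "X \<subseteq> carrier N" and e: "e > 0"
 define X' where "X' = {x \<in> A. blin x \<in> X}"
 have fin: "finite X'"
  by (rule finite_imageD[of blin]) (use X in \<open>auto simp: X'_def inj_on_def blin_inject intro: finite_subset\<close>)
 have "X' \<subseteq> A" by (auto simp: X'_def)
 from spectral_gap[OF fin this e] obtain y where y: "\<And>j. y j \<in> A" "\<And>j. norm (y j) \<le> 1"
  and g: "\<And>a. a \<in> A ==> norm a \<le> 1 ==> \<exists>b\<in>A. norm b \<le> 1 \<and> (\<forall>x\<in>X'. n2 (b * x - x * b) \<le> e) \<and>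
   (n2 a)\<^sup>2 - (cmod (tau a))\<^sup>2 \<le> 800 * (n2 (b * a - a * b) + (\<Sum>j<4::nat. n2 (y j * a - a * y j))) + e"
  by blast
 show "\<exists>y. (\<forall>j. y j \<in> norm_ball N 1) \<and> (\<forall>a\<in>norm_ball N 1. \<exists>b\<in>norm_ball N 1.
    (\<forall>x\<in>X. dist2 N (b \<otimes>\<^bsub>N\<^esub> x) (x \<otimes>\<^bsub>N\<^esub> b) \<le> e) \<and>
    Re (tr N (star N a \<otimes>\<^bsub>N\<^esub> a)) - (Re (tr N a))\<^sup>2 - (Im (tr N a))\<^sup>2 \<le>
     800 * (dist2 N (b \<otimes>\<^bsub>N\<^esub> a) (a \<otimes>\<^bsub>N\<^esub> b) + (\<Sum>j<4::nat. dist2 N (y j \<otimes>\<^bsub>N\<^esub> a) (a \<otimes>\<^bsub>N\<^esub> y j))) + e)"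
 proof (intro exI[of _ "\<lambda>j. blin (y j)"] conjI allI ballI)
  show "blin (y j) \<in> norm_ball N 1" for j using y by (auto simp: norm_ball_def carrier_iff structure_simps)
  fix a assume "a \<in> norm_ball N 1"
  then obtain a' where a: "a' \<in> A" "norm a' \<le> 1" "a = blin a'" by (auto simp: norm_ball_def carrier_iff structure_simps)
  from g[OF a(1,2)] obtain b where b: "b \<in> A" "norm b \<le> 1" "\<And>x. x \<in> X' ==> n2 (b * x - x * b) \<le> e"
   "(n2 a')\<^sup>2 - (cmod (tau a'))\<^sup>2 \<le> 800 * (n2 (b * a' - a' * b) + (\<Sum>j<4::nat. n2 (y j * a' - a' * y j))) + e" by blast
  show "\<exists>b\<in>norm_ball N 1. (\<forall>x\<in>X. dist2 N (b \<otimes>\<^bsub>N\<^esub> x) (x \<otimes>\<^bsub>N\<^esub> b) \<le> e) \<and>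
    Re (tr N (star N a \<otimes>\<^bsub>N\<^esub> a)) - (Re (tr N a))\<^sup>2 - (Im (tr N a))\<^sup>2 \<le>
     800 * (dist2 N (b \<otimes>\<^bsub>N\<^esub> a) (a \<otimes>\<^bsub>N\<^esub> b) + (\<Sum>j<4::nat. dist2 N (blin (y j) \<otimes>\<^bsub>N\<^esub> a) (a \<otimes>\<^bsub>N\<^esub> blin (y j)))) + e"
  proof (intro bexI[of _ "blin b"] conjI ballI)
   fix x assume x: "x \<in> X"
   then obtain x' where "x' \<in> A" "x = blin x'" using X(2) carrier_iff by blast
   then show "dist2 N (blin b \<otimes>\<^bsub>N\<^esub> x) (x \<otimes>\<^bsub>N\<^esub> blin b) \<le> e"
    using b x by (simp add: structure_simps dist2_blin X'_def)
  qed (use a b y in \<open>auto simp: norm_ball_def carrier_iff structure_simps dist2_blin n2_sq[symmetric] cmod_power2 algebra_simps\<close>)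
 qed
qed

lemma strong_operator_neighbourhood:
 fixes V :: "('a::real_normed_vector \<Rightarrow>\<^sub>L 'b::real_normed_vector) set"
 assumes "openin strong_operator_topology V" "T \<in> V"
 shows "\<exists>H e. finite H \<and> e > 0 \<and> (\<forall>S. (\<forall>h\<in>H. norm (blinfun_apply S h - blinfun_apply T h) < e) --> S \<in> V)"
proof -
 obtain U where U: "open U" "V = blinfun_apply -` U"
  using assms(1) unfolding strong_operator_topology_def by (auto simp: openin_pullback_topology)
 have "openin (product_topology (\<lambda>i. euclidean) UNIV) U" using U(1) by (simp add: open_fun_def)
 moreover have "blinfun_apply T \<in> U" using assms(2) U by simp
 ultimately have "\<exists>X. blinfun_apply T \<in> (\<Pi>\<^sub>E i\<in>UNIV. X i) \<and> (\<forall>i. openin euclidean (X i)) \<and>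
   finite {i. X i \<noteq> topspace euclidean} \<and> (\<Pi>\<^sub>E i\<in>UNIV. X i) \<subseteq> U"
  by (rule product_topology_open_contains_basis)
 then obtain X where X: "\<And>i. blinfun_apply T i \<in> X i" "\<And>i. open (X i)" "finite {i. X i \<noteq> UNIV}" "(\<Pi>\<^sub>E i\<in>UNIV. X i) \<subseteq> U"
  by auto
 have "\<exists>d>0. \<forall>z. dist z (blinfun_apply T i) < d --> z \<in> X i" for i
  using X(1,2)[of i] by (simp add: open_dist)
 then obtain d where d: "\<And>i. d i > 0" "\<And>i z. dist z (blinfun_apply T i) < d i ==> z \<in> X i" by metis
 define H where "H = {i. X i \<noteq> UNIV}"
 define e where "e = Min (insert 1 (d ` H))"
 have H: "finite H" using X(3) by (simp add: H_def)
 have "e > 0" using H d(1) by (simp add: e_def)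
 moreover have "S \<in> V" if "\<forall>h\<in>H. norm (blinfun_apply S h - blinfun_apply T h) < e" for S
 proof -
  have "blinfun_apply S i \<in> X i" for i
  proof (cases "i \<in> H")
   case True
   then have "e \<le> d i" using H by (simp add: e_def)
   then show ?thesis using that True by (intro d(2)) (auto simp: dist_norm)
  qed (simp add: H_def)
  then have "blinfun_apply S \<in> U" using X(4) by auto
  then show ?thesis by (simp add: U(2))
 qed
 ultimately show ?thesis using H by blast
qed

section \<open>From von Neumann algebras as sets of operators to the locales\<close>

locale tvna =
 fixes R :: "('h::chilbert_space \<Rightarrow>\<^sub>L 'h) set" and \<tau> :: "('h \<Rightarrow>\<^sub>L 'h) => complex"
 assumes tvna: "tracial_von_neumann_algebra R \<tau>"
begin

definition A where "A = {x. blin x \<in> R}"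
definition tau where "tau x = \<tau> (blin x)"

lemma sub: "R \<subseteq> bounded_operators" and star: "unital_star_subalgebra R"
 using tvna by (auto simp: tracial_von_neumann_algebra_def von_neumann_algebra_def unital_star_subalgebra_def)

lemma R_eq: "R = blin ` A"
proof -
 have "T = blin (Bop T)" if "T \<in> R" for T using Bop_inverse[OF subsetD[OF sub that]] by simp
 then show ?thesis by (auto simp: A_def image_iff) metis
qed

lemma star_alg_preimage: assumes "unital_star_subalgebra B" shows "star_alg {x. blin x \<in> B}" using assms
 by unfold_locales (auto simp: unital_star_subalgebra_def times_bop.rep_eq plus_bop.rep_eq csc.rep_eq
   one_bop.rep_eq op_adjoint_blin[symmetric])

sublocale star_alg A unfolding A_def by (rule star_alg_preimage[OF star])

lemma sot_closed:
 assumes "\<And>n. X n \<in> A" "\<And>x. (\<lambda>n. ap (X n) x) \<longlonglongrightarrow> ap T x" shows "T \<in> A"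
proof (rule ccontr)
 assume "T \<notin> A"
 moreover have "openin strong_operator_topology (UNIV - R)"
  using tvna by (auto simp: tracial_von_neumann_algebra_def von_neumann_algebra_def closedin_def strong_operator_topology_topspace)
 ultimately obtain H e where H: "finite H" "e > 0"
  "\<And>S. (\<forall>h\<in>H. norm (blinfun_apply S h - blinfun_apply (blin T) h) < e) ==> S \<in> UNIV - R"
  using strong_operator_neighbourhood[of "UNIV - R" "blin T"] by (auto simp: A_def)
 have "\<forall>\<^sub>F n in sequentially. norm (ap (X n) h - ap T h) < e" for h
  using assms(2)[of h] H(2) by (auto simp: tendsto_iff dist_norm)
 then have "\<forall>\<^sub>F n in sequentially. \<forall>h\<in>H. norm (ap (X n) h - ap T h) < e" using H(1) by (simp add: eventually_ball_finite)
 then obtain n where "\<forall>h\<in>H. norm (ap (X n) h - ap T h) < e" using eventually_happens sequentially_bot by blast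
 then have "blin (X n) \<in> UNIV - R" by (intro H(3)) (simp add: ap.rep_eq)
 then show False using assms(1)[of n] by (simp add: A_def)
qed

sublocale cstar_alg A
proof
 show "closed A" unfolding closed_sequential_limits
 proof (intro allI impI, elim conjE)
  fix X T assume X: "\<forall>n. X n \<in> A" "X \<longlonglongrightarrow> T"
  show "T \<in> A" by (rule sot_closed[of X]) (use X bounded_linear.tendsto[OF bounded_linear_ap] in auto)
 qed
qed

lemma tau_facts:
 "x \<in> A ==> y \<in> A ==> tau (x + y) = tau x + tau y" "x \<in> A ==> tau (csc c x) = c * tau x" "tau 1 = 1"
 "x \<in> A ==> tau (adj x * x) \<in> \<real>\<^sub>\<ge>\<^sub>0" "x \<in> A ==> y \<in> A ==> tau (x * y) = tau (y * x)"
 "x \<in> A ==> tau (adj x * x) = 0 ==> x = 0" using tvna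
 by (auto simp: tracial_von_neumann_algebra_def tracial_state_def faithful_state_def tau_def A_def times_bop.rep_eq
   plus_bop.rep_eq csc.rep_eq one_bop.rep_eq op_adjoint_blin[symmetric] zero_bop.rep_eq blin_inject[symmetric])

lemma tau_pos_mono: assumes "x \<in> A" "y \<in> A" "pos (y - x)" shows "Re (tau x) \<le> Re (tau y)"
proof -
 define p where "p = y - x"
 have p: "p \<in> A" "pos p" using assms by (simp_all add: p_def)
 have "0 \<le> Re (tau p) + e" if e: "e > 0" for e
 proof -
  obtain s where s: "s \<in> A" "adj s = s" "s * s = p + e *\<^sub>R 1" using sqrt_pos[OF p e] by blast
  have "0 \<le> Re (tau (adj s * s))" using tau_facts(4)[OF s(1)] by (auto simp: complex_nonneg_Reals_iff)
  also have "tau (adj s * s) = tau p + e" using s p tau_facts(1)[of p "csc (of_real e) 1"]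
   by (simp add: tau_facts flip: csc_of_real)
  finally show ?thesis by simp
 qed
 then have "0 \<le> Re (tau p)" by (rule field_le_epsilon)
 moreover have "tau y = tau p + tau x" using tau_facts(1)[OF p(1) assms(1)] by (simp add: p_def)
 ultimately show ?thesis by simp
qed

lemma op_le_blin: "op_le (blin S) (blin T) \<longleftrightarrow> (\<forall>x. inner x (ap S x) \<le> inner x (ap T x))"
 by (simp add: op_le_def Re_cinner ap.rep_eq)

text \<open>The range of an increasing sequence is directed and its strong limit is its least upper
  bound, so normality for directed families applies; the supremum of the increasing traces is their
  limit.\<close>

lemma tau_normal:
 assumes X: "\<And>n. X n \<in> A" "\<And>n. pos (X n)" "\<And>n. pos (X (Suc n) - X n)" and T: "T \<in> A"
  and lim: "\<And>x. (\<lambda>n. ap (X n) x) \<longlonglongrightarrow> ap T x"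
 shows "(\<lambda>n. Re (tau (X n))) \<longlonglongrightarrow> Re (tau T)"
proof -
 have inc: "incseq (\<lambda>n. inner x (ap (X n) x))" for x
  by (rule incseq_SucI) (rule pos_diff_inner[OF X(3)])
 have ilim: "(\<lambda>n. inner x (ap (X n) x)) \<longlonglongrightarrow> inner x (ap T x)" for x by (intro tendsto_intros lim)
 have ub: "inner x (ap (X n) x) \<le> inner x (ap T x)" for n x by (rule incseq_le[OF inc ilim])
 have sa: "adj (X n) = X n" for n using X(2) by (simp add: pos_def)
 have Tsa: "adj T = T"
 proof -
  have "cinner (ap T x) y = cinner x (ap T y)" for x y
  proof -
   have "inner (ap T x) y = inner x (ap T y)" for x y
   proof (rule LIMSEQ_unique)
    show "(\<lambda>n. inner (ap (X n) x) y) \<longlonglongrightarrow> inner (ap T x) y" by (intro tendsto_intros lim)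
    have "(\<lambda>n. inner (ap (X n) x) y) = (\<lambda>n. inner x (ap (X n) y))" by (metis inner_adj sa)
    then show "(\<lambda>n. inner (ap (X n) x) y) \<longlonglongrightarrow> inner x (ap T y)" by (simp only:) (intro tendsto_intros lim)
   qed
   then have "inner (ap T x - ap (adj T) x) y = 0" for x y by (simp add: inner_diff_left inner_adj)
   then have "ap T x = ap (adj T) x" for x by (metis eq_iff_diff_eq_0 inner_eq_zero_iff)
   then have "T = adj T" by (rule bop_eqI)
   then show ?thesis using cinner_adj[of T x y] by simp
  qed
  then show ?thesis by (rule adj_unique[symmetric])
 qed
 have posT: "pos (T - X n)" for n using ub Tsa sa by (simp add: pos_def inner_diff_right)
 define D where "D = range (\<lambda>n. blin (X n))"
 have "Re (\<tau> (blin T)) = (SUP S\<in>D. Re (\<tau> S))"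
 proof -
  have norm: "normal_state R \<tau>" using tvna by (simp add: tracial_von_neumann_algebra_def)
  show ?thesis
  proof (rule norm[unfolded normal_state_def, rule_format], intro conjI ballI allI impI)
   show "D \<subseteq> {S \<in> R. self_adjoint S}" using X(1) sa by (auto simp: D_def A_def self_adjoint_def op_adjoint_blin)
   show "D \<noteq> {}" by (simp add: D_def)
   show "\<exists>S3\<in>D. op_le S1 S3 \<and> op_le S2 S3" if S: "S1 \<in> D" "S2 \<in> D" for S1 S2
   proof -
    obtain m n where "S1 = blin (X m)" "S2 = blin (X n)" using S by (auto simp: D_def)
    then show ?thesis using incseqD[OF inc, of m "max m n"] incseqD[OF inc, of n "max m n"]
     by (intro bexI[of _ "blin (X (max m n))"]) (auto simp: op_le_blin D_def)
   qed
   show "blin T \<in> R" "self_adjoint (blin T)" using T Tsa by (simp_all add: A_def self_adjoint_def op_adjoint_blin)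
   show "op_le S (blin T)" if "S \<in> D" for S using that ub by (auto simp: D_def op_le_blin)
   fix T' assume T': "T' \<in> R" "self_adjoint T' \<and> (\<forall>S\<in>D. op_le S T')"
   then obtain T'' where t: "T' = blin T''" using R_eq by auto
   show "op_le (blin T) T'" unfolding t op_le_blin
   proof
    fix x
    have "inner x (ap (X n) x) \<le> inner x (ap T'' x)" for n using T'(2) by (auto simp: D_def t op_le_blin)
    then show "inner x (ap T x) \<le> inner x (ap T'' x)" by (intro LIMSEQ_le_const2[OF ilim]) auto
   qed
  qed
 qed
 also have "(SUP S\<in>D. Re (\<tau> S)) = (SUP n. Re (tau (X n)))" by (simp add: D_def image_image tau_def)
 finally have e: "Re (tau T) = (SUP n. Re (tau (X n)))" by (simp add: tau_def)
 show ?thesis unfolding e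
 proof (rule LIMSEQ_incseq_SUP)
  show "bdd_above (range (\<lambda>n. Re (tau (X n))))"
   by (rule bdd_aboveI[of _ "Re (tau T)"]) (auto intro: tau_pos_mono X T posT)
  show "incseq (\<lambda>n. Re (tau (X n)))" by (rule incseq_SucI) (intro tau_pos_mono X)
 qed
qed

sublocale blin_structure A tau R \<tau>
 by unfold_locales (fact sot_closed tau_facts tau_normal R_eq tau_def | blast intro: sot_closed tau_normal tau_facts)+

end

lemma hyperfinite_spectral_gap:
 fixes R :: "('h::chilbert_space \<Rightarrow>\<^sub>L 'h) set"
 assumes "hyperfinite_II1_factor R \<tau>" shows "spectral_gap_property (structure_of R \<tau>)"
proof -
 interpret tvna R \<tau> using assms by unfold_locales (simp add: hyperfinite_II1_factor_def II1_factor_def)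
 obtain F where F: "incseq F" "\<And>n. unital_star_subalgebra (F n)" "\<And>n. finite_dimensional (F n)"
  "strong_operator_topology closure_of (\<Union>n. F n) = R"
  using assms by (auto simp: hyperfinite_II1_factor_def)
 define G where "G n = {x. blin x \<in> F n}" for n
 have lin: "linear blin" by (rule linearI) (simp_all add: plus_bop.rep_eq scaleR_bop.rep_eq)
 have FR: "F n \<subseteq> R" for n
  using F(4) closure_of_subset[of "\<Union>n. F n" strong_operator_topology] by (auto simp: strong_operator_topology_topspace)
 have "hyperfinite_factor A tau G"
 proof unfold_locales
  fix z assume z: "z \<in> A" "\<And>x. x \<in> A ==> z * x = x * z"
  have "blin z \<in> center (structure_of R \<tau>)" using z by (auto simp: center_def carrier_iff structure_simps)
  moreover have "is_factor (structure_of R \<tau>)" using assms by (simp add: hyperfinite_II1_factor_def II1_factor_def)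
  ultimately obtain c where "blin z = c \<odot>\<^bsub>structure_of R \<tau>\<^esub> \<one>\<^bsub>structure_of R \<tau>\<^esub>" by (auto simp: is_factor_def)
  then show "\<exists>c. z = csc c 1" by (auto simp: structure_simps blin_inject)
 next
  fix S :: "'h bop set" assume S: "finite S"
  show "\<not> A \<subseteq> span S"
  proof
   assume "A \<subseteq> span S"
   then have "blin ` A \<subseteq> span (blin ` S)" unfolding linear_span_image[OF lin] by blast
   then have "R \<subseteq> span (blin ` S)" by (simp only: R_eq[symmetric])
   then have "finite_dimensional R" using S unfolding finite_dimensional_def by blast
   then show False using assms by (simp add: hyperfinite_II1_factor_def II1_factor_def)
  qed
 next
  show "G m \<subseteq> G n" if "m \<le> n" for m n using incseqD[OF F(1) that] by (auto simp: G_def)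
  show "1 \<in> G n" "x \<in> G n ==> y \<in> G n ==> x + y \<in> G n" "x \<in> G n ==> y \<in> G n ==> x * y \<in> G n"
   "x \<in> G n ==> csc c x \<in> G n" "x \<in> G n ==> adj x \<in> G n" for n x y c
   using star_alg_preimage[OF F(2)[of n]] unfolding G_def star_alg_def by blast+
  show "G n \<subseteq> A" for n using FR by (auto simp: G_def A_def)
  show "\<exists>S. finite S \<and> G n \<subseteq> span S" for n
  proof -
   obtain B where B: "finite B" "F n \<subseteq> span B" using F(3)[of n] by (auto simp: finite_dimensional_def)
   \<comment> \<open>The spanning set from the definition may contain operators that are only
     real-linear. A spanning set inside \<open>F n\<close> can be pulled back to the type
     \<open>bop\<close>.\<close>
   obtain B' where B': "B' \<subseteq> F n" "independent B'" "F n \<subseteq> span B'" using maximal_independent_subset by blast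
   have fin: "finite B'" using independent_span_bound[OF B(1) B'(2)] B'(1) B(2) by auto
   define S where "S = Bop ` B'"
   have "F n \<subseteq> bounded_operators" using FR sub by blast
   then have BS: "blin ` S = B'" using B'(1) by (force simp: S_def image_image Bop_inverse)
   have "G n \<subseteq> span S"
   proof
    fix x assume "x \<in> G n"
    then have "blin x \<in> blin ` span S" using B'(3) unfolding linear_span_image[OF lin, symmetric] BS by (auto simp: G_def)
    then show "x \<in> span S" by (auto simp: blin_inject)
   qed
   then show ?thesis using fin by (auto simp: S_def)
  qed
  fix x and H :: "'h set" and e :: real assume x: "x \<in> A" "finite H" "e > 0"
  define V where "V = {T. \<forall>h\<in>H. blinfun_apply T h \<in> ball (blinfun_apply (blin x) h) e}"
  have "openin strong_operator_topology V" unfolding V_def by (rule strong_operator_topology_basis[OF x(2)]) auto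
  moreover have "blin x \<in> V" using x by (simp add: V_def)
  moreover have "blin x \<in> strong_operator_topology closure_of (\<Union>n. F n)" using x F(4) by (simp add: A_def)
  ultimately obtain T n where T: "T \<in> F n" "T \<in> V" unfolding in_closure_of by blast
  moreover have "T = blin (Bop T)" using T FR sub Bop_inverse by fastforce
  ultimately have "Bop T \<in> G n" "\<forall>h\<in>H. norm (ap (x - Bop T) h) < e"
   by (auto simp: G_def V_def dist_norm ap.rep_eq minus_bop.rep_eq blinfun.diff_left)
  then show "\<exists>n. \<exists>y\<in>G n. \<forall>h\<in>H. norm (ap (x - y) h) < e" by blast
 qed
 then show ?thesis by (rule spectral_gap_propertyI)
qed

section \<open>Values of formulas\<close>

lemma poly_value_cong: "(\<And>x. x \<in> poly_vars p ==> v x = w x) ==> poly_value N v p = poly_value N w p"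
 by (induction p) auto

lemma reassignmentsD:
 "w \<in> reassignments N xs v ==> x \<in> set xs ==> w x \<in> norm_ball N (real (snd x))"
 "w \<in> reassignments N xs v ==> x \<notin> set xs ==> w x = v x"
 unfolding reassignments_def mem_Collect_eq by blast+

lemma reassignments_cong:
 assumes h: "\<And>v w. (\<And>x. x \<in> F ==> v x = w x) ==> h v = h w" and vw: "\<And>x. x \<in> F - set xs ==> v x = w x"
 shows "h ` reassignments N xs v = h ` reassignments N xs w"
proof -
 have *: "h ` reassignments N xs v \<subseteq> h ` reassignments N xs w" if vw: "\<And>x. x \<in> F - set xs ==> v x = w x" for v w
 proof
  fix y assume "y \<in> h ` reassignments N xs v"
  then obtain u where u: "u \<in> reassignments N xs v" "y = h u" by blast
  define u' where "u' x = (if x \<in> set xs then u x else w x)" for x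
  have "u' \<in> reassignments N xs w" using u(1) by (auto simp: reassignments_def u'_def)
  moreover have "h u = h u'" by (rule h) (use u(1) vw in \<open>auto simp: reassignments_def u'_def\<close>)
  ultimately show "y \<in> h ` reassignments N xs w" using u(2) by blast
 qed
 show ?thesis using *[of v w] *[of w v] vw by auto
qed

lemma formula_value_cong:
 "(\<And>x. x \<in> free_vars \<phi> ==> v x = w x) ==> formula_value N v \<phi> = formula_value N w \<phi>"
proof (induction \<phi> arbitrary: v w)
 case (ReTr p)
 then show ?case using poly_value_cong[of p v w N] by simp
next
 case (ImTr p)
 then show ?case using poly_value_cong[of p v w N] by simp
next
 case (Dist p q)
 then show ?case using poly_value_cong[of p v w N] poly_value_cong[of q v w N] by simp
next
 case (Conn f \<phi>s)
 have *: "formula_value N v \<phi> = formula_value N w \<phi>" if "\<phi> \<in> set \<phi>s" for \<phi>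
  by (rule Conn.IH[OF that]) (use Conn.prems that in auto)
 have "(\<lambda>i\<in>{..<length \<phi>s}. map (\<lambda>\<phi>. formula_value N v \<phi>) \<phi>s ! i) = (\<lambda>i\<in>{..<length \<phi>s}. map (\<lambda>\<phi>. formula_value N w \<phi>) \<phi>s ! i)"
  by (rule restrict_ext) (simp add: *)
 then show ?case unfolding formula_value.simps by (rule arg_cong[where f = f])
next
 case (QSup xs \<psi>)
 have "(\<lambda>w. formula_value N w \<psi>) ` reassignments N xs v = (\<lambda>w. formula_value N w \<psi>) ` reassignments N xs w"
 proof (rule reassignments_cong[where F = "free_vars \<psi>"])
  show "formula_value N v \<psi> = formula_value N w \<psi>" if "\<And>x. x \<in> free_vars \<psi> ==> v x = w x" for v w
   by (rule QSup.IH) (rule that)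
  show "v x = w x" if "x \<in> free_vars \<psi> - set xs" for x by (rule QSup.prems) (use that in simp)
 qed
 then show ?case by (simp only: formula_value.simps)
next
 case (QInf xs \<psi>)
 have "(\<lambda>w. formula_value N w \<psi>) ` reassignments N xs v = (\<lambda>w. formula_value N w \<psi>) ` reassignments N xs w"
 proof (rule reassignments_cong[where F = "free_vars \<psi>"])
  show "formula_value N v \<psi> = formula_value N w \<psi>" if "\<And>x. x \<in> free_vars \<psi> ==> v x = w x" for v w
   by (rule QInf.IH) (rule that)
  show "v x = w x" if "x \<in> free_vars \<psi> - set xs" for x by (rule QInf.prems) (use that in simp)
 qed
 then show ?case by (simp only: formula_value.simps)
qed

lemma finite_poly_vars: "finite (poly_vars p)" by (induction p) auto
lemma finite_free_vars: "finite (free_vars \<phi>)" by (induction \<phi>) (auto simp: finite_poly_vars)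

context tracial_structure begin

abbreviation val where "val \<equiv> formula_value N"

text \<open>Real suprema and infima behave well only for bounded nonempty sets. The bounds are
  demanded for all assignments, also those outside the balls; the clipped connective below provides
  them.\<close>

definition unit_valued where "unit_valued \<phi> \<longleftrightarrow> (\<forall>v. 0 \<le> val v \<phi> \<and> val v \<phi> \<le> 1)"

lemma zero_ball [simp]: "0 \<le> r ==> \<zero> \<in> norm_ball N r" by (simp add: norm_ball_def opnorm)

lemma reassignments_nonempty: "reassignments N xs v \<noteq> {}"
proof -
 have "(\<lambda>x. if x \<in> set xs then \<zero> else v x) \<in> reassignments N xs v" by (auto simp: reassignments_def)
 then show ?thesis by blast
qed

lemma val_QSup_least: "(\<And>w. w \<in> reassignments N xs v ==> val w \<psi> \<le> e) ==> val v (QSup xs \<psi>) \<le> e"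
 by (simp add: cSUP_least reassignments_nonempty)
lemma val_QSup_upper: "unit_valued \<psi> ==> w \<in> reassignments N xs v ==> val w \<psi> \<le> val v (QSup xs \<psi>)"
 by (simp, rule cSUP_upper) (auto simp: unit_valued_def intro!: bdd_aboveI[of _ 1])
lemma val_QInf_lower: "(\<And>w. 0 \<le> val w \<psi>) ==> w \<in> reassignments N xs v ==> val v (QInf xs \<psi>) \<le> val w \<psi>"
 by (simp, rule cINF_lower) (auto intro!: bdd_belowI[of _ 0])
lemma val_QInf_witness:
 assumes "val v (QInf xs \<psi>) < e" shows "\<exists>w\<in>reassignments N xs v. val w \<psi> < e"
proof (rule ccontr)
 assume "\<not> ?thesis"
 then have "e \<le> val v (QInf xs \<psi>)" by (simp, intro cINF_greatest) (auto simp: reassignments_nonempty not_less)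
 then show False using assms by simp
qed

lemma unit_valued_QSup: assumes "unit_valued \<psi>" shows "unit_valued (QSup xs \<psi>)"
 unfolding unit_valued_def
proof (intro allI conjI)
 fix v
 obtain w where w: "w \<in> reassignments N xs v" using reassignments_nonempty by blast
 show "0 \<le> val v (QSup xs \<psi>)" using val_QSup_upper[OF assms w] assms unfolding unit_valued_def by (meson order_trans)
 show "val v (QSup xs \<psi>) \<le> 1" by (rule val_QSup_least) (use assms in \<open>simp add: unit_valued_def\<close>)
qed

lemma unit_valued_QInf: assumes "unit_valued \<psi>" shows "unit_valued (QInf xs \<psi>)"
 unfolding unit_valued_def
proof (intro allI conjI)
 fix v
 obtain w where w: "w \<in> reassignments N xs v" using reassignments_nonempty by blast
 have "val v (QInf xs \<psi>) \<le> val w \<psi>" by (rule val_QInf_lower) (use assms w in \<open>auto simp: unit_valued_def\<close>)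
 then show "val v (QInf xs \<psi>) \<le> 1" using assms unfolding unit_valued_def by (meson order_trans)
 show "0 \<le> val v (QInf xs \<psi>)" using assms by (simp, intro cINF_greatest) (auto simp: reassignments_nonempty unit_valued_def)
qed

end

text \<open>The dense variables have index $0$ modulo $3$, the four witnesses of the $m$-th gap formula
 index $1$, and the two bound variables of the gap formulas index $2$.\<close>

definition va :: var where "va = (2, 1)"
definition vb :: var where "vb = (5, 1)"
definition vy :: "nat => nat => var" where "vy m j = (3 * (4 * m + j) + 1, 1)"
definition dense_var :: "var => bool" where "dense_var p \<longleftrightarrow> fst p mod 3 = 0"

lemma vars_distinct [simp]: "va \<noteq> vb" "vb \<noteq> va" "vy m j \<noteq> va" "vy m j \<noteq> vb" "va \<noteq> vy m j" "vb \<noteq> vy m j"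
 by (auto simp: va_def vb_def vy_def; presburger)+
lemma dense_var_distinct: "dense_var p ==> p \<noteq> va \<and> p \<noteq> vb \<and> p \<noteq> vy m j"
 by (auto simp: dense_var_def va_def vb_def vy_def; presburger)
lemma snd_vars [simp]: "snd va = 1" "snd vb = 1" "snd (vy m j) = 1" by (simp_all add: va_def vb_def vy_def)

definition comm :: "var => var => formula" where
 "comm p q = Dist (Times (Var p) (Var q)) (Times (Var q) (Var p))"

text \<open>The positive part of the gap inequality's defect plus the positive parts of the excess
  of the commutators with \<open>X\<close>: it vanishes exactly if all these inequalities hold up to
  \<open>e\<close>. Places 0 to 7 follow the order of \<open>core_atoms\<close>, and the commutators
  with \<open>X\<close> start at place 8. Clipping at 1 keeps values in the unit interval.\<close>

definition core_conn :: "nat => real => (nat => real) => real" where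
 "core_conn k e g = min 1 (max 0 (g 0 - (g 1)\<^sup>2 - (g 2)\<^sup>2 - 800 * (g 3 + (g 4 + g 5 + g 6 + g 7)) - e) + (\<Sum>i<k. max 0 (g (8 + i) - e)))"

definition core_atoms :: "var list => nat => formula list" where
 "core_atoms Xs m = [ReTr (Times (Star (Var va)) (Var va)), ReTr (Var va), ImTr (Var va), comm vb va,
   comm (vy m 0) va, comm (vy m 1) va, comm (vy m 2) va, comm (vy m 3) va] @ map (comm vb) Xs"

definition core :: "var list => nat => real => formula" where
 "core Xs m e = Conn (core_conn (length Xs) e) (core_atoms Xs m)"

text \<open>\<open>X\<close> and the \<open>y\<close>s remain free, so the depth is two. The formula
  can therefore be carried from \<open>M\<close> to the hyperfinite factor together with chosen
  witnesses.\<close>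

definition gap_formula :: "var list => nat => real => formula" where
 "gap_formula Xs m e = QSup [va] (QInf [vb] (core Xs m e))"

definition gap_sentence :: "var list => nat => real => formula" where
 "gap_sentence Xs m e = QSup Xs (QInf (map (vy m) [0..<4]) (gap_formula Xs m e))"

lemma continuous_core_conn:
 assumes "n = 8 + k" shows "continuous_map (powertop_real {..<n}) euclideanreal (core_conn k e)"
proof -
 have p: "continuous_map (powertop_real {..<n}) euclideanreal (\<lambda>g. g i)" if "i < n" for i
  by (rule continuous_map_product_projection) (use that in simp)
 show ?thesis unfolding core_conn_def
  by (intro continuous_map_real_min continuous_map_real_max continuous_map_add continuous_map_diff
    continuous_map_real_mult continuous_map_real_pow continuous_map_sum p finite_lessThan continuous_map_const[THEN iffD2] disjI2)
   (use assms in auto)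
qed

lemma length_core_atoms: "length (core_atoms Xs m) = 8 + length Xs" by (simp add: core_atoms_def)

lemma core_wf: "well_formed (core Xs m e)" "depth (core Xs m e) = 0"
  "free_vars (core Xs m e) = {va, vb, vy m 0, vy m 1, vy m 2, vy m 3} \<union> set Xs"
proof -
 have "\<forall>\<phi>\<in>set (core_atoms Xs m). well_formed \<phi> \<and> depth \<phi> = 0" by (auto simp: core_atoms_def comm_def)
 moreover have "Max (insert 0 (set (map depth (core_atoms Xs m)))) = 0"
  using calculation by (intro Max_eqI) auto
 ultimately show "well_formed (core Xs m e)" "depth (core Xs m e) = 0"
  by (simp_all add: core_def continuous_core_conn[OF length_core_atoms])
 show "free_vars (core Xs m e) = {va, vb, vy m 0, vy m 1, vy m 2, vy m 3} \<union> set Xs"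
  by (auto simp: core_def core_atoms_def comm_def)
qed

lemma gap_formula_wf: "well_formed (gap_formula Xs m e)" "depth (gap_formula Xs m e) = 2"
 by (simp_all add: gap_formula_def core_wf)

lemma gap_formula_vars:
 "free_vars (gap_formula Xs m e) \<subseteq> {vy m 0, vy m 1, vy m 2, vy m 3} \<union> set Xs"
 by (auto simp: gap_formula_def core_wf)

lemma gap_sentence_sentence: "sentence (gap_sentence Xs m e)" "depth (gap_sentence Xs m e) = 4"
proof -
 have "{vy m 0, vy m 1, vy m 2, vy m 3} \<subseteq> set (map (vy m) [0..<4])" by auto
 then show "sentence (gap_sentence Xs m e)"
  using gap_formula_vars[of Xs m e] gap_formula_wf by (auto simp: sentence_def gap_sentence_def)
 show "depth (gap_sentence Xs m e) = 4" by (simp add: gap_sentence_def gap_formula_wf)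
qed

section \<open>Values of the gap sentences and extraction of witnesses\<close>

context tracial_structure begin

definition gap where
 "gap y a b = Re (tr N (star N a \<otimes> a)) - (Re (tr N a))\<^sup>2 - (Im (tr N a))\<^sup>2 -
   800 * (dist2 N (b \<otimes> a) (a \<otimes> b) + (\<Sum>j<4::nat. dist2 N (y j \<otimes> a) (a \<otimes> y j)))"

lemma val_core:
 "val v (core Xs m e) = min 1 (max 0 (gap (\<lambda>j. v (vy m j)) (v va) (v vb) - e) +
   (\<Sum>i<length Xs. max 0 (dist2 N (v vb \<otimes> v (Xs ! i)) (v (Xs ! i) \<otimes> v vb) - e)))"
proof -
 define h where "h = (\<lambda>i\<in>{..<length (core_atoms Xs m)}. map (\<lambda>\<phi>. val v \<phi>) (core_atoms Xs m) ! i)"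
 have h: "h i = val v (core_atoms Xs m ! i)" if "i < 8 + length Xs" for i using that by (simp add: h_def length_core_atoms)
 have t: "core_atoms Xs m ! (8 + i) = comm vb (Xs ! i)" if "i < length Xs" for i
  using that by (simp add: core_atoms_def nth_append)
 have c: "val v (comm p q) = dist2 N (v p \<otimes> v q) (v q \<otimes> v p)" for p q by (simp add: comm_def dist2_def)
 have s: "(\<Sum>j<4::nat. d j) = d 0 + d 1 + d 2 + d 3" for d :: "nat => real" by (simp add: numeral_eq_Suc)
 have "h 0 = Re (tr N (star N (v va) \<otimes> v va))" "h 1 = Re (tr N (v va))" "h 2 = Im (tr N (v va))"
  "h 3 = dist2 N (v vb \<otimes> v va) (v va \<otimes> v vb)" "h 4 = dist2 N (v (vy m 0) \<otimes> v va) (v va \<otimes> v (vy m 0))"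
  "h 5 = dist2 N (v (vy m 1) \<otimes> v va) (v va \<otimes> v (vy m 1))" "h 6 = dist2 N (v (vy m 2) \<otimes> v va) (v va \<otimes> v (vy m 2))"
  "h 7 = dist2 N (v (vy m 3) \<otimes> v va) (v va \<otimes> v (vy m 3))"
  by (simp_all add: h core_atoms_def c)
 moreover have "(\<Sum>i<length Xs. max 0 (h (8 + i) - e)) = (\<Sum>i<length Xs. max 0 (dist2 N (v vb \<otimes> v (Xs ! i)) (v (Xs ! i) \<otimes> v vb) - e))"
  by (intro sum.cong refl) (simp add: h t c)
 moreover have "val v (core Xs m e) = core_conn (length Xs) e h" by (simp only: core_def formula_value.simps h_def)
 ultimately show ?thesis by (simp add: core_conn_def gap_def s)
qed

lemma core_unit: "unit_valued (core Xs m e)"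
 unfolding unit_valued_def val_core by (auto intro!: add_nonneg_nonneg sum_nonneg)

lemma gap_formula_unit: "unit_valued (gap_formula Xs m e)"
 unfolding gap_formula_def by (intro unit_valued_QSup unit_valued_QInf core_unit)

lemma unit_valued_nonneg: "unit_valued \<phi> ==> 0 \<le> val v \<phi>" by (simp add: unit_valued_def)

lemma val_gap_sentence:
 assumes N: "spectral_gap_property N" and Xs: "\<And>p. p \<in> set Xs ==> dense_var p" and e: "e > 0"
 shows "val v (gap_sentence Xs m e) \<le> 0" unfolding gap_sentence_def
proof (rule val_QSup_least)
 fix w assume w: "w \<in> reassignments N Xs v"
 have "finite (w ` set Xs) \<and> w ` set Xs \<subseteq> carrier N \<and> e > 0" using w e by (auto simp: reassignments_def norm_ball_def)
 from N[unfolded spectral_gap_property_def, THEN spec, THEN spec, THEN mp, OF this]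
 obtain y where "(\<forall>j. y j \<in> norm_ball N 1) \<and> (\<forall>a\<in>norm_ball N 1. \<exists>b\<in>norm_ball N 1.
    (\<forall>x\<in>w ` set Xs. dist2 N (b \<otimes> x) (x \<otimes> b) \<le> e) \<and>
    Re (tr N (star N a \<otimes> a)) - (Re (tr N a))\<^sup>2 - (Im (tr N a))\<^sup>2 \<le>
     800 * (dist2 N (b \<otimes> a) (a \<otimes> b) + (\<Sum>j<4::nat. dist2 N (y j \<otimes> a) (a \<otimes> y j))) + e)"
  by (elim exE) (rule that)
 then have y: "\<forall>j. y j \<in> norm_ball N 1" and g: "\<forall>a\<in>norm_ball N 1. \<exists>b\<in>norm_ball N 1.
    (\<forall>x\<in>w ` set Xs. dist2 N (b \<otimes> x) (x \<otimes> b) \<le> e) \<and>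
    Re (tr N (star N a \<otimes> a)) - (Re (tr N a))\<^sup>2 - (Im (tr N a))\<^sup>2 \<le>
     800 * (dist2 N (b \<otimes> a) (a \<otimes> b) + (\<Sum>j<4::nat. dist2 N (y j \<otimes> a) (a \<otimes> y j))) + e"
  by (rule conjunct1, rule conjunct2)
 have g': "\<exists>b\<in>norm_ball N 1. (\<forall>x\<in>w ` set Xs. dist2 N (b \<otimes> x) (x \<otimes> b) \<le> e) \<and> gap y a b \<le> e"
  if "a \<in> norm_ball N 1" for a using bspec[OF g that] by (simp only: gap_def diff_le_eq add_ac)
 \<comment> \<open>The number \<open>(fst p - 1) div 3 - 4 * m\<close> recovers \<open>j\<close>
   from the variable \<open>vy m j\<close>.\<close>
 define w2 where "w2 p = (if p \<in> vy m ` {..<4} then y ((fst p - 1) div 3 - 4 * m) else w p)" for p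
 have w2y: "w2 (vy m j) = y j" if "j < 4" for j using that by (auto simp: w2_def vy_def)
 have w2x: "w2 p = w p" if "p \<in> set Xs" for p using dense_var_distinct[OF Xs[OF that]] by (auto simp: w2_def)
 have "w2 \<in> reassignments N (map (vy m) [0..<4]) w"
  using y w2y by (auto simp: reassignments_def) (auto simp: w2_def)
 then have "val w (QInf (map (vy m) [0..<4]) (gap_formula Xs m e)) \<le> val w2 (gap_formula Xs m e)"
  by (intro val_QInf_lower unit_valued_nonneg gap_formula_unit)
 also have "\<dots> \<le> 0" unfolding gap_formula_def
 proof (rule val_QSup_least)
  fix w3 assume w3: "w3 \<in> reassignments N [va] w2"
  then have "w3 va \<in> norm_ball N 1" using reassignmentsD(1)[OF w3, of va] by simp
  then obtain b where b: "b \<in> norm_ball N 1" "\<forall>x\<in>w ` set Xs. dist2 N (b \<otimes> x) (x \<otimes> b) \<le> e"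
   "gap y (w3 va) b \<le> e" using g' by blast
  define w4 where "w4 = w3(vb := b)"
  have "w4 \<in> reassignments N [vb] w3" using b(1) by (auto simp: w4_def reassignments_def)
  then have "val w3 (QInf [vb] (core Xs m e)) \<le> val w4 (core Xs m e)"
   by (intro val_QInf_lower unit_valued_nonneg core_unit)
  also have "val w4 (core Xs m e) \<le> 0"
  proof -
   have "w4 p = w p" if "p \<in> set Xs" for p
    using reassignmentsD(2)[OF w3, of p] w2x[OF that] dense_var_distinct[OF Xs[OF that]] by (simp add: w4_def)
   then have "dist2 N (b \<otimes> w4 (Xs ! i)) (w4 (Xs ! i) \<otimes> b) \<le> e" if "i < length Xs" for i
    using b(2) that by simp
   then have 1: "(\<Sum>i<length Xs. max 0 (dist2 N (w4 vb \<otimes> w4 (Xs ! i)) (w4 (Xs ! i) \<otimes> w4 vb) - e)) = 0"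
    by (intro sum.neutral) (auto simp: w4_def)
   have "w4 (vy m j) = y j" if "j < 4" for j
    using reassignmentsD(2)[OF w3, of "vy m j"] w2y[OF that] by (simp add: w4_def)
   then have 2: "gap (\<lambda>j. w4 (vy m j)) (w4 va) (w4 vb) \<le> e" using b(3) by (simp add: gap_def w4_def)
   show ?thesis unfolding val_core 1 using 2 by simp
  qed
  finally show "val w3 (QInf [vb] (core Xs m e)) \<le> 0" .
 qed
 finally show "val w (QInf (map (vy m) [0..<4]) (gap_formula Xs m e)) \<le> 0" .
qed

text \<open>The infimum need not be attained, hence the slack \<eta>. The bound is stated for every
  assignment that agrees on the relevant variables, so that the witnesses for all \<open>m\<close>
  can be merged into one assignment.\<close>

lemma gap_witnesses:
 assumes s: "val (\<lambda>_. \<zero>) (gap_sentence Xs m e) \<le> 0" and v: "\<And>p. p \<in> set Xs ==> v p \<in> norm_ball N (real (snd p))"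
  and Xs: "\<And>p. p \<in> set Xs ==> dense_var p" and \<eta>: "\<eta> > 0"
 shows "\<exists>y. (\<forall>j. y j \<in> norm_ball N 1) \<and> (\<forall>u. (\<forall>p\<in>set Xs. u p = v p) \<and> (\<forall>j<4. u (vy m j) = y j) --> val u (gap_formula Xs m e) < \<eta>)"
proof -
 define v' where "v' p = (if p \<in> set Xs then v p else \<zero>)" for p
 have "v' \<in> reassignments N Xs (\<lambda>_. \<zero>)" using v by (auto simp: reassignments_def v'_def)
 then have "val v' (QInf (map (vy m) [0..<4]) (gap_formula Xs m e)) \<le> val (\<lambda>_. \<zero>) (gap_sentence Xs m e)"
  unfolding gap_sentence_def by (rule val_QSup_upper[OF unit_valued_QInf[OF gap_formula_unit]])
 then have "val v' (QInf (map (vy m) [0..<4]) (gap_formula Xs m e)) < \<eta>" using s \<eta> by linarith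
 then obtain w where w: "w \<in> reassignments N (map (vy m) [0..<4]) v'" "val w (gap_formula Xs m e) < \<eta>"
  using val_QInf_witness by blast
 have "val u (gap_formula Xs m e) < \<eta>" if u: "\<forall>p\<in>set Xs. u p = v p" "\<forall>j<4. u (vy m j) = w (vy m j)" for u
 proof -
  have "w p = v p" if "p \<in> set Xs" for p
   using reassignmentsD(2)[OF w(1), of p] that dense_var_distinct[OF Xs[OF that]] by (auto simp: v'_def)
  then have "val u (gap_formula Xs m e) = val w (gap_formula Xs m e)"
   using u gap_formula_vars[of Xs m e] by (intro formula_value_cong) auto
  then show ?thesis using w(2) by simp
 qed
 moreover have "w (vy m j) \<in> norm_ball N 1" if "j < 4" for j using w(1) that by (auto simp: reassignments_def)
 ultimately show ?thesis by (intro exI[of _ "\<lambda>j. if j < 4 then w (vy m j) else \<zero>"]) auto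
qed

text \<open>A value below \<eta> <= 1 means that the clipping at 1 is inactive, so each of the
  nonnegative summands is below \<eta>.\<close>

lemma gap_formula_use:
 assumes g: "val w (gap_formula Xs m e) < \<eta>" "\<eta> \<le> 1" and a: "a \<in> norm_ball N 1" and Xs: "\<And>p. p \<in> set Xs ==> dense_var p"
 shows "\<exists>b\<in>norm_ball N 1. gap (\<lambda>j. w (vy m j)) a b \<le> e + \<eta> \<and> (\<forall>p\<in>set Xs. dist2 N (b \<otimes> w p) (w p \<otimes> b) \<le> e + \<eta>)"
proof -
 define w3 where "w3 = w(va := a)"
 have "w3 \<in> reassignments N [va] w" using a by (auto simp: reassignments_def w3_def)
 then have "val w3 (QInf [vb] (core Xs m e)) \<le> val w (gap_formula Xs m e)"
  unfolding gap_formula_def by (rule val_QSup_upper[OF unit_valued_QInf[OF core_unit]])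
 then have "val w3 (QInf [vb] (core Xs m e)) < \<eta>" using g by linarith
 then obtain w4 where w4: "w4 \<in> reassignments N [vb] w3" "val w4 (core Xs m e) < \<eta>"
  using val_QInf_witness by blast
 define b where "b = w4 vb"
 have b: "b \<in> norm_ball N 1" using w4(1) by (auto simp: reassignments_def b_def)
 have w4e: "w4 va = a" "w4 (vy m j) = w (vy m j)" "p \<in> set Xs ==> w4 p = w p" for j p
  using reassignmentsD(2)[OF w4(1)] dense_var_distinct[OF Xs, of p] by (simp_all add: w3_def)
 define d where "d i = max 0 (dist2 N (b \<otimes> w (Xs ! i)) (w (Xs ! i) \<otimes> b) - e)" for i
 have s: "max 0 (gap (\<lambda>j. w (vy m j)) a b - e) + (\<Sum>i<length Xs. d i) < \<eta>"
 proof -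
  have "(\<Sum>i<length Xs. max 0 (dist2 N (w4 vb \<otimes> w4 (Xs ! i)) (w4 (Xs ! i) \<otimes> w4 vb) - e)) = (\<Sum>i<length Xs. d i)"
   by (intro sum.cong refl) (simp add: d_def b_def w4e)
  then show ?thesis using w4(2) g(2) unfolding val_core by (simp add: w4e b_def[symmetric])
 qed
 have d0: "d i \<ge> 0" for i by (simp add: d_def)
 have S: "(\<Sum>i<length Xs. d i) \<ge> 0" using d0 by (intro sum_nonneg) auto
 have "dist2 N (b \<otimes> w p) (w p \<otimes> b) \<le> e + \<eta>" if "p \<in> set Xs" for p
 proof -
  obtain i where i: "i < length Xs" "p = Xs ! i" using \<open>p \<in> set Xs\<close> by (auto simp: in_set_conv_nth)
  have "d i \<le> (\<Sum>i<length Xs. d i)" using i d0 by (intro member_le_sum) auto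
  then have "d i < \<eta>" using s by linarith
  then show ?thesis by (simp add: d_def i)
 qed
 moreover have "gap (\<lambda>j. w (vy m j)) a b \<le> e + \<eta>" using s S by linarith
 ultimately show ?thesis using b by blast
qed

end

lemma value_abs_sum:
 "formula_value N u (Conn (\<lambda>g. \<Sum>i<length \<phi>s. \<bar>g i - c i\<bar>) \<phi>s) = (\<Sum>i<length \<phi>s. \<bar>formula_value N u (\<phi>s ! i) - c i\<bar>)"
 unfolding formula_value.simps by (intro sum.cong refl) simp

text \<open>That the values can be approximated is expressed by a sentence of depth three.\<close>

lemma realize:
 fixes M :: "'a tracial_algebra" and R :: "'b tracial_algebra"
 assumes M: "tracial_structure M" and R: "tracial_structure R" and eq: "equiv_depth 4 M R"
  and v: "\<And>x. v x \<in> norm_ball M (real (snd x))"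
  and \<Phi>: "finite \<Phi>" "\<And>\<phi>. \<phi> \<in> \<Phi> ==> well_formed \<phi> \<and> depth \<phi> \<le> 2" and \<eta>: "\<eta> > 0"
 shows "\<exists>w. (\<forall>x. w x \<in> norm_ball R (real (snd x))) \<and> (\<forall>\<phi>\<in>\<Phi>. \<bar>formula_value R w \<phi> - formula_value M v \<phi>\<bar> < \<eta>)"
proof -
 interpret M: tracial_structure M by (rule M)
 interpret R: tracial_structure R by (rule R)
 obtain \<phi>s where \<phi>s: "set \<phi>s = \<Phi>" using finite_list[OF \<Phi>(1)] by blast
 have "finite (\<Union>\<phi>\<in>\<Phi>. free_vars \<phi>)" using \<Phi>(1) finite_free_vars by blast
 then obtain V where V: "set V = (\<Union>\<phi>\<in>\<Phi>. free_vars \<phi>)" using finite_list by metis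
 define n where "n = length \<phi>s"
 \<comment> \<open>The values of the formulas in \<open>M\<close> are built into the connective as
   constants. The infimum of the total deviation is 0 in \<open>M\<close>, being attained at
   \<open>v\<close>.\<close>
 define f :: "(nat => real) => real" where "f g = (\<Sum>i<n. \<bar>g i - formula_value M v (\<phi>s ! i)\<bar>)" for g
 have p: "continuous_map (powertop_real {..<n}) euclideanreal (\<lambda>g. g i)" if "i < n" for i
  by (rule continuous_map_product_projection) (use that in simp)
 have cont: "continuous_map (powertop_real {..<n}) euclideanreal f" unfolding f_def
  by (intro continuous_map_sum continuous_map_real_abs continuous_map_diff p) auto
 define \<psi> where "\<psi> = Conn f \<phi>s"
 have val: "formula_value M u \<psi> = (\<Sum>i<n. \<bar>formula_value M u (\<phi>s ! i) - formula_value M v (\<phi>s ! i)\<bar>)"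
  "formula_value R u' \<psi> = (\<Sum>i<n. \<bar>formula_value R u' (\<phi>s ! i) - formula_value M v (\<phi>s ! i)\<bar>)" for u u'
  unfolding \<psi>_def f_def n_def by (rule value_abs_sum)+
 define \<sigma> where "\<sigma> = QInf V \<psi>"
 have "sentence \<sigma>" using \<phi>s V cont \<Phi>(2) by (auto simp: sentence_def \<sigma>_def \<psi>_def n_def)
 moreover have "depth \<sigma> \<le> 4"
 proof -
  have "\<forall>\<phi>\<in>set \<phi>s. depth \<phi> \<le> 3" using \<Phi>(2) \<phi>s by fastforce
  then show ?thesis by (simp add: \<sigma>_def \<psi>_def)
 qed
 ultimately have sv: "sentence_value M \<sigma> = sentence_value R \<sigma>" using eq by (simp add: equiv_depth_def)
 have nn: "0 \<le> formula_value M u \<psi>" for u unfolding val by (simp add: sum_nonneg)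
 define v' where "v' x = (if x \<in> set V then v x else \<zero>\<^bsub>M\<^esub>)" for x
 have "formula_value M (\<lambda>_. \<zero>\<^bsub>M\<^esub>) \<sigma> \<le> formula_value M v' \<psi>"
  unfolding \<sigma>_def by (rule M.val_QInf_lower[OF nn]) (use v in \<open>auto simp: reassignments_def v'_def\<close>)
 also have "formula_value M v' \<psi> = 0"
 proof -
  have "formula_value M v' \<phi> = formula_value M v \<phi>" if "\<phi> \<in> \<Phi>" for \<phi>
   using that V by (intro formula_value_cong) (auto simp: v'_def)
  moreover have "\<phi>s ! i \<in> \<Phi>" if "i < n" for i using that \<phi>s nth_mem by (auto simp: n_def)
  ultimately show ?thesis unfolding val by (intro sum.neutral) simp
 qed
 finally have "formula_value R (\<lambda>_. \<zero>\<^bsub>R\<^esub>) (QInf V \<psi>) < \<eta>" using sv \<eta> by (simp add: sentence_value_def \<sigma>_def[symmetric] del: formula_value.simps)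
 then obtain w where w: "w \<in> reassignments R V (\<lambda>_. \<zero>\<^bsub>R\<^esub>)" "formula_value R w \<psi> < \<eta>"
  using R.val_QInf_witness by blast
 have "\<bar>formula_value R w \<phi> - formula_value M v \<phi>\<bar> < \<eta>" if \<phi>: "\<phi> \<in> \<Phi>" for \<phi>
 proof -
  obtain i where i: "i < n" "\<phi> = \<phi>s ! i" using \<phi> \<phi>s unfolding n_def by (metis in_set_conv_nth)
  have "\<bar>formula_value R w (\<phi>s ! i) - formula_value M v (\<phi>s ! i)\<bar> \<le> formula_value R w \<psi>"
   unfolding val by (rule member_le_sum[of i "{..<n}" "\<lambda>i. \<bar>formula_value R w (\<phi>s ! i) - formula_value M v (\<phi>s ! i)\<bar>"]) (use i in auto)
  then show ?thesis using w(2) by (simp add: i(2))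
 qed
 moreover have "w x \<in> norm_ball R (real (snd x))" for x using reassignmentsD[OF w(1), of x] by (cases "x \<in> set V") simp_all
 ultimately show ?thesis by blast
qed

section \<open>Tracial ultrapowers\<close>

text \<open>Compactness of the disc gives a cluster point; for an ultrafilter a cluster point is a
  limit.\<close>

lemma ultrafilter_limit:
 fixes f :: "'i => complex"
 assumes U: "ultrafilter U" and f: "\<And>i. cmod (f i) \<le> c"
 shows "\<exists>t. (f \<longlongrightarrow> t) U"
proof -
 have F: "filtermap f U \<noteq> bot" using U by (simp add: ultrafilter_def filtermap_bot_iff)
 have "eventually (\<lambda>z. z \<in> cball 0 c) (filtermap f U)" using f by (simp add: eventually_filtermap)
 then obtain t where t: "inf (nhds t) (filtermap f U) \<noteq> bot"
  using compact_cball[of "0::complex" c] F unfolding compact_filter by blast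
 have "(f \<longlongrightarrow> t) U"
 proof (rule topological_tendstoI)
  fix S assume S: "open S" "t \<in> S"
  show "\<forall>\<^sub>F i in U. f i \<in> S"
  proof (rule ccontr)
   assume "\<not> ?thesis"
   then have "\<forall>\<^sub>F i in U. f i \<notin> S" using U unfolding ultrafilter_def by blast
   then have "\<forall>\<^sub>F z in filtermap f U. z \<notin> S" by (simp add: eventually_filtermap)
   moreover have "\<forall>\<^sub>F z in nhds t. z \<in> S" using S by (rule eventually_nhds_in_open)
   ultimately have "eventually (\<lambda>z. False) (inf (nhds t) (filtermap f U))" unfolding eventually_inf by blast
   then show False using t by (simp add: trivial_limit_def)
  qed
 qed
 then show ?thesis by blast
qed

locale tracial_ultrapower = tracial_structure N for N :: "'a tracial_algebra" (structure) +
 fixes U :: "'i filter" assumes U: "ultrafilter U"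
begin

lemma U_bot: "U \<noteq> bot" using U by (simp add: ultrafilter_def)

definition bf :: "('i => 'a) set" where "bf = bounded_families N"
definition cl :: "('i => 'a) => ('i => 'a) set" where "cl x = ultra_rel U N `` {x}"
definition null :: "('i => 'a) => ('i => 'a) => bool" where
 "null x y \<longleftrightarrow> ((\<lambda>i. dist2 N (x i) (y i)) \<longlongrightarrow> 0) U"

lemma bfI: "(\<And>i. x i \<in> carrier N) ==> (\<And>i. opnorm N (x i) \<le> c) ==> x \<in> bf"
 by (auto simp: bf_def bounded_families_def intro!: bdd_aboveI[of _ c])
lemma bf_in: "x \<in> bf ==> x i \<in> carrier N" by (auto simp: bf_def bounded_families_def)
lemma bf_bound: "x \<in> bf ==> \<exists>c>0. \<forall>i. opnorm N (x i) \<le> c"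
proof -
 assume x: "x \<in> bf"
 then obtain c where c: "\<And>i. opnorm N (x i) \<le> c" by (auto simp: bf_def bounded_families_def bdd_above_def)
 then have "opnorm N (x i) \<le> max c 1" for i by (simp add: le_max_iff_disj)
 then show ?thesis by (intro exI[of _ "max c 1"]) simp
qed

lemma bf_ball: "(\<And>i. x i \<in> norm_ball N r) ==> x \<in> bf"
 by (rule bfI[of _ r]) (auto simp: norm_ball_def)
lemma bf_mult: assumes "x \<in> bf" "y \<in> bf" shows "(\<lambda>i. x i \<otimes> y i) \<in> bf"
proof -
 obtain c d where c: "c > 0" "\<forall>i. opnorm N (x i) \<le> c" and d: "\<forall>i. opnorm N (y i) \<le> d"
  using bf_bound[OF assms(1)] bf_bound[OF assms(2)] by blast
 show ?thesis
 proof (rule bfI[of _ "c * d"])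
  fix i
  have xy: "x i \<in> carrier N" "y i \<in> carrier N" using bf_in assms by auto
  then show "x i \<otimes> y i \<in> carrier N" by simp
  have "opnorm N (x i \<otimes> y i) \<le> opnorm N (x i) * opnorm N (y i)" using xy by (rule opnorm(5))
  also have "\<dots> \<le> c * d" using c d opnorm(1)[OF xy(1)] opnorm(1)[OF xy(2)] by (intro mult_mono) auto
  finally show "opnorm N (x i \<otimes> y i) \<le> c * d" .
 qed
qed
lemma bf_add: assumes "x \<in> bf" "y \<in> bf" shows "(\<lambda>i. x i \<oplus> y i) \<in> bf"
proof -
 obtain c d where c: "\<forall>i. opnorm N (x i) \<le> c" and d: "\<forall>i. opnorm N (y i) \<le> d"
  using bf_bound[OF assms(1)] bf_bound[OF assms(2)] by blast
 show ?thesis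
 proof (rule bfI[of _ "c + d"])
  fix i
  have xy: "x i \<in> carrier N" "y i \<in> carrier N" using bf_in assms by auto
  then show "x i \<oplus> y i \<in> carrier N" by simp
  show "opnorm N (x i \<oplus> y i) \<le> c + d" using opnorm(4)[OF xy] add_mono[OF spec[OF c, of i] spec[OF d, of i]] by linarith
 qed
qed
lemma bf_smult: assumes "x \<in> bf" shows "(\<lambda>i. c \<odot> x i) \<in> bf"
proof -
 obtain d where "\<forall>i. opnorm N (x i) \<le> d" using bf_bound[OF assms] by blast
 then show ?thesis using bf_in[OF assms] by (intro bfI[of _ "cmod c * d"]) (auto simp: opnorm intro!: mult_left_mono)
qed
lemma bf_star: assumes "x \<in> bf" shows "(\<lambda>i. star N (x i)) \<in> bf"
proof -
 obtain d where "\<forall>i. opnorm N (x i) \<le> d" using bf_bound[OF assms] by blast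
 then show ?thesis using bf_in[OF assms] by (intro bfI[of _ d]) (auto simp: opnorm)
qed
lemma bf_one: "(\<lambda>i. \<one>) \<in> bf" by (rule bfI[of _ 1]) (simp_all add: opnorm)

lemma nullI: assumes "x \<in> bf" "y \<in> bf" "\<forall>\<^sub>F i in U. dist2 N (x i) (y i) \<le> f i" "(f \<longlongrightarrow> 0) U"
 shows "null x y" unfolding null_def
proof (rule Lim_null_comparison[OF _ assms(4)])
 show "\<forall>\<^sub>F i in U. norm (dist2 N (x i) (y i)) \<le> f i" using assms(3) by eventually_elim (simp add: bf_in assms(1,2))
qed
lemma null_refl: "x \<in> bf ==> null x x" by (simp add: null_def bf_in)
lemma null_sym: "x \<in> bf ==> y \<in> bf ==> null x y ==> null y x" by (simp add: null_def bf_in dist2_sym)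
lemma null_trans: assumes "x \<in> bf" "y \<in> bf" "z \<in> bf" "null x y" "null y z" shows "null x z"
proof (rule nullI[OF assms(1,3)])
 show "\<forall>\<^sub>F i in U. dist2 N (x i) (z i) \<le> dist2 N (x i) (y i) + dist2 N (y i) (z i)"
  using bf_in assms by (intro always_eventually allI dist2_triangle)
 show "((\<lambda>i. dist2 N (x i) (y i) + dist2 N (y i) (z i)) \<longlongrightarrow> 0) U"
  using tendsto_add[OF assms(4,5)[unfolded null_def]] by simp
qed
lemma null_mult: assumes "x \<in> bf" "y \<in> bf" "x' \<in> bf" "y' \<in> bf" "null x x'" "null y y'"
 shows "null (\<lambda>i. x i \<otimes> y i) (\<lambda>i. x' i \<otimes> y' i)"
proof -
 obtain c d where c: "\<forall>i. opnorm N (x i) \<le> c" and d: "\<forall>i. opnorm N (y' i) \<le> d"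
  using bf_bound[OF assms(1)] bf_bound[OF assms(4)] by blast
 show ?thesis
 proof (rule nullI[OF bf_mult[OF assms(1,2)] bf_mult[OF assms(3,4)]])
  show "\<forall>\<^sub>F i in U. dist2 N (x i \<otimes> y i) (x' i \<otimes> y' i) \<le> c * dist2 N (y i) (y' i) + dist2 N (x i) (x' i) * d"
  proof (intro always_eventually allI)
   fix i
   have in': "x i \<in> carrier N" "y i \<in> carrier N" "x' i \<in> carrier N" "y' i \<in> carrier N" using bf_in assms by auto
   have "dist2 N (x i \<otimes> y i) (x' i \<otimes> y' i) \<le> opnorm N (x i) * dist2 N (y i) (y' i) + dist2 N (x i) (x' i) * opnorm N (y' i)"
    by (rule dist2_mult[OF in'])
   also have "\<dots> \<le> c * dist2 N (y i) (y' i) + dist2 N (x i) (x' i) * d"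
    using in' c d by (intro add_mono mult_right_mono mult_left_mono) auto
   finally show "dist2 N (x i \<otimes> y i) (x' i \<otimes> y' i) \<le> c * dist2 N (y i) (y' i) + dist2 N (x i) (x' i) * d" .
  qed
  show "((\<lambda>i. c * dist2 N (y i) (y' i) + dist2 N (x i) (x' i) * d) \<longlongrightarrow> 0) U"
   using tendsto_add[OF tendsto_mult_left[OF assms(6)[unfolded null_def], of c] tendsto_mult_right[OF assms(5)[unfolded null_def], of d]] by simp
 qed
qed
lemma null_add: assumes "x \<in> bf" "y \<in> bf" "x' \<in> bf" "y' \<in> bf" "null x x'" "null y y'"
 shows "null (\<lambda>i. x i \<oplus> y i) (\<lambda>i. x' i \<oplus> y' i)"
proof (rule nullI[OF bf_add[OF assms(1,2)] bf_add[OF assms(3,4)]])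
 show "\<forall>\<^sub>F i in U. dist2 N (x i \<oplus> y i) (x' i \<oplus> y' i) \<le> dist2 N (x i) (x' i) + dist2 N (y i) (y' i)"
  using bf_in assms by (intro always_eventually allI dist2_add)
 show "((\<lambda>i. dist2 N (x i) (x' i) + dist2 N (y i) (y' i)) \<longlongrightarrow> 0) U"
  using tendsto_add[OF assms(5,6)[unfolded null_def]] by simp
qed
lemma null_smult: "x \<in> bf ==> y \<in> bf ==> null x y ==> null (\<lambda>i. c \<odot> x i) (\<lambda>i. c \<odot> y i)"
 using tendsto_mult_left[of "\<lambda>i. dist2 N (x i) (y i)" 0 U "cmod c"] by (simp add: null_def bf_in dist2_smult)
lemma null_star: "x \<in> bf ==> y \<in> bf ==> null x y ==> null (\<lambda>i. star N (x i)) (\<lambda>i. star N (y i))"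
 by (simp add: null_def bf_in dist2_star)

lemma rel_iff: "(x, y) \<in> ultra_rel U N \<longleftrightarrow> x \<in> bf \<and> y \<in> bf \<and> null x y"
 by (simp add: ultra_rel_def bf_def null_def dist2_def)

lemma rel_equiv: "equiv bf (ultra_rel U N)"
proof (rule equivI)
 show "ultra_rel U N \<subseteq> bf \<times> bf" by (auto simp: rel_iff)
 show "refl_on bf (ultra_rel U N)" by (auto simp: refl_on_def rel_iff null_refl)
 show "sym (ultra_rel U N)" by (auto simp: sym_def rel_iff null_sym)
 show "trans (ultra_rel U N)" unfolding trans_def rel_iff using null_trans by blast
qed

lemma cl_eq_iff: "x \<in> bf ==> y \<in> bf ==> cl x = cl y \<longleftrightarrow> null x y"
 unfolding cl_def using eq_equiv_class_iff[OF rel_equiv] by (simp add: rel_iff)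
lemma mem_cl: "x \<in> bf ==> y \<in> cl x \<longleftrightarrow> y \<in> bf \<and> null x y" by (simp add: cl_def rel_iff)

abbreviation UP where "UP \<equiv> ultrapower U N"

lemma carrier_UP: "carrier UP = cl ` bf" by (auto simp: ultrapower_def quotient_def cl_def bf_def)

text \<open>The operations of the ultrapower are unions over all representatives; for a compatible
  operation all members of the union are the same class.\<close>

lemma Union_class:
 assumes x: "x \<in> bf" and h: "\<And>x'. x' \<in> bf ==> null x x' ==> h x = h x'" shows "(\<Union>x'\<in>cl x. h x') = h x"
proof -
 have "(\<Union>x'\<in>cl x. h x') = (\<Union>x'\<in>cl x. h x)" by (intro SUP_cong refl h[symmetric]) (simp_all add: mem_cl x)
 moreover have "x \<in> cl x" using x null_refl by (simp add: mem_cl)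
 ultimately show ?thesis by auto
qed

lemma Union_class2:
 assumes x: "x \<in> bf" and y: "y \<in> bf"
  and h: "\<And>x' y'. x' \<in> bf ==> y' \<in> bf ==> null x x' ==> null y y' ==> h x y = h x' y'"
 shows "(\<Union>x'\<in>cl x. \<Union>y'\<in>cl y. h x' y') = h x y"
proof -
 have "(\<Union>x'\<in>cl x. \<Union>y'\<in>cl y. h x' y') = (\<Union>x'\<in>cl x. \<Union>y'\<in>cl y. h x y)"
  by (intro SUP_cong refl h[symmetric]) (simp_all add: mem_cl x y)
 moreover have "x \<in> cl x" "y \<in> cl y" using x y null_refl by (simp_all add: mem_cl)
 ultimately show ?thesis by auto
qed

lemma UP_mult: assumes "x \<in> bf" "y \<in> bf" shows "cl x \<otimes>\<^bsub>UP\<^esub> cl y = cl (\<lambda>i. x i \<otimes> y i)"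
proof -
 have "cl x \<otimes>\<^bsub>UP\<^esub> cl y = (\<Union>x'\<in>cl x. \<Union>y'\<in>cl y. cl (\<lambda>i. x' i \<otimes> y' i))" by (simp add: ultrapower_def cl_def)
 also have "\<dots> = cl (\<lambda>i. x i \<otimes> y i)"
  by (rule Union_class2[OF assms]) (simp add: cl_eq_iff bf_mult assms null_mult)
 finally show ?thesis .
qed

lemma UP_add: assumes "x \<in> bf" "y \<in> bf" shows "cl x \<oplus>\<^bsub>UP\<^esub> cl y = cl (\<lambda>i. x i \<oplus> y i)"
proof -
 have "cl x \<oplus>\<^bsub>UP\<^esub> cl y = (\<Union>x'\<in>cl x. \<Union>y'\<in>cl y. cl (\<lambda>i. x' i \<oplus> y' i))" by (simp add: ultrapower_def cl_def)
 also have "\<dots> = cl (\<lambda>i. x i \<oplus> y i)"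
  by (rule Union_class2[OF assms]) (simp add: cl_eq_iff bf_add assms null_add)
 finally show ?thesis .
qed

lemma UP_smult: assumes "x \<in> bf" shows "c \<odot>\<^bsub>UP\<^esub> cl x = cl (\<lambda>i. c \<odot> x i)"
proof -
 have "c \<odot>\<^bsub>UP\<^esub> cl x = (\<Union>x'\<in>cl x. cl (\<lambda>i. c \<odot> x' i))" by (simp add: ultrapower_def cl_def)
 also have "\<dots> = cl (\<lambda>i. c \<odot> x i)"
  by (rule Union_class[OF assms]) (simp add: cl_eq_iff bf_smult assms null_smult)
 finally show ?thesis .
qed

lemma UP_star: assumes "x \<in> bf" shows "star UP (cl x) = cl (\<lambda>i. star N (x i))"
proof -
 have "star UP (cl x) = (\<Union>x'\<in>cl x. cl (\<lambda>i. star N (x' i)))" by (simp add: ultrapower_def cl_def)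
 also have "\<dots> = cl (\<lambda>i. star N (x i))"
  by (rule Union_class[OF assms]) (simp add: cl_eq_iff bf_star assms null_star)
 finally show ?thesis .
qed

lemma UP_one: "\<one>\<^bsub>UP\<^esub> = cl (\<lambda>i. \<one>)" by (simp add: ultrapower_def cl_def)

lemma null_tr:
 assumes x: "x \<in> bf" and y: "y \<in> bf" and xy: "null x y" and t: "((\<lambda>i. tr N (y i)) \<longlongrightarrow> t) U"
 shows "((\<lambda>i. tr N (x i)) \<longlongrightarrow> t) U"
proof -
 have "((\<lambda>i. tr N (x i) - tr N (y i)) \<longlongrightarrow> 0) U"
  by (rule Lim_null_comparison[OF _ xy[unfolded null_def]]) (intro always_eventually allI tr_dist2 bf_in x y)
 from tendsto_add[OF this t] show ?thesis by simp
qed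

lemma UP_tr: assumes x: "x \<in> bf" and t: "((\<lambda>i. tr N (x i)) \<longlongrightarrow> t) U" shows "tr UP (cl x) = t"
proof -
 have "tr UP (cl x) = (THE t. \<forall>y\<in>cl x. ((\<lambda>i. tr N (y i)) \<longlongrightarrow> t) U)" by (simp add: ultrapower_def)
 also have "\<dots> = t"
 proof (rule the_equality)
  show "\<forall>y\<in>cl x. ((\<lambda>i. tr N (y i)) \<longlongrightarrow> t) U"
  proof
   fix y assume "y \<in> cl x"
   then have y: "y \<in> bf" "null x y" using x by (auto simp: mem_cl)
   show "((\<lambda>i. tr N (y i)) \<longlongrightarrow> t) U" by (rule null_tr[OF y(1) x null_sym[OF x y] t])
  qed
  fix s assume "\<forall>y\<in>cl x. ((\<lambda>i. tr N (y i)) \<longlongrightarrow> s) U"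
  then have "((\<lambda>i. tr N (x i)) \<longlongrightarrow> s) U" using x null_refl by (auto simp: mem_cl)
  then show "s = t" using t U_bot tendsto_unique by blast
 qed
 finally show ?thesis .
qed

lemma UP_scalar_commute: "X \<in> carrier UP ==> (c \<odot>\<^bsub>UP\<^esub> \<one>\<^bsub>UP\<^esub>) \<otimes>\<^bsub>UP\<^esub> X = X \<otimes>\<^bsub>UP\<^esub> (c \<odot>\<^bsub>UP\<^esub> \<one>\<^bsub>UP\<^esub>)"
 by (auto simp: carrier_UP UP_one UP_smult UP_mult bf_one bf_smult scalar(1,2) bf_in)

lemma UP_scalar_in: "c \<odot>\<^bsub>UP\<^esub> \<one>\<^bsub>UP\<^esub> \<in> carrier UP"
 by (simp add: carrier_UP UP_one UP_smult bf_one bf_smult)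

end

section \<open>The embedding and its relative commutant\<close>

definition dense_vars :: "nat => var list" where
 "dense_vars m = map (\<lambda>(j, r). (3 * j, r)) (List.product [0..<Suc m] [0..<Suc m])"

definition level_vars :: "nat => var set" where "level_vars k = {..3 * k} \<times> {..k}"

definition level_gap :: "nat => formula" where
 "level_gap m = gap_formula (dense_vars m) m (1 / (real m + 1))"

text \<open>The finite stock of formulas controlled at stage \<open>k\<close>: distances that
  witness unit, adjoint, sum, product and coincidence of variables, the traces, and the gap formulas
  up to \<open>k\<close>. Multiplication by scalars is absent, as there are uncountably many
  scalars; it is recovered from traces in \<open>h_scalar\<close>.\<close>

definition level :: "nat => formula set" where
 "level k = (\<Union>p\<in>level_vars k. {Dist (Var p) (Const 1), ReTr (Var p), ImTr (Var p)}) \<union>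
   (\<Union>p\<in>level_vars k. \<Union>q\<in>level_vars k. {Dist (Var p) (Var q), Dist (Var p) (Star (Var q))}) \<union>
   (\<Union>p\<in>level_vars k. \<Union>q\<in>level_vars k. \<Union>s\<in>level_vars k. {Dist (Var p) (Plus (Var q) (Var s)), Dist (Var p) (Times (Var q) (Var s))}) \<union>
   level_gap ` {..k}"

lemma finite_level: "finite (level k)" by (simp add: level_def level_vars_def)
lemma level_wf: "\<phi> \<in> level k ==> well_formed \<phi> \<and> depth \<phi> \<le> 2"
 by (auto simp: level_def level_gap_def gap_formula_wf)

lemma set_dense_vars: "set (dense_vars m) = {(3 * j, r) | j r. j \<le> m \<and> r \<le> m}"
 by (auto simp: dense_vars_def image_iff less_Suc_eq_le)
lemma dense_vars_dense: "p \<in> set (dense_vars m) ==> dense_var p"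
 by (auto simp: set_dense_vars dense_var_def)
lemma dense_vars_level: "p \<in> set (dense_vars m) ==> p \<in> level_vars m"
 by (auto simp: set_dense_vars level_vars_def)

text \<open>The rank of \<open>i\<close> is the first \<open>n\<close> for which
  \<open>P n i\<close> fails. It exists for almost all \<open>i\<close>, and it is at least
  \<open>k\<close> wherever the first \<open>k\<close> conditions hold.\<close>

lemma countably_incomplete_rank:
 assumes U: "ultrafilter U" "countably_incomplete U"
 shows "\<exists>n :: 'i => nat. filterlim n at_top (U :: 'i filter)"
proof -
 obtain P :: "nat => 'i => bool" where P: "\<And>n. eventually (P n) U" "\<not> eventually (\<lambda>i. \<forall>n. P n i) U"
  using U(2) by (auto simp: countably_incomplete_def)
 have ex: "eventually (\<lambda>i. \<exists>n. \<not> P n i) U" using U(1) P(2) unfolding ultrafilter_def by fastforce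
 define n where "n i = (LEAST n. \<not> P n i)" for i
 have "\<forall>\<^sub>F i in U. k \<le> n i" for k
 proof -
  have "\<forall>\<^sub>F i in U. \<forall>m\<in>{..<k}. P m i" using P(1) by (simp add: eventually_ball_finite)
  with ex show ?thesis
  proof eventually_elim
   case (elim i)
   have "\<not> P (n i) i" unfolding n_def by (rule LeastI_ex[OF elim(1)])
   then show ?case using elim(2) by (meson lessThan_iff not_le)
  qed
 qed
 then show ?thesis unfolding filterlim_at_top by blast
qed

text \<open>A dense sequence of the algebra may miss the ball. For each of its members
  \<open>q k\<close> and each precision \<open>1 / (l + 1)\<close> a point of the ball that close to
  \<open>q k\<close> is selected, provided there is one.\<close>

lemma separable_ball:
 assumes "tracial_structure M" "separable2 M"
 shows "\<exists>e :: nat => 'a. (\<forall>j. e j \<in> norm_ball M (real r)) \<and> (\<forall>x\<in>norm_ball M (real r). \<forall>\<epsilon>>0. \<exists>j. dist2 M x (e j) < \<epsilon>)"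
proof -
 interpret tracial_structure M by (rule assms(1))
 obtain D where D: "countable D" "D \<subseteq> carrier M" "\<And>x e. x \<in> carrier M ==> e > 0 ==> \<exists>d\<in>D. dist2 M x d < e"
  using assms(2) unfolding separable2_def dist2_def by blast
 have "D \<noteq> {}" using D(3)[OF closed(1), of 1] by auto
 define q where "q = from_nat_into D"
 have q: "q k \<in> carrier M" for k using from_nat_into[OF \<open>D \<noteq> {}\<close>] D(2) by (auto simp: q_def)
 have qd: "\<exists>k. dist2 M x (q k) < e" if "x \<in> carrier M" "e > 0" for x e
  using D(3)[OF that] from_nat_into_surj[OF D(1)] unfolding q_def by metis
 define e where "e j = (case prod_decode j of (k, l) =>
   if \<exists>z\<in>norm_ball M (real r). dist2 M z (q k) < 1 / (real l + 1) then SOME z. z \<in> norm_ball M (real r) \<and> dist2 M z (q k) < 1 / (real l + 1) else \<zero>\<^bsub>M\<^esub>)" for j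
 have e: "e (prod_encode (k, l)) \<in> norm_ball M (real r) \<and> dist2 M (e (prod_encode (k, l))) (q k) < 1 / (real l + 1)"
  if "\<exists>z\<in>norm_ball M (real r). dist2 M z (q k) < 1 / (real l + 1)" for k l
 proof -
  have "\<exists>z. z \<in> norm_ball M (real r) \<and> dist2 M z (q k) < 1 / (real l + 1)" using that by blast
  from someI_ex[OF this] show ?thesis using that by (simp add: e_def)
 qed
 have "e j \<in> norm_ball M (real r)" for j
 proof -
  obtain k l where j: "j = prod_encode (k, l)" by (metis prod_decode_inverse surj_pair)
  show ?thesis
  proof (cases "\<exists>z\<in>norm_ball M (real r). dist2 M z (q k) < 1 / (real l + 1)")
   case True
   then show ?thesis using e[of k l] by (simp add: j)
  next
   case False
   then show ?thesis by (simp add: e_def j)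
  qed
 qed
 moreover have "\<exists>j. dist2 M x (e j) < \<epsilon>" if x: "x \<in> norm_ball M (real r)" and \<epsilon>: "\<epsilon> > 0" for x \<epsilon>
 proof -
  have xC: "x \<in> carrier M" using x by (simp add: norm_ball_def)
  obtain l where l: "1 / (real l + 1) < \<epsilon> / 2" using nat_approx_posE[of "\<epsilon> / 2"] \<epsilon> by (metis add.commute half_gt_zero of_nat_Suc)
  obtain k where k: "dist2 M x (q k) < 1 / (real l + 1)" using qd[OF xC, of "1 / (real l + 1)"] by auto
  define z where "z = e (prod_encode (k, l))"
  have z: "z \<in> norm_ball M (real r)" "dist2 M z (q k) < 1 / (real l + 1)" using e[of k l] x k unfolding z_def by blast+
  have zC: "z \<in> carrier M" using z by (simp add: norm_ball_def)
  have "dist2 M x z \<le> dist2 M x (q k) + dist2 M (q k) z" by (rule dist2_triangle[OF xC q zC])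
  also have "\<dots> < \<epsilon>" using k z(2) l dist2_sym[OF q zC] by simp
  finally show ?thesis unfolding z_def by blast
 qed
 ultimately show ?thesis by blast
qed

text \<open>The assignment \<open>v\<close> lists dense sequences of the balls and the witnesses in
  \<open>M\<close>; \<open>w k\<close> imitates it in the other algebra up to
  \<open>1 / (k + 1)\<close> on the formulas of level \<open>k\<close>; the rank \<open>n\<close>
  tells which level is used at an index of the ultrafilter.\<close>

locale transfer = M: tracial_structure M + tracial_ultrapower N U
 for M :: "'m tracial_algebra" and N :: "'a tracial_algebra" (structure) and U :: "'i filter" +
 fixes n :: "'i => nat" and v :: "var => 'm" and w :: "nat => var => 'a"
 assumes n: "filterlim n at_top U"
  and v_ball: "v p \<in> norm_ball M (real (snd p))"
  and v_dense: "x \<in> norm_ball M (real r) ==> e > 0 ==> \<exists>j. dist2 M x (v (3 * j, r)) < e"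
  and w_ball: "w k p \<in> norm_ball N (real (snd p))"
  and w_val: "\<phi> \<in> level k ==> \<bar>formula_value N (w k) \<phi> - formula_value M v \<phi>\<bar> < 1 / (real k + 1)"
  and v_gap: "formula_value M v (level_gap m) < 1 / (real m + 1)"
begin

lemma vC [simp]: "v p \<in> carrier M" using v_ball by (simp add: norm_ball_def)
lemma wC [simp]: "w k p \<in> carrier N" using w_ball by (simp add: norm_ball_def)

definition rad :: "'m => nat" where "rad x = nat \<lceil>opnorm M x\<rceil>"
text \<open>The variable whose value is nearest to \<open>x\<close> among the first
  \<open>k + 1\<close> points of the ball of radius \<open>rad x\<close>. Thus \<open>h x\<close>
  follows ever better approximations of \<open>x\<close> while staying in one ball.\<close>

definition pv :: "'m => nat => var" where
 "pv x k = (3 * arg_min_on (\<lambda>j. dist2 M x (v (3 * j, rad x))) {..k}, rad x)"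
definition \<delta> :: "'m => nat => real" where "\<delta> x k = dist2 M x (v (pv x k))"
definition h :: "'m => 'i => 'a" where "h x i = w (n i) (pv x (n i))"
definition er :: "nat => real" where "er k = 1 / (real k + 1)"

lemma rad: "x \<in> carrier M ==> x \<in> norm_ball M (real (rad x))" by (simp add: norm_ball_def rad_def of_nat_ceiling)

lemma pv_min: "arg_min_on (\<lambda>j. dist2 M x (v (3 * j, rad x))) {..k} \<le> k"
  "j \<le> k ==> \<delta> x k \<le> dist2 M x (v (3 * j, rad x))"
 using arg_min_if_finite[of "{..k}" "\<lambda>j. dist2 M x (v (3 * j, rad x))"] by (auto simp: \<delta>_def pv_def not_less)

lemma pv_dense: "rad x \<le> k ==> pv x k \<in> set (dense_vars k)"
 using pv_min(1)[of x k] by (auto simp: set_dense_vars pv_def)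
lemma pv_level: "rad x \<le> k ==> pv x k \<in> level_vars k" using pv_dense dense_vars_level by blast
lemma snd_pv [simp]: "snd (pv x k) = rad x" by (simp add: pv_def)

lemma \<delta>_nonneg: "x \<in> carrier M ==> 0 \<le> \<delta> x k" by (simp add: \<delta>_def)

lemma \<delta>_lim: assumes x: "x \<in> carrier M" shows "\<delta> x \<longlonglongrightarrow> 0"
proof (rule LIMSEQ_I)
 fix e :: real assume "e > 0"
 then obtain j where j: "dist2 M x (v (3 * j, rad x)) < e" using v_dense[OF rad[OF x]] by blast
 have "norm (\<delta> x k - 0) < e" if "k \<ge> j" for k using pv_min(2)[OF that, of x] j \<delta>_nonneg[OF x, of k] by simp
 then show "\<exists>no. \<forall>k\<ge>no. norm (\<delta> x k - 0) < e" by blast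
qed

lemma er_lim: "er \<longlonglongrightarrow> 0" unfolding er_def using LIMSEQ_inverse_real_of_nat by (simp add: inverse_eq_divide add.commute)
lemma er_pos: "er k > 0" by (simp add: er_def)

lemma w_dist: "Dist p q \<in> level k ==> dist2 N (poly_value N (w k) p) (poly_value N (w k) q) \<le>
  dist2 M (poly_value M v p) (poly_value M v q) + er k"
 using w_val[of "Dist p q" k] by (simp add: dist2_def er_def)

lemma hbf: "h x \<in> bf" using w_ball[of _ "pv x _"] by (intro bf_ball[of _ "real (rad x)"]) (simp add: h_def)
lemma wbf: "(\<lambda>i. w (n i) p) \<in> bf" using w_ball by (intro bf_ball)

lemma nU: "eventually P sequentially ==> \<forall>\<^sub>F i in U. P (n i)" by (rule eventually_compose_filterlim[OF _ n])
lemma nlim: "(f :: nat => real) \<longlonglongrightarrow> 0 ==> ((\<lambda>i. f (n i)) \<longlongrightarrow> 0) U" by (rule filterlim_compose[OF _ n])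

lemma null_level:
 assumes "x \<in> bf" "y \<in> bf" "f \<longlonglongrightarrow> 0" "\<And>i. r \<le> n i ==> dist2 N (x i) (y i) \<le> f (n i)"
 shows "null x y"
proof (rule nullI[OF assms(1,2) _ nlim[OF assms(3)]])
 have "\<forall>\<^sub>F i in U. r \<le> n i" by (rule nU) (rule eventually_ge_at_top)
 then show "\<forall>\<^sub>F i in U. dist2 N (x i) (y i) \<le> f (n i)" by eventually_elim (rule assms(4))
qed

lemma in_level:
 "p \<in> level_vars k ==> Dist (Var p) (Const 1) \<in> level k"
 "p \<in> level_vars k ==> ReTr (Var p) \<in> level k" "p \<in> level_vars k ==> ImTr (Var p) \<in> level k"
 "p \<in> level_vars k ==> q \<in> level_vars k ==> Dist (Var p) (Var q) \<in> level k"
 "p \<in> level_vars k ==> q \<in> level_vars k ==> Dist (Var p) (Star (Var q)) \<in> level k"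
 "p \<in> level_vars k ==> q \<in> level_vars k ==> s \<in> level_vars k ==> Dist (Var p) (Plus (Var q) (Var s)) \<in> level k"
 "p \<in> level_vars k ==> q \<in> level_vars k ==> s \<in> level_vars k ==> Dist (Var p) (Times (Var q) (Var s)) \<in> level k"
 by (simp_all add: level_def)

lemma v_le: "opnorm M (v p) \<le> real (snd p)" using v_ball by (simp add: norm_ball_def)

text \<open>The common pattern of the homomorphism laws: if the values in \<open>M\<close> of
  polynomials in variables approximate \<open>z\<close>, the level formulas carry the distance from
  \<open>pv z\<close> over to the other side.\<close>

lemma h_null:
 assumes z: "z \<in> carrier M" and y: "y \<in> bf" and f: "f \<longlonglongrightarrow> 0"
  and q: "\<And>i. r \<le> n i ==> Dist (Var (pv z (n i))) (q i) \<in> level (n i) \<and> poly_value N (w (n i)) (q i) = y i \<and>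
   poly_value M v (q i) \<in> carrier M \<and> dist2 M z (poly_value M v (q i)) \<le> f (n i)"
 shows "null (h z) y"
proof (rule null_level[OF hbf y])
 show "(\<lambda>k. \<delta> z k + f k + er k) \<longlonglongrightarrow> 0" using tendsto_add[OF tendsto_add[OF \<delta>_lim[OF z] f] er_lim] by simp
 fix i assume "r \<le> n i"
 note q = q[OF this]
 define p where "p = pv z (n i)"
 have "dist2 N (h z i) (y i) \<le> dist2 M (v p) (poly_value M v (q i)) + er (n i)"
  using w_dist[of "Var p" "q i" "n i"] q by (simp add: h_def p_def)
 moreover have "dist2 M (v p) (poly_value M v (q i)) \<le> dist2 M (v p) z + dist2 M z (poly_value M v (q i))"
  using q z by (intro M.dist2_triangle) auto
 moreover have "dist2 M (v p) z = \<delta> z (n i)" using M.dist2_sym[OF vC z, of p] by (simp add: \<delta>_def p_def)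
 ultimately show "dist2 N (h z i) (y i) \<le> \<delta> z (n i) + f (n i) + er (n i)" using q by linarith
qed

lemma h_add: assumes x: "x \<in> carrier M" and y: "y \<in> carrier M"
 shows "null (h (x \<oplus>\<^bsub>M\<^esub> y)) (\<lambda>i. h x i \<oplus> h y i)"
proof (rule h_null[OF _ bf_add[OF hbf hbf]])
 show "(\<lambda>k. \<delta> x k + \<delta> y k) \<longlonglongrightarrow> 0" using tendsto_add[OF \<delta>_lim[OF x] \<delta>_lim[OF y]] by simp
 fix i assume "max (rad (x \<oplus>\<^bsub>M\<^esub> y)) (max (rad x) (rad y)) \<le> n i"
 then show "Dist (Var (pv (x \<oplus>\<^bsub>M\<^esub> y) (n i))) (Plus (Var (pv x (n i))) (Var (pv y (n i)))) \<in> level (n i) \<and>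
   poly_value N (w (n i)) (Plus (Var (pv x (n i))) (Var (pv y (n i)))) = h x i \<oplus> h y i \<and>
   poly_value M v (Plus (Var (pv x (n i))) (Var (pv y (n i)))) \<in> carrier M \<and>
   dist2 M (x \<oplus>\<^bsub>M\<^esub> y) (poly_value M v (Plus (Var (pv x (n i))) (Var (pv y (n i))))) \<le> \<delta> x (n i) + \<delta> y (n i)"
  using x y by (simp add: in_level pv_level h_def \<delta>_def M.dist2_add)
qed (use x y in simp)

lemma h_mult: assumes x: "x \<in> carrier M" and y: "y \<in> carrier M"
 shows "null (h (x \<otimes>\<^bsub>M\<^esub> y)) (\<lambda>i. h x i \<otimes> h y i)"
proof (rule h_null[OF _ bf_mult[OF hbf hbf]])
 show "(\<lambda>k. opnorm M x * \<delta> y k + \<delta> x k * real (rad y)) \<longlonglongrightarrow> 0"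
  using tendsto_add[OF tendsto_mult_left[OF \<delta>_lim[OF y], of "opnorm M x"] tendsto_mult_right[OF \<delta>_lim[OF x], of "real (rad y)"]] by simp
 fix i assume i: "max (rad (x \<otimes>\<^bsub>M\<^esub> y)) (max (rad x) (rad y)) \<le> n i"
 let ?q = "pv x (n i)" and ?s = "pv y (n i)"
 have "dist2 M (x \<otimes>\<^bsub>M\<^esub> y) (v ?q \<otimes>\<^bsub>M\<^esub> v ?s) \<le> opnorm M x * dist2 M y (v ?s) + dist2 M x (v ?q) * opnorm M (v ?s)"
  using x y by (intro M.dist2_mult) auto
 moreover have "dist2 M x (v ?q) * opnorm M (v ?s) \<le> dist2 M x (v ?q) * real (rad y)"
  using v_le[of ?s] x by (intro mult_left_mono) auto
 ultimately show "Dist (Var (pv (x \<otimes>\<^bsub>M\<^esub> y) (n i))) (Times (Var ?q) (Var ?s)) \<in> level (n i) \<and>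
   poly_value N (w (n i)) (Times (Var ?q) (Var ?s)) = h x i \<otimes> h y i \<and>
   poly_value M v (Times (Var ?q) (Var ?s)) \<in> carrier M \<and>
   dist2 M (x \<otimes>\<^bsub>M\<^esub> y) (poly_value M v (Times (Var ?q) (Var ?s))) \<le> opnorm M x * \<delta> y (n i) + \<delta> x (n i) * real (rad y)"
  using i by (simp add: in_level pv_level h_def \<delta>_def)
qed (use x y in simp)

lemma h_star: assumes x: "x \<in> carrier M" shows "null (h (star M x)) (\<lambda>i. star N (h x i))"
proof (rule h_null[OF _ bf_star[OF hbf] \<delta>_lim[OF x]])
 fix i assume "max (rad (star M x)) (rad x) \<le> n i"
 then show "Dist (Var (pv (star M x) (n i))) (Star (Var (pv x (n i)))) \<in> level (n i) \<and>
   poly_value N (w (n i)) (Star (Var (pv x (n i)))) = star N (h x i) \<and>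
   poly_value M v (Star (Var (pv x (n i)))) \<in> carrier M \<and>
   dist2 M (star M x) (poly_value M v (Star (Var (pv x (n i))))) \<le> \<delta> x (n i)"
  using x by (simp add: in_level pv_level h_def \<delta>_def M.dist2_star)
qed (use x in simp)

lemma h_one: "null (h \<one>\<^bsub>M\<^esub>) (\<lambda>i. \<one>)"
 by (rule h_null[OF _ bf_one tendsto_const, where q = "\<lambda>_. Const 1" and r = "rad \<one>\<^bsub>M\<^esub>"])
  (simp_all add: in_level(1)[OF pv_level] scalar(6) M.scalar(6))

lemma h_tr: assumes x: "x \<in> carrier M" shows "((\<lambda>i. tr N (h x i)) \<longlongrightarrow> tr M x) U"
proof -
 have "((\<lambda>i. tr N (h x i) - tr M x) \<longlongrightarrow> 0) U"
 proof (rule Lim_null_comparison)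
  show "((\<lambda>i. \<delta> x (n i) + 2 * er (n i)) \<longlongrightarrow> 0) U"
   using tendsto_add[OF nlim[OF \<delta>_lim[OF x]] tendsto_mult_left[OF nlim[OF er_lim], of 2]] by simp
  have "\<forall>\<^sub>F i in U. rad x \<le> n i" by (rule nU) (rule eventually_ge_at_top)
  then show "\<forall>\<^sub>F i in U. norm (tr N (h x i) - tr M x) \<le> \<delta> x (n i) + 2 * er (n i)"
  proof eventually_elim
   case (elim i)
   define p where "p = pv x (n i)"
   have L: "p \<in> level_vars (n i)" using elim by (simp add: p_def pv_level)
   have "\<bar>Re (tr N (w (n i) p)) - Re (tr M (v p))\<bar> \<le> er (n i)" "\<bar>Im (tr N (w (n i) p)) - Im (tr M (v p))\<bar> \<le> er (n i)"
    using w_val[OF in_level(2)[OF L]] w_val[OF in_level(3)[OF L]] by (simp_all add: er_def)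
   then have "cmod (tr N (w (n i) p) - tr M (v p)) \<le> 2 * er (n i)" using cmod_le[of "tr N (w (n i) p) - tr M (v p)"] by simp
   moreover have "cmod (tr M (v p) - tr M x) \<le> \<delta> x (n i)"
    using M.tr_dist2[OF vC x, of p] M.dist2_sym[OF vC x, of p] by (simp add: \<delta>_def p_def)
   moreover have "cmod (tr N (w (n i) p) - tr M x) \<le> cmod (tr N (w (n i) p) - tr M (v p)) + cmod (tr M (v p) - tr M x)"
    using norm_triangle_ineq[of "tr N (w (n i) p) - tr M (v p)" "tr M (v p) - tr M x"] by simp
   ultimately show ?case by (simp add: h_def p_def)
  qed
 qed
 from tendsto_add[OF this tendsto_const[of "tr M x"]] show ?thesis by simp
qed

text \<open>The squared distance of \<open>h z i\<close> from \<open>c\<close> times the unit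
  expands into the traces of \<open>star (h z i) * h z i\<close> and of \<open>h z i\<close>. Both
  converge to the corresponding traces in \<open>M\<close>, where the distance is 0.\<close>

lemma h_scalar: "null (h (c \<odot>\<^bsub>M\<^esub> \<one>\<^bsub>M\<^esub>)) (\<lambda>i. c \<odot> \<one>)"
proof -
 define z where "z = c \<odot>\<^bsub>M\<^esub> \<one>\<^bsub>M\<^esub>"
 have z: "z \<in> carrier M" by (simp add: z_def)
 have "null (\<lambda>i. star N (h z i) \<otimes> h z i) (\<lambda>i. h (star M z) i \<otimes> h z i)"
  using h_star[OF z] by (intro null_mult null_sym[OF hbf bf_star[OF hbf]] null_refl bf_star hbf)
 moreover have "null (\<lambda>i. h (star M z) i \<otimes> h z i) (h (star M z \<otimes>\<^bsub>M\<^esub> z))"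
  using h_mult[of "star M z" z] z by (intro null_sym[OF hbf bf_mult[OF hbf hbf]]) simp
 ultimately have "null (\<lambda>i. star N (h z i) \<otimes> h z i) (h (star M z \<otimes>\<^bsub>M\<^esub> z))"
  by (rule null_trans[OF bf_mult[OF bf_star[OF hbf] hbf] bf_mult[OF hbf hbf] hbf])
 then have s: "((\<lambda>i. tr N (star N (h z i) \<otimes> h z i)) \<longlongrightarrow> tr M (star M z \<otimes>\<^bsub>M\<^esub> z)) U"
  by (rule null_tr[OF bf_mult[OF bf_star[OF hbf] hbf] hbf]) (simp add: h_tr z)
 have "((\<lambda>i. sqrt (Re (tr N (star N (h z i) \<otimes> h z i)) - 2 * Re (c * cnj (tr N (h z i))) + (cmod c)\<^sup>2)) \<longlongrightarrow>
   sqrt (Re (tr M (star M z \<otimes>\<^bsub>M\<^esub> z)) - 2 * Re (c * cnj (tr M z)) + (cmod c)\<^sup>2)) U"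
  by (intro tendsto_intros s h_tr z)
 moreover have "Re (tr M (star M z \<otimes>\<^bsub>M\<^esub> z)) - 2 * Re (c * cnj (tr M z)) + (cmod c)\<^sup>2 = (dist2 M z (c \<odot>\<^bsub>M\<^esub> \<one>\<^bsub>M\<^esub>))\<^sup>2"
  using z by (simp only: M.dist2_smult_sq M.closed M.tr_scalar) simp
 moreover have "dist2 M z (c \<odot>\<^bsub>M\<^esub> \<one>\<^bsub>M\<^esub>) = 0" by (simp add: z_def)
 moreover have "sqrt (Re (tr N (star N (h z i) \<otimes> h z i)) - 2 * Re (c * cnj (tr N (h z i))) + (cmod c)\<^sup>2) = dist2 N (h z i) (c \<odot> \<one>)" for i
  by (rule real_sqrt_unique) (simp_all add: dist2_smult_sq bf_in[OF hbf] tr_scalar)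
 ultimately show ?thesis unfolding z_def null_def by simp
qed

lemma h_smult: assumes x: "x \<in> carrier M" shows "null (h (c \<odot>\<^bsub>M\<^esub> x)) (\<lambda>i. c \<odot> h x i)"
proof -
 have "null (h (c \<odot>\<^bsub>M\<^esub> x)) (\<lambda>i. h (c \<odot>\<^bsub>M\<^esub> \<one>\<^bsub>M\<^esub>) i \<otimes> h x i)"
  using h_mult[of "c \<odot>\<^bsub>M\<^esub> \<one>\<^bsub>M\<^esub>" x] x by (simp add: M.scalar(1))
 moreover have "null (\<lambda>i. h (c \<odot>\<^bsub>M\<^esub> \<one>\<^bsub>M\<^esub>) i \<otimes> h x i) (\<lambda>i. (c \<odot> \<one>) \<otimes> h x i)"
  by (intro null_mult h_scalar null_refl hbf bf_smult bf_one)
 ultimately have "null (h (c \<odot>\<^bsub>M\<^esub> x)) (\<lambda>i. (c \<odot> \<one>) \<otimes> h x i)"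
  by (rule null_trans[OF hbf bf_mult[OF hbf hbf] bf_mult[OF bf_smult[OF bf_one] hbf]])
 then show ?thesis by (simp add: scalar(1) bf_in[OF hbf])
qed

theorem embedding_h: "embedding M UP (\<lambda>x. cl (h x))" unfolding embedding_def ring_hom_def
 using hbf bf_add[OF hbf hbf] bf_mult[OF hbf hbf] bf_star[OF hbf] bf_smult[OF hbf] bf_one
  h_add h_mult h_star h_smult h_one h_tr
 by (auto simp: carrier_UP UP_add UP_mult UP_star UP_smult UP_one cl_eq_iff UP_tr)

lemma h_var: "null (h (v p)) (\<lambda>i. w (n i) p)"
proof (rule h_null[OF vC wbf tendsto_const])
 fix i assume i: "max (rad (v p)) (fst p + snd p) \<le> n i"
 then have "p \<in> level_vars (n i)" by (cases p) (simp add: level_vars_def)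
 with i show "Dist (Var (pv (v p) (n i))) (Var p) \<in> level (n i) \<and> poly_value N (w (n i)) (Var p) = w (n i) p \<and>
   poly_value M v (Var p) \<in> carrier M \<and> dist2 M (v p) (poly_value M v (Var p)) \<le> 0"
  by (simp add: in_level pv_level)
qed

section \<open>The centre of the relative commutant\<close>

lemma null_commute:
 assumes "a \<in> bf" "y \<in> bf" "y' \<in> bf" "null y y'" "null (\<lambda>i. a i \<otimes> y i) (\<lambda>i. y i \<otimes> a i)"
 shows "null (\<lambda>i. a i \<otimes> y' i) (\<lambda>i. y' i \<otimes> a i)"
proof -
 have 1: "null (\<lambda>i. a i \<otimes> y' i) (\<lambda>i. a i \<otimes> y i)"
  by (rule null_mult[OF assms(1,3,1,2) null_refl[OF assms(1)] null_sym[OF assms(2,3,4)]])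
 have 2: "null (\<lambda>i. y i \<otimes> a i) (\<lambda>i. y' i \<otimes> a i)"
  by (rule null_mult[OF assms(2,1,3,1) assms(4) null_refl[OF assms(1)]])
 note b = bf_mult[OF assms(1,3)] bf_mult[OF assms(1,2)] bf_mult[OF assms(2,1)] bf_mult[OF assms(3,1)]
 show ?thesis by (rule null_trans[OF b(1,3,4) null_trans[OF b(1,2,3) 1 assms(5)] 2])
qed

lemma null_commute_iff:
 "a \<in> bf ==> y \<in> bf ==> cl a \<otimes>\<^bsub>UP\<^esub> cl y = cl y \<otimes>\<^bsub>UP\<^esub> cl a \<longleftrightarrow> null (\<lambda>i. a i \<otimes> y i) (\<lambda>i. y i \<otimes> a i)"
 by (simp add: UP_mult cl_eq_iff bf_mult)

lemma dist2_commutator: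
 assumes "b \<in> carrier N" "opnorm N b \<le> 1" "x \<in> carrier N" "y \<in> carrier N"
 shows "dist2 N (b \<otimes> x) (x \<otimes> b) \<le> dist2 N (b \<otimes> y) (y \<otimes> b) + 2 * dist2 N x y"
proof -
 have "dist2 N (b \<otimes> x) (b \<otimes> y) \<le> opnorm N b * dist2 N x y + dist2 N b b * opnorm N y"
  by (rule dist2_mult) (use assms in auto)
 moreover have "opnorm N b * dist2 N x y \<le> 1 * dist2 N x y" using assms by (intro mult_right_mono) auto
 moreover have "dist2 N (y \<otimes> b) (x \<otimes> b) \<le> opnorm N y * dist2 N b b + dist2 N y x * opnorm N b"
  by (rule dist2_mult) (use assms in auto)
 moreover have "dist2 N y x * opnorm N b \<le> dist2 N y x * 1" using assms by (intro mult_left_mono) auto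
 moreover have "dist2 N (b \<otimes> x) (x \<otimes> b) \<le> dist2 N (b \<otimes> x) (b \<otimes> y) + (dist2 N (b \<otimes> y) (y \<otimes> b) + dist2 N (y \<otimes> b) (x \<otimes> b))"
  using dist2_triangle[of "b \<otimes> x" "b \<otimes> y" "x \<otimes> b"] dist2_triangle[of "b \<otimes> y" "y \<otimes> b" "x \<otimes> b"] assms by simp
 ultimately show ?thesis using assms dist2_sym[of y x] by simp
qed

text \<open>The witnesses are chosen at a level that tends to infinity so slowly that the contraction
 almost commutes with the corresponding variables.\<close>

lemma slow_level:
 assumes s: "\<And>m. (s m \<longlongrightarrow> (0::real)) U"
 shows "\<exists>\<mu>. filterlim \<mu> at_top U \<and> (\<forall>i. \<mu> i \<le> n i) \<and> (\<forall>i. \<mu> i \<ge> 1 --> s (\<mu> i) i \<le> er (\<mu> i))"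
proof -
 define G where "G i = {m. m \<le> n i \<and> (m = 0 \<or> s m i \<le> er m)}" for i
 have G: "finite (G i)" "0 \<in> G i" for i by (auto simp: G_def)
 define \<mu> where "\<mu> i = Max (G i)" for i
 have \<mu>: "\<mu> i \<in> G i" for i using Max_in[OF G(1), of i] G(2)[of i] by (auto simp: \<mu>_def)
 have "\<forall>\<^sub>F i in U. m \<le> \<mu> i" for m
 proof -
  have "\<forall>\<^sub>F i in U. s m i < er m" using order_tendstoD(2)[OF s er_pos] .
  moreover have "\<forall>\<^sub>F i in U. m \<le> n i" by (rule nU) (rule eventually_ge_at_top)
  ultimately show ?thesis
  proof eventually_elim
   case (elim i)
   then have "m \<in> G i" by (simp add: G_def)
   then show ?case using Max_ge[OF G(1)] by (simp add: \<mu>_def)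
  qed
 qed
 then have "filterlim \<mu> at_top U" by (simp add: filterlim_at_top)
 moreover have "\<mu> i \<le> n i" "\<mu> i \<ge> 1 --> s (\<mu> i) i \<le> er (\<mu> i)" for i using \<mu>[of i] by (auto simp: G_def)
 ultimately show ?thesis by blast
qed

lemma er_mono: "k \<le> m ==> er m \<le> er k" by (simp add: er_def frac_le)

text \<open>For fixed \<open>m\<close>, the contraction \<open>a\<close> asymptotically commutes
  with the images of the witnesses, because \<open>h_var\<close> identifies them with images of
  elements of \<open>M\<close>. At the slowly growing level \<mu> the gap formula supplies
  \<open>b i\<close> almost commuting with more and more dense variables, so \<open>b\<close> lies
  in the relative commutant and commutes with \<open>a\<close>. All commutators in the gap
  inequality vanish in the limit, and with them the variance of \<open>a\<close>.\<close>

theorem central_is_scalar: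
 assumes a: "\<And>i. a i \<in> norm_ball N 1"
  and comm: "\<And>x. x \<in> carrier M ==> null (\<lambda>i. a i \<otimes> h x i) (\<lambda>i. h x i \<otimes> a i)"
  and central: "\<And>b. b \<in> bf ==> (\<And>x. x \<in> carrier M ==> null (\<lambda>i. b i \<otimes> h x i) (\<lambda>i. h x i \<otimes> b i)) ==>
   null (\<lambda>i. a i \<otimes> b i) (\<lambda>i. b i \<otimes> a i)"
 shows "\<exists>t. null a (\<lambda>i. t \<odot> \<one>)"
proof -
 have aC [simp]: "a i \<in> carrier N" and a1: "opnorm N (a i) \<le> 1" for i using a[of i] by (auto simp: norm_ball_def)
 have abf: "a \<in> bf" by (rule bf_ball[OF a])
 define s where "s m i = (\<Sum>j<4::nat. dist2 N (w (n i) (vy m j) \<otimes> a i) (a i \<otimes> w (n i) (vy m j)))" for m i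
 have "(s m \<longlongrightarrow> 0) U" for m
 proof -
  have "((\<lambda>i. dist2 N (w (n i) p \<otimes> a i) (a i \<otimes> w (n i) p)) \<longlongrightarrow> 0) U" for p
  proof -
   have "null (\<lambda>i. a i \<otimes> w (n i) p) (\<lambda>i. w (n i) p \<otimes> a i)"
    by (rule null_commute[OF abf hbf wbf h_var comm[OF vC]])
   from null_sym[OF bf_mult[OF abf wbf] bf_mult[OF wbf abf] this] show ?thesis by (simp add: null_def)
  qed
  then have "((\<lambda>i. \<Sum>j<4::nat. dist2 N (w (n i) (vy m j) \<otimes> a i) (a i \<otimes> w (n i) (vy m j))) \<longlongrightarrow> (\<Sum>j<4::nat. 0)) U"
   by (intro tendsto_sum)
  then show ?thesis by (simp add: s_def[abs_def])
 qed
 then obtain \<mu> where \<mu>: "filterlim \<mu> at_top U" "\<And>i. \<mu> i \<le> n i" "\<And>i. \<mu> i \<ge> 1 ==> s (\<mu> i) i \<le> er (\<mu> i)"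
  using slow_level[of s] by blast
 have \<mu>lim: "((\<lambda>i. er (\<mu> i)) \<longlongrightarrow> 0) U" by (rule filterlim_compose[OF er_lim \<mu>(1)])
 have \<mu>1: "\<forall>\<^sub>F i in U. k \<le> \<mu> i" for k using \<mu>(1) by (simp add: filterlim_at_top)
 have "\<exists>b\<in>norm_ball N 1. \<mu> i \<ge> 1 --> (gap (\<lambda>j. w (n i) (vy (\<mu> i) j)) (a i) b \<le> 3 * er (\<mu> i) \<and>
   (\<forall>p\<in>set (dense_vars (\<mu> i)). dist2 N (b \<otimes> w (n i) p) (w (n i) p \<otimes> b) \<le> 3 * er (\<mu> i)))" for i
 proof (cases "\<mu> i \<ge> 1")
  case True
  have "level_gap (\<mu> i) \<in> level (n i)" using \<mu>(2) by (simp add: level_def)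
  from w_val[OF this] have "val (w (n i)) (level_gap (\<mu> i)) < er (\<mu> i) + er (n i)" using v_gap[of "\<mu> i"] by (simp add: er_def)
  then have v: "val (w (n i)) (gap_formula (dense_vars (\<mu> i)) (\<mu> i) (er (\<mu> i))) < 2 * er (\<mu> i)"
   using er_mono[OF \<mu>(2)[of i]] by (simp add: level_gap_def er_def)
  \<comment> \<open>Needed for the clipping in \<open>gap_formula_use\<close>; it is the reason for
    excluding level 0.\<close>
  have "2 * er (\<mu> i) \<le> 1" using True by (simp add: er_def)
  have "er (\<mu> i) + 2 * er (\<mu> i) = 3 * er (\<mu> i)" by simp
  moreover have "\<exists>b\<in>norm_ball N 1. gap (\<lambda>j. w (n i) (vy (\<mu> i) j)) (a i) b \<le> er (\<mu> i) + 2 * er (\<mu> i) \<and>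
    (\<forall>p\<in>set (dense_vars (\<mu> i)). dist2 N (b \<otimes> w (n i) p) (w (n i) p \<otimes> b) \<le> er (\<mu> i) + 2 * er (\<mu> i))"
   by (rule gap_formula_use[OF v \<open>2 * er (\<mu> i) \<le> 1\<close> a]) (rule dense_vars_dense)
  ultimately show ?thesis by (simp only:) blast
 next
  case False
  have "\<zero> \<in> norm_ball N 1" by simp
  then show ?thesis using False by blast
 qed
 then obtain b where b: "\<And>i. b i \<in> norm_ball N 1"
  "\<And>i. \<mu> i \<ge> 1 ==> gap (\<lambda>j. w (n i) (vy (\<mu> i) j)) (a i) (b i) \<le> 3 * er (\<mu> i)"
  "\<And>i p. \<mu> i \<ge> 1 ==> p \<in> set (dense_vars (\<mu> i)) ==> dist2 N (b i \<otimes> w (n i) p) (w (n i) p \<otimes> b i) \<le> 3 * er (\<mu> i)"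
  by metis
 have bC [simp]: "b i \<in> carrier N" and b1: "opnorm N (b i) \<le> 1" for i using b(1)[of i] by (auto simp: norm_ball_def)
 have bbf: "b \<in> bf" by (rule bf_ball[OF b(1)])
 have hC: "h x i \<in> carrier N" for x i by (rule bf_in[OF hbf])
 have "null (\<lambda>i. b i \<otimes> h x i) (\<lambda>i. h x i \<otimes> b i)" if x: "x \<in> carrier M" for x
  unfolding null_def
 proof (rule tendstoI)
  fix e :: real assume e: "e > 0"
  have "\<forall>\<^sub>F k in sequentially. \<delta> x k < e / 8" using order_tendstoD(2)[OF \<delta>_lim[OF x], of "e/8"] e by simp
  moreover have "\<forall>\<^sub>F k in sequentially. er k < e / 8" using order_tendstoD(2)[OF er_lim, of "e/8"] e by simp
  moreover have "\<forall>\<^sub>F k in sequentially. rad x \<le> k" by (rule eventually_ge_at_top)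
  ultimately have ev: "\<forall>\<^sub>F k in sequentially. \<delta> x k < e / 8 \<and> er k < e / 8 \<and> rad x \<le> k" by eventually_elim simp
  then obtain k where k: "\<delta> x k < e / 8" "er k < e / 8" "rad x \<le> k"
   using eventually_happens[OF ev] by (auto simp: trivial_limit_sequentially)
  \<comment> \<open>\<open>h x i\<close> uses a variable of level \<open>n i\<close>, which
    \<open>b i\<close> need not almost commute with. A fixed approximant \<open>q\<close> of
    \<open>x\<close> eventually belongs to the dense variables of level \<mu>, and its distance from
    \<open>h x i\<close> is controlled by a level formula.\<close>
  define q where "q = pv x k"
  have "\<forall>\<^sub>F i in U. er (\<mu> i) < e / 12" using order_tendstoD(2)[OF \<mu>lim, of "e/12"] e by simp
  with nU[OF ev] \<mu>1[of "max 1 k"] show "\<forall>\<^sub>F i in U. dist (dist2 N (b i \<otimes> h x i) (h x i \<otimes> b i)) 0 < e"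
  proof eventually_elim
   case (elim i)
   define p where "p = pv x (n i)"
   have qd: "q \<in> set (dense_vars (\<mu> i))" using pv_dense[OF k(3)] elim(2) by (auto simp: q_def set_dense_vars)
   have L: "p \<in> level_vars (n i)" "q \<in> level_vars (n i)"
    using elim(1) pv_level[of x "n i"] dense_vars_level[OF qd] \<mu>(2)[of i] by (auto simp: p_def level_vars_def)
   have "dist2 N (w (n i) p) (w (n i) q) \<le> dist2 M (v p) (v q) + er (n i)"
    using w_dist[OF in_level(4)[OF L]] by simp
   moreover have "dist2 M (v p) (v q) \<le> dist2 M (v p) x + dist2 M x (v q)" using x by (intro M.dist2_triangle) auto
   moreover have "dist2 M (v p) x = \<delta> x (n i)" "dist2 M x (v q) = \<delta> x k"
    using M.dist2_sym[OF vC x, of p] by (simp_all add: \<delta>_def p_def q_def)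
   ultimately have d: "dist2 N (h x i) (w (n i) q) < 3 * e / 8" using elim(1) k by (simp add: h_def p_def)
   have "dist2 N (b i \<otimes> w (n i) q) (w (n i) q \<otimes> b i) < e / 4" using b(3)[OF _ qd] elim(2,3) by simp
   then have "dist2 N (b i \<otimes> h x i) (h x i \<otimes> b i) < e"
    using dist2_commutator[OF bC b1 hC wC, of i x i "n i" q] d by linarith
   then show ?case using hC by simp
  qed
 qed
 from central[OF bbf this] have ab: "null (\<lambda>i. a i \<otimes> b i) (\<lambda>i. b i \<otimes> a i)" .
 define d where "d i = Re (tr N (star N (a i) \<otimes> a i)) - (cmod (tr N (a i)))\<^sup>2" for i
 \<comment> \<open>Pythagoras: the variance is the squared distance from the scalars, and the rest
   is the distance of \<open>t\<close> from the trace. So vanishing variance and a limit of the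
   traces suffice.\<close>
 have d_sq: "(dist2 N (a i) (t \<odot> \<one>))\<^sup>2 = d i + (cmod (tr N (a i) - t))\<^sup>2" for i t
 proof -
  have "(dist2 N (a i) (t \<odot> \<one>))\<^sup>2 = Re (tr N (star N (a i) \<otimes> a i)) - 2 * Re (t * cnj (tr N (a i))) + (cmod t)\<^sup>2"
   by (simp add: dist2_smult_sq tr_scalar)
  also have "\<dots> = d i + (cmod (tr N (a i) - t))\<^sup>2" unfolding d_def cmod_power2 by (simp add: power2_eq_square algebra_simps)
  finally show ?thesis .
 qed
 have d0: "0 \<le> d i" for i
 proof -
  have "d i = (dist2 N (a i) (tr N (a i) \<odot> \<one>))\<^sup>2" by (simp add: d_sq)
  then show ?thesis by simp
 qed
 have dlim: "(d \<longlongrightarrow> 0) U"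
 proof (rule Lim_null_comparison)
  define D where "D i = dist2 N (a i \<otimes> b i) (b i \<otimes> a i)" for i
  have "((\<lambda>i. 800 * (D i + er (\<mu> i)) + 3 * er (\<mu> i)) \<longlongrightarrow> 800 * (0 + 0) + 3 * 0) U"
   by (intro tendsto_intros \<mu>lim) (use ab in \<open>simp add: null_def D_def[abs_def]\<close>)
  then show "((\<lambda>i. 800 * (D i + er (\<mu> i)) + 3 * er (\<mu> i)) \<longlongrightarrow> 0) U" by simp
  show "\<forall>\<^sub>F i in U. norm (d i) \<le> 800 * (D i + er (\<mu> i)) + 3 * er (\<mu> i)"
   using \<mu>1[of 1]
  proof eventually_elim
   case (elim i)
   have "gap (\<lambda>j. w (n i) (vy (\<mu> i) j)) (a i) (b i) = d i - 800 * (D i + s (\<mu> i) i)"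
    unfolding gap_def d_def cmod_power2 s_def D_def using dist2_sym[of "b i \<otimes> a i" "a i \<otimes> b i"] by simp
   then show ?case using b(2)[OF elim] \<mu>(3)[OF elim] d0[of i] by simp
  qed
 qed
 obtain t where t: "((\<lambda>i. tr N (a i)) \<longlongrightarrow> t) U"
  using ultrafilter_limit[OF U, of "\<lambda>i. tr N (a i)" 1] tr_le[OF aC] a1 by (meson order_trans)
 have "((\<lambda>i. sqrt (d i + (cmod (tr N (a i) - t))\<^sup>2)) \<longlongrightarrow> sqrt (0 + (cmod (t - t))\<^sup>2)) U"
  by (intro tendsto_intros dlim t)
 moreover have "sqrt (d i + (cmod (tr N (a i) - t))\<^sup>2) = dist2 N (a i) (t \<odot> \<one>)" for i
  unfolding d_sq[symmetric] by simp
 ultimately have "null a (\<lambda>i. t \<odot> \<one>)" by (simp add: null_def)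
 then show ?thesis by blast
qed

theorem relative_commutant_factor: "is_factor (relative_commutant ((\<lambda>x. cl (h x)) ` carrier M) UP)"
proof -
 define C where "C = {X \<in> carrier UP. \<forall>x\<in>carrier M. X \<otimes>\<^bsub>UP\<^esub> cl (h x) = cl (h x) \<otimes>\<^bsub>UP\<^esub> X}"
 have C: "center (relative_commutant ((\<lambda>x. cl (h x)) ` carrier M) UP) = {Z \<in> C. \<forall>X\<in>C. Z \<otimes>\<^bsub>UP\<^esub> X = X \<otimes>\<^bsub>UP\<^esub> Z}"
  by (auto simp: center_def relative_commutant_def C_def)
 have CI: "cl y \<in> C \<longleftrightarrow> (\<forall>x\<in>carrier M. null (\<lambda>i. y i \<otimes> h x i) (\<lambda>i. h x i \<otimes> y i))" if "y \<in> bf" for y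
  using that by (simp add: C_def null_commute_iff hbf) (simp add: carrier_UP)
 have "Z \<in> range (\<lambda>c. c \<odot>\<^bsub>UP\<^esub> \<one>\<^bsub>UP\<^esub>)" if Z: "Z \<in> C" and central: "\<forall>X\<in>C. Z \<otimes>\<^bsub>UP\<^esub> X = X \<otimes>\<^bsub>UP\<^esub> Z" for Z
 proof -
  obtain z where z: "z \<in> bf" "Z = cl z" using Z by (auto simp: C_def carrier_UP)
  obtain c where c: "c > 0" "\<And>i. opnorm N (z i) \<le> c" using bf_bound[OF z(1)] by blast
  \<comment> \<open>The variables \<open>va\<close> and \<open>vb\<close> range over the unit ball,
    so the central element is rescaled first.\<close>
  define a where "a i = of_real (1 / c) \<odot> z i" for i
  have zC: "z i \<in> carrier N" for i by (rule bf_in[OF z(1)])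
  have scale: "null (\<lambda>i. a i \<otimes> y i) (\<lambda>i. y i \<otimes> a i)"
   if y: "y \<in> bf" "null (\<lambda>i. z i \<otimes> y i) (\<lambda>i. y i \<otimes> z i)" for y
   using null_smult[OF bf_mult[OF z(1) y(1)] bf_mult[OF y(1) z(1)] y(2), of "of_real (1 / c)"] zC bf_in[OF y(1)]
   by (simp add: a_def scalar(3,4))
  have "\<exists>t. null a (\<lambda>i. t \<odot> \<one>)"
  proof (rule central_is_scalar)
   show "a i \<in> norm_ball N 1" for i
    using c zC[of i] by (simp add: norm_ball_def a_def opnorm(6) norm_divide divide_le_eq_1)
   show "null (\<lambda>i. a i \<otimes> h x i) (\<lambda>i. h x i \<otimes> a i)" if "x \<in> carrier M" for x
    using Z that CI[OF z(1)] by (intro scale hbf) (simp add: z(2))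
   show "null (\<lambda>i. a i \<otimes> b i) (\<lambda>i. b i \<otimes> a i)"
    if b: "b \<in> bf" "\<And>x. x \<in> carrier M ==> null (\<lambda>i. b i \<otimes> h x i) (\<lambda>i. h x i \<otimes> b i)" for b
   proof (rule scale[OF b(1)])
    have "cl b \<in> C" using CI[OF b(1)] b(2) by blast
    then have "Z \<otimes>\<^bsub>UP\<^esub> cl b = cl b \<otimes>\<^bsub>UP\<^esub> Z" using central by blast
    then show "null (\<lambda>i. z i \<otimes> b i) (\<lambda>i. b i \<otimes> z i)" using null_commute_iff[OF z(1) b(1)] by (simp add: z(2))
   qed
  qed
  then obtain t where t: "null a (\<lambda>i. t \<odot> \<one>)" by blast
  have "null (\<lambda>i. of_real c \<odot> a i) (\<lambda>i. of_real c \<odot> (t \<odot> \<one>))"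
   by (rule null_smult[OF _ bf_smult[OF bf_one] t]) (unfold a_def, rule bf_smult[OF z(1)])
  moreover have "(\<lambda>i. of_real c \<odot> a i) = z" using c(1) zC by (auto simp: a_def scalar(5,6) simp flip: of_real_mult)
  ultimately have "null z (\<lambda>i. (of_real c * t) \<odot> \<one>)" by (simp add: scalar(5))
  then have "Z = (of_real c * t) \<odot>\<^bsub>UP\<^esub> \<one>\<^bsub>UP\<^esub>" using z bf_smult[OF bf_one] by (simp add: UP_one UP_smult bf_one cl_eq_iff)
  then show ?thesis by blast
 qed
 moreover have "c \<odot>\<^bsub>UP\<^esub> \<one>\<^bsub>UP\<^esub> \<in> C" for c
  using UP_scalar_in UP_scalar_commute hbf by (auto simp: C_def carrier_UP)
 moreover have "\<forall>X\<in>C. (c \<odot>\<^bsub>UP\<^esub> \<one>\<^bsub>UP\<^esub>) \<otimes>\<^bsub>UP\<^esub> X = X \<otimes>\<^bsub>UP\<^esub> (c \<odot>\<^bsub>UP\<^esub> \<one>\<^bsub>UP\<^esub>)" for c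
  using UP_scalar_commute by (auto simp: C_def)
 ultimately have "{Z \<in> C. \<forall>X\<in>C. Z \<otimes>\<^bsub>UP\<^esub> X = X \<otimes>\<^bsub>UP\<^esub> Z} = range (\<lambda>c. c \<odot>\<^bsub>UP\<^esub> \<one>\<^bsub>UP\<^esub>)" by blast
 then show ?thesis unfolding is_factor_def C by (simp add: relative_commutant_def)
qed

end

theorem theoremA:
  fixes R :: "('k::chilbert_space \<Rightarrow>\<^sub>L 'k) set" and \<tau>R :: "('k \<Rightarrow>\<^sub>L 'k) \<Rightarrow> complex"
    and M :: "('h::chilbert_space \<Rightarrow>\<^sub>L 'h) set" and \<tau> :: "('h \<Rightarrow>\<^sub>L 'h) \<Rightarrow> complex"
    and \<U> :: "'i filter"
  assumes "hyperfinite_II1_factor R \<tau>R"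
    and "ultrafilter \<U>" and "countably_incomplete \<U>"
    and "II1_factor M \<tau>" and "separable2 (structure_of M \<tau>)"
    and "equiv_depth 4 (structure_of M \<tau>) (structure_of R \<tau>R)"
  shows "\<exists>\<iota>. embedding (structure_of M \<tau>) (ultrapower \<U> (structure_of R \<tau>R)) \<iota> \<and>
             is_factor (relative_commutant (\<iota> ` M) (ultrapower \<U> (structure_of R \<tau>R)))"
proof -
 let ?M = "structure_of M \<tau>" and ?R = "structure_of R \<tau>R"
 interpret R: tvna R \<tau>R using assms(1) by unfold_locales (simp add: hyperfinite_II1_factor_def II1_factor_def)
 interpret M: tvna M \<tau> using assms(4) by unfold_locales (simp add: II1_factor_def)
 have tsM: "tracial_structure ?M" and tsR: "tracial_structure ?R" by unfold_locales
 obtain n :: "'i => nat" where n: "filterlim n at_top \<U>" using countably_incomplete_rank[OF assms(2,3)] by blast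
 obtain e :: "nat => nat => 'h \<Rightarrow>\<^sub>L 'h" where e: "\<And>r j. e r j \<in> norm_ball ?M (real r)"
  "\<And>r x \<epsilon>. x \<in> norm_ball ?M (real r) ==> \<epsilon> > 0 ==> \<exists>j. dist2 ?M x (e r j) < \<epsilon>"
  using separable_ball[OF tsM assms(5)] by metis
 define v0 where "v0 p = e (snd p) (fst p div 3)" for p :: var
 have "\<exists>y. (\<forall>j. y j \<in> norm_ball ?M 1) \<and> (\<forall>u. (\<forall>p\<in>set (dense_vars m). u p = v0 p) \<and> (\<forall>j<4. u (vy m j) = y j) -->
   formula_value ?M u (level_gap m) < 1 / (real m + 1))" for m unfolding level_gap_def
 proof (rule M.gap_witnesses)
  have "sentence_value ?M (gap_sentence (dense_vars m) m (1 / (real m + 1))) = sentence_value ?R (gap_sentence (dense_vars m) m (1 / (real m + 1)))"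
   using assms(6) gap_sentence_sentence[of "dense_vars m" m "1 / (real m + 1)"] by (simp add: equiv_depth_def)
  also have "\<dots> \<le> 0" unfolding sentence_value_def
   by (rule R.val_gap_sentence[OF hyperfinite_spectral_gap[OF assms(1)] dense_vars_dense]) simp_all
  finally show "formula_value ?M (\<lambda>_. \<zero>\<^bsub>?M\<^esub>) (gap_sentence (dense_vars m) m (1 / (real m + 1))) \<le> 0"
   by (simp only: sentence_value_def)
  show "v0 p \<in> norm_ball ?M (real (snd p))" for p using e(1) by (simp add: v0_def)
  show "dense_var p" if "p \<in> set (dense_vars m)" for p using that by (rule dense_vars_dense)
 qed simp
 then obtain y where y: "\<And>m j. y m j \<in> norm_ball ?M 1"
  "\<And>m u. (\<forall>p\<in>set (dense_vars m). u p = v0 p) ==> (\<forall>j<4. u (vy m j) = y m j) ==> formula_value ?M u (level_gap m) < 1 / (real m + 1)"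
  by metis
 \<comment> \<open>Inverts the coding of \<open>vy m j\<close>: division by 12 gives
   \<open>m\<close>, and \<open>fst p div 3\<close> modulo 4 gives \<open>j\<close>. All other
   variables keep the dense sequences.\<close>
 define v where "v p = (if fst p mod 3 = 1 \<and> snd p = 1 then y (fst p div 12) (fst p div 3 mod 4) else v0 p)" for p :: var
 have v_ball: "v p \<in> norm_ball ?M (real (snd p))" for p using y(1) e(1) by (simp add: v_def v0_def)
 have v_gap: "formula_value ?M v (level_gap m) < 1 / (real m + 1)" for m
 proof (rule y(2))
  show "\<forall>p\<in>set (dense_vars m). v p = v0 p" using dense_vars_dense by (auto simp: v_def dense_var_def)
  show "\<forall>j<4. v (vy m j) = y m j"
  proof (intro allI impI)
   fix j :: nat assume j: "j < 4"
   have "fst (vy m j) mod 3 = 1" "fst (vy m j) div 3 = 4 * m + j" by (simp_all add: vy_def) presburger+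
   moreover have "fst (vy m j) div 12 = fst (vy m j) div 3 div 4" by (simp add: div_mult2_eq[symmetric])
   ultimately show "v (vy m j) = y m j" using j by (simp add: v_def)
  qed
 qed
 have "\<exists>w. (\<forall>x. w x \<in> norm_ball ?R (real (snd x))) \<and> (\<forall>\<phi>\<in>level k. \<bar>formula_value ?R w \<phi> - formula_value ?M v \<phi>\<bar> < 1 / (real k + 1))" for k
  by (rule realize[OF tsM tsR assms(6) v_ball finite_level level_wf]) simp_all
 then obtain w where w: "\<And>k x. w k x \<in> norm_ball ?R (real (snd x))"
  "\<And>k \<phi>. \<phi> \<in> level k ==> \<bar>formula_value ?R (w k) \<phi> - formula_value ?M v \<phi>\<bar> < 1 / (real k + 1)"
  by metis
 interpret transfer ?M ?R \<U> n v w
 proof unfold_locales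
  show "\<exists>j. dist2 ?M x (v (3 * j, r)) < \<epsilon>" if "x \<in> norm_ball ?M (real r)" "\<epsilon> > 0" for x r \<epsilon>
   using e(2)[OF that] by (simp add: v_def v0_def)
 qed (use assms(2) n v_ball w v_gap in auto)
 have "carrier ?M = M" by (simp add: structure_of_def)
 then show ?thesis using embedding_h relative_commutant_factor by metis
qed

end
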